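(* Let $a_1,a_2:\mathbf{R}^d\to\mathbf{R}^d$ be differentiable and suppose there are constants $c_1,c_2>0$ with $(a_i(x)-a_i(y))\cdot(x-y)\ge c_1|x-y|^2$ and $|a_i(x)-a_i(y)|\le c_2|x-y|$ for all $x,y\in\mathbf{R}^d$, $i=1,2$. Let $u_\varepsilon$, $u_0$, $K_\varepsilon$ be as in the context, assume $u_0\in C^{1,\alpha}(\overline{B_\delta(0)})$ for some $\delta>0$, $0<\alpha<1$, and put $U_0:=\nabla u_0(0)$. (i) There exists a unique solution $K\in\dot{BL}(\mathbf{R}^d)$ of $$\int_{\mathbf{R}^d}\big(\mathcal{A}_\omega(x,\nabla K+U_0)-\mathcal{A}_\omega(x,U_0)\big)\cdot\nabla\varphi\,dx=-\int_\omega(a_1(U_0)-a_2(U_0))\cdot\nabla\varphi\,dx\quad\text{for all }\varphi\in BL(\mathbf{R}^d),$$ where $\mathcal{A}_\omega(x,y):=a_1(y)\chi_\omega(x)+a_2(y)\chi_{\mathbf{R}^d\setminus\omega}(x)$. (ii) $\nabla K_\varepsilon\to\nabla K$ strongly in $L_2(\mathbf{R}^d)^d$ as $\varepsilon\searrow0$.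
   Context: Let $\mathsf{D}\subset\mathbf{R}^d$ be open and bounded, $f\in L_2(\mathsf{D})$, $\Omega\Subset\mathsf{D}$ open with $z:=0\in\mathsf{D}\setminus\overline\Omega$, and $\omega\subset\mathbf{R}^d$ open and bounded with $0\in\omega$. Put $\omega_\varepsilon:=\varepsilon\omega$ and let $\tau>0$ be such that $\omega_\varepsilon\Subset\mathsf{D}\setminus\overline\Omega$ for all $\varepsilon\in[0,\tau]$. For $\varepsilon\in(0,\tau]$ put $\Omega_\varepsilon:=\Omega\cup\omega_\varepsilon$, and put $\Omega_0:=\Omega$. Let $\mathcal{A}_{\Omega_\varepsilon}(x,y):=a_1(y)$ for $x\in\Omega_\varepsilon$ and $a_2(y)$ for $x\in\mathsf{D}\setminus\Omega_\varepsilon$. For $\varepsilon\in[0,\tau]$, $u_\varepsilon\in H^1_0(\mathsf{D})$ is the unique solution of $\int_{\mathsf{D}}\mathcal{A}_{\Omega_\varepsilon}(x,\nabla u_\varepsilon)\cdot\nabla\varphi\,dx=\int_{\mathsf{D}}f\varphi\,dx$ for all $\varphi\in H^1_0(\mathsf{D})$. With $T_\varepsilon(x):=\varepsilon x$ and $\varepsilon^{-1}\mathsf{D}:=T_\varepsilon^{-1}(\mathsf{D})$, the variation of the state is $K_\varepsilon:=\frac{(u_\varepsilon-u_0)\circ T_\varepsilon}{\varepsilon}\in H^1_0(\varepsilon^{-1}\mathsf{D})$, $\varepsilon>0$, extended by zero to $\mathbf{R}^d$. Beppo-Levi space: $BL(\mathbf{R}^d):=\{u\in H^1_{\mathrm{loc}}(\mathbf{R}^d):\nabla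 u\in L_2(\mathbf{R}^d)^d\}$, $\dot{BL}(\mathbf{R}^d):=BL(\mathbf{R}^d)/\mathbf{R}$ (quotient by constants), normed by $\|\nabla u\|_{L_2(\mathbf{R}^d)^d}$. *)

theory Defs
  imports "HOL-Analysis.Analysis"
begin

definition compactly_contained :: "'a::euclidean_space set \<Rightarrow> 'a set \<Rightarrow> bool" where
  "compactly_contained A B \<longleftrightarrow> compact (closure A) \<and> closure A \<subseteq> B"

section \<open>Test functions and weak gradients\<close>

primrec C_k :: "nat \<Rightarrow> ('a::euclidean_space \<Rightarrow> real) \<Rightarrow> bool" where
  "C_k 0 f \<longleftrightarrow> continuous_on UNIV f"
| "C_k (Suc k) f \<longleftrightarrow> (\<forall>x. f differentiable (at x)) \<and>
     (\<forall>b\<in>Basis. C_k k (\<lambda>x. frechet_derivative f (at x) b))"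

definition test_functions :: "'a::euclidean_space set \<Rightarrow> ('a \<Rightarrow> real) set" where
  "test_functions D = {\<phi>. (\<forall>k. C_k k \<phi>) \<and> compactly_contained {x. \<phi> x \<noteq> 0} D}"

text \<open>
  Elements of the function spaces below are functions, not classes modulo null sets, and only
  their values on the domain \<open>D\<close> matter. The domains are open (or compact) sets.
\<close>

definition has_weak_gradient ::
  "'a::euclidean_space set \<Rightarrow> ('a \<Rightarrow> real) \<Rightarrow> ('a \<Rightarrow> 'a) \<Rightarrow> bool" where
  "has_weak_gradient D u g \<longleftrightarrow>
     (\<forall>C. compact C \<and> C \<subseteq> D \<longrightarrow> integrable (lebesgue_on C) u \<and> integrable (lebesgue_on C) g) \<and>
     (\<forall>\<phi>\<in>test_functions D. \<forall>b\<in>Basis.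
        (LINT x|lebesgue_on D. u x * frechet_derivative \<phi> (at x) b)
          = - (LINT x|lebesgue_on D. (g x \<bullet> b) * \<phi> x))"

text \<open>A weak gradient is determined up to a null set; this picks a representative.\<close>

definition weak_gradient :: "'a::euclidean_space set \<Rightarrow> ('a \<Rightarrow> real) \<Rightarrow> 'a \<Rightarrow> 'a" where
  "weak_gradient D u = (SOME g. has_weak_gradient D u g)"

section \<open>Function spaces\<close>

definition L2 :: "'a::euclidean_space set \<Rightarrow> ('a \<Rightarrow> 'b::euclidean_space) set" where
  "L2 D = {h. h \<in> borel_measurable (lebesgue_on D) \<and>
              integrable (lebesgue_on D) (\<lambda>x. (norm (h x))\<^sup>2)}"

definition L2_norm :: "'a::euclidean_space set \<Rightarrow> ('a \<Rightarrow> 'b::euclidean_space) \<Rightarrow> real" where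
  "L2_norm D h = sqrt (LINT x|lebesgue_on D. (norm (h x))\<^sup>2)"

text \<open>
  Strong convergence. Membership of the functions in \<open>L2 D\<close> is part of the definition because
  \<open>L2_norm\<close> of a function outside \<open>L2 D\<close> may be 0.
\<close>

definition L2_tendsto ::
  "'a::euclidean_space set \<Rightarrow> ('i \<Rightarrow> 'a \<Rightarrow> 'b::euclidean_space) \<Rightarrow> ('a \<Rightarrow> 'b) \<Rightarrow> 'i filter \<Rightarrow> bool" where
  "L2_tendsto D h l F \<longleftrightarrow>
     l \<in> L2 D \<and> (\<forall>\<^sub>F i in F. h i \<in> L2 D) \<and>
     ((\<lambda>i. L2_norm D (\<lambda>x. h i x - l x)) \<longlongrightarrow> 0) F"

definition H1 :: "'a::euclidean_space set \<Rightarrow> ('a \<Rightarrow> real) set" where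
  "H1 D = {u \<in> L2 D. \<exists>g\<in>L2 D. has_weak_gradient D u g}"

definition H1_norm :: "'a::euclidean_space set \<Rightarrow> ('a \<Rightarrow> real) \<Rightarrow> real" where
  "H1_norm D u = sqrt ((L2_norm D u)\<^sup>2 + (L2_norm D (weak_gradient D u))\<^sup>2)"

definition H1_0 :: "'a::euclidean_space set \<Rightarrow> ('a \<Rightarrow> real) set" where
  "H1_0 D = {u \<in> H1 D. \<exists>\<phi>::nat \<Rightarrow> 'a \<Rightarrow> real.
     (\<forall>n. \<phi> n \<in> test_functions D) \<and> (\<lambda>n. H1_norm D (\<lambda>x. \<phi> n x - u x)) \<longlonglongrightarrow> 0}"

definition H1_loc :: "'a::euclidean_space set \<Rightarrow> ('a \<Rightarrow> real) set" where
  "H1_loc D = {u. \<exists>g. has_weak_gradient D u g \<and>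
     (\<forall>C. compact C \<and> C \<subseteq> D \<longrightarrow> u \<in> L2 C \<and> g \<in> L2 C)}"

definition BL :: "('a::euclidean_space \<Rightarrow> real) set" where
  "BL = {u \<in> H1_loc UNIV. weak_gradient UNIV u \<in> L2 UNIV}"

text \<open>Since functions are not identified modulo null sets, constants are divided out a.e.\<close>

definition BL_rel :: "(('a::euclidean_space \<Rightarrow> real) \<times> ('a \<Rightarrow> real)) set" where
  "BL_rel = {(u, v). u \<in> BL \<and> v \<in> BL \<and> (\<exists>c. AE x in lebesgue. u x = v x + c)}"

definition BL_dot :: "('a::euclidean_space \<Rightarrow> real) set set" where
  "BL_dot = BL // BL_rel"

text \<open>Up to null sets this does not depend on the member of the class.\<close>

definition BL_dot_gradient :: "('a::euclidean_space \<Rightarrow> real) set \<Rightarrow> 'a \<Rightarrow> 'a" where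
  "BL_dot_gradient K = weak_gradient UNIV (SOME u. u \<in> K)"

text \<open>
  \<open>C1_Holder \<alpha> S\<close> is \<open>C\<^sup>1\<^sup>,\<^sup>\<alpha>\<close> on the closure of the bounded open set \<open>S\<close>: \<open>v\<close> is continuous up
  to the boundary and its classical gradient on \<open>S\<close> extends to a Hoelder continuous field on
  the closure.
\<close>

definition C1_Holder :: "real \<Rightarrow> 'a::euclidean_space set \<Rightarrow> ('a \<Rightarrow> real) set" where
  "C1_Holder \<alpha> S = {v. continuous_on (closure S) v \<and>
     (\<exists>G C. (\<forall>x\<in>S. GDERIV v x :> G x) \<and>
        (\<forall>x\<in>closure S. \<forall>y\<in>closure S. norm (G x - G y) \<le> C * norm (x - y) powr \<alpha>))}"

section \<open>The perturbed problems and the limit problem\<close>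

definition two_phase :: "('a \<Rightarrow> 'b) \<Rightarrow> ('a \<Rightarrow> 'b) \<Rightarrow> 'c set \<Rightarrow> 'c \<Rightarrow> 'a \<Rightarrow> 'b" where
  "two_phase a1 a2 S x y = (if x \<in> S then a1 y else a2 y)"

definition scaled_inclusion :: "'a::euclidean_space set \<Rightarrow> real \<Rightarrow> 'a set" where
  "scaled_inclusion \<omega> \<epsilon> = (\<lambda>x. \<epsilon> *\<^sub>R x) ` \<omega>"

text \<open>The unperturbed set is \<open>\<Omega>\<close> itself, not \<open>\<Omega>\<close> together with the point 0.\<close>

definition perturbed_set :: "'a::euclidean_space set \<Rightarrow> 'a set \<Rightarrow> real \<Rightarrow> 'a set" where
  "perturbed_set \<Omega> \<omega> \<epsilon> = (if \<epsilon> = 0 then \<Omega> else \<Omega> \<union> scaled_inclusion \<omega> \<epsilon>)"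

definition state_solution ::
  "('a::euclidean_space \<Rightarrow> 'a) \<Rightarrow> ('a \<Rightarrow> 'a) \<Rightarrow> 'a set \<Rightarrow> ('a \<Rightarrow> real) \<Rightarrow> 'a set \<Rightarrow> ('a \<Rightarrow> real) \<Rightarrow> bool" where
  "state_solution a1 a2 D f S u \<longleftrightarrow> u \<in> H1_0 D \<and>
     (\<forall>\<phi>\<in>H1_0 D.
        (LINT x|lebesgue_on D. two_phase a1 a2 S x (weak_gradient D u x) \<bullet> weak_gradient D \<phi> x)
          = (LINT x|lebesgue_on D. f x * \<phi> x))"

text \<open>Defined on all of the space, with the extension by zero built in.\<close>

definition state_variation ::
  "'a::euclidean_space set \<Rightarrow> (real \<Rightarrow> 'a \<Rightarrow> real) \<Rightarrow> real \<Rightarrow> 'a \<Rightarrow> real" where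
  "state_variation D u \<epsilon> x =
     (if \<epsilon> *\<^sub>R x \<in> D then (u \<epsilon> (\<epsilon> *\<^sub>R x) - u 0 (\<epsilon> *\<^sub>R x)) / \<epsilon> else 0)"

definition limit_solution ::
  "('a::euclidean_space \<Rightarrow> 'a) \<Rightarrow> ('a \<Rightarrow> 'a) \<Rightarrow> 'a set \<Rightarrow> 'a \<Rightarrow> ('a \<Rightarrow> real) set \<Rightarrow> bool" where
  "limit_solution a1 a2 \<omega> U0 K \<longleftrightarrow> K \<in> BL_dot \<and>
     (\<forall>\<phi>\<in>BL.
        (LINT x|lebesgue. (two_phase a1 a2 \<omega> x (BL_dot_gradient K x + U0) - two_phase a1 a2 \<omega> x U0)
             \<bullet> weak_gradient UNIV \<phi> x)
          = - (LINT x|lebesgue_on \<omega>. (a1 U0 - a2 U0) \<bullet> weak_gradient UNIV \<phi> x))"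

end

theory Submission imports Defs
begin

text \<open>
  Modulo null sets the gradients of the functions in \<open>BL\<close> are the closure \<open>G\<close> in \<open>L\<^sub>2\<close> of the gradients
  of test functions. Fields in the closure are gradients by a Poincare inequality on balls.
  Conversely, a square integrable field \<open>h\<close> orthogonal to the gradients of all test functions is
  orthogonal to every \<open>\<nabla>u \<in> L\<^sub>2\<close>: by mollification it suffices to treat smooth \<open>u\<close>.
  The limit problem thus asks for \<open>k \<in> G\<close> with \<open>N k\<close> orthogonal to \<open>G\<close>, where \<open>N\<close> is a strongly monotone
  Lipschitz operator, and Zarantonello's theorem applies.

  For the convergence, let \<open>k\<^sub>\<epsilon>\<close> be the gradient of the variation of the state. The rescaled difference
  \<open>H\<^sub>\<epsilon>\<close> of the two fluxes is orthogonal to \<open>k\<^sub>\<epsilon>\<close> and to \<open>\<nabla>\<psi>\<close>, for a fixed test function \<open>\<psi>\<close> and small \<open>\<epsilon>\<close>,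
  and so is \<open>N k\<close>. If \<open>M\<^sub>\<epsilon>\<close> denotes the flux difference with \<open>\<nabla>\<psi>\<close> in place of \<open>k\<^sub>\<epsilon>\<close>, monotonicity gives
  \<open>c\<^sub>1 |k\<^sub>\<epsilon> - \<nabla>\<psi>|\<^sup>2 \<le> (H\<^sub>\<epsilon> - M\<^sub>\<epsilon>, k\<^sub>\<epsilon> - \<nabla>\<psi>) = (N k - M\<^sub>\<epsilon>, k\<^sub>\<epsilon> - \<nabla>\<psi>)\<close>. Here \<open>|N k - N \<nabla>\<psi>| \<le> c\<^sub>2 |k - \<nabla>\<psi>|\<close>
  is small by the choice of \<open>\<psi>\<close>, and \<open>N \<nabla>\<psi> - M\<^sub>\<epsilon>\<close> lives on a fixed ball and tends to 0 because \<open>\<nabla>u\<^sub>0\<close> is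
  Hoelder continuous at the origin. This avoids any a priori bound or weak compactness.
\<close>

section \<open>Smooth functions\<close>

text \<open>The unknown is a gradient and not a function: on the whole space no inequality bounds
  the \<open>L2\<close> norm of a function by that of its gradient, so the function is recovered
  afterwards, up to a constant. Everything takes place in one Hilbert space \<open>l2\<close> of
  classes, which functions on \<open>D\<close> enter through extension by zero. Orthogonality
  replaces a direct proof of density by cutoffs because the term in which the cutoff is
  differentiated is only bounded, not small, in \<open>L2\<close>; against a fixed square integrable
  field it does become negligible. In the convergence, the rescaled problems admit only test
  functions supported in the rescaled domain. The variation itself is admissible, and one fixed
  \<open>\<psi>\<close> becomes so for small \<open>\<epsilon>\<close>; their difference is then a
  legitimate test in the rescaled and in the limit problem. The comparison flux keeps the rescaled
  gradient of \<open>u 0\<close> as its base point, since monotonicity is needed on the whole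
  rescaled domain, where this gradient need not be near \<open>U0\<close>. The two base points are
  compared only on the ball carrying \<open>\<omega>\<close> and \<open>\<psi>\<close>, so
  regularity near the origin is enough.\<close>

lemma C_k_imp_continuous: "C_k k f \<Longrightarrow> continuous_on UNIV f"
  by (cases k) (auto simp: differentiable_imp_continuous_within continuous_at_imp_continuous_on)

lemma C_k_antimono_Suc: "C_k (Suc k) f \<Longrightarrow> C_k k f"
proof (induction k arbitrary: f)
  case 0
  then show ?case using C_k_imp_continuous[OF 0] by simp
qed auto

text \<open>Uniqueness of derivatives lets \<open>frechet_derivative\<close> be replaced by an
  explicit derivative, so each closure property below reduces to the form of
  \<open>f'\<close>.\<close>

lemma C_k_SucI:
  assumes "\<And>x. (f has_derivative f' x) (at x)" "\<And>b. b \<in> Basis \<Longrightarrow> C_k k (\<lambda>x. f' x b)"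
  shows "C_k (Suc k) f"
proof -
  have "frechet_derivative f (at x) = f' x" for x
    using assms(1) frechet_derivative_at by metis
  then show ?thesis using assms by (auto simp: differentiable_def)
qed

lemma C_k_Suc_has_derivative:
  "C_k (Suc k) f \<Longrightarrow> (f has_derivative frechet_derivative f (at x)) (at x)"
  by (auto simp: frechet_derivative_works)

lemma C_k_const: "C_k k (\<lambda>x. c)"
proof (induction k arbitrary: c)
  case (Suc k)
  show ?case by (rule C_k_SucI[OF has_derivative_const]) (rule Suc)
qed auto

lemma C_k_bounded_linear:
  assumes "bounded_linear f" shows "C_k k f"
proof (cases k)
  case 0
  then show ?thesis using assms by (simp add: linear_continuous_on)
next
  case (Suc m)
  then show ?thesis using C_k_SucI[OF bounded_linear_imp_has_derivative[OF assms] C_k_const] by simp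
qed

lemma C_k_add: "C_k k f \<Longrightarrow> C_k k g \<Longrightarrow> C_k k (\<lambda>x. f x + g x)"
proof (induction k arbitrary: f g)
  case 0
  then show ?case by (auto intro: continuous_intros)
next
  case (Suc k)
  show ?case
    by (rule C_k_SucI[OF has_derivative_add[OF Suc(2,3)[THEN C_k_Suc_has_derivative]]]) (use Suc in auto)
qed

lemma C_k_mult: "C_k k f \<Longrightarrow> C_k k g \<Longrightarrow> C_k k (\<lambda>x. f x * g x)"
proof (induction k arbitrary: f g)
  case 0
  then show ?case by (auto intro: continuous_intros)
next
  case (Suc k)
  show ?case
    by (rule C_k_SucI[OF has_derivative_mult[OF Suc(2,3)[THEN C_k_Suc_has_derivative]]])
      (intro C_k_add Suc(1), use Suc(2,3) C_k_antimono_Suc in auto)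
qed

lemma C_k_cmult: "C_k k f \<Longrightarrow> C_k k (\<lambda>x. c * f x)"
  by (intro C_k_mult C_k_const)

lemma C_k_diff: "C_k k f \<Longrightarrow> C_k k g \<Longrightarrow> C_k k (\<lambda>x. f x - g x)"
  using C_k_add[OF _ C_k_cmult[of k g "-1"]] by simp

lemma C_k_sum: "(\<And>i. i \<in> I \<Longrightarrow> C_k k (f i)) \<Longrightarrow> C_k k (\<lambda>x. \<Sum>i\<in>I. f i x)"
  by (induction I rule: infinite_finite_induct) (auto intro: C_k_add C_k_const)

lemma C_k_prod: "(\<And>i. i \<in> I \<Longrightarrow> C_k k (f i)) \<Longrightarrow> C_k k (\<lambda>x. \<Prod>i\<in>I. f i x)"
  by (induction I rule: infinite_finite_induct) (auto intro: C_k_mult C_k_const)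

text \<open>The derivative of the outer real function is multiplication by its value at 1. The
  derivative of the composition is therefore a product of a composition, covered by the induction
  hypothesis, and a derivative of \<open>g\<close>.\<close>

lemma C_k_compose:
  fixes f :: "real \<Rightarrow> real"
  shows "C_k k f \<Longrightarrow> C_k k g \<Longrightarrow> C_k k (\<lambda>x. f (g x))"
proof (induction k arbitrary: f g)
  case 0
  then show ?case using continuous_on_compose2 by fastforce
next
  case (Suc k)
  have f': "frechet_derivative f (at y) t = frechet_derivative f (at y) 1 * t" for y t
  proof -
    have "linear (frechet_derivative f (at y))"
      using Suc(2) by (auto intro: linear_frechet_derivative)
    from linear_scale[OF this, of t 1] show ?thesis by simp
  qed
  have "((\<lambda>x. f (g x)) has_derivative
      (\<lambda>h. frechet_derivative f (at (g x)) 1 * frechet_derivative g (at x) h)) (at x)" for x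
    unfolding f'[symmetric]
    by (rule has_derivative_compose[OF C_k_Suc_has_derivative[OF Suc(3)] C_k_Suc_has_derivative[OF Suc(2)]])
  then show ?case
    by (rule C_k_SucI)
      (rule C_k_mult[OF Suc(1)[of "\<lambda>y. frechet_derivative f (at y) 1" g]],
        use Suc(2,3) C_k_antimono_Suc in auto)
qed

text \<open>The inner map is vector valued, so \<open>C_k_compose\<close> does not apply.
  Translations, reflections and dilations of test functions rest on this case.\<close>

lemma C_k_affine: "C_k k f \<Longrightarrow> C_k k (\<lambda>x. f (c *\<^sub>R x + a))"
proof (induction k arbitrary: f)
  case 0
  have "continuous_on UNIV (\<lambda>x. f (c *\<^sub>R x + a))"
    by (rule continuous_on_compose2[where t=UNIV and g=f]) (use 0 in \<open>auto intro!: continuous_intros\<close>)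
  then show ?case by simp
next
  case (Suc k)
  have "((\<lambda>x. f (c *\<^sub>R x + a)) has_derivative
      (\<lambda>h. frechet_derivative f (at (c *\<^sub>R x + a)) (c *\<^sub>R h))) (at x)" for x
    by (rule has_derivative_compose[OF _ C_k_Suc_has_derivative[OF Suc(2)]])
      (auto intro!: derivative_eq_intros)
  moreover have "frechet_derivative f (at y) (c *\<^sub>R h) = c * frechet_derivative f (at y) h" for y h
    using Suc(2) by (auto simp: linear_scale linear_frechet_derivative)
  ultimately have "((\<lambda>x. f (c *\<^sub>R x + a)) has_derivative
      (\<lambda>h. c * frechet_derivative f (at (c *\<^sub>R x + a)) h)) (at x)" for x
    by simp
  then show ?case
    by (rule C_k_SucI) (use Suc(2) in \<open>auto intro!: C_k_cmult Suc(1)[of "\<lambda>y. frechet_derivative f (at y) b" for b]\<close>)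
qed

definition smooth :: "('a::euclidean_space \<Rightarrow> real) \<Rightarrow> bool" where
  "smooth f \<longleftrightarrow> (\<forall>k. C_k k f)"

lemma smooth_const: "smooth (\<lambda>x. c)"
  by (simp add: smooth_def C_k_const)

lemma smooth_bounded_linear: "bounded_linear f \<Longrightarrow> smooth f"
  by (simp add: smooth_def C_k_bounded_linear)

lemma smooth_add: "smooth f \<Longrightarrow> smooth g \<Longrightarrow> smooth (\<lambda>x. f x + g x)"
  by (simp add: smooth_def C_k_add)

lemma smooth_diff: "smooth f \<Longrightarrow> smooth g \<Longrightarrow> smooth (\<lambda>x. f x - g x)"
  by (simp add: smooth_def C_k_diff)

lemma smooth_mult: "smooth f \<Longrightarrow> smooth g \<Longrightarrow> smooth (\<lambda>x. f x * g x)"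
  by (simp add: smooth_def C_k_mult)

lemma smooth_compose: "smooth s \<Longrightarrow> smooth f \<Longrightarrow> smooth (\<lambda>x. s (f x))"
  unfolding smooth_def using C_k_compose[of _ s f] by simp

lemma smooth_affine: "smooth f \<Longrightarrow> smooth (\<lambda>x. f (c *\<^sub>R x + a))"
  unfolding smooth_def using C_k_affine[of _ f] by simp

lemma smooth_sum: "(\<And>i. i \<in> I \<Longrightarrow> smooth (h i)) \<Longrightarrow> smooth (\<lambda>x. \<Sum>i\<in>I. h i x)"
  by (simp add: smooth_def C_k_sum)

lemma smooth_prod: "(\<And>i. i \<in> I \<Longrightarrow> smooth (h i)) \<Longrightarrow> smooth (\<lambda>x. \<Prod>i\<in>I. h i x)"
  by (simp add: smooth_def C_k_prod)

lemma smooth_inner_left: "smooth (\<lambda>x. x \<bullet> b)"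
  by (rule smooth_bounded_linear) (rule bounded_linear_inner_left)

lemma smooth_inner_self: "smooth (\<lambda>x::'a::euclidean_space. x \<bullet> x)"
proof -
  have "smooth (\<lambda>x::'a. \<Sum>b\<in>Basis. (x \<bullet> b) * (x \<bullet> b))"
    by (intro smooth_sum smooth_mult smooth_inner_left)
  then show ?thesis by (simp flip: euclidean_inner)
qed

text \<open>Junk where the function is not differentiable.\<close>

definition grad :: "('a::euclidean_space \<Rightarrow> real) \<Rightarrow> 'a \<Rightarrow> 'a" where
  "grad f x = (\<Sum>b\<in>Basis. frechet_derivative f (at x) b *\<^sub>R b)"

lemma grad_inner_Basis: "b \<in> Basis \<Longrightarrow> grad f x \<bullet> b = frechet_derivative f (at x) b"
  by (simp add: grad_def inner_sum_left inner_Basis if_distrib sum.delta cong: if_cong)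

lemma frechet_derivative_eq_grad:
  assumes "f differentiable (at x)"
  shows "frechet_derivative f (at x) h = grad f x \<bullet> h"
proof -
  have "linear (frechet_derivative f (at x))" using assms by (rule linear_frechet_derivative)
  then have "frechet_derivative f (at x) (\<Sum>b\<in>Basis. (h \<bullet> b) *\<^sub>R b) =
      (\<Sum>b\<in>Basis. (h \<bullet> b) * frechet_derivative f (at x) b)"
    by (simp add: linear_sum linear_scale)
  then show ?thesis
    unfolding euclidean_representation
    by (simp add: grad_def inner_sum_left inner_sum_right inner_commute[of _ h] mult.commute)
qed

lemma has_derivative_grad:
  assumes "f differentiable (at x)"
  shows "(f has_derivative (\<lambda>h. grad f x \<bullet> h)) (at x)"
proof -
  have "(\<lambda>h. grad f x \<bullet> h) = frechet_derivative f (at x)"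
    using frechet_derivative_eq_grad[OF assms] by auto
  then show ?thesis using assms frechet_derivative_works by metis
qed

lemma grad_eqI:
  assumes "(f has_derivative (\<lambda>h. v \<bullet> h)) (at x)" shows "grad f x = v"
proof (rule euclidean_eqI)
  fix b :: 'a assume "b \<in> Basis"
  then show "grad f x \<bullet> b = v \<bullet> b"
    by (simp add: grad_inner_Basis frechet_derivative_at[OF assms, symmetric])
qed

lemma smooth_differentiable: "smooth f \<Longrightarrow> f differentiable (at x)"
  unfolding smooth_def using C_k.simps(2)[of 0 f] by blast

lemma smooth_frechet_derivative: "smooth f \<Longrightarrow> b \<in> Basis \<Longrightarrow> smooth (\<lambda>x. frechet_derivative f (at x) b)"
  unfolding smooth_def using C_k.simps(2) by blast

lemma smooth_continuous_on: "smooth f \<Longrightarrow> continuous_on S f"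
  unfolding smooth_def using C_k_imp_continuous continuous_on_subset by blast

lemma continuous_on_grad: "smooth f \<Longrightarrow> continuous_on S (grad f)"
  unfolding grad_def[abs_def]
  by (intro continuous_intros smooth_continuous_on smooth_frechet_derivative)

lemma grad_add: "smooth f \<Longrightarrow> smooth g \<Longrightarrow> grad (\<lambda>x. f x + g x) x = grad f x + grad g x"
  by (rule grad_eqI) (auto intro!: derivative_eq_intros has_derivative_grad smooth_differentiable
      simp: inner_add_left)

lemma grad_diff: "smooth f \<Longrightarrow> smooth g \<Longrightarrow> grad (\<lambda>x. f x - g x) x = grad f x - grad g x"
  by (rule grad_eqI) (auto intro!: derivative_eq_intros has_derivative_grad smooth_differentiable
      simp: inner_diff_left)

lemma grad_const: "grad (\<lambda>x. c) x = 0"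
  by (rule grad_eqI) (auto intro!: derivative_eq_intros)

lemma grad_mult:
  "smooth f \<Longrightarrow> smooth g \<Longrightarrow> grad (\<lambda>x. f x * g x) x = f x *\<^sub>R grad g x + g x *\<^sub>R grad f x"
  by (rule grad_eqI) (auto intro!: derivative_eq_intros has_derivative_grad smooth_differentiable
      simp: inner_add_left)

lemma grad_affine: "smooth f \<Longrightarrow> grad (\<lambda>x. f (c *\<^sub>R x + a)) x = c *\<^sub>R grad f (c *\<^sub>R x + a)"
  by (rule grad_eqI, rule has_derivative_eq_rhs,
      rule has_derivative_compose[OF _ has_derivative_grad[OF smooth_differentiable]])
    (auto intro!: derivative_eq_intros)

section \<open>Bump functions\<close>

definition exp_inv :: "real poly \<Rightarrow> real \<Rightarrow> real" where
  "exp_inv p x = (if x > 0 then poly p (1 / x) * exp (- (1 / x)) else 0)"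

lemma poly_div_exp_tendsto_0: "((\<lambda>y. poly p y * exp (- y)) \<longlongrightarrow> (0::real)) at_top"
proof -
  have "((\<lambda>y. \<Sum>i\<le>degree p. coeff p i * (y ^ i / exp y)) \<longlongrightarrow> (\<Sum>i\<le>degree p. coeff p i * 0)) at_top"
    by (intro tendsto_intros tendsto_power_div_exp_0)
  moreover have "(\<Sum>i\<le>degree p. coeff p i * (y ^ i / exp y)) = poly p y * exp (- y)" for y
    by (simp add: poly_altdef sum_distrib_right exp_minus divide_inverse mult.assoc)
  ultimately show ?thesis by simp
qed

lemma exp_inv_div_tendsto_0: "((\<lambda>h. exp_inv p h / h) \<longlongrightarrow> 0) (at 0)"
proof (rule filterlim_split_at)
  show "((\<lambda>h. exp_inv p h / h) \<longlongrightarrow> 0) (at_left 0)"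
    by (rule tendsto_eventually, rule eventually_mono[OF eventually_at_left_real[of "-1" 0]])
      (auto simp: exp_inv_def)
  \<comment> \<open>Division by \<open>h\<close> merely multiplies the polynomial in
    \<open>1 / h\<close> by its variable, so the exponential still wins.\<close>
  have "((\<lambda>h. poly ([:0, 1:] * p) (inverse h) * exp (- inverse h)) \<longlongrightarrow> (0::real)) (at_right 0)"
    by (rule filterlim_compose[OF poly_div_exp_tendsto_0 filterlim_inverse_at_top_right])
  then show "((\<lambda>h. exp_inv p h / h) \<longlongrightarrow> 0) (at_right 0)"
    by (rule Lim_transform_eventually, intro eventually_mono[OF eventually_at_right_real[of 0 1]])
      (auto simp: exp_inv_def field_simps)
qed

text \<open>With \<open>y = 1 / x\<close>, the derivative of \<open>p(y) exp(-y)\<close> is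
  \<open>(p'(y) - p(y)) exp(-y)\<close> times \<open>-y^2\<close>, again a member of the family. At
  the origin the difference quotient is \<open>exp_inv p h / h\<close>.\<close>

lemma DERIV_exp_inv:
  "(exp_inv p has_real_derivative exp_inv ([:0, 0, 1:] * (p - pderiv p)) x) (at x)"
proof (cases x "0::real" rule: linorder_cases)
  case equal
  have "((\<lambda>h. (exp_inv p (0 + h) - exp_inv p 0) / h) \<longlongrightarrow> 0) (at 0)"
    using exp_inv_div_tendsto_0[of p] by (simp add: exp_inv_def)
  then show ?thesis using equal by (simp add: DERIV_def exp_inv_def)
next
  case less
  have "((\<lambda>x. 0) has_real_derivative 0) (at x)" by simp
  then have "(exp_inv p has_real_derivative 0) (at x)"
    by (rule has_field_derivative_transform_within_open[of _ _ _ "{..<0}"]) (use less in \<open>auto simp: exp_inv_def\<close>)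
  then show ?thesis using less by (simp add: exp_inv_def)
next
  case greater
  have "((\<lambda>x. poly p (1 / x) * exp (- (1 / x))) has_real_derivative
      exp_inv ([:0, 0, 1:] * (p - pderiv p)) x) (at x)"
    using greater
    by (auto intro!: derivative_eq_intros DERIV_chain2[OF poly_DERIV] simp: exp_inv_def field_simps power2_eq_square)
  then show ?thesis
    by (rule has_field_derivative_transform_within_open[of _ _ _ "{0<..}"]) (use greater in \<open>auto simp: exp_inv_def\<close>)
qed

lemma C_k_exp_inv: "C_k k (exp_inv p)"
proof (induction k arbitrary: p)
  case 0
  show ?case
    using DERIV_isCont[OF DERIV_exp_inv] by (simp add: continuous_at_imp_continuous_on)
next
  case (Suc k)
  show ?case
    by (rule C_k_SucI[OF DERIV_exp_inv[unfolded has_field_derivative_def]])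
      (use C_k_cmult[OF Suc, of 1] in \<open>auto simp: C_k_cmult mult.commute\<close>)
qed

definition flat :: "real \<Rightarrow> real" where
  "flat x = (if x > 0 then exp (- (1 / x)) else 0)"

lemma smooth_flat: "smooth flat"
proof -
  have "flat = exp_inv 1" by (auto simp: flat_def exp_inv_def)
  then show ?thesis using C_k_exp_inv[of _ 1] by (simp add: smooth_def)
qed

lemma flat_nonneg: "0 \<le> flat x" and flat_le_1: "flat x \<le> 1"
  and flat_pos_iff: "0 < flat x \<longleftrightarrow> 0 < x" and flat_eq_0_iff: "flat x = 0 \<longleftrightarrow> x \<le> 0"
  by (auto simp: flat_def)

lemma flat_mono: "x \<le> y \<Longrightarrow> flat x \<le> flat y"
  by (auto simp: flat_def divide_simps)

text \<open>The usual quotient of \<open>flat t\<close> by \<open>flat t + flat (1 - t)\<close>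
  would require a rule for reciprocals of smooth functions. This nested form needs only composition
  and division by a constant: the inner difference is nonpositive for \<open>t \<le> 0\<close> and
  equals \<open>flat 1\<close> for \<open>t \<ge> 1\<close>.\<close>

definition smooth_step :: "real \<Rightarrow> real" where
  "smooth_step t = flat (flat 1 - flat (1 - t)) / flat (flat 1)"

lemma smooth_smooth_step: "smooth smooth_step"
proof -
  have "smooth (\<lambda>t. (1 / flat (flat 1)) * flat (flat 1 - flat ((-1) *\<^sub>R t + 1)))"
    by (intro smooth_mult[OF smooth_const] smooth_compose[OF smooth_flat] smooth_diff[OF smooth_const]
        smooth_affine[OF smooth_flat])
  then show ?thesis by (simp add: smooth_step_def[abs_def])
qed

lemma flat_flat_1_pos: "0 < flat (flat 1)"
  by (simp add: flat_pos_iff)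

lemma smooth_step_nonneg: "0 \<le> smooth_step t"
  by (simp add: smooth_step_def flat_nonneg)

lemma smooth_step_le_1: "smooth_step t \<le> 1"
  unfolding smooth_step_def using flat_flat_1_pos flat_mono[of "flat 1 - flat (1 - t)" "flat 1"] flat_nonneg
  by (simp add: divide_le_eq)

lemma smooth_step_eq_1:
  assumes "t \<ge> 1" shows "smooth_step t = 1"
proof -
  have "flat (1 - t) = 0" using assms by (simp add: flat_def)
  then show ?thesis using flat_flat_1_pos unfolding smooth_step_def by simp
qed

lemma smooth_step_eq_0:
  assumes "t \<le> 0" shows "smooth_step t = 0"
proof -
  have "flat 1 \<le> flat (1 - t)" by (rule flat_mono) (use assms in simp)
  then have "flat (flat 1 - flat (1 - t)) = 0" unfolding flat_eq_0_iff by linarith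
  then show ?thesis unfolding smooth_step_def by simp
qed

text \<open>The argument of the step is 1 on the unit sphere and 0 on the sphere of radius 2. The
  squared norm is used because it is smooth at the origin.\<close>

definition cutoff :: "'a::euclidean_space \<Rightarrow> real" where
  "cutoff x = smooth_step ((4 - x \<bullet> x) / 3)"

lemma smooth_cutoff: "smooth cutoff"
proof -
  have "smooth (\<lambda>x::'a. smooth_step ((1/3) * (4 - x \<bullet> x)))"
    by (rule smooth_compose[OF smooth_smooth_step smooth_mult[OF smooth_const smooth_diff[OF smooth_const smooth_inner_self]]])
  then show ?thesis by (simp add: cutoff_def[abs_def])
qed

lemma cutoff_nonneg: "0 \<le> cutoff x" and cutoff_le_1: "cutoff x \<le> 1"
  by (simp_all add: cutoff_def smooth_step_nonneg smooth_step_le_1)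

lemma cutoff_eq_1:
  assumes "norm x \<le> 1" shows "cutoff x = 1"
proof -
  have "x \<bullet> x \<le> 1"
    unfolding dot_square_norm by (rule power_le_one) (use assms in auto)
  then show ?thesis unfolding cutoff_def by (intro smooth_step_eq_1) simp
qed

lemma cutoff_eq_0:
  assumes "norm x \<ge> 2" shows "cutoff x = 0"
proof -
  have "2\<^sup>2 \<le> x \<bullet> x"
    unfolding dot_square_norm by (rule power_mono) (use assms in auto)
  then show ?thesis unfolding cutoff_def by (intro smooth_step_eq_0) simp
qed

section \<open>Lebesgue measure\<close>

text \<open>Fubini and translation arguments need Borel functions on \<open>lborel\<close>, whereas
  members of \<open>L2\<close> are only Lebesgue measurable. The representative is found component
  by component.\<close>

lemma lebesgue_ex_borel:
  fixes f :: "'a::euclidean_space \<Rightarrow> 'b::euclidean_space"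
  assumes "f \<in> borel_measurable lebesgue"
  obtains g where "g \<in> borel_measurable borel" "AE x in lebesgue. f x = g x"
proof -
  have "\<forall>b. \<exists>g. g \<in> borel_measurable lborel \<and> (AE x in lborel. f x \<bullet> b = g x)"
  proof
    fix b
    have "(\<lambda>x. f x \<bullet> b) \<in> borel_measurable lebesgue" using assms by simp
    then show "\<exists>g. g \<in> borel_measurable lborel \<and> (AE x in lborel. f x \<bullet> b = g x)"
      using completion_ex_borel_measurable_real by blast
  qed
  from choice[OF this] obtain h
    where h: "\<And>b. h b \<in> borel_measurable lborel" "\<And>b. AE x in lborel. f x \<bullet> b = h b x"
    by auto
  show thesis
  proof (rule that)
    show "(\<lambda>x. \<Sum>b\<in>Basis. h b x *\<^sub>R b) \<in> borel_measurable borel"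
      using h(1) by simp
    have "AE x in lborel. \<forall>b\<in>Basis. f x \<bullet> b = h b x"
      by (rule AE_finite_allI[OF finite_Basis h(2)])
    then have "AE x in lborel. f x = (\<Sum>b\<in>Basis. h b x *\<^sub>R b)"
    proof eventually_elim
      case (elim x)
      have "f x = (\<Sum>b\<in>Basis. (f x \<bullet> b) *\<^sub>R b)"
        by (rule euclidean_representation[symmetric])
      also have "\<dots> = (\<Sum>b\<in>Basis. h b x *\<^sub>R b)"
        by (rule sum.cong) (use elim in auto)
      finally show ?case .
    qed
    then show "AE x in lebesgue. f x = (\<Sum>b\<in>Basis. h b x *\<^sub>R b)"
      unfolding AE_completion_iff .
  qed
qed

lemma borel_imp_lebesgue_measurable:
  fixes f :: "'a::euclidean_space \<Rightarrow> 'b::topological_space"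
  shows "f \<in> borel_measurable borel \<Longrightarrow> f \<in> borel_measurable lebesgue"
  by (rule measurable_completion) simp

lemma integral_lebesgue_on:
  fixes f :: "'a::euclidean_space \<Rightarrow> 'b::euclidean_space"
  assumes "S \<in> sets lebesgue"
  shows "(LINT x|lebesgue_on S. f x) = (LINT x|lebesgue. indicator S x *\<^sub>R f x)"
  by (rule integral_restrict_space) (use assms in simp)

lemma integrable_lebesgue_on:
  fixes f :: "'a::euclidean_space \<Rightarrow> 'b::euclidean_space"
  assumes "S \<in> sets lebesgue"
  shows "integrable (lebesgue_on S) f \<longleftrightarrow> integrable lebesgue (\<lambda>x. indicator S x *\<^sub>R f x)"
  by (rule integrable_restrict_space) (use assms in simp)

lemma AE_lebesgue_on:
  assumes "S \<in> sets lebesgue"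
  shows "(AE x in lebesgue_on S. P x) \<longleftrightarrow> (AE x in lebesgue. x \<in> S \<longrightarrow> P x)"
  by (rule AE_restrict_space_iff) (use assms in simp)

lemma lborel_integral_translation:
  fixes f :: "'a::euclidean_space \<Rightarrow> 'b::euclidean_space"
  assumes "f \<in> borel_measurable borel"
  shows "(LINT x|lborel. f (a + x)) = (LINT x|lborel. f x)"
proof -
  have "(LINT x|lborel. f x) = (LINT x|distr lborel borel ((+) a). f x)"
    by (simp add: lborel_distr_plus)
  also have "\<dots> = (LINT x|lborel. f (a + x))"
    by (rule integral_distr) (use assms in auto)
  finally show ?thesis ..
qed

lemma lborel_integrable_translation:
  fixes f :: "'a::euclidean_space \<Rightarrow> 'b::euclidean_space"
  assumes "integrable lborel f"
  shows "integrable lborel (\<lambda>x. f (a + x))"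
proof -
  have "integrable (distr lborel borel ((+) a)) f"
    by (simp add: lborel_distr_plus assms)
  then show ?thesis
    by (rule integrable_distr[rotated]) auto
qed

text \<open>The Borel sets over which the integral of \<open>f\<close> vanishes form a Dynkin
  system, and boxes are an intersection-stable generator. The total integral must vanish for the
  system to be closed under complements.\<close>

lemma lborel_AE_eq_0_of_boxes:
  fixes f :: "'a::euclidean_space \<Rightarrow> real"
  assumes f: "integrable lborel f" and f0: "(LINT x|lborel. f x) = 0"
    and box: "\<And>a b. (LINT x|lborel. indicator (box a b) x * f x) = 0"
  shows "AE x in lborel. f x = 0"
proof -
  have zero: "set_lebesgue_integral lborel A f = 0" if "A \<in> sets borel" for A
  proof -
    have "Int_stable (range (\<lambda>(a::'a, b). box a b))"
      by (auto simp: Int_stable_def box_Int_box)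
    moreover have "range (\<lambda>(a::'a, b). box a b) \<subseteq> Pow UNIV" by simp
    moreover have "A \<in> sigma_sets UNIV (range (\<lambda>(a, b). box a b))"
      using that by (simp add: borel_eq_box)
    ultimately show ?thesis
    proof (induction rule: sigma_sets_induct_disjoint)
      case (basic A)
      then show ?case using box by (auto simp: set_lebesgue_integral_def)
    next
      case empty
      then show ?case by (simp add: set_lebesgue_integral_def)
    next
      case (compl A)
      have A: "A \<in> sets lborel" using compl(1) by (simp add: borel_eq_box)
      have "set_lebesgue_integral lborel (UNIV - A) f =
          (LINT x|lborel. f x - indicator A x *\<^sub>R f x)"
        unfolding set_lebesgue_integral_def
        by (intro Bochner_Integration.integral_cong) (auto simp: indicator_def)
      also have "\<dots> = (LINT x|lborel. f x) - set_lebesgue_integral lborel A f"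
        unfolding set_lebesgue_integral_def
        by (intro Bochner_Integration.integral_diff f integrable_mult_indicator A)
      finally show ?case using compl f0 by simp
    next
      case (union A)
      have A: "A i \<in> sets lborel" for i using union(2) by (auto simp: borel_eq_box)
      have "set_lebesgue_integral lborel (\<Union>i. A i) f = (\<Sum>i. set_lebesgue_integral lborel (A i) f)"
      proof (rule lebesgue_integral_countable_add)
        show "A i \<inter> A j = {}" if "i \<noteq> j" for i j
          using union(1) that by (auto simp: disjoint_family_on_def)
        show "set_integrable lborel (\<Union>i. A i) f"
          unfolding set_integrable_def by (intro integrable_mult_indicator f) (use A in auto)
      qed (use A in auto)
      then show ?case using union by simp
    qed
  qed
  show ?thesis
  proof (rule density_unique_real[OF f])
    fix A :: "'a set" assume "A \<in> sets lborel"
    then show "set_lebesgue_integral lborel A f = set_lebesgue_integral lborel A (\<lambda>x. 0)"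
      using zero by (simp add: set_lebesgue_integral_def)
  qed simp
qed

section \<open>Test functions\<close>

lemma test_functionsI:
  assumes "smooth \<phi>" "compact K" "K \<subseteq> D" "\<And>x. x \<notin> K \<Longrightarrow> \<phi> x = 0"
  shows "\<phi> \<in> test_functions D"
proof -
  have "closure {x. \<phi> x \<noteq> 0} \<subseteq> K"
    by (intro closure_minimal compact_imp_closed assms(2)) (use assms(4) in auto)
  then show ?thesis
    using assms unfolding test_functions_def compactly_contained_def smooth_def compact_eq_bounded_closed
    by (blast intro: bounded_subset closed_closure)
qed

lemma test_functionsE:
  assumes "\<phi> \<in> test_functions D"
  obtains K where "smooth \<phi>" "compact K" "K \<subseteq> D" "\<And>x. x \<notin> K \<Longrightarrow> \<phi> x = 0"
    "\<And>x. x \<notin> K \<Longrightarrow> frechet_derivative \<phi> (at x) = (\<lambda>h. 0)"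
proof -
  let ?K = "closure {x. \<phi> x \<noteq> 0}"
  have "frechet_derivative \<phi> (at x) = (\<lambda>h. 0)" if "x \<notin> ?K" for x
  proof -
    have "((\<lambda>x. 0) has_derivative (\<lambda>h. 0)) (at x)" by simp
    then have "(\<phi> has_derivative (\<lambda>h. 0)) (at x)"
    proof (rule has_derivative_transform_within_open[of _ _ _ _ "- ?K"])
      show "0 = \<phi> y" if "y \<in> - ?K" for y
        using that closure_subset[of "{x. \<phi> x \<noteq> 0}"] by auto
    qed (use that in auto)
    then show ?thesis by (rule frechet_derivative_at[symmetric])
  qed
  moreover have "\<phi> x = 0" if "x \<notin> ?K" for x
    using that closure_subset[of "{x. \<phi> x \<noteq> 0}"] by auto
  moreover have "smooth \<phi>" "compact ?K" "?K \<subseteq> D"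
    using assms unfolding test_functions_def compactly_contained_def smooth_def by blast+
  ultimately show thesis by (intro that[of ?K])
qed

lemma test_functions_smooth: "\<phi> \<in> test_functions D \<Longrightarrow> smooth \<phi>"
  by (auto simp: test_functions_def smooth_def)

lemma test_functions_mono: "D \<subseteq> E \<Longrightarrow> test_functions D \<subseteq> test_functions E"
  by (auto simp: test_functions_def compactly_contained_def)

lemma test_functions_zero: "(\<lambda>x. 0) \<in> test_functions D"
  by (rule test_functionsI[of _ "{}"]) (auto intro: smooth_const)

lemma test_functions_add:
  assumes "\<phi> \<in> test_functions D" "\<psi> \<in> test_functions D"
  shows "(\<lambda>x. \<phi> x + \<psi> x) \<in> test_functions D"
proof -
  obtain K where "smooth \<phi>" "compact K" "K \<subseteq> D" "\<And>x. x \<notin> K \<Longrightarrow> \<phi> x = 0"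
    using assms(1) by (rule test_functionsE) blast
  moreover obtain L where "smooth \<psi>" "compact L" "L \<subseteq> D" "\<And>x. x \<notin> L \<Longrightarrow> \<psi> x = 0"
    using assms(2) by (rule test_functionsE) blast
  ultimately show ?thesis
    by (intro test_functionsI[of _ "K \<union> L"]) (auto intro: smooth_add)
qed

lemma test_functions_mult:
  assumes "\<phi> \<in> test_functions D" "smooth s"
  shows "(\<lambda>x. \<phi> x * s x) \<in> test_functions D"
proof -
  obtain K where "smooth \<phi>" "compact K" "K \<subseteq> D" "\<And>x. x \<notin> K \<Longrightarrow> \<phi> x = 0"
    using assms(1) by (rule test_functionsE) blast
  then show ?thesis
    by (intro test_functionsI[of _ K]) (auto intro: smooth_mult assms)
qed

lemma test_functions_cmult: "\<phi> \<in> test_functions D \<Longrightarrow> (\<lambda>x. c * \<phi> x) \<in> test_functions D"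
  using test_functions_mult[OF _ smooth_const, of \<phi> D c] by (simp add: mult.commute)

lemma test_functions_diff:
  "\<phi> \<in> test_functions D \<Longrightarrow> \<psi> \<in> test_functions D \<Longrightarrow> (\<lambda>x. \<phi> x - \<psi> x) \<in> test_functions D"
  using test_functions_add[OF _ test_functions_cmult[of \<psi> D "-1"]] by simp

lemma test_functions_frechet_derivative:
  assumes "\<phi> \<in> test_functions D" "b \<in> Basis"
  shows "(\<lambda>x. frechet_derivative \<phi> (at x) b) \<in> test_functions D"
proof -
  obtain K where "smooth \<phi>" "compact K" "K \<subseteq> D"
      "\<And>x. x \<notin> K \<Longrightarrow> frechet_derivative \<phi> (at x) = (\<lambda>h. 0)"
    using assms(1) by (rule test_functionsE) blast
  then show ?thesis
    by (intro test_functionsI[of _ K] smooth_frechet_derivative assms) auto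
qed

lemma test_functions_affine:
  assumes "\<phi> \<in> test_functions UNIV" "c \<noteq> 0"
  shows "(\<lambda>x. \<phi> (c *\<^sub>R x + a)) \<in> test_functions UNIV"
proof -
  obtain K where K: "smooth \<phi>" "compact K" "\<And>x. x \<notin> K \<Longrightarrow> \<phi> x = 0"
    using assms(1) by (rule test_functionsE) blast
  show ?thesis
  proof (rule test_functionsI[of _ "(\<lambda>y. (1 / c) *\<^sub>R (y - a)) ` K"])
    show "compact ((\<lambda>y. (1 / c) *\<^sub>R (y - a)) ` K)"
      by (intro compact_continuous_image continuous_intros K(2))
    show "\<phi> (c *\<^sub>R x + a) = 0" if "x \<notin> (\<lambda>y. (1 / c) *\<^sub>R (y - a)) ` K" for x
    proof (rule K(3), rule notI)
      assume "c *\<^sub>R x + a \<in> K"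
      then have "(1 / c) *\<^sub>R (c *\<^sub>R x + a - a) \<in> (\<lambda>y. (1 / c) *\<^sub>R (y - a)) ` K"
        by (rule imageI)
      then show False using that assms(2) by simp
    qed
  qed (use smooth_affine[OF K(1)] in auto)
qed

lemma test_functions_bounded:
  assumes "\<phi> \<in> test_functions D"
  obtains M where "M > 0" "\<And>x. \<bar>\<phi> x\<bar> \<le> M"
proof -
  obtain K where K: "smooth \<phi>" "compact K" "\<And>x. x \<notin> K \<Longrightarrow> \<phi> x = 0"
    using assms by (rule test_functionsE) blast
  have "bounded (\<phi> ` K)"
    by (intro compact_imp_bounded compact_continuous_image smooth_continuous_on K)
  then obtain M where M: "M > 0" "\<And>x. x \<in> K \<Longrightarrow> \<bar>\<phi> x\<bar> \<le> M"
    by (auto simp: bounded_pos)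
  have "\<bar>\<phi> x\<bar> \<le> M" for x
    using M K(3)[of x] by (cases "x \<in> K") auto
  then show thesis using that M(1) by blast
qed

lemma test_functions_grad_bounded:
  assumes "\<phi> \<in> test_functions D"
  obtains M where "M > 0" "\<And>x. norm (grad \<phi> x) \<le> M"
proof -
  obtain K where K: "smooth \<phi>" "compact K"
      "\<And>x. x \<notin> K \<Longrightarrow> frechet_derivative \<phi> (at x) = (\<lambda>h. 0)"
    using assms by (rule test_functionsE) blast
  have "bounded (grad \<phi> ` K)"
    by (intro compact_imp_bounded compact_continuous_image continuous_on_grad K)
  then obtain M where M: "M > 0" "\<And>x. x \<in> K \<Longrightarrow> norm (grad \<phi> x) \<le> M"
    by (auto simp: bounded_pos)
  have "grad \<phi> x = 0" if "x \<notin> K" for x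
    using K(3)[OF that] by (simp add: grad_def)
  then have "norm (grad \<phi> x) \<le> M" for x
    using M by (cases "x \<in> K") auto
  then show thesis using that M(1) by blast
qed

lemma smooth_borel_measurable: "smooth f \<Longrightarrow> f \<in> borel_measurable borel"
  by (intro borel_measurable_continuous_onI smooth_continuous_on)

lemma grad_borel_measurable: "smooth f \<Longrightarrow> grad f \<in> borel_measurable borel"
  by (intro borel_measurable_continuous_onI continuous_on_grad)

lemma integrable_lebesgue_compact_support:
  fixes f :: "'a::euclidean_space \<Rightarrow> 'b::euclidean_space"
  assumes "continuous_on UNIV f" "compact K" "\<And>x. x \<notin> K \<Longrightarrow> f x = 0"
  shows "integrable lebesgue f"
proof -
  have "integrable lborel (\<lambda>x. indicator K x *\<^sub>R f x)"
    using borel_integrable_compact[OF assms(2) continuous_on_subset[OF assms(1)]] by simp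
  moreover have "indicator K x *\<^sub>R f x = f x" for x
    using assms(3) by (auto simp: indicator_def)
  moreover have "f \<in> borel_measurable lborel"
    using assms(1) by (simp add: borel_measurable_continuous_onI)
  ultimately show ?thesis by (simp add: integrable_completion)
qed

section \<open>Smooth approximation of boxes and the fundamental lemma of the calculus of
  variations\<close>

definition box_bump :: "nat \<Rightarrow> 'a::euclidean_space \<Rightarrow> 'a \<Rightarrow> 'a \<Rightarrow> real" where
  "box_bump n a b x =
     (\<Prod>i\<in>Basis. flat (real (Suc n) * (x \<bullet> i - a \<bullet> i)) * flat (real (Suc n) * (b \<bullet> i - x \<bullet> i)))"

lemma smooth_box_bump: "smooth (box_bump n a b)"
proof -
  have "smooth (\<lambda>x. real (Suc n) * (x \<bullet> i - a \<bullet> i))"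
       "smooth (\<lambda>x. real (Suc n) * (b \<bullet> i - x \<bullet> i))" for i
    by (intro smooth_mult[OF smooth_const] smooth_diff smooth_const smooth_inner_left)+
  note this[THEN smooth_compose[OF smooth_flat]]
  then show ?thesis
    unfolding box_bump_def[abs_def] by (intro smooth_prod smooth_mult) auto
qed

lemma box_bump_nonneg: "0 \<le> box_bump n a b x"
  and box_bump_le_1: "box_bump n a b x \<le> 1"
  unfolding box_bump_def
  by (auto intro!: prod_nonneg prod_le_1 mult_le_one simp: flat_nonneg flat_le_1)

lemma box_bump_eq_0:
  assumes "x \<notin> box a b" shows "box_bump n a b x = 0"
proof -
  obtain i where "i \<in> Basis" "x \<bullet> i \<le> a \<bullet> i \<or> b \<bullet> i \<le> x \<bullet> i"
    using assms by (auto simp: box_def not_less)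
  then show ?thesis
    unfolding box_bump_def by (intro prod_zero) (auto simp: flat_eq_0_iff mult_le_0_iff)
qed

lemma flat_tendsto_1:
  assumes "x > 0" shows "(\<lambda>n. flat (real (Suc n) * x)) \<longlonglongrightarrow> 1"
proof -
  have "(\<lambda>n. exp (- (1 / x) * inverse (real (Suc n)))) \<longlonglongrightarrow> exp (- (1 / x) * 0)"
    by (intro tendsto_intros LIMSEQ_inverse_real_of_nat)
  moreover have "flat (real (Suc n) * x) = exp (- (1 / x) * inverse (real (Suc n)))" for n
  proof -
    have "real (Suc n) * x > 0" using assms by simp
    then show ?thesis by (simp add: flat_def divide_inverse mult.commute)
  qed
  ultimately show ?thesis by simp
qed

text \<open>Inside the box every factor \<open>flat (m * s)\<close> has \<open>s > 0\<close> and
  tends to 1 as \<open>m\<close> grows; outside, some factor is identically 0. This yields the open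
  box, boundary excluded.\<close>

lemma box_bump_tendsto: "(\<lambda>n. box_bump n a b x) \<longlonglongrightarrow> indicator (box a b) x"
proof (cases "x \<in> box a b")
  case True
  then have "(\<lambda>n. box_bump n a b x) \<longlonglongrightarrow> (\<Prod>i\<in>(Basis::'a set). 1 * 1)"
    unfolding box_bump_def
    by (intro tendsto_prod tendsto_mult flat_tendsto_1) (auto simp: box_def)
  then show ?thesis using True by simp
qed (simp add: box_bump_eq_0)

lemma box_bump_test_function: "cbox a b \<subseteq> D \<Longrightarrow> box_bump n a b \<in> test_functions D"
  by (rule test_functionsI[OF smooth_box_bump compact_cbox])
    (use box_bump_eq_0 box_subset_cbox in blast)+

text \<open>Testing with bumps and passing to the limit by dominated convergence shows that
  \<open>g\<close> has integral 0 over every box whose closed box lies in \<open>D\<close>. Boxes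
  determine an integrable function, and \<open>D\<close> is a countable union of closed
  boxes.\<close>

lemma fundamental_lemma:
  fixes g :: "'a::euclidean_space \<Rightarrow> real"
  assumes D: "open D" and g: "\<And>K. compact K \<Longrightarrow> K \<subseteq> D \<Longrightarrow> integrable (lebesgue_on K) g"
    and test: "\<And>\<phi>. \<phi> \<in> test_functions D \<Longrightarrow> (LINT x|lebesgue_on D. g x * \<phi> x) = 0"
  shows "AE x in lebesgue_on D. g x = 0"
proof -
  have box0: "(LINT x|lebesgue. indicator (box a b) x * g x) = 0" if ab: "cbox a b \<subseteq> D" for a b
  proof -
    \<comment> \<open>\<open>g\<close> is only locally integrable on \<open>D\<close>; replacing
      \<open>D\<close> by the closed box, outside of which the bump vanishes, provides the
      integrable majorant.\<close>
    have ind: "indicator D x * (g x * box_bump n a b x) = indicator (cbox a b) x * g x * box_bump n a b x" for n x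
      using ab box_bump_eq_0[of x a b n] box_subset_cbox[of a b] by (auto simp: indicator_def)
    have cb: "integrable lebesgue (\<lambda>x. indicator (cbox a b) x * g x)"
      using g[OF compact_cbox ab] by (simp add: integrable_lebesgue_on)
    have "(\<lambda>n. LINT x|lebesgue. indicator (cbox a b) x * g x * box_bump n a b x) \<longlonglongrightarrow>
        (LINT x|lebesgue. indicator (cbox a b) x * g x * indicator (box a b) x)"
    proof (rule integral_dominated_convergence[where w = "\<lambda>x. \<bar>indicator (cbox a b) x * g x\<bar>"])
      have "box_bump n a b \<in> borel_measurable lebesgue" for n
        by (intro borel_imp_lebesgue_measurable smooth_borel_measurable smooth_box_bump)
      then show "(\<lambda>x. indicator (cbox a b) x * g x * box_bump n a b x) \<in> borel_measurable lebesgue" for n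
        by (rule borel_measurable_times[OF borel_measurable_integrable[OF cb]])
      show "(\<lambda>x. indicator (cbox a b) x * g x * indicator (box a b) x) \<in> borel_measurable lebesgue"
        by (rule borel_measurable_times[OF borel_measurable_integrable[OF cb]
              borel_imp_lebesgue_measurable]) simp
      show "AE x in lebesgue. norm (indicator (cbox a b) x * g x * box_bump n a b x)
          \<le> \<bar>indicator (cbox a b) x * g x\<bar>" for n
        using box_bump_nonneg[of n a b] box_bump_le_1[of n a b]
        by (intro AE_I2) (simp add: abs_mult mult_left_le)
      show "AE x in lebesgue. (\<lambda>n. indicator (cbox a b) x * g x * box_bump n a b x) \<longlonglongrightarrow>
          indicator (cbox a b) x * g x * indicator (box a b) x"
        by (intro AE_I2 tendsto_mult tendsto_const box_bump_tendsto)
    qed (use cb in simp)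
    moreover have "(LINT x|lebesgue. indicator (cbox a b) x * g x * box_bump n a b x) = 0" for n
      using test[OF box_bump_test_function[OF ab], of n] D
      by (simp add: integral_lebesgue_on ind)
    ultimately have "(LINT x|lebesgue. indicator (cbox a b) x * g x * indicator (box a b) x) = 0"
      by (simp add: LIMSEQ_const_iff)
    moreover have "indicator (cbox a b) x * g x * indicator (box a b) x = indicator (box a b) x * g x" for x
      using box_subset_cbox[of a b] by (auto simp: indicator_def)
    ultimately show ?thesis by simp
  qed
  have cbox0: "AE x in lebesgue. x \<in> cbox p q \<longrightarrow> g x = 0" if pq: "cbox p q \<subseteq> D" for p q
  proof -
    define h where "h x = indicator (box p q) x * g x" for x
    have cb: "integrable lebesgue (\<lambda>x. indicator (cbox p q) x * g x)"
      using g[OF compact_cbox pq] by (simp add: integrable_lebesgue_on)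
    have "integrable lebesgue (\<lambda>x. indicator (box p q) x *\<^sub>R (indicator (cbox p q) x * g x))"
      by (intro integrable_mult_indicator cb) simp
    moreover have "indicator (box p q) x *\<^sub>R (indicator (cbox p q) x * g x) = h x" for x
      using box_subset_cbox[of p q] by (auto simp: h_def indicator_def)
    ultimately have h: "integrable lebesgue h" by simp
    obtain h' where h': "h' \<in> borel_measurable borel" "AE x in lebesgue. h x = h' x"
      using lebesgue_ex_borel[OF borel_measurable_integrable[OF h]] .
    have eq: "(LINT x|lborel. s x * h' x) = (LINT x|lebesgue. s x * h x)"
      if "s \<in> borel_measurable borel" for s
    proof -
      have "(LINT x|lborel. s x * h' x) = (LINT x|lebesgue. s x * h' x)"
        using that h'(1) by (intro integral_completion[symmetric]) simp
      also have "\<dots> = (LINT x|lebesgue. s x * h x)"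
        using h'(2) that[THEN borel_imp_lebesgue_measurable] borel_measurable_integrable[OF h]
          h'(1)[THEN borel_imp_lebesgue_measurable]
        by (intro integral_cong_AE) auto
      finally show ?thesis .
    qed
    have "integrable lebesgue h'"
      using integrable_cong_AE[OF borel_measurable_integrable[OF h]
          borel_imp_lebesgue_measurable[OF h'(1)] h'(2)] h by simp
    then have h'i: "integrable lborel h'"
      using h'(1) by (simp add: integrable_completion)
    have "AE x in lborel. h' x = 0"
    proof (rule lborel_AE_eq_0_of_boxes[OF h'i])
      show "(LINT x|lborel. h' x) = 0"
        using eq[of "\<lambda>x. 1"] box0[OF pq] by (simp add: h_def)
    next
      fix a b :: 'a
      obtain c d where cd: "box a b \<inter> box p q = box c d"
        by (auto simp: box_Int_box)
      show "(LINT x|lborel. indicator (box a b) x * h' x) = 0"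
      \<comment> \<open>For an empty open box the closed box with the same corners may leave
        \<open>D\<close>. For a nonempty one it is the closure of the open box and stays inside
        \<open>cbox p q\<close>.\<close>
      proof (cases "box c d = {}")
        case True
        then have "(\<lambda>x. indicator (box a b) x * h x) = (\<lambda>x. 0)"
          using cd by (auto simp: h_def fun_eq_iff split: split_indicator)
        then show ?thesis by (simp add: eq)
      next
        case False
        then have "cbox c d = closure (box c d)" by simp
        also have "\<dots> \<subseteq> closure (box p q)" using cd by (intro closure_mono) auto
        also have "\<dots> \<subseteq> cbox p q" by (intro closure_minimal box_subset_cbox closed_cbox)
        finally have "cbox c d \<subseteq> D" using pq by simp
        then have "(LINT x|lebesgue. indicator (box c d) x * g x) = 0" by (rule box0)
        moreover have "(\<lambda>x. indicator (box a b) x * h x) = (\<lambda>x. indicator (box c d) x * g x)"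
          unfolding cd[symmetric] by (auto simp: h_def indicator_inter_arith)
        ultimately show ?thesis by (simp add: eq)
      qed
    qed
    then have "AE x in lebesgue. h' x = 0" by (simp add: AE_completion_iff)
    moreover have "negligible (cbox p q - box p q)" by (rule negligible_frontier_interval)
    then have "AE x in lebesgue. x \<notin> cbox p q - box p q"
      unfolding negligible_iff_null_sets by (rule AE_not_in)
    ultimately show ?thesis
      using h'(2)
    proof eventually_elim
      case (elim x)
      show ?case
      proof
        assume "x \<in> cbox p q"
        then have "x \<in> box p q" using elim(2) by simp
        then show "g x = 0" using elim(1,3) by (simp add: h_def)
      qed
    qed
  qed
  obtain \<D> where \<D>: "countable \<D>" "\<D> \<subseteq> Pow D" "\<And>X. X \<in> \<D> \<Longrightarrow> \<exists>a b. X = cbox a b" "\<Union>\<D> = D"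
    by (rule open_countable_Union_open_cbox[OF D]) (rule that)
  have "AE x in lebesgue. \<forall>X\<in>\<D>. x \<in> X \<longrightarrow> g x = 0"
  proof (subst AE_ball_countable[OF \<D>(1)], rule ballI)
    fix X assume X: "X \<in> \<D>"
    from \<D>(3)[OF X] obtain a b where ab: "X = cbox a b" by auto
    have "X \<subseteq> D" using X \<D>(4) by auto
    then show "AE x in lebesgue. x \<in> X \<longrightarrow> g x = 0"
      unfolding ab by (rule cbox0)
  qed
  then have "AE x in lebesgue. x \<in> \<Union>\<D> \<longrightarrow> g x = 0"
    by eventually_elim auto
  then have "AE x in lebesgue. x \<in> D \<longrightarrow> g x = 0"
    unfolding \<D>(4) .
  then show ?thesis using D by (simp add: AE_lebesgue_on)
qed

section \<open>Hilbert spaces\<close>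

lemma subspace_closure_inner:
  fixes S :: "'a::real_normed_vector set"
  assumes "subspace S" shows "subspace (closure S)"
proof (rule subspaceI)
  show "0 \<in> closure S" using assms closure_subset subspace_0 by blast
next
  fix x y assume "x \<in> closure S" "y \<in> closure S"
  then obtain f g where "\<forall>n. f n \<in> S" "f \<longlonglongrightarrow> x" "\<forall>n. g n \<in> S" "g \<longlonglongrightarrow> y"
    by (auto simp: closure_sequential)
  then show "x + y \<in> closure S"
    unfolding closure_sequential using assms
    by (intro exI[of _ "\<lambda>n. f n + g n"]) (auto intro: tendsto_add subspace_add)
next
  fix x and c :: real assume "x \<in> closure S"
  then obtain f where "\<forall>n. f n \<in> S" "f \<longlonglongrightarrow> x"
    by (auto simp: closure_sequential)
  then show "c *\<^sub>R x \<in> closure S"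
    unfolding closure_sequential using assms
    by (intro exI[of _ "\<lambda>n. c *\<^sub>R f n"]) (auto intro: tendsto_scaleR subspace_scale)
qed

lemma norm_diff_scaleR_square:
  fixes z s :: "'a::real_inner"
  shows "norm (z - t *\<^sub>R s) ^ 2 = norm z ^ 2 - 2 * t * (s \<bullet> z) + t\<^sup>2 * norm s ^ 2"
  unfolding power2_norm_eq_inner
  by (simp add: inner_diff_left inner_diff_right inner_commute[of s z] power2_eq_square algebra_simps)

lemma minimizer_imp_orthogonal:
  fixes z s :: "'a::real_inner"
  assumes "\<And>t::real. norm (z - t *\<^sub>R s) ^ 2 \<ge> norm z ^ 2"
  shows "z \<bullet> s = 0"
proof (cases "s = 0")
  case False
  \<comment> \<open>The minimum of the quadratic in \<open>t\<close>, where it lies below its value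
    at 0 by the square of \<open>z \<bullet> s\<close> divided by
    \<open>s \<bullet> s\<close>.\<close>
  define t where "t = (z \<bullet> s) / (s \<bullet> s)"
  have ss: "s \<bullet> s > 0" using False by simp
  have "norm (z - t *\<^sub>R s) ^ 2 = z \<bullet> z - 2 * t * (s \<bullet> z) + t\<^sup>2 * (s \<bullet> s)"
    using norm_diff_scaleR_square[of z t s] unfolding power2_norm_eq_inner .
  also have "\<dots> = z \<bullet> z - (z \<bullet> s)\<^sup>2 / (s \<bullet> s)"
    using ss by (simp add: t_def inner_commute[of s z] field_simps power2_eq_square)
  finally have "(z \<bullet> s)\<^sup>2 / (s \<bullet> s) \<le> 0"
    using assms[of t] by (simp add: power2_norm_eq_inner)
  then have "(z \<bullet> s)\<^sup>2 \<le> 0" using ss by (simp add: divide_le_0_iff)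
  then show ?thesis by simp
qed simp

text \<open>A sequence that almost minimises the distance to \<open>x\<close> is Cauchy. Its limit
  is a nearest point, and minimality along every line through it in \<open>S\<close> amounts to
  orthogonality.\<close>

lemma orthogonal_projection_exists:
  fixes S :: "'a::{real_inner,complete_space} set"
  assumes S: "subspace S" "closed S"
  shows "\<exists>p\<in>S. \<forall>s\<in>S. (x - p) \<bullet> s = 0"
proof -
  define A where "A = (\<lambda>s. norm (x - s) ^ 2) ` S"
  have A: "A \<noteq> {}" "bdd_below A"
    using subspace_0[OF S(1)] by (auto simp: A_def intro!: bdd_belowI[of _ 0])
  define E where "E = Inf A"
  have E_le: "E \<le> norm (x - s) ^ 2" if "s \<in> S" for s
    unfolding E_def by (rule cInf_lower) (use that A in \<open>auto simp: A_def\<close>)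
  have "\<forall>n. \<exists>s. s \<in> S \<and> norm (x - s) ^ 2 < E + 1 / real (Suc n)"
  proof
    fix n
    have "Inf A < E + 1 / real (Suc n)" by (simp add: E_def)
    then obtain a where "a \<in> A" "a < E + 1 / real (Suc n)"
      using cInf_lessD[OF A(1)] by blast
    then show "\<exists>s. s \<in> S \<and> norm (x - s) ^ 2 < E + 1 / real (Suc n)"
      by (auto simp: A_def)
  qed
  from choice[OF this] obtain s
    where s: "\<And>n. s n \<in> S" "\<And>n. norm (x - s n) ^ 2 < E + 1 / real (Suc n)" by auto
  have near: "norm (s n - s m) ^ 2 < 2 / real (Suc n) + 2 / real (Suc m)" for n m
  proof -
    \<comment> \<open>The midpoint belongs to \<open>S\<close>, so its squared distance is at least
      \<open>E\<close>; the parallelogram identity then makes two almost minimisers close to each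
      other.\<close>
    have "(1/2) *\<^sub>R (s n + s m) \<in> S" by (intro subspace_scale subspace_add S s)
    then have "E \<le> norm (x - (1/2) *\<^sub>R (s n + s m)) ^ 2" by (rule E_le)
    moreover have "norm (s n - s m) ^ 2 =
        2 * norm (x - s n) ^ 2 + 2 * norm (x - s m) ^ 2 - 4 * norm (x - (1/2) *\<^sub>R (s n + s m)) ^ 2"
      by (simp add: power2_norm_eq_inner inner_diff_left inner_diff_right inner_add_left inner_add_right
          inner_commute algebra_simps)
    ultimately show ?thesis using s(2)[of n] s(2)[of m] by simp
  qed
  have "Cauchy s"
  proof (rule CauchyI)
    fix e :: real assume e: "0 < e"
    \<comment> \<open>From index \<open>M\<close> on, both error terms in \<open>near\<close> are at
      most \<open>2 / M\<close>, and \<open>4 / M\<close> is below the square of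
      \<open>e\<close>.\<close>
    obtain M where M: "4 / e\<^sup>2 < real M" using reals_Archimedean2 by blast
    have "norm (s m - s n) < e" if "m \<ge> M" "n \<ge> M" for m n
    proof (rule power_less_imp_less_base[of _ 2])
      have "0 < 4 / e\<^sup>2" using e by simp
      then have M0: "0 < real M" using M by linarith
      have "2 / real (Suc k) \<le> 2 / real M" if "k \<ge> M" for k
        using that M0 by (intro divide_left_mono) auto
      from this[OF that(1)] this[OF that(2)]
      have "norm (s m - s n) ^ 2 < 2 / real M + 2 / real M"
        using near[of m n] by linarith
      also have "\<dots> = 4 / real M" by simp
      also have "\<dots> < e\<^sup>2"
        using M M0 e by (simp add: field_simps)
      finally show "norm (s m - s n) ^ 2 < e ^ 2" .
    qed (use e in simp)
    then show "\<exists>M. \<forall>m\<ge>M. \<forall>n\<ge>M. norm (s m - s n) < e" by blast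
  qed
  then obtain p where p: "s \<longlonglongrightarrow> p" using Cauchy_convergent convergent_def by blast
  have pS: "p \<in> S" using S(2) s(1) p by (rule closed_sequentially)
  have "norm (x - p) ^ 2 \<le> E"
  proof (rule LIMSEQ_le)
    show "(\<lambda>n. norm (x - s n) ^ 2) \<longlonglongrightarrow> norm (x - p) ^ 2" by (intro tendsto_intros p)
    have "(\<lambda>n. E + inverse (real (Suc n))) \<longlonglongrightarrow> E + 0"
      by (intro tendsto_intros LIMSEQ_inverse_real_of_nat)
    then show "(\<lambda>n. E + inverse (real (Suc n))) \<longlonglongrightarrow> E" by simp
    show "\<exists>N. \<forall>n\<ge>N. norm (x - s n) ^ 2 \<le> E + inverse (real (Suc n))"
      using s(2) by (simp add: inverse_eq_divide less_imp_le)
  qed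
  then have "norm (x - p) ^ 2 \<le> norm (x - p - t *\<^sub>R v) ^ 2" if "v \<in> S" for v t
    unfolding diff_diff_eq
    by (rule order_trans) (intro E_le subspace_add subspace_scale S pS that)
  then have "(x - p) \<bullet> v = 0" if "v \<in> S" for v
    using that by (intro minimizer_imp_orthogonal) auto
  then show ?thesis using pS by blast
qed

text \<open>The residual of the projection onto the closure is orthogonal to \<open>S\<close>, hence
  0 by assumption.\<close>

lemma dense_subspaceI:
  fixes S :: "'a::{real_inner,complete_space} set"
  assumes S: "subspace S" and orth: "\<And>x. (\<And>s. s \<in> S \<Longrightarrow> x \<bullet> s = 0) \<Longrightarrow> x = 0"
  shows "closure S = UNIV"
proof -
  have "x \<in> closure S" for x
  proof -
    obtain p where p: "p \<in> closure S" "\<forall>s\<in>closure S. (x - p) \<bullet> s = 0"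
      using orthogonal_projection_exists[OF subspace_closure_inner[OF S] closed_closure] by blast
    then have "x - p = 0" using closure_subset[of S] by (intro orth) auto
    then show ?thesis using p(1) by simp
  qed
  then show ?thesis by auto
qed

text \<open>Zarantonello's theorem: \<open>k \<mapsto> P (k - t N k)\<close>, with \<open>P\<close> the orthogonal projection onto \<open>S\<close>,
  is a contraction for \<open>t = c1 / c2\<^sup>2\<close>, and its fixed point is the solution.\<close>

lemma strongly_monotone_solution:
  fixes N :: "'a::{real_inner,complete_space} \<Rightarrow> 'a"
  assumes S: "subspace S" "closed S" and c: "c1 > 0" "c2 > 0"
    and mono: "\<And>x y. (N x - N y) \<bullet> (x - y) \<ge> c1 * norm (x - y) ^ 2"
    and lip: "\<And>x y. norm (N x - N y) \<le> c2 * norm (x - y)"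
  shows "\<exists>k\<in>S. \<forall>s\<in>S. N k \<bullet> s = 0"
proof -
  define P where "P x = (SOME p. p \<in> S \<and> (\<forall>s\<in>S. (x - p) \<bullet> s = 0))" for x
  have "\<exists>p. p \<in> S \<and> (\<forall>s\<in>S. (x - p) \<bullet> s = 0)" for x
    using orthogonal_projection_exists[OF S, of x] by blast
  then have P: "P x \<in> S \<and> (\<forall>s\<in>S. (x - P x) \<bullet> s = 0)" for x
    unfolding P_def by (rule someI_ex)
  have P_nonexp: "norm (P a - P b) \<le> norm (a - b)" for a b
  proof -
    have "P a - P b \<in> S" using P S(1) by (simp add: subspace_diff)
    then have "(a - P a) \<bullet> (P a - P b) = 0" "(b - P b) \<bullet> (P a - P b) = 0" using P by auto
    then have "norm (P a - P b) ^ 2 = (a - b) \<bullet> (P a - P b)"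
      by (simp add: power2_norm_eq_inner inner_diff_left)
    also have "\<dots> \<le> norm (a - b) * norm (P a - P b)" by (rule norm_cauchy_schwarz)
    finally show ?thesis
      by (cases "norm (P a - P b) = 0") (auto simp: power2_eq_square mult_le_cancel_right)
  qed
  define t where "t = c1 / c2\<^sup>2"
  \<comment> \<open>The squared factor \<open>1 - 2 t c1 + (t c2)^2\<close> is least at the chosen
    \<open>t\<close>, with value \<open>1 - (c1 / c2)^2\<close>. The maximum with 0 makes the root
    harmless without proving \<open>c1 \<le> c2\<close>, which can fail in the trivial
    space.\<close>
  define q where "q = max 0 (1 - c1\<^sup>2 / c2\<^sup>2)"
  have t: "t > 0" using c by (simp add: t_def)
  have q: "0 \<le> q" "q < 1" using c by (auto simp: q_def)
  define T where "T k = P (k - t *\<^sub>R N k)" for k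
  have contr: "dist (T x) (T y) \<le> sqrt q * dist x y" for x y
  proof -
    have "norm (x - t *\<^sub>R N x - (y - t *\<^sub>R N y)) ^ 2 = norm (x - y - t *\<^sub>R (N x - N y)) ^ 2"
      by (simp add: algebra_simps)
    also have "\<dots> = norm (x - y) ^ 2 - 2 * t * ((N x - N y) \<bullet> (x - y)) + t\<^sup>2 * norm (N x - N y) ^ 2"
      by (rule norm_diff_scaleR_square)
    also have "\<dots> \<le> norm (x - y) ^ 2 - 2 * t * (c1 * norm (x - y) ^ 2) + t\<^sup>2 * (c2 * norm (x - y)) ^ 2"
    proof -
      have "t * (c1 * norm (x - y) ^ 2) \<le> t * ((N x - N y) \<bullet> (x - y))"
        using t mono[of x y] by (intro mult_left_mono) auto
      moreover have "t\<^sup>2 * norm (N x - N y) ^ 2 \<le> t\<^sup>2 * (c2 * norm (x - y)) ^ 2"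
        using lip[of x y] by (intro mult_left_mono power_mono) auto
      ultimately show ?thesis by linarith
    qed
    also have "\<dots> = (1 - c1\<^sup>2 / c2\<^sup>2) * norm (x - y) ^ 2"
      using c by (simp add: t_def field_simps power2_eq_square)
    also have "\<dots> \<le> q * norm (x - y) ^ 2"
      unfolding q_def by (intro mult_right_mono) auto
    also have "\<dots> = (sqrt q * norm (x - y)) ^ 2"
      using q by (simp add: power_mult_distrib)
    finally have "norm (x - t *\<^sub>R N x - (y - t *\<^sub>R N y)) \<le> sqrt q * norm (x - y)"
      by (rule power2_le_imp_le) (use q in simp)
    then show ?thesis
      unfolding T_def dist_norm by (rule order_trans[OF P_nonexp])
  qed
  have "\<exists>!x\<in>S. T x = x"
  proof (rule Banach_fix)
    show "complete S" using S(2) by (simp add: complete_eq_closed)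
    show "S \<noteq> {}" using subspace_0[OF S(1)] by blast
    show "0 \<le> sqrt q" "sqrt q < 1" using q by auto
    show "T ` S \<subseteq> S" using P by (auto simp: T_def)
    show "dist (T x) (T y) \<le> sqrt q * dist x y" for x y by (rule contr)
  qed
  then obtain k where k: "k \<in> S" "T k = k" by blast
  have "N k \<bullet> s = 0" if "s \<in> S" for s
  proof -
    \<comment> \<open>At the fixed point the residual of the projection is \<open>- t N k\<close>,
      so its orthogonality to \<open>S\<close> is the claim up to the factor
      \<open>t\<close>.\<close>
    have "(k - t *\<^sub>R N k - P (k - t *\<^sub>R N k)) \<bullet> s = 0"
      using P[THEN conjunct2] that by blast
    then have "(k - t *\<^sub>R N k - k) \<bullet> s = 0"
      unfolding k(2)[unfolded T_def] .
    then show ?thesis using t by simp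
  qed
  then show ?thesis using k(1) by blast
qed

section \<open>The space of square integrable fields modulo null sets\<close>

lemma L2_UNIV_iff:
  "f \<in> L2 UNIV \<longleftrightarrow> f \<in> borel_measurable lebesgue \<and> integrable lebesgue (\<lambda>x. (norm (f x))\<^sup>2)"
  by (simp add: L2_def lebesgue_on_UNIV_eq)

lemma L2_measurable: "f \<in> L2 UNIV \<Longrightarrow> f \<in> borel_measurable lebesgue"
  by (simp add: L2_UNIV_iff)

lemma L2_zero: "(\<lambda>x. 0) \<in> L2 UNIV"
  by (simp add: L2_UNIV_iff)

lemma L2_bound:
  assumes f: "f \<in> L2 UNIV" and g: "g \<in> borel_measurable lebesgue"
    and le: "AE x in lebesgue. norm (g x) \<le> norm (f x)"
  shows "g \<in> L2 UNIV"
proof -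
  have "integrable lebesgue (\<lambda>x. (norm (g x))\<^sup>2)"
  proof (rule Bochner_Integration.integrable_bound)
    show "integrable lebesgue (\<lambda>x. (norm (f x))\<^sup>2)" using f by (simp add: L2_UNIV_iff)
    show "(\<lambda>x. (norm (g x))\<^sup>2) \<in> borel_measurable lebesgue" using g by simp
    show "AE x in lebesgue. norm ((norm (g x))\<^sup>2) \<le> norm ((norm (f x))\<^sup>2)"
      using le by eventually_elim (simp add: power_mono)
  qed
  then show ?thesis using g by (simp add: L2_UNIV_iff)
qed

lemma L2_cong_AE:
  assumes "f \<in> L2 UNIV" "g \<in> borel_measurable lebesgue" "AE x in lebesgue. f x = g x"
  shows "g \<in> L2 UNIV"
  by (rule L2_bound[OF assms(1,2)]) (use assms(3) in eventually_elim, simp)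

lemma L2_inner_integrable:
  assumes f: "f \<in> L2 UNIV" and g: "g \<in> L2 UNIV"
  shows "integrable lebesgue (\<lambda>x. f x \<bullet> g x)"
proof (rule Bochner_Integration.integrable_bound)
  show "integrable lebesgue (\<lambda>x. (norm (f x))\<^sup>2 + (norm (g x))\<^sup>2)"
    using f g by (simp add: L2_UNIV_iff)
  show "(\<lambda>x. f x \<bullet> g x) \<in> borel_measurable lebesgue"
    using f g by (intro borel_measurable_inner L2_measurable)
  show "AE x in lebesgue. norm (f x \<bullet> g x) \<le> norm ((norm (f x))\<^sup>2 + (norm (g x))\<^sup>2)"
  proof (rule AE_I2)
    fix x
    have "norm (f x \<bullet> g x) \<le> norm (f x) * norm (g x)" by (simp add: Cauchy_Schwarz_ineq2)
    also have "\<dots> \<le> (norm (f x))\<^sup>2 + (norm (g x))\<^sup>2"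
    proof -
      have "0 \<le> (norm (f x) - norm (g x))\<^sup>2" by simp
      then have "2 * (norm (f x) * norm (g x)) \<le> (norm (f x))\<^sup>2 + (norm (g x))\<^sup>2"
        unfolding power2_diff by linarith
      moreover have "0 \<le> norm (f x) * norm (g x)" by simp
      ultimately show ?thesis by linarith
    qed
    finally show "norm (f x \<bullet> g x) \<le> norm ((norm (f x))\<^sup>2 + (norm (g x))\<^sup>2)" by simp
  qed
qed

lemma L2_add:
  assumes f: "f \<in> L2 UNIV" and g: "g \<in> L2 UNIV"
  shows "(\<lambda>x. f x + g x) \<in> L2 UNIV"
proof -
  have "integrable lebesgue (\<lambda>x. (norm (f x))\<^sup>2 + (norm (g x))\<^sup>2 + 2 * (f x \<bullet> g x))"
    using f g L2_inner_integrable[OF f g] by (simp add: L2_UNIV_iff)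
  moreover have "(norm (f x))\<^sup>2 + (norm (g x))\<^sup>2 + 2 * (f x \<bullet> g x) = (norm (f x + g x))\<^sup>2" for x
    unfolding power2_norm_eq_inner by (simp add: inner_add inner_commute)
  ultimately have "integrable lebesgue (\<lambda>x. (norm (f x + g x))\<^sup>2)" by simp
  then show ?thesis
    unfolding L2_UNIV_iff using borel_measurable_add[OF f[THEN L2_measurable] g[THEN L2_measurable]] by blast
qed

lemma L2_scaleR:
  assumes "f \<in> L2 UNIV" shows "(\<lambda>x. c *\<^sub>R f x) \<in> L2 UNIV"
proof -
  have "(\<lambda>x. c *\<^sub>R f x) \<in> borel_measurable lebesgue"
    by (intro borel_measurable_scaleR borel_measurable_const L2_measurable assms)
  then show ?thesis using assms by (simp add: L2_UNIV_iff power_mult_distrib)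
qed

lemma L2_minus: "f \<in> L2 UNIV \<Longrightarrow> (\<lambda>x. - f x) \<in> L2 UNIV"
  using L2_scaleR[of f "-1"] by simp

lemma L2_diff: "f \<in> L2 UNIV \<Longrightarrow> g \<in> L2 UNIV \<Longrightarrow> (\<lambda>x. f x - g x) \<in> L2 UNIV"
  using L2_add[OF _ L2_minus[of g], of f] by simp

text \<open>Membership in \<open>L2 UNIV\<close> is built into the relation. It is therefore only a
  partial equivalence, and the classes of the quotient consist of square integrable functions
  alone.\<close>

definition l2_rel :: "('a::euclidean_space \<Rightarrow> 'b::euclidean_space) \<Rightarrow> ('a \<Rightarrow> 'b) \<Rightarrow> bool" where
  "l2_rel f g \<longleftrightarrow> f \<in> L2 UNIV \<and> g \<in> L2 UNIV \<and> (AE x in lebesgue. f x = g x)"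

lemma part_equivp_l2_rel:
  "part_equivp (l2_rel :: ('a::euclidean_space \<Rightarrow> 'b::euclidean_space) \<Rightarrow> _)" (is "part_equivp ?R")
proof (rule part_equivpI)
  show "\<exists>f. ?R f f" by (rule exI[of _ "\<lambda>x. 0"]) (simp add: l2_rel_def L2_zero)
  show "symp ?R" by (rule sympI) (auto simp: l2_rel_def elim: AE_mp)
  show "transp ?R"
  proof (rule transpI)
    fix f g h :: "'a \<Rightarrow> 'b" assume "l2_rel f g" "l2_rel g h"
    then have "AE x in lebesgue. f x = g x" "AE x in lebesgue. g x = h x" "f \<in> L2 UNIV" "h \<in> L2 UNIV"
      by (auto simp: l2_rel_def)
    moreover from this(1,2) have "AE x in lebesgue. f x = h x" by eventually_elim simp
    ultimately show "l2_rel f h" by (simp add: l2_rel_def)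
  qed
qed

quotient_type (overloaded) ('a, 'b) l2 = "'a::euclidean_space \<Rightarrow> 'b::euclidean_space" / partial: l2_rel
  by (rule part_equivp_l2_rel)

lemma abs_l2_eq_iff:
  "f \<in> L2 UNIV \<Longrightarrow> g \<in> L2 UNIV \<Longrightarrow> abs_l2 f = abs_l2 g \<longleftrightarrow> (AE x in lebesgue. f x = g x)"
  using Quotient_rel[OF Quotient_l2, of f g] by (auto simp: l2_rel_def)

lemma rep_l2_L2: "rep_l2 F \<in> L2 UNIV"
  using Quotient_rep_reflp[OF Quotient_l2, of F] by (simp add: l2_rel_def)

lemma abs_rep_l2: "abs_l2 (rep_l2 F) = F"
  by (rule Quotient_abs_rep[OF Quotient_l2])

instantiation l2 :: (euclidean_space, euclidean_space) real_inner
begin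

lift_definition zero_l2 :: "('a, 'b) l2" is "\<lambda>x. 0"
  by (simp add: l2_rel_def L2_zero)

lift_definition plus_l2 :: "('a, 'b) l2 \<Rightarrow> ('a, 'b) l2 \<Rightarrow> ('a, 'b) l2" is "\<lambda>f g x. f x + g x"
proof -
  fix f f' g g' :: "'a \<Rightarrow> 'b" assume "l2_rel f f'" "l2_rel g g'"
  then have "AE x in lebesgue. f x = f' x" "AE x in lebesgue. g x = g' x" by (auto simp: l2_rel_def)
  then have "AE x in lebesgue. f x + g x = f' x + g' x" by eventually_elim simp
  then show "l2_rel (\<lambda>x. f x + g x) (\<lambda>x. f' x + g' x)"
    using \<open>l2_rel f f'\<close> \<open>l2_rel g g'\<close> by (simp add: l2_rel_def L2_add)
qed

lift_definition minus_l2 :: "('a, 'b) l2 \<Rightarrow> ('a, 'b) l2 \<Rightarrow> ('a, 'b) l2" is "\<lambda>f g x. f x - g x"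
proof -
  fix f f' g g' :: "'a \<Rightarrow> 'b" assume "l2_rel f f'" "l2_rel g g'"
  then have "AE x in lebesgue. f x = f' x" "AE x in lebesgue. g x = g' x" by (auto simp: l2_rel_def)
  then have "AE x in lebesgue. f x - g x = f' x - g' x" by eventually_elim simp
  then show "l2_rel (\<lambda>x. f x - g x) (\<lambda>x. f' x - g' x)"
    using \<open>l2_rel f f'\<close> \<open>l2_rel g g'\<close> by (simp add: l2_rel_def L2_diff)
qed

lift_definition uminus_l2 :: "('a, 'b) l2 \<Rightarrow> ('a, 'b) l2" is "\<lambda>f x. - f x"
  by (auto simp: l2_rel_def intro: L2_minus)

lift_definition scaleR_l2 :: "real \<Rightarrow> ('a, 'b) l2 \<Rightarrow> ('a, 'b) l2" is "\<lambda>c f x. c *\<^sub>R f x"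
proof -
  fix c :: real and f f' :: "'a \<Rightarrow> 'b" assume f: "l2_rel f f'"
  then have "AE x in lebesgue. f x = f' x" by (simp add: l2_rel_def)
  then have "AE x in lebesgue. c *\<^sub>R f x = c *\<^sub>R f' x" by eventually_elim simp
  then show "l2_rel (\<lambda>x. c *\<^sub>R f x) (\<lambda>x. c *\<^sub>R f' x)"
    using f by (simp add: l2_rel_def L2_scaleR)
qed

lift_definition inner_l2 :: "('a, 'b) l2 \<Rightarrow> ('a, 'b) l2 \<Rightarrow> real" is "\<lambda>f g. LINT x|lebesgue. f x \<bullet> g x"
proof -
  fix f f' g g' :: "'a \<Rightarrow> 'b" assume *: "l2_rel f f'" "l2_rel g g'"
  then have "AE x in lebesgue. f x = f' x" "AE x in lebesgue. g x = g' x" by (auto simp: l2_rel_def)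
  then have "AE x in lebesgue. f x \<bullet> g x = f' x \<bullet> g' x" by eventually_elim simp
  then show "(LINT x|lebesgue. f x \<bullet> g x) = (LINT x|lebesgue. f' x \<bullet> g' x)"
    using * by (intro integral_cong_AE borel_measurable_inner) (auto simp: l2_rel_def L2_measurable)
qed

definition norm_l2 :: "('a, 'b) l2 \<Rightarrow> real" where
  "norm_l2 F = sqrt (F \<bullet> F)"

definition dist_l2 :: "('a, 'b) l2 \<Rightarrow> ('a, 'b) l2 \<Rightarrow> real" where
  "dist_l2 F G = norm (F - G)"

definition sgn_l2 :: "('a, 'b) l2 \<Rightarrow> ('a, 'b) l2" where
  "sgn_l2 F = scaleR (inverse (norm F)) F"

definition uniformity_l2 :: "(('a, 'b) l2 \<times> ('a, 'b) l2) filter" where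
  "uniformity_l2 = (INF e\<in>{0 <..}. principal {(x, y). dist x y < e})"

definition open_l2 :: "('a, 'b) l2 set \<Rightarrow> bool" where
  "open_l2 U \<longleftrightarrow> (\<forall>x\<in>U. eventually (\<lambda>(x', y). x' = x \<longrightarrow> y \<in> U) uniformity)"

instance
proof
  fix F G H :: "('a, 'b) l2" and a b :: real
  show "dist F G = norm (F - G)" by (rule dist_l2_def)
  show "sgn F = scaleR (inverse (norm F)) F" by (rule sgn_l2_def)
  show "(uniformity :: (('a, 'b) l2 \<times> ('a, 'b) l2) filter) = (INF e\<in>{0 <..}. principal {(x, y). dist x y < e})"
    by (rule uniformity_l2_def)
  show "open U \<longleftrightarrow> (\<forall>x\<in>U. eventually (\<lambda>(x', y). x' = x \<longrightarrow> y \<in> U) uniformity)"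
    for U :: "('a, 'b) l2 set" by (rule open_l2_def)
  show "norm F = sqrt (F \<bullet> F)" by (rule norm_l2_def)
  show "F + G + H = F + (G + H)"
    by transfer (auto simp: l2_rel_def add.assoc intro!: L2_add)
  show "F + G = G + F"
    by transfer (auto simp: l2_rel_def add.commute intro!: L2_add)
  show "0 + F = F" by transfer (auto simp: l2_rel_def)
  show "- F + F = 0" by transfer (auto simp: l2_rel_def L2_zero)
  show "F - G = F + - G"
    by transfer (auto simp: l2_rel_def intro!: L2_add L2_minus L2_diff)
  show "a *\<^sub>R (F + G) = a *\<^sub>R F + a *\<^sub>R G"
    by transfer (auto simp: l2_rel_def scaleR_add_right intro!: L2_add L2_scaleR)
  show "(a + b) *\<^sub>R F = a *\<^sub>R F + b *\<^sub>R F"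
    by transfer (auto simp: l2_rel_def scaleR_add_left intro!: L2_add L2_scaleR)
  show "a *\<^sub>R b *\<^sub>R F = (a * b) *\<^sub>R F"
    by transfer (auto simp: l2_rel_def intro!: L2_scaleR)
  show "1 *\<^sub>R F = F" by transfer (auto simp: l2_rel_def)
  show "F \<bullet> G = G \<bullet> F" by transfer (simp add: inner_commute)
  show "(F + G) \<bullet> H = F \<bullet> H + G \<bullet> H"
    by transfer (simp add: l2_rel_def inner_add_left L2_inner_integrable)
  show "(a *\<^sub>R F) \<bullet> G = a * (F \<bullet> G)" by transfer simp
  show "0 \<le> F \<bullet> F" by transfer simp
  show "F \<bullet> F = 0 \<longleftrightarrow> F = 0"
  proof transfer
    fix f :: "'a \<Rightarrow> 'b" assume "l2_rel f f"
    then have f: "f \<in> L2 UNIV" by (simp add: l2_rel_def)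
    have "(LINT x|lebesgue. f x \<bullet> f x) = 0 \<longleftrightarrow> (AE x in lebesgue. f x \<bullet> f x = 0)"
      by (rule integral_nonneg_eq_0_iff_AE[OF L2_inner_integrable[OF f f]]) simp
    then show "(LINT x|lebesgue. f x \<bullet> f x) = 0 \<longleftrightarrow> l2_rel f (\<lambda>x. 0)"
      using f by (simp add: l2_rel_def L2_zero)
  qed
qed

end

lemma inner_abs_l2:
  assumes "f \<in> L2 UNIV" "g \<in> L2 UNIV"
  shows "abs_l2 f \<bullet> abs_l2 g = (LINT x|lebesgue. f x \<bullet> g x)"
  by (rule inner_l2.abs_eq) (use assms in \<open>simp_all add: l2_rel_def\<close>)

lemma add_abs_l2:
  assumes "f \<in> L2 UNIV" "g \<in> L2 UNIV"
  shows "abs_l2 f + abs_l2 g = abs_l2 (\<lambda>x. f x + g x)"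
  by (rule plus_l2.abs_eq) (use assms in \<open>simp_all add: l2_rel_def\<close>)

lemma diff_abs_l2:
  assumes "f \<in> L2 UNIV" "g \<in> L2 UNIV"
  shows "abs_l2 f - abs_l2 g = abs_l2 (\<lambda>x. f x - g x)"
  by (rule minus_l2.abs_eq) (use assms in \<open>simp_all add: l2_rel_def\<close>)

lemma scaleR_abs_l2:
  assumes "f \<in> L2 UNIV"
  shows "c *\<^sub>R abs_l2 f = abs_l2 (\<lambda>x. c *\<^sub>R f x)"
  by (rule scaleR_l2.abs_eq) (use assms in \<open>simp_all add: l2_rel_def\<close>)

lemma zero_abs_l2: "0 = abs_l2 (\<lambda>x. 0)"
  by (rule zero_l2.abs_eq)

lemma norm_abs_l2_square:
  assumes "f \<in> L2 UNIV"
  shows "(norm (abs_l2 f))\<^sup>2 = (LINT x|lebesgue. (norm (f x))\<^sup>2)"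
  using inner_abs_l2[OF assms assms] by (simp add: power2_norm_eq_inner)

lemma norm_abs_l2:
  assumes "f \<in> L2 UNIV"
  shows "norm (abs_l2 f) = L2_norm UNIV f"
  using norm_abs_l2_square[OF assms]
  by (simp add: L2_norm_def lebesgue_on_UNIV_eq real_sqrt_unique)

lemma norm_abs_l2_le:
  assumes "f \<in> L2 UNIV" "g \<in> L2 UNIV" "AE x in lebesgue. norm (f x) \<le> norm (g x)"
  shows "norm (abs_l2 f) \<le> norm (abs_l2 g)"
proof (rule power2_le_imp_le)
  show "(norm (abs_l2 f))\<^sup>2 \<le> (norm (abs_l2 g))\<^sup>2"
    unfolding norm_abs_l2_square[OF assms(1)] norm_abs_l2_square[OF assms(2)]
  proof (rule integral_mono_AE)
    show "AE x in lebesgue. (norm (f x))\<^sup>2 \<le> (norm (g x))\<^sup>2"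
      using assms(3) by eventually_elim (simp add: power_mono)
  qed (use assms in \<open>simp_all add: L2_UNIV_iff\<close>)
qed simp

lemma ennreal_norm_abs_l2_square:
  assumes "f \<in> L2 UNIV"
  shows "ennreal ((norm (abs_l2 f))\<^sup>2) = (\<integral>\<^sup>+x. ennreal ((norm (f x))\<^sup>2) \<partial>lebesgue)"
  unfolding norm_abs_l2_square[OF assms]
  by (rule nn_integral_eq_integral[symmetric]) (use assms in \<open>simp_all add: L2_UNIV_iff\<close>)

lemma L2_of_nn_integral:
  assumes "f \<in> borel_measurable lebesgue" "(\<integral>\<^sup>+x. ennreal ((norm (f x))\<^sup>2) \<partial>lebesgue) < \<infinity>"
  shows "f \<in> L2 UNIV"
  using assms by (simp add: L2_UNIV_iff integrable_iff_bounded)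

section \<open>Completeness: the Riesz-Fischer theorem\<close>

lemma summable_of_weighted_squares:
  fixes a :: "nat \<Rightarrow> real"
  assumes "\<And>n. 0 \<le> a n" "summable (\<lambda>n. 2 ^ n * (a n)\<^sup>2)"
  shows "summable a"
proof (rule summable_comparison_test')
  show "summable (\<lambda>n. 2 ^ n * (a n)\<^sup>2 + (1/2) ^ n)"
    by (intro summable_add assms(2) summable_geometric) simp
  show "norm (a n) \<le> 2 ^ n * (a n)\<^sup>2 + (1/2) ^ n" for n
  proof -
    define p :: real where "p = 2 ^ n"
    have p: "p > 0" "(1/2::real) ^ n = 1 / p" by (simp_all add: p_def power_divide)
    \<comment> \<open>Completing the square with weight \<open>p = 2 ^ n\<close> gives
      \<open>2 a \<le> p a^2 + 1 / p\<close>. This trades a first power for a square, so that only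
      integrals of squares have to be controlled below.\<close>
    have "0 \<le> (p * a n - 1)\<^sup>2 / p" using p(1) by simp
    also have "\<dots> = p * (a n)\<^sup>2 - 2 * a n + 1 / p"
      using p(1) by (simp add: power2_eq_square field_simps)
    finally have "2 * a n \<le> p * (a n)\<^sup>2 + 1 / p" by simp
    then show ?thesis using assms(1)[of n] p unfolding p_def[symmetric] by simp
  qed
qed

text \<open>The weighted squares \<open>2 ^ n\<close> times \<open>(norm (d n x))^2\<close> of the
  increments have integrals at most \<open>2 ^ n\<close> times \<open>(1/4) ^ n\<close>, which is
  summable. Their sum is thus finite almost everywhere, which makes the increments absolutely
  summable there.\<close>

lemma l2_fast_Cauchy_convergent_AE:
  fixes f :: "nat \<Rightarrow> 'a::euclidean_space \<Rightarrow> 'b::euclidean_space"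
  assumes f: "\<And>n. f n \<in> L2 UNIV"
    and fast: "\<And>n. norm (abs_l2 (f (Suc n)) - abs_l2 (f n)) \<le> (1/2) ^ n"
  shows "AE x in lebesgue. convergent (\<lambda>n. f n x)"
proof -
  define d where "d n x = f (Suc n) x - f n x" for n x
  have d: "d n \<in> L2 UNIV" for n unfolding d_def by (intro L2_diff f)
  have dm: "(\<lambda>x. ennreal (2 ^ n * (norm (d n x))\<^sup>2)) \<in> borel_measurable lebesgue" for n
    using d[of n, THEN L2_measurable] by measurable
  have "(\<integral>\<^sup>+x. (\<Sum>n. ennreal (2 ^ n * (norm (d n x))\<^sup>2)) \<partial>lebesgue)
      = (\<Sum>n. \<integral>\<^sup>+x. ennreal (2 ^ n * (norm (d n x))\<^sup>2) \<partial>lebesgue)"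
    by (rule nn_integral_suminf) (rule dm)
  also have "\<dots> \<le> (\<Sum>n. ennreal ((1/2) ^ n))"
  proof (rule suminf_le)
    fix n
    have "(\<integral>\<^sup>+x. ennreal (2 ^ n * (norm (d n x))\<^sup>2) \<partial>lebesgue)
        = 2 ^ n * (\<integral>\<^sup>+x. ennreal ((norm (d n x))\<^sup>2) \<partial>lebesgue)"
      using d[of n, THEN L2_measurable]
      by (subst nn_integral_cmult[symmetric]) (simp_all add: ennreal_mult ennreal_power[symmetric])
    also have "\<dots> = ennreal (2 ^ n * (norm (abs_l2 (d n)))\<^sup>2)"
      unfolding ennreal_norm_abs_l2_square[OF d, symmetric]
      by (simp add: ennreal_mult ennreal_power[symmetric])
    also have "\<dots> \<le> ennreal ((1/2) ^ n)"
    proof (rule ennreal_leI)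
      have "abs_l2 (d n) = abs_l2 (f (Suc n)) - abs_l2 (f n)"
        unfolding d_def by (rule diff_abs_l2[symmetric]) (rule f)+
      then have "(norm (abs_l2 (d n)))\<^sup>2 \<le> ((1/2) ^ n)\<^sup>2"
        using fast[of n] by (intro power_mono) auto
      then have "2 ^ n * (norm (abs_l2 (d n)))\<^sup>2 \<le> 2 ^ n * ((1/2) ^ n)\<^sup>2"
        by (intro mult_left_mono) auto
      also have "\<dots> = (1/2) ^ n" by (simp add: power2_eq_square power_mult_distrib[symmetric] flip: mult.assoc)
      finally show "2 ^ n * (norm (abs_l2 (d n)))\<^sup>2 \<le> (1/2) ^ n" .
    qed
    finally show "(\<integral>\<^sup>+x. ennreal (2 ^ n * (norm (d n x))\<^sup>2) \<partial>lebesgue) \<le> ennreal ((1/2) ^ n)" .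
  qed (rule summableI)+
  also have "\<dots> = ennreal (\<Sum>n. (1/2) ^ n)"
    by (rule suminf_ennreal2) (simp_all add: summable_geometric)
  also have "\<dots> < \<infinity>" by simp
  finally have "(\<integral>\<^sup>+x. (\<Sum>n. ennreal (2 ^ n * (norm (d n x))\<^sup>2)) \<partial>lebesgue) \<noteq> \<infinity>" by simp
  then have "AE x in lebesgue. (\<Sum>n. ennreal (2 ^ n * (norm (d n x))\<^sup>2)) \<noteq> \<infinity>"
    by (intro nn_integral_PInf_AE borel_measurable_suminf_order dm)
  then show ?thesis
  proof eventually_elim
    case (elim x)
    then have "(\<Sum>n. ennreal (2 ^ n * (norm (d n x))\<^sup>2)) \<noteq> top"
      unfolding infinity_ennreal_def .
    then have "summable (\<lambda>n. 2 ^ n * (norm (d n x))\<^sup>2)"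
      by (rule summable_suminf_not_top[rotated]) simp
    then have "summable (\<lambda>n. norm (d n x))"
      by (rule summable_of_weighted_squares[rotated]) simp
    then have "summable (\<lambda>n. d n x)" by (rule summable_norm_cancel)
    then have "convergent (\<lambda>n. \<Sum>i<n. d i x)" by (simp add: summable_iff_convergent)
    moreover have "(\<Sum>i<n. d i x) = f n x - f 0 x" for n
      unfolding d_def by (rule sum_lessThan_telescope)
    ultimately have "convergent (\<lambda>n. f n x - f 0 x)" by simp
    then show ?case by (simp add: convergent_diff_const_right_iff)
  qed
qed

text \<open>Almost everywhere convergence comes from the preceding lemma, and Fatou's lemma turns
  the bound on \<open>f k - f n\<close> into one on \<open>g - f n\<close>. The limit is given as a
  pointwise \<open>lim\<close>, arbitrary on a null set, so that limits found on different balls can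
  later be recognised as restrictions of one function.\<close>

lemma l2_fast_Cauchy_limit:
  fixes f :: "nat \<Rightarrow> 'a::euclidean_space \<Rightarrow> 'b::euclidean_space"
  assumes f: "\<And>n. f n \<in> L2 UNIV"
    and close: "\<And>n k. n \<le> k \<Longrightarrow> norm (abs_l2 (f k) - abs_l2 (f n)) \<le> (1/2) ^ n"
  defines "g \<equiv> \<lambda>x. lim (\<lambda>n. f n x)"
  shows "AE x in lebesgue. (\<lambda>n. f n x) \<longlonglongrightarrow> g x" and "g \<in> L2 UNIV"
    and "(\<lambda>n. abs_l2 (f n)) \<longlonglongrightarrow> abs_l2 g"
proof -
  have conv: "AE x in lebesgue. convergent (\<lambda>n. f n x)"
    by (rule l2_fast_Cauchy_convergent_AE) (auto simp: f intro: close)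
  then show lim: "AE x in lebesgue. (\<lambda>n. f n x) \<longlonglongrightarrow> g x"
    by eventually_elim (simp add: g_def convergent_LIMSEQ_iff)
  have gm: "g \<in> borel_measurable lebesgue"
    unfolding g_def by (rule borel_measurable_lim_metric) (rule L2_measurable[OF f])
  have bound: "(\<integral>\<^sup>+x. ennreal ((norm (g x - f n x))\<^sup>2) \<partial>lebesgue) \<le> ennreal (((1/2) ^ n)\<^sup>2)" for n
  proof -
    have "(\<integral>\<^sup>+x. ennreal ((norm (g x - f n x))\<^sup>2) \<partial>lebesgue)
        = (\<integral>\<^sup>+x. liminf (\<lambda>k. ennreal ((norm (f k x - f n x))\<^sup>2)) \<partial>lebesgue)"
    proof (rule nn_integral_cong_AE)
      show "AE x in lebesgue. ennreal ((norm (g x - f n x))\<^sup>2)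
          = liminf (\<lambda>k. ennreal ((norm (f k x - f n x))\<^sup>2))"
        using lim
      proof eventually_elim
        case (elim x)
        then have "(\<lambda>k. ennreal ((norm (f k x - f n x))\<^sup>2)) \<longlonglongrightarrow> ennreal ((norm (g x - f n x))\<^sup>2)"
          by (intro tendsto_intros)
        then show ?case by (rule lim_imp_Liminf[OF sequentially_bot, symmetric])
      qed
    qed
    also have "\<dots> \<le> liminf (\<lambda>k. \<integral>\<^sup>+x. ennreal ((norm (f k x - f n x))\<^sup>2) \<partial>lebesgue)"
    proof (rule nn_integral_liminf)
      show "(\<lambda>x. ennreal ((norm (f k x - f n x))\<^sup>2)) \<in> borel_measurable lebesgue" for k
        using L2_diff[OF f f, of k n, THEN L2_measurable] by measurable
    qed
    also have "\<dots> \<le> ennreal (((1/2) ^ n)\<^sup>2)"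
    proof (rule Liminf_le[OF sequentially_bot], rule eventually_sequentiallyI[of n])
      fix k assume k: "n \<le> k"
      have "(\<integral>\<^sup>+x. ennreal ((norm (f k x - f n x))\<^sup>2) \<partial>lebesgue) = ennreal ((norm (abs_l2 (f k) - abs_l2 (f n)))\<^sup>2)"
        using ennreal_norm_abs_l2_square[OF L2_diff[OF f f], of k n] diff_abs_l2[OF f f, of k n] by simp
      also have "\<dots> \<le> ennreal (((1/2) ^ n)\<^sup>2)"
        by (intro ennreal_leI power_mono close k) simp
      finally show "(\<integral>\<^sup>+x. ennreal ((norm (f k x - f n x))\<^sup>2) \<partial>lebesgue) \<le> ennreal (((1/2) ^ n)\<^sup>2)" .
    qed
    finally show ?thesis .
  qed
  have diff: "(\<lambda>x. g x - f n x) \<in> L2 UNIV" for n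
    by (rule L2_of_nn_integral[OF borel_measurable_diff[OF gm L2_measurable[OF f]]])
      (rule le_less_trans[OF bound], simp)
  show gL: "g \<in> L2 UNIV" using L2_add[OF diff[of 0] f[of 0]] by simp
  have "norm (abs_l2 (f n) - abs_l2 g) \<le> (1/2) ^ n" for n
  proof (rule power2_le_imp_le)
    have "ennreal ((norm (abs_l2 g - abs_l2 (f n)))\<^sup>2) \<le> ennreal (((1/2) ^ n)\<^sup>2)"
      using bound[of n] ennreal_norm_abs_l2_square[OF diff, of n] diff_abs_l2[OF gL f, of n] by simp
    then show "(norm (abs_l2 (f n) - abs_l2 g))\<^sup>2 \<le> ((1/2) ^ n)\<^sup>2"
      by (simp add: norm_minus_commute)
  qed simp
  then have "\<forall>\<^sub>F n in sequentially. norm (abs_l2 (f n) - abs_l2 g) \<le> (1/2) ^ n"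
    by (intro always_eventually allI)
  moreover have "(\<lambda>n. (1/2::real) ^ n) \<longlonglongrightarrow> 0" by (rule LIMSEQ_power_zero) simp
  ultimately have "(\<lambda>n. abs_l2 (f n) - abs_l2 g) \<longlonglongrightarrow> 0"
    by (rule Lim_null_comparison)
  then show "(\<lambda>n. abs_l2 (f n)) \<longlonglongrightarrow> abs_l2 g" by (rule Lim_null[THEN iffD2])
qed

instance l2 :: (euclidean_space, euclidean_space) complete_space
proof
  fix X :: "nat \<Rightarrow> ('a, 'b) l2" assume X: "Cauchy X"
  have "\<forall>n::nat. \<exists>N. \<forall>m\<ge>N. \<forall>k\<ge>N. norm (X m - X k) < (1/2) ^ n"
    using CauchyD[OF X] by simp
  from choice[OF this] obtain N where N: "\<And>n m k. m \<ge> N n \<Longrightarrow> k \<ge> N n \<Longrightarrow> norm (X m - X k) < (1/2) ^ n"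
    by auto
  \<comment> \<open>The partial sum dominates every \<open>N i\<close> with
    \<open>i \<le> n\<close>, and the extra \<open>n\<close> makes the sequence strictly
    increasing.\<close>
  define r where "r n = (\<Sum>i\<le>n. N i) + n" for n
  have r_mono: "strict_mono r" by (rule strict_monoI_Suc) (simp add: r_def)
  have rN: "N n \<le> r n" for n
    unfolding r_def by (intro trans_le_add1 member_le_sum) auto
  define f where "f n = rep_l2 (X (r n))" for n
  have f: "f n \<in> L2 UNIV" "abs_l2 (f n) = X (r n)" for n
    by (simp_all add: f_def rep_l2_L2 abs_rep_l2)
  have close: "norm (abs_l2 (f k) - abs_l2 (f n)) \<le> (1/2) ^ n" if "n \<le> k" for k n
  proof -
    have "N n \<le> r k" using rN[of n] strict_mono_leD[OF r_mono that] by simp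
    then show ?thesis unfolding f(2) using N[OF _ rN[of n]] by (simp add: less_imp_le)
  qed
  have "X \<longlonglongrightarrow> abs_l2 (\<lambda>x. lim (\<lambda>n. f n x))"
    using l2_fast_Cauchy_limit(3)[OF f(1) close]
    by (intro Cauchy_converges_subseq[OF X r_mono]) (simp add: o_def f(2))
  then show "convergent X" by (rule convergentI)
qed

section \<open>Integration by parts\<close>

text \<open>Translation invariance makes the integral of every difference quotient 0, and the
  quotients converge to the directional derivative. No iterated integration along coordinate axes is
  involved.\<close>

lemma integral_directional_derivative_eq_0:
  fixes F :: "'a::euclidean_space \<Rightarrow> real"
  assumes F: "\<And>x. (F has_derivative F' x) (at x)" and cont: "continuous_on UNIV (\<lambda>x. F' x b)"
    and K: "compact K" "\<And>x. x \<notin> K \<Longrightarrow> F x = 0"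
  shows "(LINT x|lebesgue. F' x b) = 0"
proof -
  have Fc: "continuous_on UNIV F"
    using F has_derivative_continuous by (blast intro: continuous_at_imp_continuous_on)
  have F'0: "F' x b = 0" if "x \<notin> K" for x
  proof -
    have "((\<lambda>x. 0) has_derivative (\<lambda>h. 0)) (at x)" by simp
    then have "(F has_derivative (\<lambda>h. 0)) (at x)"
      by (rule has_derivative_transform_within_open[of _ _ _ _ "- K"])
        (use that K in \<open>auto simp: compact_imp_closed open_Compl\<close>)
    then have "F' x = (\<lambda>h. 0)" by (rule has_derivative_unique[OF F])
    then show ?thesis by simp
  qed
  have "bounded ((\<lambda>x. F' x b) ` K)"
    by (intro compact_imp_bounded compact_continuous_image continuous_on_subset[OF cont] K) simp
  then obtain M where "\<And>x. x \<in> K \<Longrightarrow> \<bar>F' x b\<bar> \<le> M" "M > 0" by (auto simp: bounded_pos)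
  then have M: "\<bar>F' x b\<bar> \<le> M" for x using F'0[of x] by (cases "x \<in> K") auto
  define q where "q n x = (F (b /\<^sub>R real (Suc n) + x) - F x) * real (Suc n)" for n x
  have int_F: "integrable lborel F"
    using integrable_lebesgue_compact_support[OF Fc K] borel_measurable_continuous_onI[OF Fc]
    by (simp add: integrable_completion)
  have q0: "(LINT x|lborel. q n x) = 0" for n
    using lborel_integral_translation[OF borel_measurable_continuous_onI[OF Fc], of "b /\<^sub>R real (Suc n)"]
      lborel_integrable_translation[OF int_F, of "b /\<^sub>R real (Suc n)"] int_F
    by (simp add: q_def)
  obtain B where B: "\<And>x. x \<in> K \<Longrightarrow> norm x \<le> B"
    using compact_imp_bounded[OF K(1)] by (auto simp: bounded_iff)
  \<comment> \<open>The increments have length at most \<open>norm b\<close>, because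
    \<open>inverse (real (Suc n)) \<le> 1\<close>. All quotients therefore vanish outside this ball,
    and inside it the mean value theorem bounds them by \<open>M\<close>.\<close>
  define C where "C = cball (0::'a) (B + norm b)"
  have q_bound: "\<bar>q n x\<bar> \<le> indicator C x * M" for n x
  proof (cases "x \<in> C")
    case True
    define h :: real where "h = inverse (real (Suc n))"
    have h: "h > 0" by (simp add: h_def)
    have "((\<lambda>t. F (t *\<^sub>R b + x)) has_real_derivative F' (t *\<^sub>R b + x) b) (at t)" for t
    proof -
      have "((\<lambda>t. F (t *\<^sub>R b + x)) has_derivative (\<lambda>s. F' (t *\<^sub>R b + x) (s *\<^sub>R b))) (at t)"
        by (rule has_derivative_compose[OF _ F]) (auto intro!: derivative_eq_intros)
      moreover have "(\<lambda>s. F' (t *\<^sub>R b + x) (s *\<^sub>R b)) = (*) (F' (t *\<^sub>R b + x) b)"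
        using has_derivative_linear[OF F] by (auto simp: linear_scale mult.commute)
      ultimately show ?thesis by (simp add: has_field_derivative_def)
    qed
    from MVT2[OF h this] obtain z
      where "F (h *\<^sub>R b + x) - F (0 *\<^sub>R b + x) = (h - 0) * F' (z *\<^sub>R b + x) b" by auto
    then have "q n x = h * F' (z *\<^sub>R b + x) b * real (Suc n)"
      unfolding q_def h_def by (simp only: scaleR_zero_left add_0 diff_zero)
    also have "\<dots> = F' (z *\<^sub>R b + x) b"
      by (simp add: h_def del: of_nat_Suc)
    finally have "q n x = F' (z *\<^sub>R b + x) b" .
    then show ?thesis using M True by simp
  next
    case False
    have "x \<notin> K" using B[of x] False norm_ge_zero[of b] unfolding C_def mem_cball dist_0_norm by linarith
    moreover have "b /\<^sub>R real (Suc n) + x \<notin> K"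
    proof
      assume "b /\<^sub>R real (Suc n) + x \<in> K"
      then have "norm (b /\<^sub>R real (Suc n) + x) \<le> B" by (rule B)
      moreover have "norm (b /\<^sub>R real (Suc n)) \<le> norm b"
        using mult_right_mono[of "inverse (real (Suc n))" 1 "norm b"] by (simp add: inverse_le_1_iff)
      moreover have "norm x \<le> norm (b /\<^sub>R real (Suc n) + x) + norm (b /\<^sub>R real (Suc n))"
        using norm_triangle_sub[of x "- (b /\<^sub>R real (Suc n))"] norm_triangle_ineq4[of "b /\<^sub>R real (Suc n) + x" "b /\<^sub>R real (Suc n)"]
        by simp
      ultimately show False using False unfolding C_def mem_cball dist_0_norm by linarith
    qed
    ultimately show ?thesis using False by (simp add: q_def K(2))
  qed
  have "(\<lambda>n. LINT x|lborel. q n x) \<longlonglongrightarrow> (LINT x|lborel. F' x b)"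
  proof (rule integral_dominated_convergence[where w = "\<lambda>x. indicator C x * M"])
    show "(\<lambda>x. F' x b) \<in> borel_measurable lborel"
      using borel_measurable_continuous_onI[OF cont] by simp
    have "continuous_on UNIV (q n)" for n
      unfolding q_def by (intro continuous_intros continuous_on_compose2[OF Fc]) auto
    then show "q n \<in> borel_measurable lborel" for n
      by (simp add: borel_measurable_continuous_onI)
    show "integrable lborel (\<lambda>x. indicator C x * M)"
      unfolding C_def by (intro integrable_mult_left integrable_real_indicator) (use emeasure_bounded_finite[OF bounded_cball, of "0::'a" "B + norm b"] in simp_all)
    show "AE x in lborel. (\<lambda>n. q n x) \<longlonglongrightarrow> F' x b"
    proof (rule AE_I2)
      fix x
      have "((\<lambda>t. F (t *\<^sub>R b + x)) has_real_derivative F' x b) (at 0)"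
      proof -
        have "((\<lambda>t. F (t *\<^sub>R b + x)) has_derivative (\<lambda>s. F' (0 *\<^sub>R b + x) (s *\<^sub>R b))) (at 0)"
          by (rule has_derivative_compose[OF _ F]) (auto intro!: derivative_eq_intros)
        moreover have "(\<lambda>s. F' (0 *\<^sub>R b + x) (s *\<^sub>R b)) = (*) (F' x b)"
          using has_derivative_linear[OF F] by (auto simp: linear_scale mult.commute)
        ultimately show ?thesis by (simp add: has_field_derivative_def)
      qed
      then have "((\<lambda>h. (F (h *\<^sub>R b + x) - F x) / h) \<longlongrightarrow> F' x b) (at 0)"
        by (simp add: DERIV_def)
      moreover have "filterlim (\<lambda>n. inverse (real (Suc n))) (at 0) sequentially"
        by (rule filterlim_atI[OF LIMSEQ_inverse_real_of_nat]) simp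
      ultimately have "(\<lambda>n. (F (inverse (real (Suc n)) *\<^sub>R b + x) - F x) / inverse (real (Suc n))) \<longlonglongrightarrow> F' x b"
        by (rule filterlim_compose)
      then show "(\<lambda>n. q n x) \<longlonglongrightarrow> F' x b" by (simp add: q_def divide_inverse)
    qed
    show "AE x in lborel. norm (q n x) \<le> indicator C x * M" for n
      using q_bound by simp
  qed
  then have "(LINT x|lborel. F' x b) = 0" by (simp add: q0 LIMSEQ_const_iff)
  then show ?thesis
    using borel_measurable_continuous_onI[OF cont] by (simp add: integral_completion)
qed

section \<open>Weak gradients\<close>

lemma L2_subset:
  fixes f :: "'a::euclidean_space \<Rightarrow> 'b::euclidean_space"
  assumes "f \<in> L2 UNIV" "S \<in> sets lebesgue"
  shows "f \<in> L2 S"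
proof -
  have "integrable lebesgue (\<lambda>x. indicator S x *\<^sub>R (norm (f x))\<^sup>2)"
    by (rule integrable_mult_indicator[OF assms(2)]) (use assms(1) in \<open>simp add: L2_UNIV_iff\<close>)
  moreover have "f \<in> borel_measurable (lebesgue_on S)"
    by (rule measurable_restrict_space1) (rule L2_measurable[OF assms(1)])
  ultimately show ?thesis
    by (simp add: L2_def integrable_lebesgue_on[OF assms(2)])
qed

text \<open>Through extension by zero, all functions on domains can be treated in the one space
  \<open>l2\<close> over the whole space.\<close>

lemma L2_indicator_iff:
  fixes f :: "'a::euclidean_space \<Rightarrow> 'b::euclidean_space"
  assumes "S \<in> sets lebesgue"
  shows "(\<lambda>x. indicator S x *\<^sub>R f x) \<in> L2 UNIV \<longleftrightarrow> f \<in> L2 S"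
proof -
  have "(norm (indicator S x *\<^sub>R f x))\<^sup>2 = indicator S x *\<^sub>R (norm (f x))\<^sup>2" for x
    by (simp add: indicator_def)
  then have A: "integrable lebesgue (\<lambda>x. (norm (indicator S x *\<^sub>R f x))\<^sup>2)
      \<longleftrightarrow> integrable (lebesgue_on S) (\<lambda>x. (norm (f x))\<^sup>2)"
    by (simp only: integrable_lebesgue_on[OF assms])
  have B: "f \<in> borel_measurable (lebesgue_on S)
      \<longleftrightarrow> (\<lambda>x. indicator S x *\<^sub>R f x) \<in> borel_measurable lebesgue"
    by (rule borel_measurable_restrict_space_iff) (use assms in simp)
  show ?thesis unfolding L2_def mem_Collect_eq lebesgue_on_UNIV_eq A B ..
qed

lemma L2_norm_indicator:
  fixes f :: "'a::euclidean_space \<Rightarrow> 'b::euclidean_space"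
  assumes "S \<in> sets lebesgue" "f \<in> L2 S"
  shows "L2_norm S f = norm (abs_l2 (\<lambda>x. indicator S x *\<^sub>R f x))"
proof -
  have "(norm (indicator S x *\<^sub>R f x))\<^sup>2 = indicator S x *\<^sub>R (norm (f x))\<^sup>2" for x
    by (simp add: indicator_def)
  then have "L2_norm UNIV (\<lambda>x. indicator S x *\<^sub>R f x) = L2_norm S f"
    unfolding L2_norm_def lebesgue_on_UNIV_eq
    by (simp only: integral_lebesgue_on[OF assms(1)])
  then show ?thesis
    using norm_abs_l2[of "\<lambda>x. indicator S x *\<^sub>R f x"] L2_indicator_iff[OF assms(1), of f] assms(2) by simp
qed

lemma L2_integrable_on_bounded:
  fixes f :: "'a::euclidean_space \<Rightarrow> 'b::euclidean_space"
  assumes f: "f \<in> L2 S" and S: "S \<in> sets lebesgue" "bounded S"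
  shows "integrable (lebesgue_on S) f"
proof (rule Bochner_Integration.integrable_bound)
  have "S \<in> lmeasurable" by (rule bounded_set_imp_lmeasurable[OF S(2,1)])
  then have "integrable (lebesgue_on S) (\<lambda>x. 1::real)"
    unfolding integrable_lebesgue_on[OF S(1)] by (simp add: lmeasurable_iff_integrable)
  then show "integrable (lebesgue_on S) (\<lambda>x. 1 + (norm (f x))\<^sup>2)"
    using f by (intro Bochner_Integration.integrable_add) (simp_all add: L2_def)
  show "f \<in> borel_measurable (lebesgue_on S)" using f by (simp add: L2_def)
  show "AE x in lebesgue_on S. norm (f x) \<le> norm (1 + (norm (f x))\<^sup>2)"
  proof (rule AE_I2)
    fix x
    have "0 \<le> (norm (f x) - 1)\<^sup>2" by simp
    then have "2 * norm (f x) \<le> 1 + (norm (f x))\<^sup>2" unfolding power2_diff by simp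
    moreover have "0 \<le> (norm (f x))\<^sup>2" by simp
    moreover have "0 \<le> norm (f x)" by simp
    ultimately show "norm (f x) \<le> norm (1 + (norm (f x))\<^sup>2)" unfolding real_norm_def by linarith
  qed
qed

lemma integrable_continuous_mult:
  fixes f :: "'a::euclidean_space \<Rightarrow> 'b::euclidean_space"
  assumes f: "integrable (lebesgue_on K) f" and K: "compact K"
    and s: "continuous_on UNIV s" "\<And>x. x \<notin> K \<Longrightarrow> s x = (0::real)"
  shows "integrable lebesgue (\<lambda>x. s x *\<^sub>R f x)"
proof -
  have Kl: "K \<in> sets lebesgue" using K by (simp add: compact_imp_closed)
  have "bounded (s ` K)"
    by (intro compact_imp_bounded compact_continuous_image continuous_on_subset[OF s(1)] K) simp
  then obtain M where M: "\<And>x. x \<in> K \<Longrightarrow> \<bar>s x\<bar> \<le> M" by (auto simp: bounded_iff)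
  have fi: "integrable lebesgue (\<lambda>x. indicator K x *\<^sub>R f x)"
    using f by (simp add: integrable_lebesgue_on[OF Kl])
  have sm: "s \<in> borel_measurable lebesgue"
    by (intro borel_imp_lebesgue_measurable borel_measurable_continuous_onI s)
  have "integrable lebesgue (\<lambda>x. s x *\<^sub>R (indicator K x *\<^sub>R f x))"
  proof (rule Bochner_Integration.integrable_bound)
    show "integrable lebesgue (\<lambda>x. M *\<^sub>R (indicator K x *\<^sub>R f x))"
      by (rule integrable_scaleR_right) (rule fi)
    show "(\<lambda>x. s x *\<^sub>R (indicator K x *\<^sub>R f x)) \<in> borel_measurable lebesgue"
      by (rule borel_measurable_scaleR[OF sm borel_measurable_integrable[OF fi]])
    show "AE x in lebesgue. norm (s x *\<^sub>R (indicator K x *\<^sub>R f x)) \<le> norm (M *\<^sub>R (indicator K x *\<^sub>R f x))"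
    proof (rule AE_I2)
      fix x
      show "norm (s x *\<^sub>R (indicator K x *\<^sub>R f x)) \<le> norm (M *\<^sub>R (indicator K x *\<^sub>R f x))"
        using M[of x] by (cases "x \<in> K") (auto intro: mult_right_mono)
    qed
  qed
  moreover have "s x *\<^sub>R (indicator K x *\<^sub>R f x) = s x *\<^sub>R f x" for x
    using s(2)[of x] by (cases "x \<in> K") auto
  ultimately show ?thesis by (simp only:)
qed

lemma integrable_test_mult:
  fixes f :: "'a::euclidean_space \<Rightarrow> 'b::euclidean_space"
  assumes f: "\<And>K. compact K \<Longrightarrow> K \<subseteq> D \<Longrightarrow> integrable (lebesgue_on K) f"
    and \<phi>: "\<phi> \<in> test_functions D"
  shows "integrable lebesgue (\<lambda>x. \<phi> x *\<^sub>R f x)"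
proof -
  obtain K where K: "smooth \<phi>" "compact K" "K \<subseteq> D" "\<And>x. x \<notin> K \<Longrightarrow> \<phi> x = 0"
    using \<phi> by (rule test_functionsE) blast
  show ?thesis
    by (rule integrable_continuous_mult[OF f[OF K(2,3)] K(2) smooth_continuous_on[OF K(1)] K(4)])
qed

lemma test_function_outside: "\<phi> \<in> test_functions D \<Longrightarrow> x \<notin> D \<Longrightarrow> \<phi> x = 0"
  by (erule test_functionsE) auto

lemma integral_lebesgue_on_test_mult:
  fixes f :: "'a::euclidean_space \<Rightarrow> real"
  assumes "\<phi> \<in> test_functions D" "open D"
  shows "(LINT x|lebesgue_on D. f x * \<phi> x) = (LINT x|lebesgue. f x * \<phi> x)"
proof -
  have "indicator D x *\<^sub>R (f x * \<phi> x) = f x * \<phi> x" for x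
    using test_function_outside[OF assms(1), of x] by (cases "x \<in> D") auto
  moreover have "D \<in> sets lebesgue" using assms(2) by simp
  ultimately show ?thesis by (simp only: integral_lebesgue_on)
qed

lemma integrable_lebesgue_on_test_mult:
  fixes f :: "'a::euclidean_space \<Rightarrow> real"
  assumes f: "\<And>K. compact K \<Longrightarrow> K \<subseteq> D \<Longrightarrow> integrable (lebesgue_on K) f"
    and \<phi>: "\<phi> \<in> test_functions D" and D: "open D"
  shows "integrable (lebesgue_on D) (\<lambda>x. f x * \<phi> x)"
proof -
  have "indicator D x *\<^sub>R (f x * \<phi> x) = \<phi> x *\<^sub>R f x" for x
    using test_function_outside[OF \<phi>, of x] by (cases "x \<in> D") auto
  moreover have "D \<in> sets lebesgue" using D by simp
  ultimately show ?thesis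
    using integrable_test_mult[OF f \<phi>] by (simp only: integrable_lebesgue_on)
qed

lemma has_weak_gradientD:
  assumes "has_weak_gradient D u g"
  shows "\<And>K. compact K \<Longrightarrow> K \<subseteq> D \<Longrightarrow> integrable (lebesgue_on K) u"
    and "\<And>K. compact K \<Longrightarrow> K \<subseteq> D \<Longrightarrow> integrable (lebesgue_on K) g"
    and "\<And>\<phi> b. \<phi> \<in> test_functions D \<Longrightarrow> b \<in> Basis \<Longrightarrow>
      (LINT x|lebesgue_on D. u x * frechet_derivative \<phi> (at x) b) = - (LINT x|lebesgue_on D. (g x \<bullet> b) * \<phi> x)"
  using assms unfolding has_weak_gradient_def by blast+

lemma has_weak_gradient_test:
  assumes "has_weak_gradient D u g" "open D" "\<phi> \<in> test_functions D" "b \<in> Basis"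
  shows "(LINT x|lebesgue. u x * frechet_derivative \<phi> (at x) b) = - (LINT x|lebesgue. (g x \<bullet> b) * \<phi> x)"
  using has_weak_gradientD(3)[OF assms(1,3,4)]
  by (simp only: integral_lebesgue_on_test_mult[OF assms(3,2)]
      integral_lebesgue_on_test_mult[OF test_functions_frechet_derivative[OF assms(3,4)] assms(2)])

lemma has_weak_gradientI:
  assumes "open D"
    and "\<And>K. compact K \<Longrightarrow> K \<subseteq> D \<Longrightarrow> integrable (lebesgue_on K) u"
    and "\<And>K. compact K \<Longrightarrow> K \<subseteq> D \<Longrightarrow> integrable (lebesgue_on K) g"
    and "\<And>\<phi> b. \<phi> \<in> test_functions D \<Longrightarrow> b \<in> Basis \<Longrightarrow>
      (LINT x|lebesgue. u x * frechet_derivative \<phi> (at x) b) = - (LINT x|lebesgue. (g x \<bullet> b) * \<phi> x)"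
  shows "has_weak_gradient D u g"
  unfolding has_weak_gradient_def
proof (intro conjI allI impI ballI)
  fix \<phi> and b :: 'a assume \<phi>: "\<phi> \<in> test_functions D" and b: "b \<in> Basis"
  show "(LINT x|lebesgue_on D. u x * frechet_derivative \<phi> (at x) b) = - (LINT x|lebesgue_on D. (g x \<bullet> b) * \<phi> x)"
    using assms(4)[OF \<phi> b]
    by (simp only: integral_lebesgue_on_test_mult[OF \<phi> assms(1)]
      integral_lebesgue_on_test_mult[OF test_functions_frechet_derivative[OF \<phi> b] assms(1)])
qed (use assms(2,3) in auto)

lemma has_weak_gradient_unique:
  assumes D: "open D" and g: "has_weak_gradient D u g" "has_weak_gradient D u g'"
  shows "AE x in lebesgue_on D. g x = g' x"
proof -
  have "AE x in lebesgue_on D. (g x - g' x) \<bullet> b = 0" if b: "b \<in> Basis" for b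
  proof (rule fundamental_lemma[OF D])
    show "integrable (lebesgue_on K) (\<lambda>x. (g x - g' x) \<bullet> b)" if "compact K" "K \<subseteq> D" for K
      by (intro integrable_inner_left Bochner_Integration.integrable_diff has_weak_gradientD(2)[OF g(1)]
          has_weak_gradientD(2)[OF g(2)] that)
    fix \<phi> assume \<phi>: "\<phi> \<in> test_functions D"
    have i: "integrable (lebesgue_on D) (\<lambda>x. (h x \<bullet> b) * \<phi> x)" if "has_weak_gradient D u h" for h
      by (rule integrable_lebesgue_on_test_mult[OF _ \<phi> D])
        (intro integrable_inner_left has_weak_gradientD(2)[OF that])
    have "(LINT x|lebesgue_on D. ((g x - g' x) \<bullet> b) * \<phi> x)
        = (LINT x|lebesgue_on D. (g x \<bullet> b) * \<phi> x) - (LINT x|lebesgue_on D. (g' x \<bullet> b) * \<phi> x)"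
      unfolding inner_diff_left left_diff_distrib
      by (rule Bochner_Integration.integral_diff[OF i[OF g(1)] i[OF g(2)]])
    then show "(LINT x|lebesgue_on D. ((g x - g' x) \<bullet> b) * \<phi> x) = 0"
      using has_weak_gradientD(3)[OF g(1) \<phi> b] has_weak_gradientD(3)[OF g(2) \<phi> b] by simp
  qed
  then have "AE x in lebesgue_on D. \<forall>b\<in>Basis. (g x - g' x) \<bullet> b = 0"
    by (rule AE_finite_allI[OF finite_Basis])
  then show ?thesis
  proof eventually_elim
    case (elim x)
    then have "g x - g' x = 0" unfolding euclidean_all_zero_iff .
    then show ?case by simp
  qed
qed

lemma has_weak_gradient_weak_gradient:
  "has_weak_gradient D u g \<Longrightarrow> has_weak_gradient D u (weak_gradient D u)"
  unfolding weak_gradient_def by (rule someI[where P = "has_weak_gradient D u"])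

lemma weak_gradient_AE:
  "open D \<Longrightarrow> has_weak_gradient D u g \<Longrightarrow> AE x in lebesgue_on D. weak_gradient D u x = g x"
  by (rule has_weak_gradient_unique[OF _ has_weak_gradient_weak_gradient])

lemma has_weak_gradient_diff:
  assumes D: "open D" and u: "has_weak_gradient D u g" and v: "has_weak_gradient D v h"
  shows "has_weak_gradient D (\<lambda>x. u x - v x) (\<lambda>x. g x - h x)"
  unfolding has_weak_gradient_def
proof (intro conjI allI impI ballI)
  fix \<phi> and b :: 'a assume \<phi>: "\<phi> \<in> test_functions D" and b: "b \<in> Basis"
  note \<phi>' = test_functions_frechet_derivative[OF \<phi> b]
  have iu: "integrable (lebesgue_on D) (\<lambda>x. w x * frechet_derivative \<phi> (at x) b)"
    and ig: "integrable (lebesgue_on D) (\<lambda>x. (k x \<bullet> b) * \<phi> x)" if "has_weak_gradient D w k" for w k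
    by (rule integrable_lebesgue_on_test_mult[OF _ \<phi>' D], rule has_weak_gradientD(1)[OF that], assumption+)
      (rule integrable_lebesgue_on_test_mult[OF _ \<phi> D],
        intro integrable_inner_left has_weak_gradientD(2)[OF that], assumption+)
  have "(LINT x|lebesgue_on D. (u x - v x) * frechet_derivative \<phi> (at x) b)
      = (LINT x|lebesgue_on D. u x * frechet_derivative \<phi> (at x) b)
        - (LINT x|lebesgue_on D. v x * frechet_derivative \<phi> (at x) b)"
    unfolding left_diff_distrib by (rule Bochner_Integration.integral_diff[OF iu[OF u] iu[OF v]])
  moreover have "(LINT x|lebesgue_on D. ((g x - h x) \<bullet> b) * \<phi> x)
      = (LINT x|lebesgue_on D. (g x \<bullet> b) * \<phi> x) - (LINT x|lebesgue_on D. (h x \<bullet> b) * \<phi> x)"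
    unfolding inner_diff_left left_diff_distrib
    by (rule Bochner_Integration.integral_diff[OF ig[OF u] ig[OF v]])
  ultimately show "(LINT x|lebesgue_on D. (u x - v x) * frechet_derivative \<phi> (at x) b)
      = - (LINT x|lebesgue_on D. ((g x - h x) \<bullet> b) * \<phi> x)"
    using has_weak_gradientD(3)[OF u \<phi> b] has_weak_gradientD(3)[OF v \<phi> b] by simp
qed (use has_weak_gradientD[OF u] has_weak_gradientD[OF v] in auto)

lemma has_weak_gradient_mono:
  assumes "has_weak_gradient D u g" "open D" "open E" "E \<subseteq> D"
  shows "has_weak_gradient E u g"
proof (rule has_weak_gradientI[OF assms(3)])
  fix \<phi> and b :: 'a assume "\<phi> \<in> test_functions E" and b: "b \<in> Basis"
  then have "\<phi> \<in> test_functions D" using test_functions_mono[OF assms(4)] by auto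
  then show "(LINT x|lebesgue. u x * frechet_derivative \<phi> (at x) b) = - (LINT x|lebesgue. (g x \<bullet> b) * \<phi> x)"
    by (rule has_weak_gradient_test[OF assms(1,2) _ b])
next
  fix K assume K: "compact K" "K \<subseteq> E"
  then have "K \<subseteq> D" using assms(4) by auto
  then show "integrable (lebesgue_on K) u" "integrable (lebesgue_on K) g"
    using has_weak_gradientD(1,2)[OF assms(1) K(1)] by simp_all
qed

lemma integrable_lebesgue_on_continuous:
  fixes f :: "'a::euclidean_space \<Rightarrow> 'b::euclidean_space"
  assumes "compact K" "continuous_on K f"
  shows "integrable (lebesgue_on K) f"
proof -
  have K: "K \<in> sets lebesgue" using assms(1) by (simp add: compact_imp_closed)
  have "integrable lborel (\<lambda>x. indicator K x *\<^sub>R f x)"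
    using borel_integrable_compact[OF assms] by simp
  then have "integrable lebesgue (\<lambda>x. indicator K x *\<^sub>R f x)"
    using integrable_completion[OF borel_measurable_integrable] by blast
  then show ?thesis by (simp add: integrable_lebesgue_on[OF K])
qed

text \<open>The product of \<open>v\<close> with a test function is continuously differentiable on
  the whole space, whatever the values of \<open>v\<close> off \<open>D\<close>. The integral of its
  derivative is 0, and the product rule splits it into the two sides of integration by
  parts.\<close>

lemma has_weak_gradient_GDERIV:
  fixes v :: "'a::euclidean_space \<Rightarrow> real"
  assumes D: "open D" and v: "\<And>x. x \<in> D \<Longrightarrow> GDERIV v x :> G x" and G: "continuous_on D G"
  shows "has_weak_gradient D v G"
proof (rule has_weak_gradientI[OF D])
  have vd: "(v has_derivative (\<lambda>h. G x \<bullet> h)) (at x)" if "x \<in> D" for x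
    using v[OF that] by (simp add: gderiv_def inner_commute[of _ "G x"])
  have vc: "continuous_on D v"
    using vd has_derivative_continuous continuous_at_imp_continuous_on by blast
  show "integrable (lebesgue_on K) v" "integrable (lebesgue_on K) G" if "compact K" "K \<subseteq> D" for K
    by (rule integrable_lebesgue_on_continuous[OF that(1) continuous_on_subset[OF _ that(2)]], rule vc G)+
  fix \<phi> and b :: 'a assume \<phi>: "\<phi> \<in> test_functions D" and b: "b \<in> Basis"
  obtain K where K: "smooth \<phi>" "compact K" "K \<subseteq> D" "\<And>x. x \<notin> K \<Longrightarrow> \<phi> x = 0"
      "\<And>x. x \<notin> K \<Longrightarrow> frechet_derivative \<phi> (at x) = (\<lambda>h. 0)"
    using \<phi> by (rule test_functionsE) (rule that)
  have \<phi>d: "(\<phi> has_derivative frechet_derivative \<phi> (at x)) (at x)" for x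
    using smooth_differentiable[OF K(1)] by (simp add: frechet_derivative_works)
  have Kc: "open (- K)" using K(2) by (simp add: compact_imp_closed open_Compl)
  define F where "F x = v x * \<phi> x" for x
  define F' where "F' x h = v x * frechet_derivative \<phi> (at x) h + (G x \<bullet> h) * \<phi> x" for x h
  have F0: "F x = 0" "F' x = (\<lambda>h. 0)" if "x \<notin> K" for x
    using K(4,5)[OF that] by (auto simp: F_def F'_def)
  have "(F has_derivative F' x) (at x)" for x
  proof (cases "x \<in> D")
    case True
    show ?thesis unfolding F_def F'_def by (rule has_derivative_mult[OF vd[OF True] \<phi>d])
  next
    case False
    then have "x \<in> - K" using K(3) by auto
    have "((\<lambda>x. 0) has_derivative (\<lambda>h. 0)) (at x)" by simp
    then have "(F has_derivative (\<lambda>h. 0)) (at x)"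
      by (rule has_derivative_transform_within_open[OF _ Kc \<open>x \<in> - K\<close>]) (simp add: F0)
    then show ?thesis using F0(2) \<open>x \<in> - K\<close> by simp
  qed
  \<comment> \<open>\<open>v\<close> and \<open>G\<close> are controlled on \<open>D\<close> only,
    whereas \<open>F'\<close> vanishes off \<open>K\<close>. The open sets \<open>D\<close> and
    \<open>- K\<close> cover the space, so continuity can be glued.\<close>
  moreover have F'c: "continuous_on UNIV (\<lambda>x. F' x b)"
  proof -
    have "continuous_on D (\<lambda>x. F' x b)"
      unfolding F'_def
      by (intro continuous_intros vc G smooth_continuous_on[OF K(1)]
          smooth_continuous_on[OF smooth_frechet_derivative[OF K(1) b]])
    moreover have "continuous_on (- K) (\<lambda>x. F' x b)"
      by (rule continuous_on_eq[OF continuous_on_const[of _ 0]]) (simp add: F0)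
    ultimately have "continuous_on (D \<union> - K) (\<lambda>x. F' x b)"
      by (rule continuous_on_open_Un[OF D Kc])
    moreover have "D \<union> - K = UNIV" using K(3) by auto
    ultimately show ?thesis by simp
  qed
  ultimately have "(LINT x|lebesgue. F' x b) = 0"
    by (rule integral_directional_derivative_eq_0[OF _ _ K(2) F0(1)])
  moreover have "(LINT x|lebesgue. F' x b) = (LINT x|lebesgue. v x * frechet_derivative \<phi> (at x) b)
      + (LINT x|lebesgue. (G x \<bullet> b) * \<phi> x)"
    unfolding F'_def
  proof (rule Bochner_Integration.integral_add)
    have "integrable lebesgue (\<lambda>x. frechet_derivative \<phi> (at x) b *\<^sub>R v x)"
      by (rule integrable_test_mult[OF _ test_functions_frechet_derivative[OF \<phi> b]])
        (rule integrable_lebesgue_on_continuous, assumption, rule continuous_on_subset[OF vc])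
    then show "integrable lebesgue (\<lambda>x. v x * frechet_derivative \<phi> (at x) b)"
      by (simp add: mult.commute)
    have "integrable lebesgue (\<lambda>x. \<phi> x *\<^sub>R (G x \<bullet> b))"
      by (rule integrable_test_mult[OF _ \<phi>])
        (rule integrable_lebesgue_on_continuous, assumption,
          intro continuous_intros continuous_on_subset[OF G])
    then show "integrable lebesgue (\<lambda>x. (G x \<bullet> b) * \<phi> x)"
      by (simp add: mult.commute)
  qed
  ultimately show "(LINT x|lebesgue. v x * frechet_derivative \<phi> (at x) b) = - (LINT x|lebesgue. (G x \<bullet> b) * \<phi> x)"
    by simp
qed

lemma has_weak_gradient_smooth:
  assumes "open D" "smooth \<phi>" shows "has_weak_gradient D \<phi> (grad \<phi>)"
proof (rule has_weak_gradient_GDERIV[OF assms(1) _ continuous_on_grad[OF assms(2)]])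
  show "GDERIV \<phi> x :> grad \<phi> x" for x
    using has_derivative_grad[OF smooth_differentiable[OF assms(2)], of x]
    by (simp add: gderiv_def inner_commute[of _ "grad \<phi> x"])
qed

section \<open>Differences of smooth functions\<close>

lemma L2_compact_support:
  fixes f :: "'a::euclidean_space \<Rightarrow> 'b::euclidean_space"
  assumes "continuous_on UNIV f" "compact K" "\<And>x. x \<notin> K \<Longrightarrow> f x = 0"
  shows "f \<in> L2 UNIV"
proof -
  have "integrable lebesgue (\<lambda>x. (norm (f x))\<^sup>2)"
    by (rule integrable_lebesgue_compact_support[OF _ assms(2)])
      (intro continuous_intros assms(1), simp add: assms(3))
  moreover have "f \<in> borel_measurable lebesgue"
    by (intro borel_imp_lebesgue_measurable borel_measurable_continuous_onI assms(1))
  ultimately show ?thesis by (simp add: L2_UNIV_iff)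
qed

lemma test_function_L2:
  assumes "\<phi> \<in> test_functions D" shows "\<phi> \<in> L2 UNIV"
proof -
  obtain K where K: "smooth \<phi>" "compact K" "\<And>x. x \<notin> K \<Longrightarrow> \<phi> x = 0"
    using assms by (rule test_functionsE) blast
  show ?thesis by (rule L2_compact_support[OF smooth_continuous_on[OF K(1)] K(2,3)])
qed

lemma grad_test_function_support:
  assumes "\<phi> \<in> test_functions D"
  obtains K where "smooth \<phi>" "compact K" "K \<subseteq> D" "\<And>x. x \<notin> K \<Longrightarrow> \<phi> x = 0" "\<And>x. x \<notin> K \<Longrightarrow> grad \<phi> x = 0"
proof -
  obtain K where K: "smooth \<phi>" "compact K" "K \<subseteq> D" "\<And>x. x \<notin> K \<Longrightarrow> \<phi> x = 0"
      "\<And>x. x \<notin> K \<Longrightarrow> frechet_derivative \<phi> (at x) = (\<lambda>h. 0)"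
    using assms by (rule test_functionsE) (rule that)
  have "grad \<phi> x = 0" if "x \<notin> K" for x
    using K(5)[OF that] by (simp add: grad_def)
  then show thesis using that[OF K(1-4)] by simp
qed

lemma grad_test_function_L2:
  assumes "\<phi> \<in> test_functions D" shows "grad \<phi> \<in> L2 UNIV"
proof -
  obtain K where K: "smooth \<phi>" "compact K" "\<And>x. x \<notin> K \<Longrightarrow> grad \<phi> x = 0"
    using assms by (rule grad_test_function_support) (rule that)
  show ?thesis by (rule L2_compact_support[OF continuous_on_grad[OF K(1)] K(2,3)])
qed

lemma nn_integral_lborel_translation:
  fixes f :: "'a::euclidean_space \<Rightarrow> ennreal"
  assumes "f \<in> borel_measurable borel"
  shows "(\<integral>\<^sup>+x. f (a + x) \<partial>lborel) = (\<integral>\<^sup>+x. f x \<partial>lborel)"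
proof -
  have "(\<integral>\<^sup>+x. f x \<partial>lborel) = (\<integral>\<^sup>+x. f x \<partial>distr lborel borel ((+) a))"
    by (simp add: lborel_distr_plus)
  also have "\<dots> = (\<integral>\<^sup>+x. f (a + x) \<partial>lborel)"
    by (rule nn_integral_distr) (use assms in auto)
  finally show ?thesis ..
qed

text \<open>The difference \<open>c\<close> is the mean over the unit interval of the derivative
  \<open>f\<close> along the segment, and the variance \<open>\<integral> (f - c)^2\<close> is
  nonnegative. Extended nonnegative integrals are used so that Tonelli applies next without
  integrability conditions.\<close>

lemma square_difference_le:
  fixes w :: "'a::euclidean_space \<Rightarrow> real"
  assumes w: "smooth w"
  shows "ennreal ((w (z + x) - w x)\<^sup>2)
    \<le> (\<integral>\<^sup>+t. indicator {0..1} t * ennreal ((norm z)\<^sup>2 * (norm (grad w (t *\<^sub>R z + x)))\<^sup>2) \<partial>lborel)"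
proof -
  define f where "f t = grad w (t *\<^sub>R z + x) \<bullet> z" for t
  define c where "c = w (z + x) - w x"
  have gc: "continuous_on S (\<lambda>t. grad w (t *\<^sub>R z + x))" for S :: "real set"
    by (rule continuous_on_compose2[OF continuous_on_grad[OF w, of UNIV]]) (auto intro!: continuous_intros)
  have fc: "continuous_on S f" for S
    unfolding f_def by (intro continuous_intros gc)
  have "(\<integral>t. indicator {0..1} t *\<^sub>R f t \<partial>lborel) = w (1 *\<^sub>R z + x) - w (0 *\<^sub>R z + x)"
  proof (rule integral_FTC_atLeastAtMost)
    fix t :: real
    have "((\<lambda>t. w (t *\<^sub>R z + x)) has_derivative (\<lambda>s. grad w (t *\<^sub>R z + x) \<bullet> (s *\<^sub>R z))) (at t)"
      by (rule has_derivative_compose[OF _ has_derivative_grad[OF smooth_differentiable[OF w]]])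
        (auto intro!: derivative_eq_intros)
    then have "((\<lambda>t. w (t *\<^sub>R z + x)) has_vector_derivative f t) (at t)"
      by (simp add: has_vector_derivative_def f_def mult.commute)
    then show "((\<lambda>t. w (t *\<^sub>R z + x)) has_vector_derivative f t) (at t within {0..1})"
      by (rule has_vector_derivative_at_within)
  qed (simp_all add: fc)
  then have c: "(\<integral>t. indicator {0..1} t * f t \<partial>lborel) = c" by (simp add: c_def)
  have i1: "integrable lborel (\<lambda>t::real. indicator {0..1} t * s t)" if "continuous_on {0..1} s" for s :: "real \<Rightarrow> real"
    using borel_integrable_compact[OF compact_Icc that] by simp
  have "0 \<le> (\<integral>t. indicator {0..1} t * (f t - c)\<^sup>2 \<partial>lborel)" by simp
  also have "\<dots> = (\<integral>t. indicator {0..1} t * (f t)\<^sup>2 - 2 * c * (indicator {0..1} t * f t)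
      + c\<^sup>2 * indicator {0..1} t \<partial>lborel)"
    by (rule Bochner_Integration.integral_cong) (simp_all add: power2_eq_square algebra_simps)
  also have "\<dots> = (\<integral>t. indicator {0..1} t * (f t)\<^sup>2 \<partial>lborel) - 2 * c * c + c\<^sup>2"
  proof -
    have "integrable lborel (\<lambda>t. indicator {0..1} t * (f t)\<^sup>2)"
      by (intro i1 continuous_intros fc)
    moreover have "integrable lborel (\<lambda>t. indicator {0..1} t * f t)"
      by (intro i1 fc)
    moreover have "integrable lborel (indicator {0..1::real} :: real \<Rightarrow> real)"
      by simp
    ultimately show ?thesis using c by simp
  qed
  finally have "c\<^sup>2 \<le> (\<integral>t. indicator {0..1} t * (f t)\<^sup>2 \<partial>lborel)"
    by (simp add: power2_eq_square)
  also have "\<dots> \<le> (\<integral>t. indicator {0..1} t * ((norm z)\<^sup>2 * (norm (grad w (t *\<^sub>R z + x)))\<^sup>2) \<partial>lborel)"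
  proof (rule integral_mono)
    show "integrable lborel (\<lambda>t. indicator {0..1} t * (f t)\<^sup>2)"
      by (intro i1 continuous_intros fc)
    show "integrable lborel (\<lambda>t. indicator {0..1} t * ((norm z)\<^sup>2 * (norm (grad w (t *\<^sub>R z + x)))\<^sup>2))"
      by (intro i1 continuous_intros gc)
    fix t :: real
    have "(f t)\<^sup>2 \<le> (norm (grad w (t *\<^sub>R z + x)) * norm z)\<^sup>2"
      unfolding f_def using Cauchy_Schwarz_ineq2 by (rule power2_le_iff_abs_le[THEN iffD2, rotated]) simp
    then show "indicator {0..1} t * (f t)\<^sup>2 \<le> indicator {0..1} t * ((norm z)\<^sup>2 * (norm (grad w (t *\<^sub>R z + x)))\<^sup>2)"
      by (intro mult_left_mono) (simp_all add: power_mult_distrib mult.commute)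
  qed
  finally have "ennreal (c\<^sup>2)
      \<le> ennreal (\<integral>t. indicator {0..1} t * ((norm z)\<^sup>2 * (norm (grad w (t *\<^sub>R z + x)))\<^sup>2) \<partial>lborel)"
    by (rule ennreal_leI)
  also have "\<dots> = (\<integral>\<^sup>+t. ennreal (indicator {0..1} t * ((norm z)\<^sup>2 * (norm (grad w (t *\<^sub>R z + x)))\<^sup>2)) \<partial>lborel)"
    by (rule nn_integral_eq_integral[symmetric]) (intro i1 continuous_intros gc, simp)
  also have "\<dots> = (\<integral>\<^sup>+t. indicator {0..1} t * ennreal ((norm z)\<^sup>2 * (norm (grad w (t *\<^sub>R z + x)))\<^sup>2) \<partial>lborel)"
    by (rule nn_integral_cong) (simp add: ennreal_mult ennreal_indicator)
  finally show ?thesis unfolding c_def .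
qed

text \<open>After exchanging the integrals, the shift by \<open>t *\<^sub>R z\<close> disappears by
  translation invariance, and the average over \<open>t\<close> is trivial.\<close>

lemma nn_integral_difference_le:
  fixes w :: "'a::euclidean_space \<Rightarrow> real"
  assumes w: "smooth w"
  shows "(\<integral>\<^sup>+x. ennreal ((w (z + x) - w x)\<^sup>2) \<partial>lborel)
    \<le> ennreal ((norm z)\<^sup>2) * (\<integral>\<^sup>+x. ennreal ((norm (grad w x))\<^sup>2) \<partial>lborel)"
proof -
  note gm = grad_borel_measurable[OF w]
  have m: "(\<lambda>p. indicator {0..1} (snd p) * ennreal ((norm z)\<^sup>2 * (norm (grad w (snd p *\<^sub>R z + fst p)))\<^sup>2))
      \<in> borel_measurable (lborel \<Otimes>\<^sub>M lborel)"
  proof -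
    have "(\<lambda>p. snd p *\<^sub>R z + fst p) \<in> borel_measurable (lborel \<Otimes>\<^sub>M lborel)" by measurable
    then have "(\<lambda>p. grad w (snd p *\<^sub>R z + fst p)) \<in> borel_measurable (lborel \<Otimes>\<^sub>M lborel)"
      by (rule measurable_compose[OF _ gm])
    then show ?thesis by measurable
  qed
  have "(\<integral>\<^sup>+x. ennreal ((w (z + x) - w x)\<^sup>2) \<partial>lborel)
      \<le> (\<integral>\<^sup>+x. \<integral>\<^sup>+t. indicator {0..1} t * ennreal ((norm z)\<^sup>2 * (norm (grad w (t *\<^sub>R z + x)))\<^sup>2) \<partial>lborel \<partial>lborel)"
    by (intro nn_integral_mono square_difference_le w)
  also have "\<dots> = (\<integral>\<^sup>+t. \<integral>\<^sup>+x. indicator {0..1} t * ennreal ((norm z)\<^sup>2 * (norm (grad w (t *\<^sub>R z + x)))\<^sup>2) \<partial>lborel \<partial>lborel)"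
    using lborel_pair.Fubini[OF m] by simp
  also have "\<dots> = (\<integral>\<^sup>+t. indicator {0..1::real} t * (ennreal ((norm z)\<^sup>2) * (\<integral>\<^sup>+x. ennreal ((norm (grad w x))\<^sup>2) \<partial>lborel)) \<partial>lborel)"
  proof (rule nn_integral_cong)
    fix t :: real
    have m2: "(\<lambda>x. ennreal ((norm (grad w x))\<^sup>2)) \<in> borel_measurable borel"
      using gm by measurable
    have m3: "(\<lambda>x. ennreal ((norm (grad w (t *\<^sub>R z + x)))\<^sup>2)) \<in> borel_measurable lborel"
      using measurable_compose[OF _ m2, of "\<lambda>x. t *\<^sub>R z + x" lborel] by simp
    have "(\<integral>\<^sup>+x. indicator {0..1} t * ennreal ((norm z)\<^sup>2 * (norm (grad w (t *\<^sub>R z + x)))\<^sup>2) \<partial>lborel)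
        = indicator {0..1} t * ennreal ((norm z)\<^sup>2) * (\<integral>\<^sup>+x. ennreal ((norm (grad w (t *\<^sub>R z + x)))\<^sup>2) \<partial>lborel)"
      by (subst nn_integral_cmult[OF m3, symmetric]) (simp add: ennreal_mult mult.assoc)
    also have "\<dots> = indicator {0..1} t * (ennreal ((norm z)\<^sup>2) * (\<integral>\<^sup>+x. ennreal ((norm (grad w x))\<^sup>2) \<partial>lborel))"
      by (simp only: nn_integral_lborel_translation[OF m2] mult.assoc)
    finally show "(\<integral>\<^sup>+x. indicator {0..1} t * ennreal ((norm z)\<^sup>2 * (norm (grad w (t *\<^sub>R z + x)))\<^sup>2) \<partial>lborel)
        = indicator {0..1} t * (ennreal ((norm z)\<^sup>2) * (\<integral>\<^sup>+x. ennreal ((norm (grad w x))\<^sup>2) \<partial>lborel))" .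
  qed
  also have "\<dots> = ennreal ((norm z)\<^sup>2) * (\<integral>\<^sup>+x. ennreal ((norm (grad w x))\<^sup>2) \<partial>lborel)"
    by (subst nn_integral_multc) simp_all
  finally show ?thesis .
qed

text \<open>A Poincare inequality in which the gradient is taken over the whole space. Taking the
  constant to be a value of the function, rather than its mean, avoids Jensen's inequality.\<close>

lemma poincare_ball:
  fixes w :: "'a::euclidean_space \<Rightarrow> real"
  assumes w: "smooth w" and g: "grad w \<in> L2 UNIV" and A: "(norm (abs_l2 (grad w)))\<^sup>2 < A" and R: "R > 0"
  shows "\<exists>c. (\<integral>\<^sup>+x. indicator (ball 0 R) x * ennreal ((w x - c)\<^sup>2) \<partial>lborel) \<le> ennreal (2 ^ DIM('a) * (2 * R)\<^sup>2 * A)"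
proof (rule ccontr)
  let ?B = "ball (0::'a) R" and ?B2 = "ball (0::'a) (2 * R)"
  define V where "V r = unit_ball_vol (real DIM('a)) * r ^ DIM('a)" for r
  have V: "emeasure lborel (ball (0::'a) r) = ennreal (V r)" "V r > 0" if "r > 0" for r
    using emeasure_ball[of r "0::'a"] that by (simp_all add: V_def unit_ball_vol_pos)
  have V2: "V (2 * R) = 2 ^ DIM('a) * V R" by (simp add: V_def power_mult_distrib)
  define G where "G = (norm (abs_l2 (grad w)))\<^sup>2"
  have G: "(\<integral>\<^sup>+x. ennreal ((norm (grad w x))\<^sup>2) \<partial>lborel) = ennreal G"
    using ennreal_norm_abs_l2_square[OF g] unfolding G_def nn_integral_completion by simp
  have A0: "0 < A" using A zero_le_power2[of "norm (abs_l2 (grad w))"] by linarith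
  assume "\<not> ?thesis"
  \<comment> \<open>If every constant fails, so does every value \<open>w y\<close>. Integrating
    this failure over \<open>y\<close> in the ball contradicts the bound on translates; the strict
    inequality between the squared norm and \<open>A\<close> is what produces the
    contradiction.\<close>
  then have big: "ennreal (2 ^ DIM('a) * (2 * R)\<^sup>2 * A) \<le> (\<integral>\<^sup>+x. indicator ?B x * ennreal ((w x - c)\<^sup>2) \<partial>lborel)" for c
    by (simp add: not_le less_imp_le)
  note wm = smooth_borel_measurable[OF w]
  have [measurable]: "?B \<in> sets borel" "?B2 \<in> sets borel" "w \<in> borel_measurable borel"
    using wm by simp_all
  \<comment> \<open>Differences of points of the ball fill a ball of twice the radius. The factor
    \<open>2 ^ DIM('a)\<close> in the constant is the ratio of the two volumes.\<close>
  have "ennreal (V (2 * R) * (2 * R)\<^sup>2 * A) = ennreal (2 ^ DIM('a) * (2 * R)\<^sup>2 * A) * emeasure lborel ?B"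
    unfolding V2 V(1)[OF R] using V(2)[OF R] A0 by (simp add: ennreal_mult[symmetric] mult_ac)
  also have "\<dots> = (\<integral>\<^sup>+y. ennreal (2 ^ DIM('a) * (2 * R)\<^sup>2 * A) * indicator ?B y \<partial>lborel)"
    by (simp add: nn_integral_cmult_indicator)
  also have "\<dots> \<le> (\<integral>\<^sup>+y. (\<integral>\<^sup>+x. indicator ?B x * ennreal ((w x - w y)\<^sup>2) \<partial>lborel) * indicator ?B y \<partial>lborel)"
    by (intro nn_integral_mono mult_right_mono big) simp
  also have "\<dots> \<le> (\<integral>\<^sup>+y. \<integral>\<^sup>+z. indicator ?B2 z * ennreal ((w (z + y) - w y)\<^sup>2) \<partial>lborel \<partial>lborel)"
  proof (rule nn_integral_mono)
    fix y :: 'a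
    have "(\<lambda>x. indicator ?B x * ennreal ((w x - w y)\<^sup>2)) \<in> borel_measurable borel"
      by measurable
    from nn_integral_lborel_translation[OF this, of y]
    have eq: "(\<integral>\<^sup>+x. indicator ?B x * ennreal ((w x - w y)\<^sup>2) \<partial>lborel)
        = (\<integral>\<^sup>+z. indicator ?B (y + z) * ennreal ((w (y + z) - w y)\<^sup>2) \<partial>lborel)" by simp
    show "(\<integral>\<^sup>+x. indicator ?B x * ennreal ((w x - w y)\<^sup>2) \<partial>lborel) * indicator ?B y
        \<le> (\<integral>\<^sup>+z. indicator ?B2 z * ennreal ((w (z + y) - w y)\<^sup>2) \<partial>lborel)"
    proof (cases "y \<in> ?B")
      case True
      have "(\<integral>\<^sup>+z. indicator ?B (y + z) * ennreal ((w (y + z) - w y)\<^sup>2) \<partial>lborel)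
          \<le> (\<integral>\<^sup>+z. indicator ?B2 z * ennreal ((w (z + y) - w y)\<^sup>2) \<partial>lborel)"
      proof (rule nn_integral_mono)
        fix z
        have "z \<in> ?B2" if "y + z \<in> ?B"
        proof -
          have "norm z \<le> norm (y + z) + norm y" using norm_triangle_ineq4[of "y + z" y] by simp
          then show ?thesis using that True by simp
        qed
        then show "indicator ?B (y + z) * ennreal ((w (y + z) - w y)\<^sup>2)
            \<le> indicator ?B2 z * ennreal ((w (z + y) - w y)\<^sup>2)"
          by (cases "y + z \<in> ?B") (simp_all add: add.commute)
      qed
      then show ?thesis using True by (simp add: eq)
    qed simp
  qed
  also have "\<dots> = (\<integral>\<^sup>+z. \<integral>\<^sup>+y. indicator ?B2 z * ennreal ((w (z + y) - w y)\<^sup>2) \<partial>lborel \<partial>lborel)"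
  proof -
    have "(\<lambda>p. snd p + fst p) \<in> borel_measurable (lborel \<Otimes>\<^sub>M (lborel :: 'a measure))" by measurable
    then have "(\<lambda>p. w (snd p + fst p)) \<in> borel_measurable (lborel \<Otimes>\<^sub>M lborel)"
      by (rule measurable_compose[OF _ wm])
    moreover have "(\<lambda>p. w (fst p)) \<in> borel_measurable (lborel \<Otimes>\<^sub>M (lborel :: 'a measure))"
      by (rule measurable_compose[OF _ wm]) simp
    ultimately have "(\<lambda>p. indicator ?B2 (snd p) * ennreal ((w (snd p + fst p) - w (fst p))\<^sup>2))
        \<in> borel_measurable (lborel \<Otimes>\<^sub>M lborel)" by measurable
    from lborel_pair.Fubini[OF this] show ?thesis by simp
  qed
  also have "\<dots> \<le> (\<integral>\<^sup>+z. ennreal ((2 * R)\<^sup>2 * G) * indicator ?B2 z \<partial>lborel)"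
  proof (rule nn_integral_mono)
    fix z :: 'a
    show "(\<integral>\<^sup>+y. indicator ?B2 z * ennreal ((w (z + y) - w y)\<^sup>2) \<partial>lborel) \<le> ennreal ((2 * R)\<^sup>2 * G) * indicator ?B2 z"
    proof (cases "z \<in> ?B2")
      case True
      then have "(norm z)\<^sup>2 \<le> (2 * R)\<^sup>2" by (intro power_mono) auto
      then have "(norm z)\<^sup>2 * G \<le> (2 * R)\<^sup>2 * G" by (intro mult_right_mono) (simp_all add: G_def)
      then have "ennreal ((norm z)\<^sup>2) * ennreal G \<le> ennreal ((2 * R)\<^sup>2 * G)"
        by (simp add: ennreal_mult[symmetric] G_def ennreal_leI)
      then show ?thesis using True nn_integral_difference_le[OF w, of z] unfolding G by simp
    qed simp
  qed
  also have "\<dots> = ennreal ((2 * R)\<^sup>2 * G) * emeasure lborel ?B2"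
    by (rule nn_integral_cmult_indicator) simp
  also have "\<dots> = ennreal (V (2 * R) * (2 * R)\<^sup>2 * G)"
    using V[of "2 * R"] R by (simp add: ennreal_mult[symmetric] G_def mult_ac)
  finally have "V (2 * R) * (2 * R)\<^sup>2 * A \<le> V (2 * R) * (2 * R)\<^sup>2 * G"
    using V(2)[of "2 * R"] R by (subst (asm) ennreal_le_iff) (auto simp: G_def intro!: mult_nonneg_nonneg)
  moreover have "V (2 * R) * (2 * R)\<^sup>2 * G < V (2 * R) * (2 * R)\<^sup>2 * A"
    using V(2)[of "2 * R"] R A unfolding G_def by (intro mult_strict_left_mono) auto
  ultimately show False by simp
qed

section \<open>Divergence free fields and smooth functions with square integrable gradient\<close>

lemma grad_eq_0_on_open:
  assumes "open S" "x \<in> S" "\<And>y. y \<in> S \<Longrightarrow> f y = c"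
  shows "grad f x = 0"
proof -
  have "((\<lambda>x. c) has_derivative (\<lambda>h. 0)) (at x)" by simp
  then have "(f has_derivative (\<lambda>h. 0)) (at x)"
    by (rule has_derivative_transform_within_open[OF _ assms(1,2)]) (simp add: assms(3))
  then show ?thesis by (intro grad_eqI) simp
qed

lemma cutoff_test_function: "(\<lambda>x. cutoff (c *\<^sub>R x)) \<in> test_functions UNIV" if "c > 0"
proof (rule test_functionsI)
  show "smooth (\<lambda>x. cutoff (c *\<^sub>R x))"
    using smooth_affine[OF smooth_cutoff, of c 0] by simp
  show "compact (cball (0::'a) (2 / c))" by simp
  show "cutoff (c *\<^sub>R x) = 0" if "x \<notin> cball (0::'a) (2 / c)" for x
    by (rule cutoff_eq_0) (use that \<open>c > 0\<close> in \<open>simp add: field_simps\<close>)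
qed simp

text \<open>The tests are \<open>\<eta> n\<close> times \<open>w - c n\<close>, with cutoffs on
  balls of radius \<open>R n\<close> and constants from the Poincare inequality on twice these
  balls. The factor \<open>1 / R n\<close> in the gradient of the cutoff cancels the growth of the
  Poincare constant, so the extra term is bounded in \<open>L2\<close>. It vanishes on the ball of
  radius \<open>R n\<close>, hence meets only the tail of \<open>h\<close>, which tends to 0. This
  works in every dimension.\<close>

lemma orthogonal_to_smooth_gradient:
  fixes h :: "'a::euclidean_space \<Rightarrow> 'a"
  assumes h: "h \<in> L2 UNIV"
    and orth: "\<And>\<phi>. \<phi> \<in> test_functions UNIV \<Longrightarrow> (LINT x|lebesgue. h x \<bullet> grad \<phi> x) = 0"
    and w: "smooth w" and g: "grad w \<in> L2 UNIV"
  shows "(LINT x|lebesgue. h x \<bullet> grad w x) = 0"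
proof -
  define R where "R n = real (Suc n)" for n
  have R: "R n > 0" for n by (simp add: R_def)
  \<comment> \<open>The added 1 supplies the strict inequality required by
    \<open>poincare_ball\<close>.\<close>
  define A where "A = (norm (abs_l2 (grad w)))\<^sup>2 + 1"
  have A: "A > 0" by (simp add: A_def add_nonneg_pos)
  define N :: real where "N = 2 ^ DIM('a)"
  have N: "N > 0" by (simp add: N_def)
  have "\<forall>n. \<exists>c. (\<integral>\<^sup>+x. indicator (ball 0 (2 * R n)) x * ennreal ((w x - c)\<^sup>2) \<partial>lborel)
      \<le> ennreal (N * (2 * (2 * R n))\<^sup>2 * A)"
    unfolding N_def by (intro allI poincare_ball[OF w g]) (use R in \<open>simp_all add: A_def\<close>)
  from choice[OF this] obtain c where c: "\<And>n. (\<integral>\<^sup>+x. indicator (ball 0 (2 * R n)) x * ennreal ((w x - c n)\<^sup>2) \<partial>lborel)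
      \<le> ennreal (N * (2 * (2 * R n))\<^sup>2 * A)" by auto
  define \<eta> :: "nat \<Rightarrow> 'a \<Rightarrow> real" where "\<eta> n x = cutoff ((1 / R n) *\<^sub>R x)" for n x
  have chi: "\<eta> n \<in> test_functions UNIV" for n
    unfolding \<eta>_def by (rule cutoff_test_function) (use R in simp)
  have chi_grad: "grad (\<eta> n) x = (1 / R n) *\<^sub>R grad cutoff ((1 / R n) *\<^sub>R x)" for n x
    using grad_affine[OF smooth_cutoff, of "1 / R n" 0 x] by (simp add: \<eta>_def[abs_def])
  have "(\<lambda>x::'a. cutoff (1 *\<^sub>R x)) \<in> test_functions UNIV" by (rule cutoff_test_function) simp
  then obtain L where L: "L > 0" "\<And>x::'a. norm (grad cutoff x) \<le> L"
    using test_functions_grad_bounded[of "cutoff :: 'a \<Rightarrow> real" UNIV] by auto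
  have chi_grad_le: "norm (grad (\<eta> n) x) \<le> L / R n" for n x
    unfolding chi_grad using L(2)[of "(1 / R n) *\<^sub>R x"] R[of n] by (simp add: field_simps)
  have chi_grad_in: "grad (\<eta> n) x = 0" if "x \<in> ball 0 (R n)" for n x
  proof (rule grad_eq_0_on_open[OF open_ball that])
    fix y assume "y \<in> ball (0::'a) (R n)"
    then show "\<eta> n y = 1" unfolding \<eta>_def using R[of n] by (intro cutoff_eq_1) (simp add: field_simps)
  qed
  have chi_grad_out: "grad (\<eta> n) x = 0" if "x \<notin> cball 0 (2 * R n)" for n x
  proof (rule grad_eq_0_on_open[of "- cball 0 (2 * R n)"])
    fix y assume "y \<in> - cball (0::'a) (2 * R n)"
    then show "\<eta> n y = 0" unfolding \<eta>_def using R[of n] by (intro cutoff_eq_0) (simp add: field_simps)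
  qed (use that in auto)
  define \<psi> where "\<psi> n x = \<eta> n x * (w x - c n)" for n x
  have wc: "smooth (\<lambda>x. w x - c n)" for n by (intro smooth_diff w smooth_const)
  have psi: "\<psi> n \<in> test_functions UNIV" for n
    unfolding \<psi>_def by (rule test_functions_mult[OF chi wc])
  have psi_grad: "grad (\<psi> n) x = \<eta> n x *\<^sub>R grad w x + (w x - c n) *\<^sub>R grad (\<eta> n) x" for n x
    unfolding \<psi>_def
    using grad_mult[OF test_functions_smooth[OF chi] wc, of n n x] grad_diff[OF w smooth_const, of "c n" x]
    by (simp add: grad_const)
  \<comment> \<open>\<open>a n\<close> is the tail of \<open>h\<close>, and \<open>b n\<close> is
    the term of the gradient of \<open>\<psi> n\<close> in which the cutoff is differentiated. As
    \<open>b n\<close> vanishes on the ball, pairing it with \<open>h\<close> or with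
    \<open>a n\<close> is the same.\<close>
  define a where "a n x = indicator (- ball 0 (R n)) x *\<^sub>R h x" for n x
  define b where "b n x = (w x - c n) *\<^sub>R grad (\<eta> n) x" for n x
  have a: "a n \<in> L2 UNIV" for n
  proof (rule L2_bound[OF h])
    show "a n \<in> borel_measurable lebesgue" unfolding a_def
      by (intro borel_measurable_scaleR borel_imp_lebesgue_measurable[of "indicator _"] L2_measurable[OF h]) simp
    show "AE x in lebesgue. norm (a n x) \<le> norm (h x)"
      by (rule AE_I2) (simp add: a_def indicator_def)
  qed
  have b: "b n \<in> L2 UNIV" for n
  proof -
    have "b n = (\<lambda>x. grad (\<psi> n) x - \<eta> n x *\<^sub>R grad w x)" by (simp add: fun_eq_iff b_def psi_grad)
    moreover have "(\<lambda>x. \<eta> n x *\<^sub>R grad w x) \<in> L2 UNIV"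
    proof (rule L2_bound[OF g])
      show "(\<lambda>x. \<eta> n x *\<^sub>R grad w x) \<in> borel_measurable lebesgue"
        by (intro borel_measurable_scaleR L2_measurable[OF g] borel_imp_lebesgue_measurable
            smooth_borel_measurable test_functions_smooth[OF chi])
      show "AE x in lebesgue. norm (\<eta> n x *\<^sub>R grad w x) \<le> norm (grad w x)"
        by (rule AE_I2) (simp add: \<eta>_def cutoff_nonneg cutoff_le_1 mult_left_le_one_le)
    qed
    ultimately show ?thesis using L2_diff[OF grad_test_function_L2[OF psi]] by simp
  qed
  have b_norm: "(norm (abs_l2 (b n)))\<^sup>2 \<le> 16 * L\<^sup>2 * N * A" for n
  proof -
    have "ennreal ((norm (abs_l2 (b n)))\<^sup>2) = (\<integral>\<^sup>+x. ennreal ((norm (b n x))\<^sup>2) \<partial>lborel)"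
      using ennreal_norm_abs_l2_square[OF b] unfolding nn_integral_completion .
    also have "\<dots> \<le> (\<integral>\<^sup>+x. ennreal ((L / R n)\<^sup>2) * (indicator (ball 0 (2 * R n)) x * ennreal ((w x - c n)\<^sup>2)) \<partial>lborel)"
    proof (rule nn_integral_mono_AE)
      \<comment> \<open>The Poincare estimate covers the open ball, while the gradient of the cutoff
        is known to vanish only off the closed one; the sphere between them is a null set.\<close>
      have "negligible (sphere (0::'a) (2 * R n))" by (rule negligible_sphere)
      then have "AE x in lebesgue. x \<notin> sphere (0::'a) (2 * R n)"
        unfolding negligible_iff_null_sets by (rule AE_not_in)
      then have "AE x in lborel. x \<notin> sphere (0::'a) (2 * R n)" unfolding AE_completion_iff .
      then show "AE x in lborel. ennreal ((norm (b n x))\<^sup>2)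
          \<le> ennreal ((L / R n)\<^sup>2) * (indicator (ball 0 (2 * R n)) x * ennreal ((w x - c n)\<^sup>2))"
      proof eventually_elim
        case (elim x)
        show ?case
        proof (cases "x \<in> ball 0 (2 * R n)")
          case True
          have "(norm (b n x))\<^sup>2 = (norm (grad (\<eta> n) x))\<^sup>2 * (w x - c n)\<^sup>2"
            by (simp add: b_def power_mult_distrib)
          also have "\<dots> \<le> (L / R n)\<^sup>2 * (w x - c n)\<^sup>2"
            by (intro mult_right_mono power_mono chi_grad_le) simp_all
          finally have "ennreal ((norm (b n x))\<^sup>2) \<le> ennreal ((L / R n)\<^sup>2 * (w x - c n)\<^sup>2)"
            by (rule ennreal_leI)
          then show ?thesis using True by (simp add: ennreal_mult)
        next
          case False
          then have "x \<notin> cball 0 (2 * R n)" using elim by (auto simp: sphere_def)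
          then show ?thesis using chi_grad_out[of x n] by (simp add: b_def)
        qed
      qed
    qed
    also have "\<dots> = ennreal ((L / R n)\<^sup>2) * (\<integral>\<^sup>+x. indicator (ball 0 (2 * R n)) x * ennreal ((w x - c n)\<^sup>2) \<partial>lborel)"
    proof (rule nn_integral_cmult)
      have [measurable]: "w \<in> borel_measurable borel" "ball (0::'a) (2 * R n) \<in> sets borel"
        using smooth_borel_measurable[OF w] by simp_all
      show "(\<lambda>x. indicator (ball 0 (2 * R n)) x * ennreal ((w x - c n)\<^sup>2)) \<in> borel_measurable lborel"
        by measurable
    qed
    also have "\<dots> \<le> ennreal ((L / R n)\<^sup>2) * ennreal (N * (2 * (2 * R n))\<^sup>2 * A)"
      by (intro mult_left_mono c) simp
    also have "\<dots> = ennreal ((L / R n)\<^sup>2 * (N * (2 * (2 * R n))\<^sup>2 * A))"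
      using N A by (simp add: ennreal_mult)
    \<comment> \<open>The Poincare inequality is used at radius \<open>2 * R n\<close>, so its
      constant contains the square of \<open>4 * R n\<close>; this leaves 16 and no dependence on
      \<open>n\<close>.\<close>
    also have "(L / R n)\<^sup>2 * (N * (2 * (2 * R n))\<^sup>2 * A) = 16 * L\<^sup>2 * N * A"
      using R[of n] by (simp add: power2_eq_square field_simps)
    finally show ?thesis
      by (subst (asm) ennreal_le_iff) (use N A in simp_all)
  qed
  have b_norm': "norm (abs_l2 (b n)) \<le> sqrt (16 * L\<^sup>2 * N * A)" for n
    using b_norm[of n] by (rule real_le_rsqrt)
  have R_lim: "eventually (\<lambda>n. norm x < R n) sequentially" for x :: 'a
  proof -
    obtain m where "norm x < real m" using reals_Archimedean2 by blast
    then have "norm x < R n" if "n \<ge> m" for n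
      using that unfolding R_def by linarith
    then show ?thesis by (rule eventually_sequentiallyI)
  qed
  have "(\<lambda>n. LINT x|lebesgue. (norm (a n x))\<^sup>2) \<longlonglongrightarrow> (LINT x::'a|lebesgue. 0::real)"
  proof (rule integral_dominated_convergence[where w = "\<lambda>x. (norm (h x))\<^sup>2"])
    show "integrable lebesgue (\<lambda>x. (norm (h x))\<^sup>2)" using h by (simp add: L2_UNIV_iff)
    show "(\<lambda>x. (norm (a n x))\<^sup>2) \<in> borel_measurable lebesgue" for n
      using L2_measurable[OF a, of n] by simp
    show "AE x in lebesgue. norm ((norm (a n x))\<^sup>2) \<le> (norm (h x))\<^sup>2" for n
      by (rule AE_I2) (simp add: a_def indicator_def)
    show "AE x in lebesgue. (\<lambda>n. (norm (a n x))\<^sup>2) \<longlonglongrightarrow> 0"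
    proof (rule AE_I2)
      fix x :: 'a
      have "eventually (\<lambda>n. (norm (a n x))\<^sup>2 = 0) sequentially"
        using R_lim[of x] by eventually_elim (simp add: a_def)
      then show "(\<lambda>n. (norm (a n x))\<^sup>2) \<longlonglongrightarrow> 0" by (rule tendsto_eventually)
    qed
  qed simp
  then have "(\<lambda>n. (norm (abs_l2 (a n)))\<^sup>2) \<longlonglongrightarrow> 0" by (simp add: norm_abs_l2_square[OF a])
  then have "(\<lambda>n. sqrt ((norm (abs_l2 (a n)))\<^sup>2)) \<longlonglongrightarrow> sqrt 0" by (rule tendsto_real_sqrt)
  then have a_lim: "(\<lambda>n. norm (abs_l2 (a n))) \<longlonglongrightarrow> 0" by simp
  have E_lim: "(\<lambda>n. LINT x|lebesgue. h x \<bullet> b n x) \<longlonglongrightarrow> 0"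
  proof (rule Lim_null_comparison)
    show "(\<lambda>n. norm (abs_l2 (a n)) * sqrt (16 * L\<^sup>2 * N * A)) \<longlonglongrightarrow> 0"
      using tendsto_mult[OF a_lim tendsto_const[of "sqrt (16 * L\<^sup>2 * N * A)"]] by simp
    have "norm (LINT x|lebesgue. h x \<bullet> b n x) \<le> norm (abs_l2 (a n)) * sqrt (16 * L\<^sup>2 * N * A)" for n
    proof -
      have "h x \<bullet> b n x = a n x \<bullet> b n x" for x
        using chi_grad_in[of x n] by (cases "x \<in> ball 0 (R n)") (simp_all add: a_def b_def)
      then have "(LINT x|lebesgue. h x \<bullet> b n x) = abs_l2 (a n) \<bullet> abs_l2 (b n)"
        by (simp add: inner_abs_l2[OF a b])
      also have "norm \<dots> \<le> norm (abs_l2 (a n)) * norm (abs_l2 (b n))"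
        by (simp add: Cauchy_Schwarz_ineq2)
      also have "\<dots> \<le> norm (abs_l2 (a n)) * sqrt (16 * L\<^sup>2 * N * A)"
        by (intro mult_left_mono b_norm') simp
      finally show ?thesis .
    qed
    then show "\<forall>\<^sub>F n in sequentially. norm (LINT x|lebesgue. h x \<bullet> b n x) \<le> norm (abs_l2 (a n)) * sqrt (16 * L\<^sup>2 * N * A)"
      by (intro always_eventually allI)
  qed
  have hg: "integrable lebesgue (\<lambda>x. h x \<bullet> grad w x)" by (rule L2_inner_integrable[OF h g])
  have main_lim: "(\<lambda>n. LINT x|lebesgue. \<eta> n x * (h x \<bullet> grad w x)) \<longlonglongrightarrow> (LINT x|lebesgue. h x \<bullet> grad w x)"
  proof (rule integral_dominated_convergence[where w = "\<lambda>x. \<bar>h x \<bullet> grad w x\<bar>"])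
    show "(\<lambda>x. h x \<bullet> grad w x) \<in> borel_measurable lebesgue" by (rule borel_measurable_integrable[OF hg])
    show "(\<lambda>x. \<eta> n x * (h x \<bullet> grad w x)) \<in> borel_measurable lebesgue" for n
      by (rule borel_measurable_times[OF borel_imp_lebesgue_measurable borel_measurable_integrable[OF hg]])
        (rule smooth_borel_measurable[OF test_functions_smooth[OF chi]])
    show "integrable lebesgue (\<lambda>x. \<bar>h x \<bullet> grad w x\<bar>)" using hg by simp
    show "AE x in lebesgue. norm (\<eta> n x * (h x \<bullet> grad w x)) \<le> \<bar>h x \<bullet> grad w x\<bar>" for n
      by (rule AE_I2) (simp add: \<eta>_def abs_mult cutoff_nonneg cutoff_le_1 mult_left_le_one_le)
    show "AE x in lebesgue. (\<lambda>n. \<eta> n x * (h x \<bullet> grad w x)) \<longlonglongrightarrow> h x \<bullet> grad w x"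
    proof (rule AE_I2)
      fix x :: 'a
      have "eventually (\<lambda>n. \<eta> n x * (h x \<bullet> grad w x) = h x \<bullet> grad w x) sequentially"
        using R_lim[of x]
      proof eventually_elim
        case (elim n)
        then have "\<eta> n x = 1" unfolding \<eta>_def using R[of n] by (intro cutoff_eq_1) (simp add: field_simps)
        then show ?case by simp
      qed
      then show "(\<lambda>n. \<eta> n x * (h x \<bullet> grad w x)) \<longlonglongrightarrow> h x \<bullet> grad w x" by (rule tendsto_eventually)
    qed
  qed
  have "(LINT x|lebesgue. \<eta> n x * (h x \<bullet> grad w x)) = - (LINT x|lebesgue. h x \<bullet> b n x)" for n
  proof -
    have i: "integrable lebesgue (\<lambda>x. h x \<bullet> b n x)" by (rule L2_inner_integrable[OF h b])
    have "0 = (LINT x|lebesgue. h x \<bullet> grad (\<psi> n) x)" using orth[OF psi] by simp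
    moreover have j: "integrable lebesgue (\<lambda>x. h x \<bullet> grad (\<psi> n) x)"
      by (rule L2_inner_integrable[OF h grad_test_function_L2[OF psi]])
    moreover have "\<eta> n x * (h x \<bullet> grad w x) = h x \<bullet> grad (\<psi> n) x - h x \<bullet> b n x" for x
      by (simp add: psi_grad b_def inner_add_right)
    ultimately show ?thesis using i by simp
  qed
  then have "(\<lambda>n. LINT x|lebesgue. \<eta> n x * (h x \<bullet> grad w x)) \<longlonglongrightarrow> - 0"
    using tendsto_minus[OF E_lim] by simp
  then show ?thesis using LIMSEQ_unique[OF main_lim] by simp
qed

section \<open>Convolution\<close>

text \<open>With the argument of \<open>u\<close> as the variable of integration, all derivatives
  fall on \<open>\<rho>\<close> and local integrability of \<open>u\<close> suffices.\<close>

definition conv :: "('a::euclidean_space \<Rightarrow> real) \<Rightarrow> ('a \<Rightarrow> real) \<Rightarrow> 'a \<Rightarrow> real" where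
  "conv \<rho> u x = (LINT y|lebesgue. \<rho> (x - y) * u y)"

lemma test_functions_reflect:
  assumes "\<rho> \<in> test_functions UNIV" shows "(\<lambda>y. \<rho> (x - y)) \<in> test_functions UNIV"
  using test_functions_affine[OF assms, of "-1" x] by simp

lemma frechet_derivative_reflect:
  assumes "\<rho> \<in> test_functions UNIV" "b \<in> Basis"
  shows "frechet_derivative (\<lambda>y. \<rho> (x - y)) (at y) b = - frechet_derivative \<rho> (at (x - y)) b"
  using grad_affine[OF test_functions_smooth[OF assms(1)], of "-1" x y]
    grad_inner_Basis[OF assms(2), of "\<lambda>y. \<rho> (x - y)" y] grad_inner_Basis[OF assms(2), of \<rho> "x - y"]
  by simp

lemma smooth_mean_value:
  assumes "smooth f"
  obtains s where "0 < s" "s < 1" "f (x + h) - f x = grad f (x + s *\<^sub>R h) \<bullet> h"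
proof -
  have "((\<lambda>t. f (x + t *\<^sub>R h)) has_real_derivative grad f (x + t *\<^sub>R h) \<bullet> h) (at t)" for t
  proof -
    have "((\<lambda>t. f (x + t *\<^sub>R h)) has_derivative (\<lambda>s. grad f (x + t *\<^sub>R h) \<bullet> (s *\<^sub>R h))) (at t)"
      by (rule has_derivative_compose[OF _ has_derivative_grad[OF smooth_differentiable[OF assms]]])
        (auto intro!: derivative_eq_intros)
    moreover have "(\<lambda>s. grad f (x + t *\<^sub>R h) \<bullet> (s *\<^sub>R h)) = (*) (grad f (x + t *\<^sub>R h) \<bullet> h)"
      by (simp add: fun_eq_iff)
    ultimately show ?thesis unfolding has_field_derivative_def by (simp only:)
  qed
  from MVT2[OF zero_less_one this] obtain s
    where "0 < s" "s < 1" "f (x + 1 *\<^sub>R h) - f (x + 0 *\<^sub>R h) = (1 - 0) * (grad f (x + s *\<^sub>R h) \<bullet> h)"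
    by auto
  then show thesis using that by simp
qed

text \<open>Partial derivatives of a test function are again test functions, so their gradients are
  bounded. Hence the gradient is globally Lipschitz, and the mean value theorem gives a remainder
  uniform in \<open>x\<close>.\<close>

lemma test_function_taylor:
  assumes \<rho>: "\<rho> \<in> test_functions UNIV"
  obtains M where "M > 0" "\<And>x h. \<bar>\<rho> (x + h) - \<rho> x - grad \<rho> x \<bullet> h\<bar> \<le> M * (norm h)\<^sup>2"
proof -
  note sm = test_functions_smooth[OF \<rho>]
  have "\<forall>b\<in>Basis. \<exists>m. \<forall>x. norm (grad (\<lambda>x. frechet_derivative \<rho> (at x) b) x) \<le> m"
  proof
    fix b :: 'a assume "b \<in> Basis"
    from test_functions_frechet_derivative[OF \<rho> this]
    show "\<exists>m. \<forall>x. norm (grad (\<lambda>x. frechet_derivative \<rho> (at x) b) x) \<le> m"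
      by (rule test_functions_grad_bounded) blast
  qed
  from bchoice[OF this] obtain m
    where m: "\<And>b x. b \<in> Basis \<Longrightarrow> norm (grad (\<lambda>x. frechet_derivative \<rho> (at x) b) x) \<le> m b" by auto
  define M where "M = (\<Sum>b\<in>Basis. m b) + 1"
  have m0: "0 \<le> m b" if "b \<in> Basis" for b
    using m[OF that, of 0] norm_ge_zero order_trans by blast
  have M: "M > 0" unfolding M_def using m0 by (simp add: add_nonneg_pos sum_nonneg)
  have lip: "norm (grad \<rho> (x + k) - grad \<rho> x) \<le> M * norm k" for x k
  proof -
    have "norm (grad \<rho> (x + k) - grad \<rho> x) \<le> (\<Sum>b\<in>Basis. \<bar>(grad \<rho> (x + k) - grad \<rho> x) \<bullet> b\<bar>)"
      by (rule norm_le_l1)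
    also have "\<dots> \<le> (\<Sum>b\<in>Basis. m b * norm k)"
    proof (rule sum_mono)
      fix b :: 'a assume b: "b \<in> Basis"
      obtain s where "frechet_derivative \<rho> (at (x + k)) b - frechet_derivative \<rho> (at x) b
          = grad (\<lambda>x. frechet_derivative \<rho> (at x) b) (x + s *\<^sub>R k) \<bullet> k"
        by (rule smooth_mean_value[OF smooth_frechet_derivative[OF sm b], of x k])
      then have "\<bar>(grad \<rho> (x + k) - grad \<rho> x) \<bullet> b\<bar>
          = \<bar>grad (\<lambda>x. frechet_derivative \<rho> (at x) b) (x + s *\<^sub>R k) \<bullet> k\<bar>"
        by (simp add: inner_diff_left grad_inner_Basis[OF b])
      also have "\<dots> \<le> norm (grad (\<lambda>x. frechet_derivative \<rho> (at x) b) (x + s *\<^sub>R k)) * norm k"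
        by (rule Cauchy_Schwarz_ineq2)
      also have "\<dots> \<le> m b * norm k" by (intro mult_right_mono m b) simp
      finally show "\<bar>(grad \<rho> (x + k) - grad \<rho> x) \<bullet> b\<bar> \<le> m b * norm k" .
    qed
    also have "\<dots> = (\<Sum>b\<in>Basis. m b) * norm k" by (simp add: sum_distrib_right)
    also have "\<dots> \<le> M * norm k" unfolding M_def by (intro mult_right_mono) simp_all
    finally show ?thesis .
  qed
  have "\<bar>\<rho> (x + h) - \<rho> x - grad \<rho> x \<bullet> h\<bar> \<le> M * (norm h)\<^sup>2" for x h
  proof -
    obtain s where s: "0 < s" "s < 1" "\<rho> (x + h) - \<rho> x = grad \<rho> (x + s *\<^sub>R h) \<bullet> h"
      by (rule smooth_mean_value[OF sm])
    have "\<bar>\<rho> (x + h) - \<rho> x - grad \<rho> x \<bullet> h\<bar> = \<bar>(grad \<rho> (x + s *\<^sub>R h) - grad \<rho> x) \<bullet> h\<bar>"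
      by (simp add: s(3) inner_diff_left)
    also have "\<dots> \<le> norm (grad \<rho> (x + s *\<^sub>R h) - grad \<rho> x) * norm h" by (rule Cauchy_Schwarz_ineq2)
    also have "\<dots> \<le> (M * norm (s *\<^sub>R h)) * norm h" by (intro mult_right_mono lip) simp
    also have "\<dots> \<le> M * norm h * norm h"
      using s M by (intro mult_right_mono mult_left_mono) (simp_all add: mult_left_le_one_le)
    finally show ?thesis by (simp add: power2_eq_square)
  qed
  then show thesis using that[OF M] by simp
qed

lemma conv_integrable:
  assumes "\<rho> \<in> test_functions UNIV" "\<And>K. compact K \<Longrightarrow> integrable (lebesgue_on K) u"
  shows "integrable lebesgue (\<lambda>y. \<rho> (x - y) * u y)"
  using integrable_test_mult[OF _ test_functions_reflect[OF assms(1), of x], of u] assms(2) by simp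

text \<open>The uniform quadratic remainder of \<open>\<rho>\<close> can be integrated against
  \<open>u\<close>, which bounds the remainder of the convolution by a multiple of the squared
  increment.\<close>

lemma conv_has_derivative:
  assumes \<rho>: "\<rho> \<in> test_functions UNIV" and u: "\<And>K. compact K \<Longrightarrow> integrable (lebesgue_on K) u"
  shows "(conv \<rho> u has_derivative
    (\<lambda>h. (\<Sum>b\<in>Basis. conv (\<lambda>x. frechet_derivative \<rho> (at x) b) u x *\<^sub>R b) \<bullet> h)) (at x)"
proof -
  let ?v = "\<Sum>b\<in>Basis. conv (\<lambda>x. frechet_derivative \<rho> (at x) b) u x *\<^sub>R b"
  obtain M where M: "M > 0" "\<And>x h. \<bar>\<rho> (x + h) - \<rho> x - grad \<rho> x \<bullet> h\<bar> \<le> M * (norm h)\<^sup>2"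
    using \<rho> by (rule test_function_taylor) (rule that)
  obtain K where K: "smooth \<rho>" "compact K" "\<And>x. x \<notin> K \<Longrightarrow> \<rho> x = 0" "\<And>x. x \<notin> K \<Longrightarrow> grad \<rho> x = 0"
    using \<rho> by (rule grad_test_function_support) (rule that)
  obtain B where B: "\<And>x. x \<in> K \<Longrightarrow> norm x \<le> B"
    using compact_imp_bounded[OF K(2)] by (auto simp: bounded_iff)
  \<comment> \<open>For increments shorter than 1 the three terms of the remainder vanish for
    \<open>z\<close> outside this ball, so only the integral of \<open>u\<close> over a fixed
    compact set enters.\<close>
  define C where "C = cball x (B + 1)"
  have Cl: "C \<in> sets lebesgue" by (simp add: C_def)
  have uC: "integrable lebesgue (\<lambda>z. indicator C z * \<bar>u z\<bar>)"
  proof -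
    have "compact C" by (simp add: C_def)
    from u[OF this] have "integrable lebesgue (\<lambda>z. norm (indicator C z *\<^sub>R u z))"
      unfolding integrable_lebesgue_on[OF Cl] by (rule integrable_norm)
    then show ?thesis by (simp add: abs_mult)
  qed
  define I where "I = (LINT z|lebesgue. indicator C z * \<bar>u z\<bar>)"
  have pd: "integrable lebesgue (\<lambda>z. frechet_derivative \<rho> (at (x - z)) b * u z)" if "b \<in> Basis" for b
    by (rule conv_integrable[OF test_functions_frechet_derivative[OF \<rho> that] u])
  have v_int: "integrable lebesgue (\<lambda>z. (grad \<rho> (x - z) \<bullet> h) * u z)"
    and v: "?v \<bullet> h = (LINT z|lebesgue. (grad \<rho> (x - z) \<bullet> h) * u z)" for h
  proof -
    have eq: "(grad \<rho> (x - z) \<bullet> h) * u z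
        = (\<Sum>b\<in>Basis. (b \<bullet> h) * (frechet_derivative \<rho> (at (x - z)) b * u z))" for z
      by (simp add: grad_def inner_sum_left sum_distrib_left mult_ac)
    show "integrable lebesgue (\<lambda>z. (grad \<rho> (x - z) \<bullet> h) * u z)"
      unfolding eq by (intro Bochner_Integration.integrable_sum integrable_mult_right pd)
    have "(LINT z|lebesgue. (grad \<rho> (x - z) \<bullet> h) * u z)
        = (\<Sum>b\<in>Basis. LINT z|lebesgue. (b \<bullet> h) * (frechet_derivative \<rho> (at (x - z)) b * u z))"
      unfolding eq by (intro Bochner_Integration.integral_sum integrable_mult_right pd)
    also have "\<dots> = (\<Sum>b\<in>Basis. (b \<bullet> h) * conv (\<lambda>x. frechet_derivative \<rho> (at x) b) u x)"
      by (rule sum.cong[OF refl]) (simp add: conv_def)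
    also have "\<dots> = ?v \<bullet> h" by (simp add: inner_sum_left mult.commute)
    finally show "?v \<bullet> h = (LINT z|lebesgue. (grad \<rho> (x - z) \<bullet> h) * u z)" ..
  qed
  have est: "norm (conv \<rho> u y - conv \<rho> u x - ?v \<bullet> (y - x)) \<le> M * I * (norm (y - x))\<^sup>2"
    if y: "dist y x < 1" for y
  proof -
    define h where "h = y - x"
    have h: "norm h < 1" "y = x + h" using y by (simp_all add: h_def dist_norm)
    have i: "integrable lebesgue (\<lambda>z. (\<rho> (y - z) - \<rho> (x - z) - grad \<rho> (x - z) \<bullet> h) * u z)"
      unfolding left_diff_distrib
      by (intro Bochner_Integration.integrable_diff conv_integrable[OF \<rho> u] v_int)
    have "conv \<rho> u y - conv \<rho> u x - ?v \<bullet> h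
        = (LINT z|lebesgue. (\<rho> (y - z) - \<rho> (x - z) - grad \<rho> (x - z) \<bullet> h) * u z)"
      unfolding v unfolding conv_def left_diff_distrib
      by (simp add: conv_integrable[OF \<rho> u] v_int)
    also have "norm \<dots> \<le> (LINT z|lebesgue. norm ((\<rho> (y - z) - \<rho> (x - z) - grad \<rho> (x - z) \<bullet> h) * u z))"
      by (rule integral_norm_bound)
    also have "\<dots> \<le> (LINT z|lebesgue. M * (norm h)\<^sup>2 * (indicator C z * \<bar>u z\<bar>))"
    proof (rule integral_mono[OF integrable_norm[OF i] integrable_mult_right[OF uC]])
      fix z
      show "norm ((\<rho> (y - z) - \<rho> (x - z) - grad \<rho> (x - z) \<bullet> h) * u z)
          \<le> M * (norm h)\<^sup>2 * (indicator C z * \<bar>u z\<bar>)"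
      proof (cases "z \<in> C")
        case True
        have "\<bar>\<rho> (x - z + h) - \<rho> (x - z) - grad \<rho> (x - z) \<bullet> h\<bar> * \<bar>u z\<bar> \<le> M * (norm h)\<^sup>2 * \<bar>u z\<bar>"
          by (intro mult_right_mono M) simp
        moreover have e: "x - z + h = y - z" by (simp add: h(2))
        ultimately have "\<bar>\<rho> (y - z) - \<rho> (x - z) - grad \<rho> (x - z) \<bullet> h\<bar> * \<bar>u z\<bar> \<le> M * (norm h)\<^sup>2 * \<bar>u z\<bar>"
          unfolding e by blast
        then show ?thesis using True by (simp add: abs_mult)
      next
        case False
        then have far: "norm (x - z) > B + 1" by (simp add: C_def dist_norm)
        then have "x - z \<notin> K" using B[of "x - z"] by auto
        moreover have "norm (x - z) \<le> norm (y - z) + norm h"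
          using norm_triangle_ineq4[of "y - z" h] by (simp add: h(2))
        then have "y - z \<notin> K" using far h(1) B[of "y - z"] by auto
        ultimately show ?thesis using False K(3,4) by simp
      qed
    qed
    also have "\<dots> = M * I * (norm h)\<^sup>2" by (simp add: I_def)
    finally show ?thesis unfolding h_def .
  qed
  show ?thesis
  proof (rule has_derivativeI_sandwich[of 1])
    show "bounded_linear (\<lambda>h. ?v \<bullet> h)" by (rule bounded_linear_inner_right)
    show "norm (conv \<rho> u y - conv \<rho> u x - ?v \<bullet> (y - x)) / norm (y - x) \<le> M * I * norm (y - x)"
      if "y \<noteq> x" "dist y x < 1" for y
    proof -
      have "norm (y - x) > 0" using that(1) by simp
      then show ?thesis
        using est[OF that(2)] unfolding power2_eq_square by (simp only: pos_divide_le_eq mult.assoc)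
    qed
    have "((\<lambda>y. M * I * norm (y - x)) \<longlongrightarrow> M * I * norm (x - x)) (at x)"
      by (intro tendsto_intros)
    then show "((\<lambda>y. M * I * norm (y - x)) \<longlongrightarrow> 0) (at x)" by simp
  qed simp
qed

text \<open>A partial derivative of a convolution is the convolution with the corresponding
  derivative of \<open>\<rho>\<close>; the induction therefore runs over all test functions at
  once.\<close>

lemma smooth_conv:
  assumes "\<rho> \<in> test_functions UNIV" and u: "\<And>K. compact K \<Longrightarrow> integrable (lebesgue_on K) u"
  shows "smooth (conv \<rho> u)"
proof -
  have "C_k k (conv \<rho> u)" if "\<rho> \<in> test_functions UNIV" for k \<rho>
    using that
  proof (induction k arbitrary: \<rho>)
    case 0
    have "isCont (conv \<rho> u) x" for x
      by (rule has_derivative_continuous[OF conv_has_derivative[OF 0 u]])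
    then show ?case by (simp add: continuous_at_imp_continuous_on)
  next
    case (Suc k)
    show ?case
    proof (rule C_k_SucI[OF conv_has_derivative[OF Suc(2) u]])
      fix b :: 'a assume b: "b \<in> Basis"
      have "(\<Sum>c\<in>Basis. conv (\<lambda>x. frechet_derivative \<rho> (at x) c) u x *\<^sub>R c) \<bullet> b
          = conv (\<lambda>x. frechet_derivative \<rho> (at x) b) u x" for x
        using b by (simp add: inner_sum_left inner_Basis if_distrib sum.delta cong: if_cong)
      then show "C_k k (\<lambda>x. (\<Sum>c\<in>Basis. conv (\<lambda>x. frechet_derivative \<rho> (at x) c) u x *\<^sub>R c) \<bullet> b)"
        using Suc(1)[OF test_functions_frechet_derivative[OF Suc(2) b]] by simp
    qed
  qed
  then show ?thesis using assms(1) by (simp add: smooth_def)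
qed

text \<open>For fixed \<open>x\<close>, the reflected function \<open>\<rho> (x - y)\<close> is a
  test function in \<open>y\<close>. The sign from the reflection cancels the one from the
  definition of the weak gradient.\<close>

lemma grad_conv:
  assumes \<rho>: "\<rho> \<in> test_functions UNIV" and u: "has_weak_gradient UNIV u g" and b: "b \<in> Basis"
  shows "grad (conv \<rho> u) x \<bullet> b = conv \<rho> (\<lambda>y. g y \<bullet> b) x"
proof -
  note ui = has_weak_gradientD(1)[OF u, simplified]
  have "grad (conv \<rho> u) x = (\<Sum>b\<in>Basis. conv (\<lambda>x. frechet_derivative \<rho> (at x) b) u x *\<^sub>R b)"
    by (rule grad_eqI[OF conv_has_derivative[OF \<rho> ui]])
  then have "grad (conv \<rho> u) x \<bullet> b = conv (\<lambda>x. frechet_derivative \<rho> (at x) b) u x"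
    using b by (simp add: inner_sum_left inner_Basis if_distrib sum.delta cong: if_cong)
  also have "\<dots> = - (LINT y|lebesgue. u y * frechet_derivative (\<lambda>y. \<rho> (x - y)) (at y) b)"
    unfolding conv_def frechet_derivative_reflect[OF \<rho> b] by (simp add: mult.commute)
  also have "\<dots> = (LINT y|lebesgue. (g y \<bullet> b) * \<rho> (x - y))"
    using has_weak_gradient_test[OF u open_UNIV test_functions_reflect[OF \<rho>] b, of x] by simp
  finally show ?thesis by (simp add: conv_def mult.commute)
qed

lemma L2_loc_integrable:
  assumes "f \<in> L2 UNIV" "compact K" shows "integrable (lebesgue_on K) f"
proof -
  have K: "K \<in> sets lebesgue" using assms(2) by (simp add: compact_imp_closed)
  show ?thesis
    by (rule L2_integrable_on_bounded[OF L2_subset[OF assms(1) K] K compact_imp_bounded[OF assms(2)]])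
qed

text \<open>A crude form of Young's inequality. Cauchy-Schwarz on the ball of radius
  \<open>r\<close> around \<open>x\<close> bounds the square pointwise by \<open>M^2 V\<close> times
  the integral of the squared \<open>g\<close> over that ball, and Tonelli contributes another
  factor \<open>V\<close>. The Borel assumption serves joint measurability.\<close>

lemma conv_L2:
  fixes g :: "'a::euclidean_space \<Rightarrow> real"
  assumes \<rho>: "\<rho> \<in> test_functions UNIV" and g: "g \<in> L2 UNIV" "g \<in> borel_measurable borel"
  shows "conv \<rho> g \<in> L2 UNIV"
proof (rule L2_of_nn_integral)
  have cs: "smooth (conv \<rho> g)" by (rule smooth_conv[OF \<rho>]) (rule L2_loc_integrable[OF g(1)])
  show "conv \<rho> g \<in> borel_measurable lebesgue"
    by (intro borel_imp_lebesgue_measurable smooth_borel_measurable cs)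
  obtain M where M: "M > 0" "\<And>x. \<bar>\<rho> x\<bar> \<le> M" using \<rho> by (rule test_functions_bounded) (rule that)
  obtain K where K: "compact K" "\<And>x. x \<notin> K \<Longrightarrow> \<rho> x = 0" using \<rho> by (rule test_functionsE) blast
  obtain r where r: "r > 0" "\<And>x. x \<in> K \<Longrightarrow> norm x \<le> r"
    using compact_imp_bounded[OF K(1)] by (auto simp: bounded_pos)
  define V where "V = unit_ball_vol (real DIM('a)) * r ^ DIM('a)"
  \<comment> \<open>Writing the ball through \<open>norm (x - y)\<close> keeps the kernel symmetric
    and jointly measurable in \<open>x\<close> and \<open>y\<close>.\<close>
  have V: "(\<integral>\<^sup>+y. indicator {..r} (norm (x - y)) \<partial>lborel) = ennreal V" for x :: 'a
  proof -
    have "(\<lambda>y. indicator {..r} (norm (x - y)) :: ennreal) = indicator (cball x r)"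
      by (auto simp: fun_eq_iff indicator_def dist_norm)
    then show ?thesis using emeasure_cball[of r x] r by (simp add: V_def)
  qed
  have V0: "V \<ge> 0" using r by (simp add: V_def)
  have pt: "ennreal ((norm (conv \<rho> g x))\<^sup>2)
      \<le> ennreal (M\<^sup>2 * V) * (\<integral>\<^sup>+y. indicator {..r} (norm (x - y)) * ennreal ((norm (g y))\<^sup>2) \<partial>lborel)" for x
  proof -
    define p where "p y = \<rho> (x - y)" for y
    define q where "q y = indicator {..r} (norm (x - y)) * g y" for y
    have p: "p \<in> L2 UNIV" unfolding p_def by (rule test_function_L2[OF test_functions_reflect[OF \<rho>]])
    have qm: "q \<in> borel_measurable borel" unfolding q_def using g(2) by measurable
    have q: "q \<in> L2 UNIV"
      by (rule L2_bound[OF g(1) borel_imp_lebesgue_measurable[OF qm]], rule AE_I2) (simp add: q_def indicator_def)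
    have pq: "p y * g y = p y \<bullet> q y" for y
      using K(2)[of "x - y"] r(2)[of "x - y"] by (cases "x - y \<in> K") (simp_all add: p_def q_def)
    have "conv \<rho> g x = (LINT y|lebesgue. p y * g y)" by (simp add: conv_def p_def)
    also have "\<dots> = abs_l2 p \<bullet> abs_l2 q" unfolding inner_abs_l2[OF p q] pq ..
    finally have "conv \<rho> g x = abs_l2 p \<bullet> abs_l2 q" .
    then have "norm (conv \<rho> g x) \<le> norm (abs_l2 p) * norm (abs_l2 q)"
      by (simp add: Cauchy_Schwarz_ineq2)
    then have "(norm (conv \<rho> g x))\<^sup>2 \<le> (norm (abs_l2 p))\<^sup>2 * (norm (abs_l2 q))\<^sup>2"
      unfolding power_mult_distrib[symmetric] by (rule power_mono) simp
    then have "ennreal ((norm (conv \<rho> g x))\<^sup>2) \<le> ennreal ((norm (abs_l2 p))\<^sup>2) * ennreal ((norm (abs_l2 q))\<^sup>2)"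
      by (simp add: ennreal_mult[symmetric] ennreal_leI)
    also have "\<dots> \<le> ennreal (M\<^sup>2 * V) * (\<integral>\<^sup>+y. indicator {..r} (norm (x - y)) * ennreal ((norm (g y))\<^sup>2) \<partial>lborel)"
    proof (rule mult_mono)
      have "ennreal ((norm (abs_l2 p))\<^sup>2) = (\<integral>\<^sup>+y. ennreal ((norm (p y))\<^sup>2) \<partial>lborel)"
        using ennreal_norm_abs_l2_square[OF p] unfolding nn_integral_completion .
      also have "\<dots> \<le> (\<integral>\<^sup>+y. ennreal (M\<^sup>2) * indicator {..r} (norm (x - y)) \<partial>lborel)"
      proof (rule nn_integral_mono)
        fix y
        have "(norm (p y))\<^sup>2 \<le> M\<^sup>2" by (rule power_mono) (simp_all add: p_def M)
        then show "ennreal ((norm (p y))\<^sup>2) \<le> ennreal (M\<^sup>2) * indicator {..r} (norm (x - y))"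
          using K(2)[of "x - y"] r(2)[of "x - y"]
          by (cases "x - y \<in> K") (simp_all add: p_def ennreal_leI)
      qed
      also have "\<dots> = ennreal (M\<^sup>2) * (\<integral>\<^sup>+y. indicator {..r} (norm (x - y)) \<partial>lborel)"
        by (rule nn_integral_cmult) measurable
      also have "\<dots> = ennreal (M\<^sup>2 * V)" unfolding V using V0 by (simp add: ennreal_mult)
      finally show "ennreal ((norm (abs_l2 p))\<^sup>2) \<le> ennreal (M\<^sup>2 * V)" .
      have "ennreal ((norm (abs_l2 q))\<^sup>2) = (\<integral>\<^sup>+y. ennreal ((norm (q y))\<^sup>2) \<partial>lborel)"
        using ennreal_norm_abs_l2_square[OF q] unfolding nn_integral_completion .
      also have "\<dots> = (\<integral>\<^sup>+y. indicator {..r} (norm (x - y)) * ennreal ((norm (g y))\<^sup>2) \<partial>lborel)"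
        by (rule nn_integral_cong) (simp add: q_def indicator_def)
      finally show "ennreal ((norm (abs_l2 q))\<^sup>2)
          \<le> (\<integral>\<^sup>+y. indicator {..r} (norm (x - y)) * ennreal ((norm (g y))\<^sup>2) \<partial>lborel)" by simp
    qed simp_all
    finally show ?thesis .
  qed
  have m: "(\<lambda>p. indicator {..r} (norm (fst p - snd p)) * ennreal ((norm (g (snd p)))\<^sup>2))
      \<in> borel_measurable (lborel \<Otimes>\<^sub>M lborel)"
  proof -
    have "(\<lambda>p. g (snd p)) \<in> borel_measurable (lborel \<Otimes>\<^sub>M (lborel :: 'a measure))"
      by (rule measurable_compose[OF _ g(2)]) simp
    then show ?thesis by measurable
  qed
  have "(\<integral>\<^sup>+x. ennreal ((norm (conv \<rho> g x))\<^sup>2) \<partial>lebesgue) = (\<integral>\<^sup>+x. ennreal ((norm (conv \<rho> g x))\<^sup>2) \<partial>lborel)"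
    by (rule nn_integral_completion)
  also have "\<dots> \<le> (\<integral>\<^sup>+x. ennreal (M\<^sup>2 * V) * (\<integral>\<^sup>+y. indicator {..r} (norm (x - y)) * ennreal ((norm (g y))\<^sup>2) \<partial>lborel) \<partial>lborel)"
    by (intro nn_integral_mono pt)
  also have "\<dots> = ennreal (M\<^sup>2 * V) * (\<integral>\<^sup>+x. \<integral>\<^sup>+y. indicator {..r} (norm (x - y)) * ennreal ((norm (g y))\<^sup>2) \<partial>lborel \<partial>lborel)"
    by (rule nn_integral_cmult) (use lborel.borel_measurable_nn_integral_fst[OF m] in simp)
  also have "\<dots> = ennreal (M\<^sup>2 * V) * (\<integral>\<^sup>+y. \<integral>\<^sup>+x. indicator {..r} (norm (x - y)) * ennreal ((norm (g y))\<^sup>2) \<partial>lborel \<partial>lborel)"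
    using lborel_pair.Fubini[OF m] by simp
  also have "(\<integral>\<^sup>+y. \<integral>\<^sup>+x. indicator {..r} (norm (x - y)) * ennreal ((norm (g y))\<^sup>2) \<partial>lborel \<partial>lborel)
      = (\<integral>\<^sup>+y. ennreal V * ennreal ((norm (g y))\<^sup>2) \<partial>lborel)"
  proof (rule nn_integral_cong)
    fix y
    have "(\<integral>\<^sup>+x. indicator {..r} (norm (x - y)) * ennreal ((norm (g y))\<^sup>2) \<partial>lborel)
        = (\<integral>\<^sup>+x. indicator {..r} (norm (y - x)) \<partial>lborel) * ennreal ((norm (g y))\<^sup>2)"
      by (subst nn_integral_multc) (simp_all add: norm_minus_commute)
    then show "(\<integral>\<^sup>+x. indicator {..r} (norm (x - y)) * ennreal ((norm (g y))\<^sup>2) \<partial>lborel)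
        = ennreal V * ennreal ((norm (g y))\<^sup>2)" by (simp add: V)
  qed
  also have "(\<integral>\<^sup>+y. ennreal V * ennreal ((norm (g y))\<^sup>2) \<partial>lborel) = ennreal V * ennreal ((norm (abs_l2 g))\<^sup>2)"
    unfolding ennreal_norm_abs_l2_square[OF g(1)] nn_integral_completion
    by (rule nn_integral_cmult) (use g(2) in measurable)
  also have "ennreal (M\<^sup>2 * V) * (ennreal V * ennreal ((norm (abs_l2 g))\<^sup>2)) < \<infinity>"
    by (simp add: ennreal_mult_less_top)
  finally show "(\<integral>\<^sup>+x. ennreal ((norm (conv \<rho> g x))\<^sup>2) \<partial>lebesgue) < \<infinity>" .
qed

section \<open>Translations\<close>

lemma L2_nn_integral_lborel:
  assumes "f \<in> borel_measurable borel" "(\<integral>\<^sup>+x. ennreal ((norm (f x))\<^sup>2) \<partial>lborel) < \<infinity>"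
  shows "f \<in> L2 UNIV"
  by (rule L2_of_nn_integral[OF borel_imp_lebesgue_measurable[OF assms(1)]])
    (use assms(2) in \<open>simp add: nn_integral_completion\<close>)

lemma norm_abs_l2_lborel:
  "f \<in> L2 UNIV \<Longrightarrow> ennreal ((norm (abs_l2 f))\<^sup>2) = (\<integral>\<^sup>+x. ennreal ((norm (f x))\<^sup>2) \<partial>lborel)"
  by (simp add: ennreal_norm_abs_l2_square nn_integral_completion)

lemma L2_translation:
  fixes g :: "'a::euclidean_space \<Rightarrow> real"
  assumes g: "g \<in> L2 UNIV" "g \<in> borel_measurable borel"
  shows "(\<lambda>x. g (z + x)) \<in> L2 UNIV" "(\<lambda>x. g (z + x)) \<in> borel_measurable borel"
    "norm (abs_l2 (\<lambda>x. g (z + x))) = norm (abs_l2 g)"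
proof -
  show m: "(\<lambda>x. g (z + x)) \<in> borel_measurable borel"
    by (rule measurable_compose[OF _ g(2)]) simp
  have "(\<lambda>x. ennreal ((norm (g x))\<^sup>2)) \<in> borel_measurable borel" using g(2) by measurable
  note tr = nn_integral_lborel_translation[OF this, of z]
  show L: "(\<lambda>x. g (z + x)) \<in> L2 UNIV"
    by (rule L2_nn_integral_lborel[OF m]) (simp only: tr norm_abs_l2_lborel[OF g(1), symmetric], simp)
  have "ennreal ((norm (abs_l2 (\<lambda>x. g (z + x))))\<^sup>2) = ennreal ((norm (abs_l2 g))\<^sup>2)"
    unfolding norm_abs_l2_lborel[OF g(1)] norm_abs_l2_lborel[OF L] by (rule tr)
  then have "(norm (abs_l2 (\<lambda>x. g (z + x))))\<^sup>2 = (norm (abs_l2 g))\<^sup>2"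
    by (subst (asm) ennreal_inj) simp_all
  then show "norm (abs_l2 (\<lambda>x. g (z + x))) = norm (abs_l2 g)"
    by (rule power2_eq_imp_eq) simp_all
qed

text \<open>By the fundamental lemma only the zero class is orthogonal to all test
  functions.\<close>

lemma test_functions_dense_L2:
  "closure (abs_l2 ` test_functions UNIV) = (UNIV :: ('a::euclidean_space, real) l2 set)"
proof (rule dense_subspaceI)
  show "subspace (abs_l2 ` test_functions UNIV :: ('a, real) l2 set)"
  proof (rule subspaceI)
    show "0 \<in> abs_l2 ` (test_functions UNIV :: ('a \<Rightarrow> real) set)"
      unfolding zero_abs_l2 by (rule imageI[OF test_functions_zero])
  next
    fix F G :: "('a, real) l2"
    assume "F \<in> abs_l2 ` test_functions UNIV" "G \<in> abs_l2 ` test_functions UNIV"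
    then obtain \<phi> \<psi> where *: "\<phi> \<in> test_functions UNIV" "F = abs_l2 \<phi>" "\<psi> \<in> test_functions UNIV" "G = abs_l2 \<psi>"
      by auto
    then have "F + G = abs_l2 (\<lambda>x. \<phi> x + \<psi> x)" by (simp add: add_abs_l2 test_function_L2)
    then show "F + G \<in> abs_l2 ` test_functions UNIV"
      using test_functions_add[OF *(1,3)] by simp
  next
    fix F :: "('a, real) l2" and c :: real
    assume "F \<in> abs_l2 ` test_functions UNIV"
    then obtain \<phi> where *: "\<phi> \<in> test_functions UNIV" "F = abs_l2 \<phi>" by auto
    then have "c *\<^sub>R F = abs_l2 (\<lambda>x. c * \<phi> x)" by (simp add: scaleR_abs_l2 test_function_L2)
    then show "c *\<^sub>R F \<in> abs_l2 ` test_functions UNIV"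
      using test_functions_cmult[OF *(1), of c] by simp
  qed
next
  fix F :: "('a, real) l2"
  assume orth: "\<And>s. s \<in> abs_l2 ` test_functions UNIV \<Longrightarrow> F \<bullet> s = 0"
  define f where "f = rep_l2 F"
  have f: "f \<in> L2 UNIV" "F = abs_l2 f" by (simp_all add: f_def rep_l2_L2 abs_rep_l2)
  have "AE x in lebesgue_on UNIV. f x = 0"
  proof (rule fundamental_lemma[OF open_UNIV L2_loc_integrable[OF f(1)]])
    fix \<phi> :: "'a \<Rightarrow> real" assume \<phi>: "\<phi> \<in> test_functions UNIV"
    then have "F \<bullet> abs_l2 \<phi> = 0" by (intro orth) simp
    then show "(LINT x|lebesgue_on UNIV. f x * \<phi> x) = 0"
      unfolding f(2) inner_abs_l2[OF f(1) test_function_L2[OF \<phi>]] by (simp add: lebesgue_on_UNIV_eq)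
  qed
  then have "AE x in lebesgue. f x = 0" unfolding lebesgue_on_UNIV_eq .
  then show "F = 0"
    unfolding f(2) zero_abs_l2 by (subst abs_l2_eq_iff) (simp_all add: f(1) L2_zero)
qed

text \<open>A test function moves under translation by at most \<open>norm z\<close> times the norm
  of its gradient. Translation is an isometry, so the error of approximating \<open>g\<close> by a
  test function is the same before and after.\<close>

lemma L2_translation_continuous:
  fixes g :: "'a::euclidean_space \<Rightarrow> real"
  assumes g: "g \<in> L2 UNIV" "g \<in> borel_measurable borel"
  shows "((\<lambda>z. abs_l2 (\<lambda>x. g (z + x))) \<longlongrightarrow> abs_l2 g) (at 0)"
proof (rule tendstoI)
  fix e :: real assume e: "e > 0"
  have "abs_l2 g \<in> closure (abs_l2 ` test_functions UNIV)"
    unfolding test_functions_dense_L2 by simp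
  then have "\<forall>e>0. \<exists>y\<in>abs_l2 ` test_functions UNIV. dist y (abs_l2 g) < e"
    unfolding closure_approachable .
  moreover have "e / 3 > 0" using e by simp
  ultimately have "\<exists>y\<in>abs_l2 ` test_functions UNIV. dist y (abs_l2 g) < e / 3" by blast
  then obtain \<phi> where \<phi>: "\<phi> \<in> test_functions UNIV" "dist (abs_l2 \<phi>) (abs_l2 g) < e / 3"
    by auto
  note \<phi>L = test_function_L2[OF \<phi>(1)]
  note \<phi>s = test_functions_smooth[OF \<phi>(1)]
  note \<phi>b = smooth_borel_measurable[OF \<phi>s]
  define G where "G = norm (abs_l2 (grad \<phi>))"
  have b1: "norm (abs_l2 (\<lambda>x. \<phi> (z + x)) - abs_l2 \<phi>) \<le> norm z * G" for z
  proof (rule power2_le_imp_le)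
    have d: "(\<lambda>x. \<phi> (z + x) - \<phi> x) \<in> L2 UNIV" by (rule L2_diff[OF L2_translation(1)[OF \<phi>L \<phi>b] \<phi>L])
    have "ennreal ((norm (abs_l2 (\<lambda>x. \<phi> (z + x)) - abs_l2 \<phi>))\<^sup>2) = (\<integral>\<^sup>+x. ennreal ((\<phi> (z + x) - \<phi> x)\<^sup>2) \<partial>lborel)"
      unfolding diff_abs_l2[OF L2_translation(1)[OF \<phi>L \<phi>b] \<phi>L] norm_abs_l2_lborel[OF d] by simp
    also have "\<dots> \<le> ennreal ((norm z)\<^sup>2) * (\<integral>\<^sup>+x. ennreal ((norm (grad \<phi> x))\<^sup>2) \<partial>lborel)"
      by (rule nn_integral_difference_le[OF \<phi>s])
    also have "\<dots> = ennreal ((norm z * G)\<^sup>2)"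
      unfolding norm_abs_l2_lborel[OF grad_test_function_L2[OF \<phi>(1)], symmetric] G_def
      by (simp add: ennreal_mult power_mult_distrib)
    finally show "(norm (abs_l2 (\<lambda>x. \<phi> (z + x)) - abs_l2 \<phi>))\<^sup>2 \<le> (norm z * G)\<^sup>2" by simp
  qed (simp add: G_def)
  have b2: "norm (abs_l2 (\<lambda>x. g (z + x)) - abs_l2 (\<lambda>x. \<phi> (z + x))) = norm (abs_l2 g - abs_l2 \<phi>)" for z
    unfolding diff_abs_l2[OF L2_translation(1)[OF g] L2_translation(1)[OF \<phi>L \<phi>b]] diff_abs_l2[OF g(1) \<phi>L]
    by (rule L2_translation(3)[OF L2_diff[OF g(1) \<phi>L] borel_measurable_diff[OF g(2) \<phi>b]])
  have b3: "norm (abs_l2 (\<lambda>x. g (z + x)) - abs_l2 g)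
      \<le> norm (abs_l2 (\<lambda>x. g (z + x)) - abs_l2 (\<lambda>x. \<phi> (z + x)))
        + norm (abs_l2 (\<lambda>x. \<phi> (z + x)) - abs_l2 \<phi>) + norm (abs_l2 \<phi> - abs_l2 g)" for z
    using norm_triangle_ineq[of "abs_l2 (\<lambda>x. g (z + x)) - abs_l2 (\<lambda>x. \<phi> (z + x))" "abs_l2 (\<lambda>x. \<phi> (z + x)) - abs_l2 \<phi>"]
      norm_triangle_ineq[of "abs_l2 (\<lambda>x. g (z + x)) - abs_l2 \<phi>" "abs_l2 \<phi> - abs_l2 g"]
    by simp
  have bound: "norm (abs_l2 (\<lambda>x. g (z + x)) - abs_l2 g) \<le> 2 * (e / 3) + norm z * G" for z
    using \<phi>(2) norm_minus_commute[of "abs_l2 g" "abs_l2 \<phi>"] b1[of z] b2[of z] b3[of z]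
    unfolding dist_norm by linarith
  have "((\<lambda>z::'a. norm z * G) \<longlongrightarrow> norm (0::'a) * G) (at 0)" by (intro tendsto_intros)
  then have "((\<lambda>z::'a. norm z * G) \<longlongrightarrow> 0) (at 0)" by simp
  then have "eventually (\<lambda>z::'a. norm z * G < e / 3) (at 0)"
    by (rule order_tendstoD) (use e in simp)
  then show "eventually (\<lambda>z. dist (abs_l2 (\<lambda>x. g (z + x))) (abs_l2 g) < e) (at 0)"
  proof eventually_elim
    case (elim z)
    then show ?case using bound[of z] unfolding dist_norm by linarith
  qed
qed

text \<open>By Cauchy-Schwarz and translation invariance the inner integral of absolute values is
  bounded uniformly in \<open>z\<close>, and \<open>\<sigma>\<close> is integrable; this gives
  integrability on the product space.\<close>

lemma correlation_Fubini:
  fixes g h \<sigma> :: "'a::euclidean_space \<Rightarrow> real"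
  assumes h: "h \<in> L2 UNIV" "h \<in> borel_measurable borel"
    and g: "g \<in> L2 UNIV" "g \<in> borel_measurable borel"
    and \<sigma>: "\<sigma> \<in> test_functions UNIV"
  shows "(LINT x|lborel. h x * (LINT z|lborel. \<sigma> z * g (z + x)))
    = (LINT z|lborel. \<sigma> z * (LINT x|lborel. h x * g (z + x)))"
proof -
  note \<sigma>b = smooth_borel_measurable[OF test_functions_smooth[OF \<sigma>]]
  have m: "(\<lambda>(x, z). h x * (\<sigma> z * g (z + x))) \<in> borel_measurable (lborel \<Otimes>\<^sub>M lborel)"
  proof -
    have "(\<lambda>p. snd p + fst p) \<in> borel_measurable (lborel \<Otimes>\<^sub>M (lborel :: 'a measure))" by measurable
    then have "(\<lambda>p. g (snd p + fst p)) \<in> borel_measurable (lborel \<Otimes>\<^sub>M lborel)"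
      by (rule measurable_compose[OF _ g(2)])
    moreover have "(\<lambda>p. h (fst p)) \<in> borel_measurable (lborel \<Otimes>\<^sub>M (lborel :: 'a measure))"
      by (rule measurable_compose[OF _ h(2)]) simp
    moreover have "(\<lambda>p. \<sigma> (snd p)) \<in> borel_measurable ((lborel :: 'a measure) \<Otimes>\<^sub>M lborel)"
      by (rule measurable_compose[OF _ \<sigma>b]) simp
    ultimately show ?thesis unfolding case_prod_beta by measurable
  qed
  have "integrable (lborel \<Otimes>\<^sub>M lborel) (\<lambda>(x, z). h x * (\<sigma> z * g (z + x)))"
  proof (rule integrableI_bounded[OF m])
    have mn: "(\<lambda>p. ennreal (norm (case p of (x, z) \<Rightarrow> h x * (\<sigma> z * g (z + x))))) \<in> borel_measurable (lborel \<Otimes>\<^sub>M lborel)"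
      using m by measurable
    have "(\<integral>\<^sup>+p. ennreal (norm (case p of (x, z) \<Rightarrow> h x * (\<sigma> z * g (z + x)))) \<partial>(lborel \<Otimes>\<^sub>M lborel))
        = (\<integral>\<^sup>+z. \<integral>\<^sup>+x. ennreal (norm (h x * (\<sigma> z * g (z + x)))) \<partial>lborel \<partial>lborel)"
      using lborel_pair.nn_integral_snd[OF mn] by simp
    also have "\<dots> \<le> (\<integral>\<^sup>+z. ennreal \<bar>\<sigma> z\<bar> * ennreal (norm (abs_l2 (\<lambda>x. \<bar>h x\<bar>)) * norm (abs_l2 (\<lambda>x. \<bar>g x\<bar>))) \<partial>lborel)"
    proof (rule nn_integral_mono)
      fix z
      have ha: "(\<lambda>x. \<bar>h x\<bar>) \<in> L2 UNIV"
        by (rule L2_bound[OF h(1)]) (use borel_imp_lebesgue_measurable[OF h(2)] in simp_all)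
      have ga: "(\<lambda>x. \<bar>g x\<bar>) \<in> L2 UNIV"
        by (rule L2_bound[OF g(1)]) (use borel_imp_lebesgue_measurable[OF g(2)] in simp_all)
      have gab: "(\<lambda>x. \<bar>g x\<bar>) \<in> borel_measurable borel" using g(2) by simp
      note t = L2_translation[OF ga gab, of z]
      have "(\<integral>\<^sup>+x. ennreal (norm (h x * (\<sigma> z * g (z + x)))) \<partial>lborel)
          = (\<integral>\<^sup>+x. ennreal \<bar>\<sigma> z\<bar> * ennreal (\<bar>h x\<bar> \<bullet> \<bar>g (z + x)\<bar>) \<partial>lborel)"
        by (rule nn_integral_cong) (simp add: abs_mult ennreal_mult[symmetric] mult_ac)
      also have "\<dots> = ennreal \<bar>\<sigma> z\<bar> * (\<integral>\<^sup>+x. ennreal (\<bar>h x\<bar> \<bullet> \<bar>g (z + x)\<bar>) \<partial>lborel)"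
        by (rule nn_integral_cmult) (use h(2) t(2) in measurable)
      also have "(\<integral>\<^sup>+x. ennreal (\<bar>h x\<bar> \<bullet> \<bar>g (z + x)\<bar>) \<partial>lborel)
          = ennreal (LINT x|lebesgue. \<bar>h x\<bar> \<bullet> \<bar>g (z + x)\<bar>)"
        using nn_integral_eq_integral[OF L2_inner_integrable[OF ha t(1)]] by (simp add: nn_integral_completion)
      also have "\<dots> \<le> ennreal (norm (abs_l2 (\<lambda>x. \<bar>h x\<bar>)) * norm (abs_l2 (\<lambda>x. \<bar>g x\<bar>)))"
        using norm_cauchy_schwarz[of "abs_l2 (\<lambda>x. \<bar>h x\<bar>)" "abs_l2 (\<lambda>x. \<bar>g (z + x)\<bar>)"]
        unfolding inner_abs_l2[OF ha t(1)] t(3) by (rule ennreal_leI)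
      finally show "(\<integral>\<^sup>+x. ennreal (norm (h x * (\<sigma> z * g (z + x)))) \<partial>lborel)
          \<le> ennreal \<bar>\<sigma> z\<bar> * ennreal (norm (abs_l2 (\<lambda>x. \<bar>h x\<bar>)) * norm (abs_l2 (\<lambda>x. \<bar>g x\<bar>)))"
        by (auto simp: mult_left_mono)
    qed
    also have "\<dots> = (\<integral>\<^sup>+z. ennreal \<bar>\<sigma> z\<bar> \<partial>lborel) * ennreal (norm (abs_l2 (\<lambda>x. \<bar>h x\<bar>)) * norm (abs_l2 (\<lambda>x. \<bar>g x\<bar>)))"
      by (rule nn_integral_multc) (use \<sigma>b in measurable)
    also have "\<dots> < \<infinity>"
    proof -
      obtain K where K: "smooth \<sigma>" "compact K" "\<And>x. x \<notin> K \<Longrightarrow> \<sigma> x = 0" using \<sigma> by (rule test_functionsE) blast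
      have "integrable lebesgue \<sigma>"
        by (rule integrable_lebesgue_compact_support[OF smooth_continuous_on[OF K(1)] K(2,3)])
      then have "(\<integral>\<^sup>+z. ennreal \<bar>\<sigma> z\<bar> \<partial>lborel) < \<infinity>"
        by (simp add: integrable_iff_bounded nn_integral_completion)
      then show ?thesis by (simp add: ennreal_mult_less_top)
    qed
    finally show "(\<integral>\<^sup>+p. ennreal (norm (case p of (x, z) \<Rightarrow> h x * (\<sigma> z * g (z + x)))) \<partial>(lborel \<Otimes>\<^sub>M lborel)) < \<infinity>" .
  qed
  from lborel_pair.Fubini_integral[OF this]
  have "(LINT z|lborel. LINT x|lborel. h x * (\<sigma> z * g (z + x))) = (LINT x|lborel. LINT z|lborel. h x * (\<sigma> z * g (z + x)))" .
  moreover have "(LINT x|lborel. h x * (\<sigma> z * g (z + x))) = \<sigma> z * (LINT x|lborel. h x * g (z + x))" for z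
    by (simp add: mult.left_commute[of _ "\<sigma> z"])
  ultimately show ?thesis by simp
qed

lemma L2_componentwise:
  fixes f :: "'a::euclidean_space \<Rightarrow> 'b::euclidean_space"
  assumes "\<And>b. b \<in> Basis \<Longrightarrow> (\<lambda>x. f x \<bullet> b) \<in> L2 UNIV"
  shows "f \<in> L2 UNIV"
proof -
  have "f \<in> borel_measurable lebesgue"
    by (subst borel_measurable_euclidean_space) (use assms L2_measurable in blast)
  moreover have "integrable lebesgue (\<lambda>x. \<Sum>b\<in>Basis. (norm (f x \<bullet> b))\<^sup>2)"
    by (intro Bochner_Integration.integrable_sum) (use assms in \<open>simp add: L2_UNIV_iff\<close>)
  moreover have "(\<Sum>b\<in>Basis. (norm (f x \<bullet> b))\<^sup>2) = (norm (f x))\<^sup>2" for x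
    unfolding power2_norm_eq_inner[of "f x"] euclidean_inner[of "f x" "f x"] by (simp add: power2_eq_square)
  ultimately show ?thesis by (simp add: L2_UNIV_iff)
qed

lemma L2_component:
  fixes f :: "'a::euclidean_space \<Rightarrow> 'b::euclidean_space"
  assumes "f \<in> L2 UNIV" "b \<in> Basis" shows "(\<lambda>x. f x \<bullet> b) \<in> L2 UNIV"
proof (rule L2_bound[OF assms(1)])
  show "(\<lambda>x. f x \<bullet> b) \<in> borel_measurable lebesgue" using L2_measurable[OF assms(1)] by simp
  show "AE x in lebesgue. norm (f x \<bullet> b) \<le> norm (f x)"
    by (rule AE_I2) (use assms(2) in \<open>simp add: Basis_le_norm\<close>)
qed

text \<open>The mollified function has a gradient to which the previous results apply. The conclusion then
  says that the correlation of the two fields vanishes as a distribution; it is also continuous at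
  the origin, where its value is the claimed integral.\<close>

lemma orthogonal_to_weak_gradient:
  fixes h :: "'a::euclidean_space \<Rightarrow> 'a"
  assumes h: "h \<in> L2 UNIV"
    and orth: "\<And>\<phi>. \<phi> \<in> test_functions UNIV \<Longrightarrow> (LINT x|lebesgue. h x \<bullet> grad \<phi> x) = 0"
    and u: "has_weak_gradient UNIV u g" and g: "g \<in> L2 UNIV"
  shows "(LINT x|lebesgue. h x \<bullet> g x) = 0"
proof -
  \<comment> \<open>Borel representatives are needed because the correlation \<open>\<Phi>\<close>
    mixes two variables and its measurability is a statement on the product space.\<close>
  obtain h' where h'b: "h' \<in> borel_measurable borel" and h': "AE x in lebesgue. h x = h' x"
    using lebesgue_ex_borel[OF L2_measurable[OF h]] .
  obtain g' where g'b: "g' \<in> borel_measurable borel" and g': "AE x in lebesgue. g x = g' x"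
    using lebesgue_ex_borel[OF L2_measurable[OF g]] .
  have h'L: "h' \<in> L2 UNIV" by (rule L2_cong_AE[OF h borel_imp_lebesgue_measurable[OF h'b] h'])
  have g'L: "g' \<in> L2 UNIV" by (rule L2_cong_AE[OF g borel_imp_lebesgue_measurable[OF g'b] g'])
  have hc: "(\<lambda>x. h' x \<bullet> b) \<in> L2 UNIV" "(\<lambda>x. h' x \<bullet> b) \<in> borel_measurable borel"
    and gc: "(\<lambda>x. g' x \<bullet> b) \<in> L2 UNIV" "(\<lambda>x. g' x \<bullet> b) \<in> borel_measurable borel" if "b \<in> Basis" for b
    using L2_component[OF h'L that] L2_component[OF g'L that] h'b g'b by simp_all
  have h'h: "(LINT x|lebesgue. h x \<bullet> k x) = (\<Sum>b\<in>Basis. LINT x|lebesgue. (h' x \<bullet> b) * (k x \<bullet> b))"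
    if k: "k \<in> L2 UNIV" for k :: "'a \<Rightarrow> 'a"
  proof -
    have "(LINT x|lebesgue. h x \<bullet> k x) = (LINT x|lebesgue. h' x \<bullet> k x)"
    proof (rule integral_cong_AE)
      show "AE x in lebesgue. h x \<bullet> k x = h' x \<bullet> k x" using h' by eventually_elim simp
    qed (intro borel_measurable_inner L2_measurable h h'L k)+
    also have "\<dots> = (LINT x|lebesgue. (\<Sum>b\<in>Basis. (h' x \<bullet> b) * (k x \<bullet> b)))"
      by (rule Bochner_Integration.integral_cong[OF refl euclidean_inner])
    also have "\<dots> = (\<Sum>b\<in>Basis. LINT x|lebesgue. (h' x \<bullet> b) * (k x \<bullet> b))"
    proof (rule Bochner_Integration.integral_sum)
      fix b :: 'a assume b: "b \<in> Basis"
      show "integrable lebesgue (\<lambda>x. (h' x \<bullet> b) * (k x \<bullet> b))"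
        using L2_inner_integrable[OF hc(1)[OF b] L2_component[OF k b]] by simp
    qed
    finally show ?thesis .
  qed
  define \<Phi> where "\<Phi> z = (\<Sum>b\<in>Basis. LINT x|lborel. (h' x \<bullet> b) * (g' (z + x) \<bullet> b))" for z
  have cor: "(LINT x|lborel. (h' x \<bullet> b) * (g' (z + x) \<bullet> b))
      = abs_l2 (\<lambda>x. h' x \<bullet> b) \<bullet> abs_l2 (\<lambda>x. g' (z + x) \<bullet> b)" if b: "b \<in> Basis" for b z
    unfolding inner_abs_l2[OF hc(1)[OF b] L2_translation(1)[OF gc[OF b]]]
    using hc(2)[OF b] L2_translation(2)[OF gc[OF b], of z] by (simp add: integral_completion)
  have \<Phi>m: "(\<lambda>z. LINT x|lborel. (h' x \<bullet> b) * (g' (z + x) \<bullet> b)) \<in> borel_measurable borel" if b: "b \<in> Basis" for b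
  proof -
    have "(\<lambda>p. fst p + snd p) \<in> borel_measurable (lborel \<Otimes>\<^sub>M (lborel :: 'a measure))" by measurable
    then have "(\<lambda>p. g' (fst p + snd p) \<bullet> b) \<in> borel_measurable (lborel \<Otimes>\<^sub>M lborel)"
      by (rule measurable_compose[OF _ gc(2)[OF b]])
    moreover have "(\<lambda>p. h' (snd p) \<bullet> b) \<in> borel_measurable ((lborel :: 'a measure) \<Otimes>\<^sub>M lborel)"
      by (rule measurable_compose[OF _ hc(2)[OF b]]) simp
    ultimately have "(\<lambda>p. (h' (snd p) \<bullet> b) * (g' (fst p + snd p) \<bullet> b)) \<in> borel_measurable (lborel \<Otimes>\<^sub>M lborel)"
      by (intro borel_measurable_times)
    then have "(\<lambda>z. LINT x|lborel. (h' x \<bullet> b) * (g' (z + x) \<bullet> b)) \<in> borel_measurable lborel"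
      by (intro lborel.borel_measurable_lebesgue_integral) (simp add: case_prod_beta)
    then show ?thesis by simp
  qed
  define C where "C = (\<Sum>b\<in>Basis. norm (abs_l2 (\<lambda>x. h' x \<bullet> b)) * norm (abs_l2 (\<lambda>x. g' x \<bullet> b)))"
  have cor_le: "\<bar>LINT x|lborel. (h' x \<bullet> b) * (g' (z + x) \<bullet> b)\<bar>
      \<le> norm (abs_l2 (\<lambda>x. h' x \<bullet> b)) * norm (abs_l2 (\<lambda>x. g' x \<bullet> b))" if b: "b \<in> Basis" for b z
    unfolding cor[OF b] L2_translation(3)[OF gc[OF b], of z, symmetric] by (rule Cauchy_Schwarz_ineq2)
  have \<Phi>_int: "integrable lebesgue (\<lambda>z. \<sigma> z * (LINT x|lborel. (h' x \<bullet> b) * (g' (z + x) \<bullet> b)))"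
    if \<sigma>: "\<sigma> \<in> test_functions UNIV" and b: "b \<in> Basis" for \<sigma> b
  proof (rule Bochner_Integration.integrable_bound)
    let ?c = "norm (abs_l2 (\<lambda>x. h' x \<bullet> b)) * norm (abs_l2 (\<lambda>x. g' x \<bullet> b))"
    obtain K where K: "smooth \<sigma>" "compact K" "\<And>x. x \<notin> K \<Longrightarrow> \<sigma> x = 0" using \<sigma> by (rule test_functionsE) blast
    show "integrable lebesgue (\<lambda>z. ?c * \<sigma> z)"
      by (intro integrable_mult_right integrable_lebesgue_compact_support[OF smooth_continuous_on[OF K(1)] K(2,3)])
    show "(\<lambda>z. \<sigma> z * (LINT x|lborel. (h' x \<bullet> b) * (g' (z + x) \<bullet> b))) \<in> borel_measurable lebesgue"
      by (intro borel_imp_lebesgue_measurable borel_measurable_times smooth_borel_measurable K(1) \<Phi>m b)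
    show "AE z in lebesgue. norm (\<sigma> z * (LINT x|lborel. (h' x \<bullet> b) * (g' (z + x) \<bullet> b))) \<le> norm (?c * \<sigma> z)"
    proof (rule AE_I2)
      fix z
      have "\<bar>\<sigma> z\<bar> * \<bar>LINT x|lborel. (h' x \<bullet> b) * (g' (z + x) \<bullet> b)\<bar> \<le> \<bar>\<sigma> z\<bar> * ?c"
        by (intro mult_left_mono cor_le b) simp
      then show "norm (\<sigma> z * (LINT x|lborel. (h' x \<bullet> b) * (g' (z + x) \<bullet> b))) \<le> norm (?c * \<sigma> z)"
        by (simp add: abs_mult mult_ac)
    qed
  qed
  have weak0: "(LINT z|lebesgue. \<Phi> z * \<sigma> z) = 0" if \<sigma>: "\<sigma> \<in> test_functions UNIV" for \<sigma>
  proof -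
    \<comment> \<open>Reflecting \<open>\<sigma>\<close> turns the convolution into a correlation:
      after the shift \<open>y = x + z\<close> the kernel is \<open>\<sigma> z\<close> and
      \<open>g'\<close> is evaluated at \<open>z + x\<close>.\<close>
    define \<rho> where "\<rho> x = \<sigma> (0 - x)" for x
    have \<rho>: "\<rho> \<in> test_functions UNIV" unfolding \<rho>_def by (rule test_functions_reflect[OF \<sigma>])
    note ui = has_weak_gradientD(1)[OF u, simplified]
    have conv_eq: "grad (conv \<rho> u) x \<bullet> b = (LINT z|lborel. \<sigma> z * (g' (z + x) \<bullet> b))"
      and conv_eq': "grad (conv \<rho> u) x \<bullet> b = conv \<rho> (\<lambda>y. g' y \<bullet> b) x" if b: "b \<in> Basis" for b x
    proof -
      have \<rho>b: "(\<lambda>y. \<rho> (x - y)) \<in> borel_measurable borel"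
        by (intro smooth_borel_measurable test_functions_smooth[OF test_functions_reflect[OF \<rho>]])
      have "grad (conv \<rho> u) x \<bullet> b = (LINT y|lebesgue. \<rho> (x - y) * (g y \<bullet> b))"
        unfolding grad_conv[OF \<rho> u b] conv_def ..
      also have "\<dots> = (LINT y|lebesgue. \<rho> (x - y) * (g' y \<bullet> b))"
      proof (rule integral_cong_AE)
        show "AE y in lebesgue. \<rho> (x - y) * (g y \<bullet> b) = \<rho> (x - y) * (g' y \<bullet> b)"
          using g' by eventually_elim simp
      qed (intro borel_measurable_times borel_imp_lebesgue_measurable[OF \<rho>b] L2_measurable
          L2_component[OF g b] gc(1)[OF b])+
      finally have eq: "grad (conv \<rho> u) x \<bullet> b = (LINT y|lebesgue. \<rho> (x - y) * (g' y \<bullet> b))" .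
      then show "grad (conv \<rho> u) x \<bullet> b = conv \<rho> (\<lambda>y. g' y \<bullet> b) x" by (simp add: conv_def)
      note m = borel_measurable_times[OF \<rho>b gc(2)[OF b]]
      have "(LINT y|lebesgue. \<rho> (x - y) * (g' y \<bullet> b)) = (LINT y|lborel. \<rho> (x - y) * (g' y \<bullet> b))"
        using m by (simp add: integral_completion)
      also have "\<dots> = (LINT z|lborel. \<rho> (x - (x + z)) * (g' (x + z) \<bullet> b))"
        by (rule lborel_integral_translation[OF m, symmetric])
      also have "\<dots> = (LINT z|lborel. \<sigma> z * (g' (z + x) \<bullet> b))"
        by (simp add: \<rho>_def add.commute)
      finally show "grad (conv \<rho> u) x \<bullet> b = (LINT z|lborel. \<sigma> z * (g' (z + x) \<bullet> b))" using eq by simp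
    qed
    have gradL: "grad (conv \<rho> u) \<in> L2 UNIV"
      by (rule L2_componentwise) (simp only: conv_eq', rule conv_L2[OF \<rho> gc])
    have cm: "(\<lambda>x. LINT z|lborel. \<sigma> z * (g' (z + x) \<bullet> b)) \<in> borel_measurable borel" if b: "b \<in> Basis" for b
      unfolding conv_eq[OF b, symmetric]
      using grad_borel_measurable[OF smooth_conv[OF \<rho> ui]] by simp
    have "0 = (LINT x|lebesgue. h x \<bullet> grad (conv \<rho> u) x)"
      by (rule orthogonal_to_smooth_gradient[OF h orth smooth_conv[OF \<rho> ui] gradL, symmetric])
    also have "\<dots> = (\<Sum>b\<in>Basis. LINT x|lebesgue. (h' x \<bullet> b) * (LINT z|lborel. \<sigma> z * (g' (z + x) \<bullet> b)))"
      unfolding h'h[OF gradL] by (rule sum.cong[OF refl]) (simp add: conv_eq)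
    also have "\<dots> = (\<Sum>b\<in>Basis. LINT z|lebesgue. \<sigma> z * (LINT x|lborel. (h' x \<bullet> b) * (g' (z + x) \<bullet> b)))"
    proof (rule sum.cong[OF refl])
      fix b :: 'a assume b: "b \<in> Basis"
      have "(LINT x|lebesgue. (h' x \<bullet> b) * (LINT z|lborel. \<sigma> z * (g' (z + x) \<bullet> b)))
          = (LINT x|lborel. (h' x \<bullet> b) * (LINT z|lborel. \<sigma> z * (g' (z + x) \<bullet> b)))"
        by (rule integral_completion) (simp add: borel_measurable_times[OF hc(2)[OF b] cm[OF b]])
      also have "\<dots> = (LINT z|lborel. \<sigma> z * (LINT x|lborel. (h' x \<bullet> b) * (g' (z + x) \<bullet> b)))"
        by (rule correlation_Fubini[OF hc[OF b] gc[OF b] \<sigma>])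
      also have "\<dots> = (LINT z|lebesgue. \<sigma> z * (LINT x|lborel. (h' x \<bullet> b) * (g' (z + x) \<bullet> b)))"
        by (rule integral_completion[symmetric])
          (simp add: borel_measurable_times[OF smooth_borel_measurable[OF test_functions_smooth[OF \<sigma>]] \<Phi>m[OF b]])
      finally show "(LINT x|lebesgue. (h' x \<bullet> b) * (LINT z|lborel. \<sigma> z * (g' (z + x) \<bullet> b)))
          = (LINT z|lebesgue. \<sigma> z * (LINT x|lborel. (h' x \<bullet> b) * (g' (z + x) \<bullet> b)))" .
    qed
    also have "\<dots> = (LINT z|lebesgue. (\<Sum>b\<in>Basis. \<sigma> z * (LINT x|lborel. (h' x \<bullet> b) * (g' (z + x) \<bullet> b))))"
      by (rule Bochner_Integration.integral_sum[symmetric]) (rule \<Phi>_int[OF \<sigma>])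
    also have "\<dots> = (LINT z|lebesgue. \<Phi> z * \<sigma> z)"
      by (simp add: \<Phi>_def sum_distrib_left mult.commute[of "\<Sum>b\<in>Basis. _ b"])
    finally show ?thesis ..
  qed
  have "AE z in lebesgue_on UNIV. \<Phi> z = 0"
  proof (rule fundamental_lemma[OF open_UNIV])
    fix K :: "'a set" assume K: "compact K"
    then have Kl: "K \<in> sets lebesgue" by (simp add: compact_imp_closed)
    have "K \<in> lmeasurable" by (rule lmeasurable_compact[OF K])
    show "integrable (lebesgue_on K) \<Phi>"
      unfolding integrable_lebesgue_on[OF Kl]
    proof (rule Bochner_Integration.integrable_bound)
      show "integrable lebesgue (\<lambda>z. C * indicator K z)"
        using \<open>K \<in> lmeasurable\<close> by (intro integrable_mult_right) (simp add: lmeasurable_iff_integrable)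
      show "(\<lambda>z. indicator K z *\<^sub>R \<Phi> z) \<in> borel_measurable lebesgue"
        unfolding \<Phi>_def
        by (intro borel_measurable_scaleR borel_measurable_sum borel_imp_lebesgue_measurable[OF \<Phi>m]) (use Kl in simp_all)
      have "\<bar>\<Phi> z\<bar> \<le> C" for z
        unfolding \<Phi>_def C_def by (rule order_trans[OF sum_abs]) (intro sum_mono cor_le)
      then show "AE z in lebesgue. norm (indicator K z *\<^sub>R \<Phi> z) \<le> norm (C * indicator K z)"
        by (intro AE_I2) (auto simp: indicator_def intro: order_trans[OF _ abs_ge_self])
    qed
  qed (simp add: lebesgue_on_UNIV_eq weak0)
  \<comment> \<open>Almost everywhere vanishing says nothing about the single value at the origin;
    continuity of translations has to supply it.\<close>
  then have AE0: "AE z in lborel. \<Phi> z = 0"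
    unfolding lebesgue_on_UNIV_eq AE_completion_iff .
  have "(\<Phi> \<longlongrightarrow> (\<Sum>b\<in>Basis. abs_l2 (\<lambda>x. h' x \<bullet> b) \<bullet> abs_l2 (\<lambda>x. g' x \<bullet> b))) (at 0)"
  proof -
    have "((\<lambda>z. \<Sum>b\<in>Basis. abs_l2 (\<lambda>x. h' x \<bullet> b) \<bullet> abs_l2 (\<lambda>x. g' (z + x) \<bullet> b))
        \<longlongrightarrow> (\<Sum>b\<in>Basis. abs_l2 (\<lambda>x. h' x \<bullet> b) \<bullet> abs_l2 (\<lambda>x. g' x \<bullet> b))) (at 0)"
      by (intro tendsto_sum tendsto_inner tendsto_const L2_translation_continuous gc)
    then show ?thesis by (simp add: \<Phi>_def[abs_def] cor)
  qed
  moreover have "(\<Sum>b\<in>Basis. abs_l2 (\<lambda>x. h' x \<bullet> b) \<bullet> abs_l2 (\<lambda>x. g' x \<bullet> b)) = (LINT x|lebesgue. h x \<bullet> g x)"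
  proof -
    have "(LINT x|lebesgue. h x \<bullet> g x) = (LINT x|lebesgue. h x \<bullet> g' x)"
    proof (rule integral_cong_AE)
      show "AE x in lebesgue. h x \<bullet> g x = h x \<bullet> g' x" using g' by eventually_elim simp
    qed (intro borel_measurable_inner L2_measurable h g g'L)+
    also have "\<dots> = (\<Sum>b\<in>Basis. LINT x|lebesgue. (h' x \<bullet> b) * (g' x \<bullet> b))" by (rule h'h[OF g'L])
    also have "\<dots> = (\<Sum>b\<in>Basis. abs_l2 (\<lambda>x. h' x \<bullet> b) \<bullet> abs_l2 (\<lambda>x. g' x \<bullet> b))"
      by (rule sum.cong[OF refl]) (simp add: inner_abs_l2[OF hc(1) gc(1)])
    finally show ?thesis ..
  qed
  ultimately have lim: "(\<Phi> \<longlongrightarrow> (LINT x|lebesgue. h x \<bullet> g x)) (at 0)" by simp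
  show ?thesis
  proof (rule ccontr)
    assume "(LINT x|lebesgue. h x \<bullet> g x) \<noteq> 0"
    \<comment> \<open>A nonzero limit would keep \<open>\<Phi>\<close> away from 0 on a punctured
      ball, which would then be a null set.\<close>
    then have "eventually (\<lambda>z. \<Phi> z \<noteq> 0) (at 0)" by (rule tendsto_imp_eventually_ne[OF lim])
    then obtain d where d: "d > 0" "\<And>z. z \<noteq> 0 \<Longrightarrow> dist z 0 < d \<Longrightarrow> \<Phi> z \<noteq> 0"
      unfolding eventually_at by auto
    have "AE z::'a in lborel. z \<noteq> 0" by (rule AE_lborel_singleton)
    with AE0 have "AE z::'a in lborel. z \<notin> ball 0 d"
    proof eventually_elim
      case (elim z)
      then show ?case using d(2)[of z] by (auto simp: dist_commute)
    qed
    then have "ball (0::'a) d \<in> null_sets lborel"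
      by (subst AE_iff_null_sets) simp_all
    then show False using emeasure_ball[of d "0::'a"] d(1) unit_ball_vol_pos[of "real DIM('a)"]
      by (simp add: null_sets_def)
  qed
qed

section \<open>Functions with vanishing weak gradient\<close>

lemma locally_integrable_measurable:
  fixes g :: "'a::euclidean_space \<Rightarrow> 'b::euclidean_space"
  assumes "\<And>K. compact K \<Longrightarrow> integrable (lebesgue_on K) g"
  shows "g \<in> borel_measurable lebesgue"
proof (rule borel_measurable_LIMSEQ_metric)
  fix n :: nat
  have "integrable (lebesgue_on (cball 0 (real n))) g" by (rule assms) simp
  then have "integrable lebesgue (\<lambda>x. indicator (cball 0 (real n)) x *\<^sub>R g x)"
    by (simp add: integrable_lebesgue_on)
  then show "(\<lambda>x. indicator (cball 0 (real n)) x *\<^sub>R g x) \<in> borel_measurable lebesgue"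
    by (rule borel_measurable_integrable)
next
  fix x :: 'a
  obtain m where "norm x \<le> real m" using real_arch_simple by blast
  then have "indicator (cball 0 (real n)) x *\<^sub>R g x = g x" if "n \<ge> m" for n
    using that by simp
  then have "eventually (\<lambda>n. indicator (cball 0 (real n)) x *\<^sub>R g x = g x) sequentially"
    by (rule eventually_sequentiallyI)
  then show "(\<lambda>n. indicator (cball 0 (real n)) x *\<^sub>R g x) \<longlonglongrightarrow> g x"
    by (rule tendsto_eventually)
qed

lemma integrable_lborel_of_lebesgue:
  fixes f :: "'a::euclidean_space \<Rightarrow> 'b::euclidean_space"
  assumes "f \<in> borel_measurable borel"
  shows "integrable lebesgue f \<longleftrightarrow> integrable lborel f"
  by (rule integrable_completion) (simp add: assms)

text \<open>Every mollification of \<open>u\<close> has zero gradient and so is constant. Its value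
  at \<open>x\<close> is the integral of a translate of \<open>u'\<close> by \<open>x\<close>
  against a test function, so the translates by \<open>a\<close> and by 0 cannot be told apart by
  test functions.\<close>

lemma has_weak_gradient_zero_translation:
  fixes u u' :: "'a::euclidean_space \<Rightarrow> real"
  assumes u: "has_weak_gradient UNIV u g" and g: "AE x in lebesgue. g x = 0"
    and u'b: "u' \<in> borel_measurable borel" and u': "AE x in lebesgue. u x = u' x"
  shows "AE y in lborel. u' (a + y) = u' y"
proof -
  note ui = has_weak_gradientD(1)[OF u, simplified]
  have taub: "(\<lambda>y. u' (a + y)) \<in> borel_measurable borel"
    by (rule measurable_compose[OF _ u'b]) simp
  have loc: "integrable (lebesgue_on K) (\<lambda>y. u' (a + y))" if K: "compact K" for a and K :: "'a set"
  proof -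
    have tb: "(\<lambda>y. u' (a + y)) \<in> borel_measurable borel"
      by (rule measurable_compose[OF _ u'b]) simp
    have Kl: "K \<in> sets lebesgue" "K \<in> sets borel" using K by (simp_all add: compact_imp_closed)
    define L where "L = (\<lambda>x. a + x) ` K"
    have L: "compact L" unfolding L_def by (rule compact_translation[OF K])
    then have Ll: "L \<in> sets lebesgue" "L \<in> sets borel" by (simp_all add: compact_imp_closed)
    have m: "(\<lambda>y. indicator L y *\<^sub>R u' y) \<in> borel_measurable borel"
      by (intro borel_measurable_scaleR borel_measurable_indicator Ll u'b)
    have "integrable lebesgue (\<lambda>y. indicator L y *\<^sub>R u y)"
      using ui[OF L] unfolding integrable_lebesgue_on[OF Ll(1)] .
    then have "integrable lebesgue (\<lambda>y. indicator L y *\<^sub>R u' y)"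
    proof (rule integrable_cong_AE[THEN iffD1, rotated 3])
      show "(\<lambda>y. indicator L y *\<^sub>R u' y) \<in> borel_measurable lebesgue"
        by (rule borel_imp_lebesgue_measurable[OF m])
      show "AE y in lebesgue. indicator L y *\<^sub>R u y = indicator L y *\<^sub>R u' y"
        using u' by eventually_elim simp
    qed (rule borel_measurable_integrable, fact)
    then have "integrable lborel (\<lambda>y. indicator L y *\<^sub>R u' y)"
      unfolding integrable_lborel_of_lebesgue[OF m] .
    from lborel_integrable_translation[OF this, of a]
    have "integrable lborel (\<lambda>y. indicator L (a + y) *\<^sub>R u' (a + y))" .
    moreover have "indicator L (a + y) = (indicator K y :: real)" for y
      by (simp add: L_def indicator_def image_iff)
    ultimately have "integrable lborel (\<lambda>y. indicator K y *\<^sub>R u' (a + y))" by (simp only:)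
    moreover have "(\<lambda>y. indicator K y *\<^sub>R u' (a + y)) \<in> borel_measurable borel"
      by (intro borel_measurable_scaleR borel_measurable_indicator Kl tb)
    ultimately have "integrable lebesgue (\<lambda>y. indicator K y *\<^sub>R u' (a + y))"
      by (simp only: integrable_lborel_of_lebesgue)
    then show ?thesis unfolding integrable_lebesgue_on[OF Kl(1)] .
  qed
  have "AE y in lebesgue_on UNIV. u' (a + y) - u' y = 0"
  proof (rule fundamental_lemma[OF open_UNIV])
    show "integrable (lebesgue_on K) (\<lambda>y. u' (a + y) - u' y)" if "compact K" for K
      using Bochner_Integration.integrable_diff[OF loc[OF that, of a] loc[OF that, of 0]] by simp
  next
    fix \<phi> :: "'a \<Rightarrow> real" assume \<phi>: "\<phi> \<in> test_functions UNIV"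
    note \<phi>b = smooth_borel_measurable[OF test_functions_smooth[OF \<phi>]]
    define \<rho> where "\<rho> x = \<phi> (0 - x)" for x
    have \<rho>: "\<rho> \<in> test_functions UNIV" unfolding \<rho>_def by (rule test_functions_reflect[OF \<phi>])
    have "grad (conv \<rho> u) x = 0" for x
    proof (rule euclidean_eqI)
      fix b :: 'a assume b: "b \<in> Basis"
      have "grad (conv \<rho> u) x \<bullet> b = (LINT y|lebesgue. \<rho> (x - y) * (g y \<bullet> b))"
        unfolding grad_conv[OF \<rho> u b] conv_def ..
      also have "\<dots> = (LINT y::'a|lebesgue. 0)"
      proof (rule integral_cong_AE)
        show "(\<lambda>y. \<rho> (x - y) * (g y \<bullet> b)) \<in> borel_measurable lebesgue"
          using borel_measurable_integrable[OF integrable_test_mult[OF _ test_functions_reflect[OF \<rho>, of x], of "\<lambda>y. g y \<bullet> b"]]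
            has_weak_gradientD(2)[OF u] by simp
        show "AE y in lebesgue. \<rho> (x - y) * (g y \<bullet> b) = 0" using g by eventually_elim simp
      qed simp
      finally show "grad (conv \<rho> u) x \<bullet> b = 0 \<bullet> b" by simp
    qed
    then have "(conv \<rho> u has_derivative (\<lambda>h. 0)) (at x within UNIV)" for x
      using has_derivative_grad[OF smooth_differentiable[OF smooth_conv[OF \<rho> ui]], of x] by simp
    then obtain c where c: "\<And>x. conv \<rho> u x = c"
      using has_derivative_zero_constant[OF convex_UNIV, of "conv \<rho> u"] by auto
    have cv: "conv \<rho> u x = (LINT y|lebesgue. u' (x + y) * \<phi> y)" for x
    proof -
      have m: "(\<lambda>y. \<phi> (y - x) * u' y) \<in> borel_measurable borel"
        by (rule borel_measurable_times[OF measurable_compose[OF _ \<phi>b] u'b]) simp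
      have m': "(\<lambda>y. u' (x + y) * \<phi> y) \<in> borel_measurable borel"
        by (rule borel_measurable_times[OF measurable_compose[OF _ u'b] \<phi>b]) simp
      have "conv \<rho> u x = (LINT y|lebesgue. \<phi> (y - x) * u' y)"
        unfolding conv_def
      proof (rule integral_cong_AE)
        show "(\<lambda>y. \<rho> (x - y) * u y) \<in> borel_measurable lebesgue"
          by (rule borel_measurable_integrable[OF conv_integrable[OF \<rho> ui]])
        show "(\<lambda>y. \<phi> (y - x) * u' y) \<in> borel_measurable lebesgue"
          by (rule borel_imp_lebesgue_measurable[OF m])
        show "AE y in lebesgue. \<rho> (x - y) * u y = \<phi> (y - x) * u' y"
          using u' by eventually_elim (simp add: \<rho>_def)
      qed
      also have "\<dots> = (LINT y|lborel. \<phi> (y - x) * u' y)"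
        by (rule integral_completion) (simp add: m)
      also have "\<dots> = (LINT y|lborel. \<phi> (x + y - x) * u' (x + y))"
        by (rule lborel_integral_translation[OF m, symmetric])
      also have "\<dots> = (LINT y|lborel. u' (x + y) * \<phi> y)"
        by (simp add: mult.commute)
      also have "\<dots> = (LINT y|lebesgue. u' (x + y) * \<phi> y)"
        by (rule integral_completion[symmetric]) (simp add: m')
      finally show ?thesis .
    qed
    have i: "integrable lebesgue (\<lambda>y. u' (x + y) * \<phi> y)" for x
      using integrable_test_mult[OF loc \<phi>, of x] by (simp add: mult.commute)
    have "(LINT y|lebesgue. (u' (a + y) - u' y) * \<phi> y)
        = (LINT y|lebesgue. u' (a + y) * \<phi> y) - (LINT y|lebesgue. u' (0 + y) * \<phi> y)"
      using Bochner_Integration.integral_diff[OF i[of a] i[of 0]] by (simp add: left_diff_distrib)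
    also have "\<dots> = 0" unfolding cv[symmetric] c by simp
    finally show "(LINT y|lebesgue_on UNIV. (u' (a + y) - u' y) * \<phi> y) = 0"
      unfolding lebesgue_on_UNIV_eq .
  qed
  then have "AE y in lborel. u' (a + y) - u' y = 0"
    unfolding lebesgue_on_UNIV_eq AE_completion_iff .
  then show ?thesis by eventually_elim simp
qed

text \<open>For each shift \<open>a\<close> the translate agrees with \<open>u'\<close> off a null
  set depending on \<open>a\<close>. Fubini exchanges the quantifiers, so some fixed
  \<open>y\<close> satisfies \<open>u' (a + y) = u' y\<close> for almost all \<open>a\<close>, which
  is constancy after a translation.\<close>

lemma has_weak_gradient_zero_constant:
  fixes u :: "'a::euclidean_space \<Rightarrow> real"
  assumes u: "has_weak_gradient UNIV u g" and g: "AE x in lebesgue. g x = 0"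
  shows "\<exists>c. AE x in lebesgue. u x = c"
proof -
  have "u \<in> borel_measurable lebesgue"
    by (rule locally_integrable_measurable) (rule has_weak_gradientD(1)[OF u], simp_all)
  then obtain u' where u'b: "u' \<in> borel_measurable borel" and u': "AE x in lebesgue. u x = u' x"
    by (rule lebesgue_ex_borel)
  have "AE a in lborel. AE y in lborel. u' (a + y) = u' y"
    by (intro AE_I2 has_weak_gradient_zero_translation[OF u g u'b u'])
  then have "AE y in lborel. AE a in lborel. u' (a + y) = u' y"
  proof (rule lborel_pair.AE_commute[THEN iffD1, rotated])
    have "(\<lambda>p. fst p + snd p) \<in> borel_measurable (lborel \<Otimes>\<^sub>M (lborel :: 'a measure))" by measurable
    then have [measurable]: "(\<lambda>p. u' (fst p + snd p)) \<in> borel_measurable (lborel \<Otimes>\<^sub>M lborel)"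
      by (rule measurable_compose[OF _ u'b])
    have [measurable]: "(\<lambda>p. u' (snd p)) \<in> borel_measurable ((lborel :: 'a measure) \<Otimes>\<^sub>M lborel)"
      by (rule measurable_compose[OF _ u'b]) simp
    show "{x \<in> space (lborel \<Otimes>\<^sub>M lborel). u' (fst x + snd x) = u' (snd x)} \<in> sets (lborel \<Otimes>\<^sub>M lborel)"
      by measurable
  qed
  note AE2 = this
  have nontriv: "\<not> (AE y::'a in lborel. False)"
  proof
    assume "AE y::'a in lborel. False"
    then have "AE y::'a in lborel. y \<notin> ball 0 1" by eventually_elim simp
    then have "ball (0::'a) 1 \<in> null_sets lborel" by (subst AE_iff_null_sets) simp_all
    then show False using emeasure_ball[of 1 "0::'a"] unit_ball_vol_pos[of "real DIM('a)"]
      by (simp add: null_sets_def)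
  qed
  have "\<exists>y. AE a in lborel. u' (a + y) = u' y"
  proof (rule ccontr)
    assume none: "\<nexists>y. AE a in lborel. u' (a + y) = u' y"
    from AE2 have "AE y::'a in lborel. False"
    proof eventually_elim
      case (elim y)
      then show False using none by blast
    qed
    then show False using nontriv by contradiction
  qed
  then obtain y where y: "AE a in lborel. u' (a + y) = u' y" ..
  have "AE x in distr lborel borel ((+) y). u' x = u' y"
  proof (subst AE_distr_iff)
    show "{x \<in> space borel. u' x = u' y} \<in> sets borel" using u'b by measurable
    show "AE x in lborel. u' (y + x) = u' y" using y by (simp add: add.commute)
  qed simp
  then have "AE x in lebesgue. u' x = u' y"
    unfolding lborel_distr_plus AE_completion_iff .
  with u' have "AE x in lebesgue. u x = u' y" by eventually_elim simp
  then show ?thesis by blast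
qed

section \<open>The Beppo-Levi space\<close>

lemma BL_D:
  assumes "u \<in> BL"
  shows "has_weak_gradient UNIV u (weak_gradient UNIV u)" "weak_gradient UNIV u \<in> L2 UNIV"
    "\<And>C. compact C \<Longrightarrow> u \<in> L2 C"
  using assms has_weak_gradient_weak_gradient by (auto simp: BL_def H1_loc_def)

lemma weak_gradient_AE_UNIV:
  "has_weak_gradient UNIV u g \<Longrightarrow> AE x in lebesgue. weak_gradient UNIV u x = g x"
  using weak_gradient_AE[OF open_UNIV] unfolding lebesgue_on_UNIV_eq .

lemma weak_gradient_measurable:
  "has_weak_gradient UNIV u g \<Longrightarrow> g \<in> borel_measurable lebesgue"
  by (rule locally_integrable_measurable) (erule has_weak_gradientD(2), simp_all)

lemma BL_I:
  assumes u: "has_weak_gradient UNIV u g" and g: "g \<in> L2 UNIV" and loc: "\<And>C. compact C \<Longrightarrow> u \<in> L2 C"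
  shows "u \<in> BL"
proof -
  have "AE x in lebesgue. g x = weak_gradient UNIV u x"
    using weak_gradient_AE_UNIV[OF u] by eventually_elim simp
  then have "weak_gradient UNIV u \<in> L2 UNIV"
    by (rule L2_cong_AE[OF g weak_gradient_measurable[OF has_weak_gradient_weak_gradient[OF u]]])
  moreover have "g \<in> L2 C" if "compact C" for C
    by (rule L2_subset[OF g]) (use that in \<open>simp add: compact_imp_closed\<close>)
  ultimately show ?thesis using u loc by (auto simp: BL_def H1_loc_def)
qed

lemma L2_diff_on:
  fixes f g :: "'a::euclidean_space \<Rightarrow> 'b::euclidean_space"
  assumes "f \<in> L2 S" "g \<in> L2 S" "S \<in> sets lebesgue"
  shows "(\<lambda>x. f x - g x) \<in> L2 S"
proof -
  have "(\<lambda>x. indicator S x *\<^sub>R f x - indicator S x *\<^sub>R g x) \<in> L2 UNIV"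
    using assms by (intro L2_diff) (simp_all add: L2_indicator_iff)
  then have "(\<lambda>x. indicator S x *\<^sub>R (f x - g x)) \<in> L2 UNIV" by (simp add: scaleR_diff_right)
  then show ?thesis using L2_indicator_iff[OF assms(3), of "\<lambda>x. f x - g x"] by simp
qed

lemma BL_diff:
  assumes u: "u \<in> BL" and v: "v \<in> BL"
  shows "(\<lambda>x. u x - v x) \<in> BL"
    and "has_weak_gradient UNIV (\<lambda>x. u x - v x) (\<lambda>x. weak_gradient UNIV u x - weak_gradient UNIV v x)"
proof -
  show w: "has_weak_gradient UNIV (\<lambda>x. u x - v x) (\<lambda>x. weak_gradient UNIV u x - weak_gradient UNIV v x)"
    by (rule has_weak_gradient_diff[OF open_UNIV BL_D(1)[OF u] BL_D(1)[OF v]])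
  show "(\<lambda>x. u x - v x) \<in> BL"
  proof (rule BL_I[OF w L2_diff[OF BL_D(2)[OF u] BL_D(2)[OF v]]])
    show "(\<lambda>x. u x - v x) \<in> L2 C" if "compact C" for C
      by (rule L2_diff_on[OF BL_D(3)[OF u that] BL_D(3)[OF v that]])
        (use that in \<open>simp add: compact_imp_closed\<close>)
  qed
qed

lemma equiv_BL_rel: "equiv (BL :: ('a::euclidean_space \<Rightarrow> real) set) BL_rel"
proof (rule equivI)
  show "refl_on (BL :: ('a \<Rightarrow> real) set) BL_rel"
  proof (rule refl_onI)
    fix u :: "'a \<Rightarrow> real" assume "u \<in> BL"
    moreover have "AE x in lebesgue. u x = u x + 0" by simp
    ultimately show "(u, u) \<in> BL_rel" unfolding BL_rel_def by blast
  qed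
  show "BL_rel \<subseteq> BL \<times> (BL :: ('a \<Rightarrow> real) set)" by (auto simp: BL_rel_def)
  show "sym (BL_rel :: (('a \<Rightarrow> real) \<times> _) set)"
  proof (rule symI)
    fix u v :: "'a \<Rightarrow> real" assume "(u, v) \<in> BL_rel"
    then obtain c where uv: "u \<in> BL" "v \<in> BL" "AE x in lebesgue. u x = v x + c" by (auto simp: BL_rel_def)
    from uv(3) have "AE x in lebesgue. v x = u x + (- c)" by eventually_elim simp
    then show "(v, u) \<in> BL_rel" using uv(1,2) unfolding BL_rel_def by blast
  qed
  show "trans (BL_rel :: (('a \<Rightarrow> real) \<times> _) set)"
  proof (rule transI)
    fix u v w :: "'a \<Rightarrow> real" assume "(u, v) \<in> BL_rel" "(v, w) \<in> BL_rel"
    then obtain c d where uv: "u \<in> BL" "w \<in> BL" "AE x in lebesgue. u x = v x + c" "AE x in lebesgue. v x = w x + d"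
      by (auto simp: BL_rel_def)
    from uv(3,4) have "AE x in lebesgue. u x = w x + (d + c)" by eventually_elim simp
    then show "(u, w) \<in> BL_rel" using uv(1,2) unfolding BL_rel_def by blast
  qed
qed

lemma BL_dot_representative:
  assumes "K \<in> BL_dot"
  shows "(SOME u. u \<in> K) \<in> BL" "K = BL_rel `` {SOME u. u \<in> K}"
proof -
  obtain v where v: "v \<in> BL" "K = BL_rel `` {v}"
    using assms unfolding BL_dot_def by (rule quotientE)
  have "v \<in> K" using v equiv_class_self[OF equiv_BL_rel] by simp
  then have "(SOME u. u \<in> K) \<in> K" by (rule someI[where P = "\<lambda>u. u \<in> K"])
  then have r: "(v, SOME u. u \<in> K) \<in> BL_rel" unfolding v(2) by simp
  then show "(SOME u. u \<in> K) \<in> BL" by (simp add: BL_rel_def)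
  show "K = BL_rel `` {SOME u. u \<in> K}"
    by (rule trans[OF v(2) equiv_class_eq[OF equiv_BL_rel r]])
qed

section \<open>The closure of the gradients of test functions\<close>

definition test_gradients :: "('a::euclidean_space, 'a) l2 set" where
  "test_gradients = (\<lambda>\<phi>. abs_l2 (grad \<phi>)) ` test_functions UNIV"

lemma grad_cmult: "smooth f \<Longrightarrow> grad (\<lambda>x. c * f x) x = c *\<^sub>R grad f x"
  using grad_mult[OF smooth_const[of c], of f x] by (simp add: grad_const)

lemma subspace_abs_l2_grad:
  "subspace ((\<lambda>\<phi>. abs_l2 (grad \<phi>)) ` test_functions D :: ('a::euclidean_space, 'a) l2 set)"
proof (rule subspaceI)
  have "grad (\<lambda>x::'a. 0) = (\<lambda>x. 0)" by (rule ext) (rule grad_const)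
  then show "0 \<in> (\<lambda>\<phi>. abs_l2 (grad \<phi>)) ` (test_functions D :: ('a \<Rightarrow> real) set)"
    using test_functions_zero[of D] unfolding zero_abs_l2 by (metis image_eqI)
next
  fix F G :: "('a, 'a) l2"
  assume "F \<in> (\<lambda>\<phi>. abs_l2 (grad \<phi>)) ` test_functions D" "G \<in> (\<lambda>\<phi>. abs_l2 (grad \<phi>)) ` test_functions D"
  then obtain \<phi> \<psi> where *: "\<phi> \<in> test_functions D" "F = abs_l2 (grad \<phi>)" "\<psi> \<in> test_functions D" "G = abs_l2 (grad \<psi>)"
    by auto
  have "F + G = abs_l2 (\<lambda>x. grad \<phi> x + grad \<psi> x)"
    unfolding *(2,4) by (rule add_abs_l2) (intro grad_test_function_L2[OF *(1)] grad_test_function_L2[OF *(3)])+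
  also have "(\<lambda>x. grad \<phi> x + grad \<psi> x) = grad (\<lambda>x. \<phi> x + \<psi> x)"
    by (rule ext) (rule grad_add[OF test_functions_smooth[OF *(1)] test_functions_smooth[OF *(3)], symmetric])
  finally show "F + G \<in> (\<lambda>\<phi>. abs_l2 (grad \<phi>)) ` test_functions D"
    using test_functions_add[OF *(1,3)] by simp
next
  fix F :: "('a, 'a) l2" and c :: real
  assume "F \<in> (\<lambda>\<phi>. abs_l2 (grad \<phi>)) ` test_functions D"
  then obtain \<phi> where *: "\<phi> \<in> test_functions D" "F = abs_l2 (grad \<phi>)" by auto
  have "c *\<^sub>R F = abs_l2 (\<lambda>x. c *\<^sub>R grad \<phi> x)"
    unfolding *(2) by (rule scaleR_abs_l2[OF grad_test_function_L2[OF *(1)]])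
  also have "(\<lambda>x. c *\<^sub>R grad \<phi> x) = grad (\<lambda>x. c * \<phi> x)"
    by (rule ext) (rule grad_cmult[OF test_functions_smooth[OF *(1)], symmetric])
  finally show "c *\<^sub>R F \<in> (\<lambda>\<phi>. abs_l2 (grad \<phi>)) ` test_functions D"
    using test_functions_cmult[OF *(1)] by simp
qed

lemma geometric_steps_close:
  fixes X :: "nat \<Rightarrow> 'a::real_normed_vector"
  assumes "\<And>n. norm (X (Suc n) - X n) \<le> (1/2) ^ Suc n" "n \<le> k"
  shows "norm (X k - X n) \<le> (1/2) ^ n"
proof -
  \<comment> \<open>Subtracting the exact tail of the geometric series strengthens the bound so that
    the induction closes.\<close>
  have "norm (X (n + j) - X n) \<le> (1/2) ^ n - (1/2) ^ (n + j)" for j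
  proof (induction j)
    case (Suc j)
    have "norm (X (n + Suc j) - X n) \<le> norm (X (Suc (n + j)) - X (n + j)) + norm (X (n + j) - X n)"
      using norm_triangle_ineq[of "X (Suc (n + j)) - X (n + j)" "X (n + j) - X n"] by simp
    also have "\<dots> \<le> (1/2) ^ Suc (n + j) + ((1/2) ^ n - (1/2) ^ (n + j))"
      by (intro add_mono assms(1) Suc)
    also have "\<dots> = (1/2) ^ n - (1/2) ^ (n + Suc j)" by simp
    finally show ?case .
  qed simp
  from this[of "k - n"] have "norm (X k - X n) \<le> (1/2) ^ n - (1/2) ^ k" using assms(2) by simp
  moreover have "0 \<le> (1/2::real) ^ k" by simp
  ultimately show ?thesis by linarith
qed

text \<open>A rapidly converging sequence of gradients of test functions is corrected by constants chosen
  by the Poincare inequality on growing balls, so that the functions themselves converge locally.\<close>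

lemma closure_gradients_imp_BL:
  fixes F :: "('a::euclidean_space, 'a) l2"
  assumes F: "F \<in> closure test_gradients"
  shows "\<exists>u\<in>BL. abs_l2 (weak_gradient UNIV u) = F"
proof -
  define N :: real where "N = 2 ^ DIM('a)"
  have N: "N > 0" by (simp add: N_def)
  \<comment> \<open>Chosen so that the Poincare constant \<open>N (2 (n + 1))^2\<close> on the ball
    of radius \<open>n + 1\<close>, times \<open>A n\<close>, is exactly the square of
    \<open>(1/2) ^ Suc n\<close>.\<close>
  define A :: "nat \<Rightarrow> real" where "A n = (1/4) ^ Suc n / (N * (2 * real (Suc n))\<^sup>2)" for n
  have A: "A n > 0" for n using N by (simp add: A_def)
  have A_dec: "A (Suc n) \<le> A n" for n
  proof -
    have "N * (2 * real (Suc n))\<^sup>2 \<le> N * (2 * real (Suc (Suc n)))\<^sup>2"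
      using N by (intro mult_left_mono power_mono) simp_all
    then show ?thesis unfolding A_def using N
      by (intro frac_le) (simp_all del: of_nat_Suc)
  qed
  \<comment> \<open>Half of the root of \<open>A n\<close>, since two consecutive approximations
    enter each increment and \<open>A\<close> decreases.\<close>
  have "\<forall>n. \<exists>\<phi>. \<phi> \<in> test_functions UNIV \<and> dist (abs_l2 (grad \<phi>)) F < sqrt (A n) / 2"
  proof
    fix n
    have "sqrt (A n) / 2 > 0" using A by simp
    moreover have "\<forall>e>0. \<exists>y\<in>test_gradients. dist y F < e" using F unfolding closure_approachable .
    ultimately have "\<exists>y\<in>test_gradients. dist y F < sqrt (A n) / 2" by blast
    then show "\<exists>\<phi>. \<phi> \<in> test_functions UNIV \<and> dist (abs_l2 (grad \<phi>)) F < sqrt (A n) / 2"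
      by (auto simp: test_gradients_def)
  qed
  from choice[OF this] obtain \<phi> where \<phi>: "\<And>n. \<phi> n \<in> test_functions UNIV"
    "\<And>n. dist (abs_l2 (grad (\<phi> n))) F < sqrt (A n) / 2" by blast
  define w where "w n x = \<phi> (Suc n) x - \<phi> n x" for n x
  have w: "w n \<in> test_functions UNIV" for n
    unfolding w_def by (intro test_functions_diff \<phi>)
  have grad_w: "(norm (abs_l2 (grad (w n))))\<^sup>2 < A n" for n
  proof -
    have "grad (w n) = (\<lambda>x. grad (\<phi> (Suc n)) x - grad (\<phi> n) x)"
      unfolding w_def by (rule ext) (intro grad_diff test_functions_smooth[OF \<phi>(1)])
    then have "norm (abs_l2 (grad (w n))) = dist (abs_l2 (grad (\<phi> (Suc n)))) (abs_l2 (grad (\<phi> n)))"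
      by (simp add: dist_norm diff_abs_l2 grad_test_function_L2[OF \<phi>(1)])
    also have "\<dots> \<le> dist (abs_l2 (grad (\<phi> (Suc n)))) F + dist (abs_l2 (grad (\<phi> n))) F"
      by (rule dist_triangle2)
    also have "\<dots> < sqrt (A (Suc n)) / 2 + sqrt (A n) / 2" by (intro add_strict_mono \<phi>)
    also have "\<dots> \<le> sqrt (A n)" using real_sqrt_le_mono[OF A_dec[of n]] by linarith
    finally have "(norm (abs_l2 (grad (w n))))\<^sup>2 < (sqrt (A n))\<^sup>2"
      by (rule power_strict_mono) simp_all
    also have "\<dots> = A n" by (rule real_sqrt_pow2[OF less_imp_le[OF A]])
    finally show ?thesis .
  qed
  have "\<forall>n. \<exists>c. (\<integral>\<^sup>+x. indicator (ball 0 (real (Suc n))) x * ennreal ((w n x - c)\<^sup>2) \<partial>lborel)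
      \<le> ennreal (N * (2 * real (Suc n))\<^sup>2 * A n)"
  proof
    fix n
    have "0 < real (Suc n)" by simp
    from poincare_ball[OF test_functions_smooth[OF w] grad_test_function_L2[OF w] grad_w this]
    show "\<exists>c. (\<integral>\<^sup>+x. indicator (ball 0 (real (Suc n))) x * ennreal ((w n x - c)\<^sup>2) \<partial>lborel)
      \<le> ennreal (N * (2 * real (Suc n))\<^sup>2 * A n)" unfolding N_def .
  qed
  from choice[OF this] obtain c
    where c0: "\<forall>n. (\<integral>\<^sup>+x. indicator (ball 0 (real (Suc n))) x * ennreal ((w n x - c n)\<^sup>2) \<partial>lborel)
      \<le> ennreal (N * (2 * real (Suc n))\<^sup>2 * A n)" ..
  have NA: "N * (2 * real (Suc n))\<^sup>2 * A n = ((1/2) ^ Suc n)\<^sup>2" for n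
  proof -
    have half: "((1/2::real) ^ Suc n)\<^sup>2 = (1/4) ^ Suc n"
      unfolding power2_eq_square power_mult_distrib[symmetric] by simp
    have ne: "N * (2 * real (Suc n))\<^sup>2 \<noteq> 0" using N by simp
    show ?thesis unfolding A_def half times_divide_eq_right
      by (rule nonzero_mult_div_cancel_left[OF ne])
  qed
  have c: "(\<integral>\<^sup>+x. indicator (ball 0 (real (Suc n))) x * ennreal ((w n x - c n)\<^sup>2) \<partial>lborel)
      \<le> ennreal (((1/2) ^ Suc n)\<^sup>2)" for n using spec[OF c0, of n] unfolding NA .
  \<comment> \<open>Subtracting the accumulated constants leaves the gradients unchanged and makes
    each increment equal to \<open>w n - c n\<close>, which Poincare controls.\<close>
  define \<psi> where "\<psi> n x = \<phi> n x - (\<Sum>j<n. c j)" for n x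
  have \<psi>s: "smooth (\<psi> n)" for n
    unfolding \<psi>_def by (intro smooth_diff smooth_const test_functions_smooth[OF \<phi>(1)])
  have \<psi>_grad: "grad (\<psi> n) = grad (\<phi> n)" for n
    unfolding \<psi>_def
    by (rule ext) (simp add: grad_diff[OF test_functions_smooth[OF \<phi>(1)] smooth_const] grad_const)
  have \<psi>_step: "\<psi> (Suc n) x - \<psi> n x = w n x - c n" for n x
    by (simp add: \<psi>_def w_def)
  \<comment> \<open>The shift of the index by \<open>m\<close> guarantees that the ball of radius
    \<open>m\<close> lies in every ball on which the increments are estimated.\<close>
  define f where "f m n x = indicator (ball 0 (real m)) x *\<^sub>R \<psi> (n + m) x" for m n :: nat and x :: 'a
  have fL: "f m n \<in> L2 UNIV" for m n
  proof -
    have "integrable (lebesgue_on (cball 0 (real m))) (\<lambda>x. (norm (\<psi> (n + m) x))\<^sup>2)"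
      by (intro integrable_lebesgue_on_continuous continuous_intros smooth_continuous_on \<psi>s) simp
    moreover have "\<psi> (n + m) \<in> borel_measurable (lebesgue_on (cball 0 (real m)))"
      by (intro measurable_restrict_space1 borel_imp_lebesgue_measurable smooth_borel_measurable \<psi>s)
    ultimately have "\<psi> (n + m) \<in> L2 (cball 0 (real m))" by (simp add: L2_def)
    moreover have cb: "cball (0::'a) (real m) \<in> sets lebesgue" by simp
    ultimately have "(\<lambda>x. indicator (cball 0 (real m)) x *\<^sub>R \<psi> (n + m) x) \<in> L2 UNIV"
      unfolding L2_indicator_iff[OF cb] by simp
    then show ?thesis
    proof (rule L2_bound)
      show "f m n \<in> borel_measurable lebesgue" unfolding f_def
        by (intro borel_imp_lebesgue_measurable borel_measurable_scaleR smooth_borel_measurable[OF \<psi>s]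
            borel_measurable_indicator borel_open open_ball)
      show "AE x in lebesgue. norm (f m n x) \<le> norm (indicator (cball 0 (real m)) x *\<^sub>R \<psi> (n + m) x)"
        by (rule AE_I2) (simp add: f_def indicator_def)
    qed
  qed
  have step: "norm (abs_l2 (f m (Suc n)) - abs_l2 (f m n)) \<le> (1/2) ^ Suc n" for m n
  proof (rule power2_le_imp_le)
    have d: "(\<lambda>x. f m (Suc n) x - f m n x) \<in> L2 UNIV" by (rule L2_diff[OF fL fL])
    have "ennreal ((norm (abs_l2 (f m (Suc n)) - abs_l2 (f m n)))\<^sup>2)
        = (\<integral>\<^sup>+x. ennreal ((norm (f m (Suc n) x - f m n x))\<^sup>2) \<partial>lborel)"
      unfolding diff_abs_l2[OF fL fL] by (rule norm_abs_l2_lborel[OF d])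
    also have "\<dots> \<le> (\<integral>\<^sup>+x. indicator (ball 0 (real (Suc (n + m)))) x * ennreal ((w (n + m) x - c (n + m))\<^sup>2) \<partial>lborel)"
    proof (rule nn_integral_mono)
      fix x :: 'a
      have "f m (Suc n) x - f m n x = indicator (ball 0 (real m)) x *\<^sub>R (w (n + m) x - c (n + m))"
        unfolding f_def scaleR_diff_right[symmetric] add_Suc \<psi>_step ..
      then show "ennreal ((norm (f m (Suc n) x - f m n x))\<^sup>2)
          \<le> indicator (ball 0 (real (Suc (n + m)))) x * ennreal ((w (n + m) x - c (n + m))\<^sup>2)"
        by (cases "x \<in> ball 0 (real m)") simp_all
    qed
    also have "\<dots> \<le> ennreal (((1/2) ^ Suc (n + m))\<^sup>2)" by (rule c)
    also have "\<dots> \<le> ennreal (((1/2) ^ Suc n)\<^sup>2)"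
      by (intro ennreal_leI power_mono power_decreasing) simp_all
    finally show "(norm (abs_l2 (f m (Suc n)) - abs_l2 (f m n)))\<^sup>2 \<le> ((1/2) ^ Suc n)\<^sup>2" by simp
  qed simp
  have close: "norm (abs_l2 (f m k) - abs_l2 (f m n)) \<le> (1/2) ^ n" if "n \<le> k" for m n k
    by (rule geometric_steps_close[OF step that])
  \<comment> \<open>One pointwise limit serves all balls; on each of them it agrees almost
    everywhere with the \<open>L2\<close> limit.\<close>
  define u where "u x = lim (\<lambda>n. \<psi> n x)" for x
  have um: "u \<in> borel_measurable lebesgue"
    unfolding u_def
    by (rule borel_measurable_lim_metric) (intro borel_imp_lebesgue_measurable smooth_borel_measurable \<psi>s)
  have lim_u: "(\<lambda>x. indicator (ball 0 (real m)) x *\<^sub>R u x) \<in> L2 UNIV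
      \<and> (\<lambda>n. abs_l2 (f m n)) \<longlonglongrightarrow> abs_l2 (\<lambda>x. indicator (ball 0 (real m)) x *\<^sub>R u x)" for m
  proof -
    let ?g = "\<lambda>x. lim (\<lambda>n. f m n x)"
    have L: "AE x in lebesgue. (\<lambda>n. f m n x) \<longlonglongrightarrow> ?g x" "?g \<in> L2 UNIV"
      "(\<lambda>n. abs_l2 (f m n)) \<longlonglongrightarrow> abs_l2 ?g"
      by (rule l2_fast_Cauchy_limit[of "f m", OF fL]; rule close; assumption)+
    have eq: "AE x in lebesgue. ?g x = indicator (ball 0 (real m)) x *\<^sub>R u x"
      using L(1)
    proof eventually_elim
      case (elim x)
      show ?case
      proof (cases "x \<in> ball 0 (real m)")
        case True
        then have "(\<lambda>n. \<psi> (n + m) x) \<longlonglongrightarrow> ?g x" using elim by (simp add: f_def)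
        then have "(\<lambda>n. \<psi> n x) \<longlonglongrightarrow> ?g x" by (rule LIMSEQ_offset)
        then have "lim (\<lambda>n. \<psi> n x) = ?g x" by (rule limI)
        then show ?thesis using True by (simp add: u_def)
      next
        case False
        then show ?thesis by (simp add: f_def)
      qed
    qed
    have iL: "(\<lambda>x. indicator (ball 0 (real m)) x *\<^sub>R u x) \<in> L2 UNIV"
      by (rule L2_cong_AE[OF L(2) borel_measurable_scaleR[OF borel_measurable_indicator um] eq]) simp
    have "abs_l2 ?g = abs_l2 (\<lambda>x. indicator (ball 0 (real m)) x *\<^sub>R u x)"
      unfolding abs_l2_eq_iff[OF L(2) iL] by (rule eq)
    from L(3)[unfolded this] iL show ?thesis by (rule conjI[rotated])
  qed
  have in_ball: "\<exists>m. K \<subseteq> ball 0 (real m)" if K: "compact K" for K :: "'a set"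
  proof -
    obtain B where "K \<subseteq> ball 0 B" using bounded_subset_ballD[OF compact_imp_bounded[OF K]] by blast
    moreover obtain m where "B < real m" using reals_Archimedean2[of B] by blast
    ultimately show ?thesis by (meson less_imp_le subset_ball subset_trans)
  qed
  have uL: "u \<in> L2 K" if K: "compact K" for K
  proof -
    obtain m where m: "K \<subseteq> ball 0 (real m)" using in_ball[OF K] by blast
    have Kl: "K \<in> sets lebesgue" using K by (simp add: compact_imp_closed)
    have "(\<lambda>x. indicator K x *\<^sub>R u x) \<in> L2 UNIV"
    proof (rule L2_bound[OF conjunct1[OF lim_u[of m]]])
      show "(\<lambda>x. indicator K x *\<^sub>R u x) \<in> borel_measurable lebesgue"
        by (intro borel_measurable_scaleR um borel_measurable_indicator Kl)
      show "AE x in lebesgue. norm (indicator K x *\<^sub>R u x) \<le> norm (indicator (ball 0 (real m)) x *\<^sub>R u x)"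
        using m by (intro AE_I2) (auto simp: indicator_def)
    qed
    then show ?thesis unfolding L2_indicator_iff[OF Kl] .
  qed
  define g where "g = rep_l2 F"
  have g: "g \<in> L2 UNIV" "abs_l2 g = F" by (simp_all add: g_def rep_l2_L2 abs_rep_l2)
  have grad_lim: "(\<lambda>n. abs_l2 (grad (\<phi> n))) \<longlonglongrightarrow> F"
  proof (rule metric_tendsto_imp_tendsto[OF _ always_eventually])
    have "norm (sqrt (A n)) \<le> (1/2) ^ n" for n
    proof -
      have "A n \<le> (1/4) ^ Suc n"
      proof -
        have "1 \<le> N" by (simp add: N_def)
        moreover have "1 \<le> (2 * real (Suc n))\<^sup>2" by (rule one_le_power) simp
        ultimately have "1 \<le> N * (2 * real (Suc n))\<^sup>2" using mult_mono[of 1 N 1 "(2 * real (Suc n))\<^sup>2"] by simp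
        then show ?thesis unfolding A_def by (simp add: divide_le_eq mult_le_cancel_left1 del: of_nat_Suc power_Suc)
      qed
      also have "\<dots> \<le> (1/4) ^ n" by (intro power_decreasing) simp_all
      also have "\<dots> = ((1/2) ^ n)\<^sup>2"
        unfolding power2_eq_square power_mult_distrib[symmetric] by simp
      finally show ?thesis using A[of n] by (simp add: real_le_lsqrt)
    qed
    then have "\<forall>\<^sub>F n in sequentially. norm (sqrt (A n)) \<le> (1/2) ^ n" by simp
    moreover have "(\<lambda>n. (1/2::real) ^ n) \<longlonglongrightarrow> 0" by (rule LIMSEQ_power_zero) simp
    ultimately show "(\<lambda>n. sqrt (A n)) \<longlonglongrightarrow> 0" by (rule Lim_null_comparison)
    show "\<forall>n. dist (abs_l2 (grad (\<phi> n))) F \<le> dist (sqrt (A n)) 0"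
    proof
      fix n
      have "0 \<le> sqrt (A n)" using A[of n] by simp
      then show "dist (abs_l2 (grad (\<phi> n))) F \<le> dist (sqrt (A n)) 0"
        using \<phi>(2)[of n] unfolding dist_real_def by linarith
    qed
  qed
  have wg: "has_weak_gradient UNIV u g"
  proof (rule has_weak_gradientI[OF open_UNIV])
    show "integrable (lebesgue_on K) u" if "compact K" for K
      by (rule L2_integrable_on_bounded[OF uL[OF that] _ compact_imp_bounded[OF that]])
        (use that in \<open>simp add: compact_imp_closed\<close>)
    show "integrable (lebesgue_on K) g" if "compact K" for K by (rule L2_loc_integrable[OF g(1) that])
    fix \<theta> :: "'a \<Rightarrow> real" and b :: 'a assume \<theta>: "\<theta> \<in> test_functions UNIV" and b: "b \<in> Basis"
    note \<theta>' = test_functions_frechet_derivative[OF \<theta> b]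
    obtain K where K: "compact K" "\<And>x. x \<notin> K \<Longrightarrow> frechet_derivative \<theta> (at x) b = 0"
      using \<theta>' by (rule test_functionsE) blast
    obtain m where m: "K \<subseteq> ball 0 (real m)" using in_ball[OF K(1)] by blast
    let ?d = "\<lambda>x. frechet_derivative \<theta> (at x) b"
    have ind: "(indicator (ball 0 (real m)) x *\<^sub>R v) \<bullet> ?d x = v * ?d x" for x and v :: real
      using K(2)[of x] m by (cases "x \<in> K") auto
    define \<theta>b where "\<theta>b x = \<theta> x *\<^sub>R b" for x
    have \<theta>bL: "\<theta>b \<in> L2 UNIV"
    proof (rule L2_bound[OF test_function_L2[OF \<theta>]])
      show "\<theta>b \<in> borel_measurable lebesgue" unfolding \<theta>b_def
        by (intro borel_measurable_scaleR borel_measurable_const L2_measurable test_function_L2[OF \<theta>])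
      show "AE x in lebesgue. norm (\<theta>b x) \<le> norm (\<theta> x)" using b by (intro AE_I2) (simp add: \<theta>b_def)
    qed
    \<comment> \<open>Both sides of the integration by parts are inner products with fixed classes,
      so the identity survives the limit. The indicator does no harm because the derivative of
      \<open>\<theta>\<close> is supported inside the ball.\<close>
    have L1: "(\<lambda>n. abs_l2 (f m n) \<bullet> abs_l2 ?d) \<longlonglongrightarrow> abs_l2 (\<lambda>x. indicator (ball 0 (real m)) x *\<^sub>R u x) \<bullet> abs_l2 ?d"
      by (intro tendsto_intros conjunct2[OF lim_u])
    have R1: "abs_l2 (\<lambda>x. indicator (ball 0 (real m)) x *\<^sub>R u x) \<bullet> abs_l2 ?d = (LINT x|lebesgue. u x * ?d x)"
      unfolding inner_abs_l2[OF conjunct1[OF lim_u] test_function_L2[OF \<theta>']] ind ..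
    have E: "abs_l2 (f m n) \<bullet> abs_l2 ?d = - (abs_l2 (grad (\<phi> (n + m))) \<bullet> abs_l2 \<theta>b)" for n
    proof -
      have "abs_l2 (f m n) \<bullet> abs_l2 ?d = (LINT x|lebesgue. \<psi> (n + m) x * ?d x)"
        unfolding inner_abs_l2[OF fL test_function_L2[OF \<theta>']] f_def ind ..
      also have "\<dots> = - (LINT x|lebesgue. (grad (\<psi> (n + m)) x \<bullet> b) * \<theta> x)"
        by (rule has_weak_gradient_test[OF has_weak_gradient_smooth[OF open_UNIV \<psi>s] open_UNIV \<theta> b])
      also have "\<dots> = - (LINT x|lebesgue. grad (\<phi> (n + m)) x \<bullet> \<theta>b x)"
        by (simp add: \<psi>_grad \<theta>b_def mult.commute)
      finally show ?thesis unfolding inner_abs_l2[OF grad_test_function_L2[OF \<phi>(1)] \<theta>bL] .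
    qed
    have L2: "(\<lambda>n. - (abs_l2 (grad (\<phi> (n + m))) \<bullet> abs_l2 \<theta>b)) \<longlonglongrightarrow> - (F \<bullet> abs_l2 \<theta>b)"
      by (intro tendsto_intros LIMSEQ_ignore_initial_segment[OF grad_lim])
    have "(LINT x|lebesgue. u x * ?d x) = - (F \<bullet> abs_l2 \<theta>b)"
      by (rule LIMSEQ_unique[OF L1[unfolded R1 E] L2])
    also have "F \<bullet> abs_l2 \<theta>b = (LINT x|lebesgue. (g x \<bullet> b) * \<theta> x)"
      unfolding g(2)[symmetric] inner_abs_l2[OF g(1) \<theta>bL] by (simp add: \<theta>b_def mult.commute)
    finally show "(LINT x|lebesgue. u x * ?d x) = - (LINT x|lebesgue. (g x \<bullet> b) * \<theta> x)" .
  qed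
  have BL: "u \<in> BL" by (rule BL_I[OF wg g(1) uL])
  have ug: "abs_l2 (weak_gradient UNIV u) = F"
    unfolding g(2)[symmetric] abs_l2_eq_iff[OF BL_D(2)[OF BL] g(1)] by (rule weak_gradient_AE_UNIV[OF wg])
  from ug BL show ?thesis by (rule bexI[where x = u])
qed

section \<open>The limit problem\<close>

lemma l2_monotone:
  fixes f g F G :: "'a::euclidean_space \<Rightarrow> 'b::euclidean_space"
  assumes L: "f \<in> L2 UNIV" "g \<in> L2 UNIV" "F \<in> L2 UNIV" "G \<in> L2 UNIV"
    and le: "AE x in lebesgue. c * (norm (f x - g x))\<^sup>2 \<le> (F x - G x) \<bullet> (f x - g x)"
  shows "c * (norm (abs_l2 f - abs_l2 g))\<^sup>2 \<le> (abs_l2 F - abs_l2 G) \<bullet> (abs_l2 f - abs_l2 g)"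
proof -
  note d = L2_diff[OF L(1,2)] and D = L2_diff[OF L(3,4)]
  have "c * (norm (abs_l2 f - abs_l2 g))\<^sup>2 = (LINT x|lebesgue. c * (norm (f x - g x))\<^sup>2)"
    unfolding diff_abs_l2[OF L(1,2)] norm_abs_l2_square[OF d] by simp
  also have "\<dots> \<le> (LINT x|lebesgue. (F x - G x) \<bullet> (f x - g x))"
  proof (rule integral_mono_AE[OF _ L2_inner_integrable[OF D d] le])
    show "integrable lebesgue (\<lambda>x. c * (norm (f x - g x))\<^sup>2)"
      using d unfolding L2_UNIV_iff by (intro integrable_mult_right) blast
  qed
  also have "\<dots> = (abs_l2 F - abs_l2 G) \<bullet> (abs_l2 f - abs_l2 g)"
    unfolding diff_abs_l2[OF L(1,2)] diff_abs_l2[OF L(3,4)] inner_abs_l2[OF D d] ..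
  finally show ?thesis .
qed

lemma l2_lipschitz:
  fixes f g :: "'a::euclidean_space \<Rightarrow> 'c::euclidean_space" and F G :: "'a \<Rightarrow> 'b::euclidean_space"
  assumes L: "f \<in> L2 UNIV" "g \<in> L2 UNIV" "F \<in> L2 UNIV" "G \<in> L2 UNIV" and c: "c \<ge> 0"
    and le: "AE x in lebesgue. norm (F x - G x) \<le> c * norm (f x - g x)"
  shows "norm (abs_l2 F - abs_l2 G) \<le> c * norm (abs_l2 f - abs_l2 g)"
proof (rule power2_le_imp_le)
  note d = L2_diff[OF L(1,2)] and D = L2_diff[OF L(3,4)]
  have "(norm (abs_l2 F - abs_l2 G))\<^sup>2 = (LINT x|lebesgue. (norm (F x - G x))\<^sup>2)"
    unfolding diff_abs_l2[OF L(3,4)] by (rule norm_abs_l2_square[OF D])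
  also have "\<dots> \<le> (LINT x|lebesgue. c\<^sup>2 * (norm (f x - g x))\<^sup>2)"
  proof (rule integral_mono_AE)
    show "integrable lebesgue (\<lambda>x. (norm (F x - G x))\<^sup>2)" using D unfolding L2_UNIV_iff by blast
    show "integrable lebesgue (\<lambda>x. c\<^sup>2 * (norm (f x - g x))\<^sup>2)"
      using d unfolding L2_UNIV_iff by (intro integrable_mult_right) blast
    show "AE x in lebesgue. (norm (F x - G x))\<^sup>2 \<le> c\<^sup>2 * (norm (f x - g x))\<^sup>2"
      using le
    proof eventually_elim
      case (elim x)
      then show ?case unfolding power_mult_distrib[symmetric] by (rule power_mono) simp
    qed
  qed
  also have "\<dots> = c\<^sup>2 * (norm (abs_l2 f - abs_l2 g))\<^sup>2"
    unfolding diff_abs_l2[OF L(1,2)] norm_abs_l2_square[OF d] by simp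
  finally show "(norm (abs_l2 F - abs_l2 G))\<^sup>2 \<le> (c * norm (abs_l2 f - abs_l2 g))\<^sup>2"
    by (simp add: power_mult_distrib)
qed (use c in simp)

lemma rep_abs_l2: "f \<in> L2 UNIV \<Longrightarrow> AE x in lebesgue. rep_l2 (abs_l2 f) x = f x"
  using abs_l2_eq_iff[OF rep_l2_L2] abs_rep_l2 by blast

text \<open>The zero field is also a weak gradient of a function that vanishes almost everywhere.
  This is what makes gradients independent of representatives.\<close>

lemma has_weak_gradient_AE_zero:
  assumes D: "open D" and w: "has_weak_gradient D w g" and z: "AE x in lebesgue_on D. w x = 0"
  shows "AE x in lebesgue_on D. g x = 0"
proof (rule has_weak_gradient_unique[OF D w])
  have "(LINT x|lebesgue_on D. w x * frechet_derivative \<phi> (at x) b) = - (LINT x|lebesgue_on D. (0 \<bullet> b) * \<phi> x)" for \<phi> b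
  proof -
    have "(LINT x|lebesgue_on D. w x * frechet_derivative \<phi> (at x) b) = 0"
    proof (rule integral_eq_zero_AE)
      show "AE x in lebesgue_on D. w x * frechet_derivative \<phi> (at x) b = 0" using z by eventually_elim simp
    qed
    then show ?thesis by simp
  qed
  then show "has_weak_gradient D w (\<lambda>x. 0)"
    using has_weak_gradientD(1)[OF w] unfolding has_weak_gradient_def by simp
qed

lemma has_weak_gradient_const: "open D \<Longrightarrow> has_weak_gradient D (\<lambda>x. c) (\<lambda>x. 0)"
  using has_weak_gradient_smooth[OF _ smooth_const[of c]] unfolding grad_const[abs_def] .

lemma BL_rel_gradient:
  fixes u v :: "'a::euclidean_space \<Rightarrow> real"
  assumes "(u, v) \<in> BL_rel"
  shows "AE x in lebesgue. weak_gradient UNIV u x = weak_gradient UNIV v x"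
proof -
  from assms obtain c where uv: "u \<in> BL" "v \<in> BL" "AE x in lebesgue. u x = v x + c"
    unfolding BL_rel_def by auto
  have "has_weak_gradient UNIV (\<lambda>x. (u x - v x) - c) (\<lambda>x. (weak_gradient UNIV u x - weak_gradient UNIV v x) - 0)"
    by (rule has_weak_gradient_diff[OF open_UNIV BL_diff(2)[OF uv(1,2)] has_weak_gradient_const[OF open_UNIV]])
  moreover have "AE x in lebesgue_on UNIV. (u x - v x) - c = 0"
    unfolding lebesgue_on_UNIV_eq using uv(3) by eventually_elim simp
  ultimately have "AE x in lebesgue_on UNIV. (weak_gradient UNIV u x - weak_gradient UNIV v x) - 0 = 0"
    by (rule has_weak_gradient_AE_zero[OF open_UNIV])
  then show ?thesis unfolding lebesgue_on_UNIV_eq by eventually_elim simp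
qed

lemma const_L2:
  assumes "S \<in> sets lebesgue" "bounded S"
  shows "(\<lambda>x. c) \<in> L2 S"
proof -
  have "S \<in> lmeasurable" using assms by (rule bounded_set_imp_lmeasurable[rotated])
  then have "integrable (lebesgue_on S) (\<lambda>x. (norm c)\<^sup>2)"
    by (intro finite_measure.integrable_const finite_measure_lebesgue_on)
  then show ?thesis unfolding L2_def by simp
qed

section \<open>Monotone two-phase fields and well-posedness of the limit problem\<close>

locale two_phase_field =
  fixes a1 a2 :: "'a::euclidean_space \<Rightarrow> 'a" and c1 c2 :: real
  assumes constants: "c1 > 0" "c2 > 0"
    and monotone: "\<And>x y. (a1 x - a1 y) \<bullet> (x - y) \<ge> c1 * (norm (x - y))\<^sup>2"
      "\<And>x y. (a2 x - a2 y) \<bullet> (x - y) \<ge> c1 * (norm (x - y))\<^sup>2"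
    and lipschitz: "\<And>x y. norm (a1 x - a1 y) \<le> c2 * norm (x - y)"
      "\<And>x y. norm (a2 x - a2 y) \<le> c2 * norm (x - y)"
begin

abbreviation phase :: "'a set \<Rightarrow> 'a \<Rightarrow> 'a \<Rightarrow> 'a" where
  "phase S \<equiv> two_phase a1 a2 S"

lemma phase_monotone: "(phase S x y - phase S x z) \<bullet> (y - z) \<ge> c1 * (norm (y - z))\<^sup>2"
  using monotone by (simp add: two_phase_def)

lemma phase_lipschitz: "norm (phase S x y - phase S x z) \<le> c2 * norm (y - z)"
  using lipschitz by (simp add: two_phase_def)

lemma phase_measurable:
  assumes S: "S \<in> sets lebesgue" and p: "p \<in> borel_measurable lebesgue"
  shows "(\<lambda>x. phase S x (p x)) \<in> borel_measurable lebesgue"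
proof -
  have cont: "continuous_on UNIV a" if "\<And>x y. norm (a x - a y) \<le> c2 * norm (x - y)" for a :: "'a \<Rightarrow> 'a"
    by (rule lipschitz_on_continuous_on[of c2]) (use that constants in \<open>simp add: lipschitz_on_def dist_norm\<close>)
  show ?thesis unfolding two_phase_def
    by (rule measurable_If_set)
      (use S in \<open>simp_all add: borel_measurable_continuous_on[OF cont[OF lipschitz(1)] p]
        borel_measurable_continuous_on[OF cont[OF lipschitz(2)] p]\<close>)
qed

text \<open>\<open>A\<^sub>\<omega>(x, F + U) - A\<^sub>\<omega>(x, U)\<close> plus the source term \<open>\<chi>\<^sub>\<omega> (a\<^sub>1(U) - a\<^sub>2(U))\<close>: the limit
  problem asks that this field be orthogonal to all gradients.\<close>

definition limit_field :: "'a set \<Rightarrow> 'a \<Rightarrow> ('a \<Rightarrow> 'a) \<Rightarrow> 'a \<Rightarrow> 'a" where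
  "limit_field S U F x = phase S x (F x + U) - a2 U"

lemma limit_field_eq:
  "limit_field S U F x = (phase S x (F x + U) - phase S x U) + indicator S x *\<^sub>R (a1 U - a2 U)"
  by (simp add: limit_field_def two_phase_def)

lemma limit_field_monotone:
  "(limit_field S U F x - limit_field S U G x) \<bullet> (F x - G x) \<ge> c1 * (norm (F x - G x))\<^sup>2"
  using phase_monotone[of "F x + U" "G x + U" S x] by (simp add: limit_field_def)

lemma limit_field_lipschitz: "norm (limit_field S U F x - limit_field S U G x) \<le> c2 * norm (F x - G x)"
  using phase_lipschitz[of S x "F x + U" "G x + U"] by (simp add: limit_field_def)

context
  fixes S :: "'a set"
  assumes S: "S \<in> sets lebesgue" "bounded S"
begin

lemma source_L2: "(\<lambda>x. indicator S x *\<^sub>R c) \<in> L2 UNIV" for c :: 'a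
  unfolding L2_indicator_iff[OF S(1)] by (rule const_L2[OF S])

text \<open>A constant flux is not square integrable on the whole space, so the form of the field
  matters: the difference to the flux at \<open>U\<close> is dominated by \<open>c2\<close> times
  \<open>F\<close>, and the source lives on the bounded set \<open>S\<close>.\<close>

lemma limit_field_L2:
  assumes F: "F \<in> L2 UNIV"
  shows "limit_field S U F \<in> L2 UNIV"
proof -
  have Fm: "(\<lambda>x. F x + U) \<in> borel_measurable lebesgue"
    by (rule borel_measurable_add[OF L2_measurable[OF F]]) simp
  have m: "(\<lambda>x. phase S x (F x + U) - phase S x U) \<in> borel_measurable lebesgue"
    by (rule borel_measurable_diff[OF phase_measurable[OF S(1) Fm] phase_measurable[OF S(1)]]) simp
  have "(\<lambda>x. phase S x (F x + U) - phase S x U) \<in> L2 UNIV"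
  proof (rule L2_bound[OF L2_scaleR[OF F, of c2] m], rule AE_I2)
    fix x
    show "norm (phase S x (F x + U) - phase S x U) \<le> norm (c2 *\<^sub>R F x)"
      using phase_lipschitz[of S x "F x + U" U] constants by simp
  qed
  from L2_add[OF this source_L2] show ?thesis unfolding limit_field_eq[abs_def] .
qed

text \<open>The pointwise monotonicity and Lipschitz bounds integrate with the same constants.
  Representatives are chosen because the field acts on functions rather than on classes.\<close>

lemma limit_problem_l2:
  "\<exists>k\<in>closure test_gradients. \<forall>s\<in>closure test_gradients. abs_l2 (limit_field S U (rep_l2 k)) \<bullet> s = 0"
proof (rule strongly_monotone_solution[OF subspace_closure_inner closed_closure constants])
  show "subspace (test_gradients :: ('a, 'a) l2 set)"
    unfolding test_gradients_def by (rule subspace_abs_l2_grad)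
  fix F G :: "('a, 'a) l2"
  note L = rep_l2_L2[of F] rep_l2_L2[of G] limit_field_L2[OF rep_l2_L2] limit_field_L2[OF rep_l2_L2]
  show "c1 * norm (F - G) ^ 2 \<le>
      (abs_l2 (limit_field S U (rep_l2 F)) - abs_l2 (limit_field S U (rep_l2 G))) \<bullet> (F - G)"
    using l2_monotone[OF L AE_I2[OF limit_field_monotone]] unfolding abs_rep_l2 .
  show "norm (abs_l2 (limit_field S U (rep_l2 F)) - abs_l2 (limit_field S U (rep_l2 G))) \<le> c2 * norm (F - G)"
    using l2_lipschitz[OF L less_imp_le[OF constants(2)] AE_I2[OF limit_field_lipschitz]] unfolding abs_rep_l2 .
qed

lemma BL_dot_gradient_L2: "K \<in> BL_dot \<Longrightarrow> BL_dot_gradient K \<in> L2 UNIV"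
  unfolding BL_dot_gradient_def by (rule BL_D(2)[OF BL_dot_representative(1)])

text \<open>Moving the source to the left is legitimate because both fields are separately square
  integrable. The problem thereby becomes a pure orthogonality relation.\<close>

lemma limit_solution_iff:
  "limit_solution a1 a2 S U K \<longleftrightarrow> K \<in> BL_dot \<and>
    (\<forall>\<phi>\<in>BL. (LINT x|lebesgue. limit_field S U (BL_dot_gradient K) x \<bullet> weak_gradient UNIV \<phi> x) = 0)"
proof -
  have "((LINT x|lebesgue. (phase S x (BL_dot_gradient K x + U) - phase S x U) \<bullet> weak_gradient UNIV \<phi> x)
      = - (LINT x|lebesgue_on S. (a1 U - a2 U) \<bullet> weak_gradient UNIV \<phi> x))
    \<longleftrightarrow> (LINT x|lebesgue. limit_field S U (BL_dot_gradient K) x \<bullet> weak_gradient UNIV \<phi> x) = 0"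
    if K: "K \<in> BL_dot" and \<phi>: "\<phi> \<in> BL" for \<phi>
  proof -
    note L = limit_field_L2[OF BL_dot_gradient_L2[OF K], of U] and G = BL_D(2)[OF \<phi>]
    have "(phase S x (BL_dot_gradient K x + U) - phase S x U) \<bullet> weak_gradient UNIV \<phi> x
        = limit_field S U (BL_dot_gradient K) x \<bullet> weak_gradient UNIV \<phi> x
          - (indicator S x *\<^sub>R (a1 U - a2 U)) \<bullet> weak_gradient UNIV \<phi> x" for x
      unfolding limit_field_eq by (simp add: inner_add_left)
    then have "(LINT x|lebesgue. (phase S x (BL_dot_gradient K x + U) - phase S x U) \<bullet> weak_gradient UNIV \<phi> x)
        = (LINT x|lebesgue. limit_field S U (BL_dot_gradient K) x \<bullet> weak_gradient UNIV \<phi> x)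
          - (LINT x|lebesgue. (indicator S x *\<^sub>R (a1 U - a2 U)) \<bullet> weak_gradient UNIV \<phi> x)"
      by (simp only: Bochner_Integration.integral_diff[OF L2_inner_integrable[OF L G] L2_inner_integrable[OF source_L2 G]])
    moreover have "(LINT x|lebesgue_on S. (a1 U - a2 U) \<bullet> weak_gradient UNIV \<phi> x)
        = (LINT x|lebesgue. (indicator S x *\<^sub>R (a1 U - a2 U)) \<bullet> weak_gradient UNIV \<phi> x)"
      unfolding integral_lebesgue_on[OF S(1)] inner_scaleR_left real_scaleR_def ..
    ultimately show ?thesis by linarith
  qed
  then show ?thesis unfolding limit_solution_def by blast
qed

text \<open>The difference of two representatives is itself an admissible test. Strong monotonicity
  makes their gradients equal, so the representatives differ by a constant, which is exactly
  equality in the quotient.\<close>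

lemma limit_solution_unique:
  assumes "limit_solution a1 a2 S U K" "limit_solution a1 a2 S U K'"
  shows "K = K'"
proof -
  have K: "K \<in> BL_dot" "K' \<in> BL_dot" using assms by (simp_all add: limit_solution_iff)
  define u v where "u = (SOME u. u \<in> K)" and "v = (SOME u. u \<in> K')"
  have uv: "u \<in> BL" "K = BL_rel `` {u}" "v \<in> BL" "K' = BL_rel `` {v}"
    unfolding u_def v_def by (rule BL_dot_representative[OF K(1)] BL_dot_representative[OF K(2)])+
  let ?g = "BL_dot_gradient K" and ?h = "BL_dot_gradient K'"
  let ?d = "\<lambda>x. u x - v x"
  note gL = BL_dot_gradient_L2[OF K(1)] and hL = BL_dot_gradient_L2[OF K(2)]
  note G = limit_field_L2[OF gL, of U] and H = limit_field_L2[OF hL, of U]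
  note d = BL_diff[OF uv(1,3)]
  have wd: "has_weak_gradient UNIV ?d (\<lambda>x. ?g x - ?h x)"
    using d(2) unfolding BL_dot_gradient_def u_def v_def .
  note W = BL_D(2)[OF d(1)]
  have eq: "abs_l2 (weak_gradient UNIV ?d) = abs_l2 ?g - abs_l2 ?h"
    unfolding diff_abs_l2[OF gL hL] abs_l2_eq_iff[OF W L2_diff[OF gL hL]] by (rule weak_gradient_AE_UNIV[OF wd])
  have "(LINT x|lebesgue. limit_field S U ?g x \<bullet> weak_gradient UNIV ?d x) = 0"
    "(LINT x|lebesgue. limit_field S U ?h x \<bullet> weak_gradient UNIV ?d x) = 0"
    using assms d(1) unfolding limit_solution_iff by simp_all
  then have "abs_l2 (limit_field S U ?g) \<bullet> (abs_l2 ?g - abs_l2 ?h) = 0"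
    "abs_l2 (limit_field S U ?h) \<bullet> (abs_l2 ?g - abs_l2 ?h) = 0"
    unfolding eq[symmetric] inner_abs_l2[OF G W] inner_abs_l2[OF H W] .
  then have "c1 * (norm (abs_l2 ?g - abs_l2 ?h))\<^sup>2 \<le> 0"
    using l2_monotone[OF gL hL G H AE_I2[OF limit_field_monotone]] by (simp only: inner_diff_left)
  then have "abs_l2 ?g = abs_l2 ?h" using constants by (simp add: mult_le_0_iff)
  then have "AE x in lebesgue. ?g x = ?h x" unfolding abs_l2_eq_iff[OF gL hL] .
  then have "AE x in lebesgue. ?g x - ?h x = 0" by eventually_elim simp
  from has_weak_gradient_zero_constant[OF wd this] obtain c where "AE x in lebesgue. u x - v x = c" by blast
  then have "AE x in lebesgue. u x = v x + c" by eventually_elim simp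
  then have "(u, v) \<in> BL_rel" using uv unfolding BL_rel_def by blast
  then show ?thesis unfolding uv(2) uv(4) by (rule equiv_class_eq[OF equiv_BL_rel])
qed

text \<open>The abstract solution is orthogonal to gradients of test functions only;
  \<open>orthogonal_to_weak_gradient\<close> extends this to all of \<open>BL\<close>. The class
  \<open>k\<close> and its properties are exported as well, because the convergence proof works with
  it directly.\<close>

lemma limit_solution_exists:
  "\<exists>k K. (\<forall>s\<in>closure test_gradients. abs_l2 (limit_field S U (rep_l2 k)) \<bullet> s = 0)
    \<and> k \<in> closure test_gradients \<and> limit_solution a1 a2 S U K \<and> abs_l2 (BL_dot_gradient K) = k"
proof -
  obtain k where k: "k \<in> closure test_gradients"
    "\<forall>s\<in>closure test_gradients. abs_l2 (limit_field S U (rep_l2 k)) \<bullet> s = 0"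
    using limit_problem_l2[of U] by blast
  obtain w where w: "w \<in> BL" "abs_l2 (weak_gradient UNIV w) = k"
    using closure_gradients_imp_BL[OF k(1)] by blast
  define K where "K = BL_rel `` {w}"
  have K: "K \<in> BL_dot" unfolding K_def BL_dot_def by (rule quotientI[OF w(1)])
  note gL = BL_dot_gradient_L2[OF K]
  have "w \<in> K" unfolding K_def using equiv_class_self[OF equiv_BL_rel w(1)] .
  then have "(SOME u. u \<in> K) \<in> K" by (rule someI[where P = "\<lambda>u. u \<in> K"])
  then have "(w, SOME u. u \<in> K) \<in> BL_rel" unfolding K_def by simp
  from BL_rel_gradient[OF this] have "AE x in lebesgue. weak_gradient UNIV w x = BL_dot_gradient K x"
    unfolding BL_dot_gradient_def .
  then have gk: "abs_l2 (BL_dot_gradient K) = k"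
    unfolding w(2)[symmetric] using abs_l2_eq_iff[OF BL_D(2)[OF w(1)] gL] by simp
  have AE_k: "AE x in lebesgue. rep_l2 k x = BL_dot_gradient K x"
    using rep_abs_l2[OF gL] unfolding gk .
  note L = limit_field_L2[OF rep_l2_L2, of U k] and G = limit_field_L2[OF gL, of U]
  have Nk: "abs_l2 (limit_field S U (rep_l2 k)) = abs_l2 (limit_field S U (BL_dot_gradient K))"
    unfolding abs_l2_eq_iff[OF L G] using AE_k by eventually_elim (simp add: limit_field_def)
  have "(LINT x|lebesgue. limit_field S U (BL_dot_gradient K) x \<bullet> weak_gradient UNIV \<phi> x) = 0" if \<phi>: "\<phi> \<in> BL" for \<phi>
  proof (rule orthogonal_to_weak_gradient[OF G _ BL_D(1)[OF \<phi>] BL_D(2)[OF \<phi>]])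
    fix \<psi> :: "'a \<Rightarrow> real" assume \<psi>: "\<psi> \<in> test_functions UNIV"
    then have "abs_l2 (grad \<psi>) \<in> closure test_gradients"
      unfolding test_gradients_def by (intro subsetD[OF closure_subset] imageI)
    then have "abs_l2 (limit_field S U (BL_dot_gradient K)) \<bullet> abs_l2 (grad \<psi>) = 0"
      using k(2) unfolding Nk by blast
    then show "(LINT x|lebesgue. limit_field S U (BL_dot_gradient K) x \<bullet> grad \<psi> x) = 0"
      unfolding inner_abs_l2[OF G grad_test_function_L2[OF \<psi>]] .
  qed
  then have "limit_solution a1 a2 S U K" unfolding limit_solution_iff using K by blast
  then show ?thesis using k gk by blast
qed

end

end

section \<open>Dilations\<close>

lemma lebesgue_scale:
  fixes c :: real
  assumes "c \<noteq> 0"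
  shows "(lebesgue :: 'a::euclidean_space measure)
    = density (distr lebesgue lebesgue (\<lambda>x. c *\<^sub>R x)) (\<lambda>x. ennreal (\<bar>c\<bar> ^ DIM('a)))"
proof -
  have T: "(\<lambda>x::'a. 0 + (\<Sum>j\<in>Basis. (c * (x \<bullet> j)) *\<^sub>R j)) = (\<lambda>x. c *\<^sub>R x)"
    unfolding scaleR_scaleR[symmetric] scaleR_sum_right[symmetric] euclidean_representation by simp
  have P: "(\<Prod>j\<in>(Basis::'a set). \<bar>c\<bar>) = \<bar>c\<bar> ^ DIM('a)" by simp
  show ?thesis
    using lebesgue_affine_euclidean[of "\<lambda>_. c" "0::'a"] assms unfolding T P by simp
qed

lemma AE_lebesgue_scale:
  fixes P :: "'a::euclidean_space \<Rightarrow> bool"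
  assumes c: "c \<noteq> 0" and P: "AE x in lebesgue. P x"
  shows "AE x in lebesgue. P (c *\<^sub>R x)"
proof -
  let ?D = "distr lebesgue lebesgue (\<lambda>x::'a. c *\<^sub>R x)"
  have "AE x in density ?D (\<lambda>x. ennreal (\<bar>c\<bar> ^ DIM('a))). P x"
    using P unfolding lebesgue_scale[OF c, symmetric] .
  then have "AE x in ?D. 0 < ennreal (\<bar>c\<bar> ^ DIM('a)) \<longrightarrow> P x"
    by (subst (asm) AE_density) simp_all
  then have "AE x in ?D. P x" using c by simp
  then show ?thesis by (rule AE_distrD[OF lebesgue_measurable_scaling])
qed

lemma
  fixes f :: "'a::euclidean_space \<Rightarrow> real"
  assumes c: "c \<noteq> 0" and f: "f \<in> borel_measurable lebesgue"
  shows integral_lebesgue_scale: "(LINT x|lebesgue. f x) = \<bar>c\<bar> ^ DIM('a) * (LINT x|lebesgue. f (c *\<^sub>R x))"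
    and integrable_lebesgue_scale: "integrable lebesgue f \<longleftrightarrow> integrable lebesgue (\<lambda>x. f (c *\<^sub>R x))"
proof -
  let ?D = "distr lebesgue lebesgue (\<lambda>x::'a. c *\<^sub>R x)"
  let ?p = "\<bar>c\<bar> ^ DIM('a)"
  have fD: "f \<in> borel_measurable ?D" using f by simp
  have "(LINT x|lebesgue. f x) = (LINT x|density ?D (\<lambda>x. ennreal ?p). f x)"
    unfolding lebesgue_scale[OF c, symmetric] ..
  also have "\<dots> = (LINT x|?D. ?p *\<^sub>R f x)" by (rule integral_density[OF fD]) simp_all
  also have "\<dots> = ?p * (LINT x|?D. f x)" by simp
  also have "(LINT x|?D. f x) = (LINT x|lebesgue. f (c *\<^sub>R x))"
    by (rule integral_distr[OF lebesgue_measurable_scaling f])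
  finally show "(LINT x|lebesgue. f x) = ?p * (LINT x|lebesgue. f (c *\<^sub>R x))" .
  have "integrable lebesgue f \<longleftrightarrow> integrable (density ?D (\<lambda>x. ennreal ?p)) f"
    unfolding lebesgue_scale[OF c, symmetric] ..
  also have "\<dots> \<longleftrightarrow> integrable ?D (\<lambda>x. ?p *\<^sub>R f x)" by (rule integrable_density[OF fD]) simp_all
  also have "\<dots> \<longleftrightarrow> integrable ?D f" using c by simp
  also have "\<dots> \<longleftrightarrow> integrable lebesgue (\<lambda>x. f (c *\<^sub>R x))"
    by (rule integrable_distr_eq[OF lebesgue_measurable_scaling f])
  finally show "integrable lebesgue f \<longleftrightarrow> integrable lebesgue (\<lambda>x. f (c *\<^sub>R x))" .
qed

lemma measurable_lebesgue_scale:
  assumes "f \<in> borel_measurable lebesgue" shows "(\<lambda>x. f (c *\<^sub>R x)) \<in> borel_measurable lebesgue"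
  by (rule measurable_compose[OF lebesgue_measurable_scaling assms])

lemma L2_scale:
  fixes f :: "'a::euclidean_space \<Rightarrow> 'b::euclidean_space"
  assumes c: "c \<noteq> 0" and f: "f \<in> L2 UNIV"
  shows "(\<lambda>x. f (c *\<^sub>R x)) \<in> L2 UNIV"
proof -
  have "(\<lambda>x. (norm (f x))\<^sup>2) \<in> borel_measurable lebesgue"
    using f unfolding L2_UNIV_iff by (intro borel_measurable_integrable) blast
  from integrable_lebesgue_scale[OF c this] show ?thesis
    using f measurable_lebesgue_scale[OF L2_measurable[OF f]] unfolding L2_UNIV_iff by simp
qed

text \<open>A dilation multiplies all inner products by the same factor. Orthogonality of fluxes and
  gradients on \<open>D\<close> therefore carries over to the rescaled fields.\<close>

lemma inner_l2_scale:
  fixes f g :: "'a::euclidean_space \<Rightarrow> 'b::euclidean_space"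
  assumes c: "c \<noteq> 0" and f: "f \<in> L2 UNIV" and g: "g \<in> L2 UNIV"
  shows "abs_l2 f \<bullet> abs_l2 g = \<bar>c\<bar> ^ DIM('a) * (abs_l2 (\<lambda>x. f (c *\<^sub>R x)) \<bullet> abs_l2 (\<lambda>x. g (c *\<^sub>R x)))"
  unfolding inner_abs_l2[OF f g] inner_abs_l2[OF L2_scale[OF c f] L2_scale[OF c g]]
  by (rule integral_lebesgue_scale[OF c borel_measurable_integrable[OF L2_inner_integrable[OF f g]]])

lemma tendsto_l2_scale:
  fixes f :: "nat \<Rightarrow> 'a::euclidean_space \<Rightarrow> 'b::euclidean_space"
  assumes c: "c \<noteq> 0" and f: "\<And>n. f n \<in> L2 UNIV" and g: "g \<in> L2 UNIV"
    and lim: "(\<lambda>n. abs_l2 (f n)) \<longlonglongrightarrow> abs_l2 g"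
  shows "(\<lambda>n. abs_l2 (\<lambda>x. f n (c *\<^sub>R x))) \<longlonglongrightarrow> abs_l2 (\<lambda>x. g (c *\<^sub>R x))"
proof -
  let ?p = "\<bar>c\<bar> ^ DIM('a)"
  let ?d = "\<lambda>n. abs_l2 (\<lambda>x. f n (c *\<^sub>R x)) - abs_l2 (\<lambda>x. g (c *\<^sub>R x))"
  have p: "?p > 0" using c by simp
  have eq: "norm (?d n) = norm (abs_l2 (f n) - abs_l2 g) / sqrt ?p" for n
  proof -
    note d = L2_diff[OF f[of n] g]
    have dd: "?d n = abs_l2 (\<lambda>x. f n (c *\<^sub>R x) - g (c *\<^sub>R x))"
      by (rule diff_abs_l2[OF L2_scale[OF c f] L2_scale[OF c g]])
    have "(norm (abs_l2 (f n) - abs_l2 g))\<^sup>2 = ?p * (norm (?d n))\<^sup>2"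
      unfolding dd diff_abs_l2[OF f g] power2_norm_eq_inner by (rule inner_l2_scale[OF c d d])
    then have "sqrt ((norm (abs_l2 (f n) - abs_l2 g))\<^sup>2) = sqrt (?p * (norm (?d n))\<^sup>2)" by (rule arg_cong)
    then have "norm (abs_l2 (f n) - abs_l2 g) = sqrt ?p * norm (?d n)"
      unfolding real_sqrt_mult by simp
    then show ?thesis using p by (simp add: field_simps)
  qed
  have "(\<lambda>n. norm (abs_l2 (f n) - abs_l2 g)) \<longlonglongrightarrow> 0"
    using lim by (intro tendsto_norm_zero LIM_zero)
  then have "(\<lambda>n. norm (abs_l2 (f n) - abs_l2 g) / sqrt ?p) \<longlonglongrightarrow> 0 / sqrt ?p"
    by (rule tendsto_divide[OF _ tendsto_const]) (use c in simp)
  then have "(\<lambda>n. norm (?d n)) \<longlonglongrightarrow> 0" unfolding eq by simp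
  then show ?thesis by (rule LIM_zero_cancel[OF tendsto_norm_zero_cancel])
qed

text \<open>Closedness of the weak gradient: for a fixed test function both sides of integration by
  parts are continuous on \<open>l2\<close>.\<close>

lemma has_weak_gradient_l2_limit:
  fixes \<psi> :: "nat \<Rightarrow> 'a::euclidean_space \<Rightarrow> real"
  assumes \<psi>: "\<And>n. \<psi> n \<in> test_functions UNIV" and s: "s \<in> L2 UNIV" and k: "k \<in> L2 UNIV"
    and lim: "(\<lambda>n. abs_l2 (\<psi> n)) \<longlonglongrightarrow> abs_l2 s" "(\<lambda>n. abs_l2 (grad (\<psi> n))) \<longlonglongrightarrow> abs_l2 k"
  shows "has_weak_gradient UNIV s k"
proof (rule has_weak_gradientI[OF open_UNIV])
  show "integrable (lebesgue_on K) s" if "compact K" for K by (rule L2_loc_integrable[OF s that])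
  show "integrable (lebesgue_on K) k" if "compact K" for K by (rule L2_loc_integrable[OF k that])
  fix \<theta> :: "'a \<Rightarrow> real" and b :: 'a assume \<theta>: "\<theta> \<in> test_functions UNIV" and b: "b \<in> Basis"
  note \<theta>' = test_functions_frechet_derivative[OF \<theta> b]
  let ?d = "\<lambda>x. frechet_derivative \<theta> (at x) b"
  define \<theta>b where "\<theta>b x = \<theta> x *\<^sub>R b" for x
  have \<theta>bL: "\<theta>b \<in> L2 UNIV"
  proof (rule L2_bound[OF test_function_L2[OF \<theta>]])
    show "\<theta>b \<in> borel_measurable lebesgue" unfolding \<theta>b_def
      by (intro borel_measurable_scaleR borel_measurable_const L2_measurable test_function_L2[OF \<theta>])
    show "AE x in lebesgue. norm (\<theta>b x) \<le> norm (\<theta> x)" using b by (intro AE_I2) (simp add: \<theta>b_def)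
  qed
  have E: "abs_l2 (\<psi> n) \<bullet> abs_l2 ?d = - (abs_l2 (grad (\<psi> n)) \<bullet> abs_l2 \<theta>b)" for n
  proof -
    have "abs_l2 (\<psi> n) \<bullet> abs_l2 ?d = (LINT x|lebesgue. \<psi> n x * ?d x)"
      unfolding inner_abs_l2[OF test_function_L2[OF \<psi>] test_function_L2[OF \<theta>']] by simp
    also have "\<dots> = - (LINT x|lebesgue. (grad (\<psi> n) x \<bullet> b) * \<theta> x)"
      by (rule has_weak_gradient_test[OF has_weak_gradient_smooth[OF open_UNIV test_functions_smooth[OF \<psi>]] open_UNIV \<theta> b])
    also have "\<dots> = - (LINT x|lebesgue. grad (\<psi> n) x \<bullet> \<theta>b x)" by (simp add: \<theta>b_def mult.commute)
    finally show ?thesis unfolding inner_abs_l2[OF grad_test_function_L2[OF \<psi>] \<theta>bL] .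
  qed
  have L1: "(\<lambda>n. abs_l2 (\<psi> n) \<bullet> abs_l2 ?d) \<longlonglongrightarrow> abs_l2 s \<bullet> abs_l2 ?d"
    by (intro tendsto_intros lim)
  have L2: "(\<lambda>n. - (abs_l2 (grad (\<psi> n)) \<bullet> abs_l2 \<theta>b)) \<longlonglongrightarrow> - (abs_l2 k \<bullet> abs_l2 \<theta>b)"
    by (intro tendsto_intros lim)
  have "abs_l2 s \<bullet> abs_l2 ?d = - (abs_l2 k \<bullet> abs_l2 \<theta>b)" by (rule LIMSEQ_unique[OF L1[unfolded E] L2])
  then show "(LINT x|lebesgue. s x * ?d x) = - (LINT x|lebesgue. (k x \<bullet> b) * \<theta> x)"
    unfolding inner_abs_l2[OF s test_function_L2[OF \<theta>']] inner_abs_l2[OF k \<theta>bL]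
    by (simp add: \<theta>b_def mult.commute)
qed

section \<open>The perturbed problems\<close>

abbreviation zero_ext :: "'a::euclidean_space set \<Rightarrow> ('a \<Rightarrow> 'b::real_vector) \<Rightarrow> 'a \<Rightarrow> 'b" where
  "zero_ext D f \<equiv> \<lambda>x. indicator D x *\<^sub>R f x"

lemma zero_ext_test_function:
  assumes "\<phi> \<in> test_functions D"
  shows "zero_ext D \<phi> = \<phi>" "zero_ext D (grad \<phi>) = grad \<phi>"
proof -
  obtain K where K: "K \<subseteq> D" "\<And>x. x \<notin> K \<Longrightarrow> \<phi> x = 0" "\<And>x. x \<notin> K \<Longrightarrow> grad \<phi> x = 0"
    using assms by (rule grad_test_function_support) (rule that)
  show "zero_ext D \<phi> = \<phi>"
    by (rule ext) (use K in \<open>auto simp: indicator_def\<close>)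
  show "zero_ext D (grad \<phi>) = grad \<phi>"
    by (rule ext) (use K in \<open>auto simp: indicator_def\<close>)
qed

lemma weak_gradient_test_function:
  assumes "open D" "\<phi> \<in> test_functions D"
  shows "AE x in lebesgue_on D. weak_gradient D \<phi> x = grad \<phi> x"
  by (rule weak_gradient_AE[OF assms(1) has_weak_gradient_smooth[OF assms(1) test_functions_smooth[OF assms(2)]]])

lemma H1_0_D:
  fixes u :: "'a::euclidean_space \<Rightarrow> real"
  assumes D: "open D" and u: "u \<in> H1_0 D"
  shows "has_weak_gradient D u (weak_gradient D u)" "zero_ext D u \<in> L2 UNIV"
    "zero_ext D (weak_gradient D u) \<in> L2 UNIV"
proof -
  have Dl: "D \<in> sets lebesgue" using D by simp
  obtain g where g: "u \<in> L2 D" "g \<in> L2 D" "has_weak_gradient D u g"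
    using u unfolding H1_0_def H1_def by blast
  show "has_weak_gradient D u (weak_gradient D u)" by (rule has_weak_gradient_weak_gradient[OF g(3)])
  show "zero_ext D u \<in> L2 UNIV" unfolding L2_indicator_iff[OF Dl] by (rule g(1))
  have gL: "zero_ext D g \<in> L2 UNIV" unfolding L2_indicator_iff[OF Dl] by (rule g(2))
  have "AE x in lebesgue. x \<in> D \<longrightarrow> weak_gradient D u x = g x"
    using weak_gradient_AE[OF D g(3)] unfolding AE_lebesgue_on[OF Dl] .
  then have eq: "AE x in lebesgue. zero_ext D g x = zero_ext D (weak_gradient D u) x"
    by eventually_elim (auto simp: indicator_def)
  show "zero_ext D (weak_gradient D u) \<in> L2 UNIV"
    by (rule L2_cong_AE[OF gL borel_measurable_AE[OF L2_measurable[OF gL] eq] eq])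
qed

text \<open>Test functions of \<open>D\<close> vanish off \<open>D\<close> on the whole space, so
  their distance to the extension by zero is the distance on \<open>D\<close>. Both summands in
  \<open>H1_norm\<close> then give convergence of classes over the whole space.\<close>

lemma H1_0_approx:
  fixes u :: "'a::euclidean_space \<Rightarrow> real"
  assumes D: "open D" and u: "u \<in> H1_0 D"
  shows "\<exists>\<phi>. (\<forall>n. \<phi> n \<in> test_functions D) \<and> (\<lambda>n. abs_l2 (\<phi> n)) \<longlonglongrightarrow> abs_l2 (zero_ext D u) \<and>
    (\<lambda>n. abs_l2 (grad (\<phi> n))) \<longlonglongrightarrow> abs_l2 (zero_ext D (weak_gradient D u))"
proof -
  have Dl: "D \<in> sets lebesgue" using D by simp
  note U = H1_0_D[OF D u]
  obtain \<phi> :: "nat \<Rightarrow> 'a \<Rightarrow> real" where \<phi>: "\<forall>n. \<phi> n \<in> test_functions D"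
    and lim: "(\<lambda>n. H1_norm D (\<lambda>x. \<phi> n x - u x)) \<longlonglongrightarrow> 0"
    using u unfolding H1_0_def by blast
  note \<phi> = spec[OF \<phi>]
  have n1: "norm (abs_l2 (\<phi> n) - abs_l2 (zero_ext D u)) \<le> H1_norm D (\<lambda>x. \<phi> n x - u x)" for n
  proof -
    have eq: "(\<lambda>x. \<phi> n x - zero_ext D u x) = zero_ext D (\<lambda>x. \<phi> n x - u x)"
      by (subst zero_ext_test_function(1)[OF \<phi>, symmetric]) (simp add: right_diff_distrib)
    have L: "zero_ext D (\<lambda>x. \<phi> n x - u x) \<in> L2 UNIV"
      using L2_diff[OF test_function_L2[OF \<phi>[of n]] U(2)] unfolding eq .
    then have "L2_norm D (\<lambda>x. \<phi> n x - u x) = norm (abs_l2 (zero_ext D (\<lambda>x. \<phi> n x - u x)))"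
      unfolding L2_indicator_iff[OF Dl] by (rule L2_norm_indicator[OF Dl])
    then have "norm (abs_l2 (\<phi> n) - abs_l2 (zero_ext D u)) = L2_norm D (\<lambda>x. \<phi> n x - u x)"
      unfolding diff_abs_l2[OF test_function_L2[OF \<phi>] U(2)] eq by simp
    also have "\<dots> \<le> H1_norm D (\<lambda>x. \<phi> n x - u x)" unfolding H1_norm_def by (rule real_sqrt_sum_squares_ge1)
    finally show ?thesis .
  qed
  have n2: "norm (abs_l2 (grad (\<phi> n)) - abs_l2 (zero_ext D (weak_gradient D u))) \<le> H1_norm D (\<lambda>x. \<phi> n x - u x)" for n
  proof -
    let ?W = "weak_gradient D (\<lambda>x. \<phi> n x - u x)"
    note GL = L2_diff[OF grad_test_function_L2[OF \<phi>] U(3)]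
    have "has_weak_gradient D (\<lambda>x. \<phi> n x - u x) (\<lambda>x. grad (\<phi> n) x - weak_gradient D u x)"
      by (rule has_weak_gradient_diff[OF D has_weak_gradient_smooth[OF D test_functions_smooth[OF \<phi>]] U(1)])
    from weak_gradient_AE[OF D this]
    have ae: "AE x in lebesgue. x \<in> D \<longrightarrow> ?W x = grad (\<phi> n) x - weak_gradient D u x"
      unfolding AE_lebesgue_on[OF Dl] .
    have eq: "AE x in lebesgue. grad (\<phi> n) x - zero_ext D (weak_gradient D u) x = zero_ext D ?W x"
      using ae
    proof eventually_elim
      case (elim x)
      have "grad (\<phi> n) x = zero_ext D (grad (\<phi> n)) x" 
        by (rule fun_cong[OF zero_ext_test_function(2)[OF \<phi>[of n], symmetric]])
      then show ?case using elim by (cases "x \<in> D") simp_all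
    qed
    have L: "zero_ext D ?W \<in> L2 UNIV"
      by (rule L2_cong_AE[OF GL borel_measurable_AE[OF L2_measurable[OF GL] eq] eq])
    then have "L2_norm D ?W = norm (abs_l2 (zero_ext D ?W))"
      unfolding L2_indicator_iff[OF Dl] by (rule L2_norm_indicator[OF Dl])
    moreover have "abs_l2 (grad (\<phi> n)) - abs_l2 (zero_ext D (weak_gradient D u)) = abs_l2 (zero_ext D ?W)"
      unfolding diff_abs_l2[OF grad_test_function_L2[OF \<phi>] U(3)] abs_l2_eq_iff[OF GL L] by (rule eq)
    ultimately have "norm (abs_l2 (grad (\<phi> n)) - abs_l2 (zero_ext D (weak_gradient D u))) = L2_norm D ?W"
      by simp
    also have "\<dots> \<le> H1_norm D (\<lambda>x. \<phi> n x - u x)" unfolding H1_norm_def by (rule real_sqrt_sum_squares_ge2)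
    finally show ?thesis .
  qed
  show ?thesis
  proof (intro exI[of _ \<phi>] conjI allI)
    show "\<phi> n \<in> test_functions D" for n by (rule \<phi>)
    show "(\<lambda>n. abs_l2 (\<phi> n)) \<longlonglongrightarrow> abs_l2 (zero_ext D u)"
      by (rule LIM_zero_cancel[OF Lim_null_comparison[OF always_eventually[OF allI] lim]]) (rule n1)
    show "(\<lambda>n. abs_l2 (grad (\<phi> n))) \<longlonglongrightarrow> abs_l2 (zero_ext D (weak_gradient D u))"
      by (rule LIM_zero_cancel[OF Lim_null_comparison[OF always_eventually[OF allI] lim]]) (rule n2)
  qed
qed

text \<open>The constant sequence approximates. Its distance 0 still needs an argument, because the
  chosen \<open>weak_gradient\<close> of the zero function vanishes only almost everywhere.\<close>

lemma test_functions_subset_H1_0: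
  assumes D: "open D" and \<phi>: "\<phi> \<in> test_functions D"
  shows "\<phi> \<in> H1_0 D"
proof -
  have Dl: "D \<in> sets lebesgue" using D by simp
  have W: "has_weak_gradient D (\<lambda>x. \<phi> x - \<phi> x) (\<lambda>x. 0)"
    using has_weak_gradient_const[OF D, of 0] by simp
  have "AE x in lebesgue_on D. (norm (weak_gradient D (\<lambda>x. \<phi> x - \<phi> x) x))\<^sup>2 = 0"
    using weak_gradient_AE[OF D W] by eventually_elim simp
  then have "(LINT x|lebesgue_on D. (norm (weak_gradient D (\<lambda>x. \<phi> x - \<phi> x) x))\<^sup>2) = 0"
    by (rule integral_eq_zero_AE)
  then have "H1_norm D (\<lambda>x. \<phi> x - \<phi> x) = 0" unfolding H1_norm_def L2_norm_def by simp
  moreover have "\<phi> \<in> H1 D" unfolding H1_def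
    using L2_subset[OF test_function_L2[OF \<phi>] Dl] L2_subset[OF grad_test_function_L2[OF \<phi>] Dl]
      has_weak_gradient_smooth[OF D test_functions_smooth[OF \<phi>]] by blast
  ultimately show ?thesis unfolding H1_0_def
    using \<phi> by (intro CollectI conjI exI[of _ "\<lambda>n. \<phi>"]) simp_all
qed

text \<open>On the ball the weak gradient coincides almost everywhere with the classical gradient of
  the regular representative \<open>v\<close>; Hoelder continuity is then used only between a point
  and the origin.\<close>

lemma gradient_at_regular_point:
  fixes v :: "'a::euclidean_space \<Rightarrow> real"
  assumes D: "open D" "ball 0 \<delta> \<subseteq> D" and u: "has_weak_gradient D u g"
    and v: "v \<in> C1_Holder \<alpha> (ball 0 \<delta>)" "AE x in lebesgue_on (ball 0 \<delta>). u x = v x" "GDERIV v 0 :> U"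
    and pos: "\<delta> > 0" "\<alpha> > 0"
  obtains C where "C \<ge> 0" "AE x in lebesgue. x \<in> ball 0 \<delta> \<longrightarrow> norm (g x - U) \<le> C * norm x powr \<alpha>"
proof -
  let ?B = "ball (0::'a) \<delta>"
  obtain G C where G: "\<And>x. x \<in> ?B \<Longrightarrow> GDERIV v x :> G x"
    and H: "\<And>x y. x \<in> closure ?B \<Longrightarrow> y \<in> closure ?B \<Longrightarrow> norm (G x - G y) \<le> C * norm (x - y) powr \<alpha>"
    using v(1) unfolding C1_Holder_def by blast
  have 0: "0 \<in> ?B" using pos by simp
  have "G 0 = U"
    using G[OF 0] v(3) unfolding gderiv_def inner_commute[of _ U] inner_commute[of _ "G 0"]
    by (metis grad_eqI)
  have cl: "x \<in> closure ?B" if "x \<in> ?B" for x using that closure_subset by blast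
  have cont: "continuous_on ?B G"
    unfolding continuous_on_def
  proof
    fix x assume x: "x \<in> ?B"
    have "((\<lambda>y. norm (y - x)) \<longlongrightarrow> norm (x - x)) (at x within ?B)" by (intro tendsto_intros)
    then have "((\<lambda>y. norm (y - x)) \<longlongrightarrow> 0) (at x within ?B)" by simp
    then have "((\<lambda>y. norm (y - x) powr \<alpha>) \<longlongrightarrow> 0) (at x within ?B)"
      using pos by (intro tendsto_zero_powrI[OF _ tendsto_const]) simp_all
    then have "((\<lambda>y. C * norm (y - x) powr \<alpha>) \<longlongrightarrow> C * 0) (at x within ?B)" by (rule tendsto_mult_left)
    then have l: "((\<lambda>y. C * norm (y - x) powr \<alpha>) \<longlongrightarrow> 0) (at x within ?B)" by simp
    have "\<forall>\<^sub>F y in at x within ?B. norm (G y - G x) \<le> C * norm (y - x) powr \<alpha>"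
      unfolding eventually_at_filter
      by (rule always_eventually) (use H[OF cl cl[OF x]] in blast)
    from LIM_zero_cancel[OF Lim_null_comparison[OF this l]]
    show "(G \<longlongrightarrow> G x) (at x within ?B)" .
  qed
  have W: "has_weak_gradient ?B (\<lambda>x. u x - v x) (\<lambda>x. g x - G x)"
    by (rule has_weak_gradient_diff[OF open_ball has_weak_gradient_mono[OF u D(1) open_ball D(2)]
          has_weak_gradient_GDERIV[OF open_ball G cont]])
  have "AE x in lebesgue_on ?B. u x - v x = 0" using v(2) by eventually_elim simp
  from has_weak_gradient_AE_zero[OF open_ball W this]
  have "AE x in lebesgue. x \<in> ?B \<longrightarrow> g x - G x = 0" by (subst (asm) AE_lebesgue_on) simp_all
  \<comment> \<open>The definition of \<open>C1_Holder\<close> fixes no sign for the constant; the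
    absolute value yields a nonnegative one.\<close>
  then have "AE x in lebesgue. x \<in> ?B \<longrightarrow> norm (g x - U) \<le> \<bar>C\<bar> * norm x powr \<alpha>"
  proof eventually_elim
    case (elim x)
    show ?case
    proof
      assume x: "x \<in> ?B"
      have "norm (g x - U) = norm (G x - G 0)" using elim x \<open>G 0 = U\<close> by simp
      also have "\<dots> \<le> C * norm (x - 0) powr \<alpha>" by (rule H[OF cl[OF x] cl[OF 0]])
      also have "\<dots> \<le> \<bar>C\<bar> * norm x powr \<alpha>" by (simp add: mult_right_mono)
      finally show "norm (g x - U) \<le> \<bar>C\<bar> * norm x powr \<alpha>" .
    qed
  qed
  then show thesis by (rule that[rotated]) simp
qed

text \<open>The prefactor \<open>1 / c\<close> makes dilation commute with the gradient; it is also
  the normalisation in \<open>state_variation\<close>.\<close>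

lemma test_function_dilation:
  fixes \<phi> :: "'a::euclidean_space \<Rightarrow> real"
  assumes \<phi>: "\<phi> \<in> test_functions UNIV" and c: "c \<noteq> 0"
  shows "(\<lambda>x. (1 / c) * \<phi> (c *\<^sub>R x)) \<in> test_functions UNIV"
    "grad (\<lambda>x. (1 / c) * \<phi> (c *\<^sub>R x)) = (\<lambda>x. grad \<phi> (c *\<^sub>R x))"
proof -
  have t: "(\<lambda>x. \<phi> (c *\<^sub>R x)) \<in> test_functions UNIV" using test_functions_affine[OF \<phi> c, of 0] by simp
  then show "(\<lambda>x. (1 / c) * \<phi> (c *\<^sub>R x)) \<in> test_functions UNIV" by (rule test_functions_cmult)
  have g: "grad (\<lambda>x. \<phi> (c *\<^sub>R x)) x = c *\<^sub>R grad \<phi> (c *\<^sub>R x)" for x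
    using grad_affine[OF test_functions_smooth[OF \<phi>], of c 0 x] by simp
  show "grad (\<lambda>x. (1 / c) * \<phi> (c *\<^sub>R x)) = (\<lambda>x. grad \<phi> (c *\<^sub>R x))"
    by (rule ext) (simp only: grad_cmult[OF test_functions_smooth[OF t]] g, use c in simp)
qed

lemma closure_sequentialI:
  fixes l :: "'a::first_countable_topology"
  shows "(\<And>n. x n \<in> S) \<Longrightarrow> x \<longlonglongrightarrow> l \<Longrightarrow> l \<in> closure S"
  unfolding closure_sequential by (rule exI[of _ x]) simp

text \<open>The factor \<open>1 / \<epsilon>\<close> of the variation cancels against the chain
  rule. The field is written by extension by zero, so that on the rescaled domain it is visibly a
  difference of the two gradients.\<close>

definition variation_gradient ::
  "'a::euclidean_space set \<Rightarrow> (real \<Rightarrow> 'a \<Rightarrow> real) \<Rightarrow> real \<Rightarrow> 'a \<Rightarrow> 'a" where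
  "variation_gradient D u \<epsilon> x =
    zero_ext D (weak_gradient D (u \<epsilon>)) (\<epsilon> *\<^sub>R x) - zero_ext D (weak_gradient D (u 0)) (\<epsilon> *\<^sub>R x)"

lemma H1_0_diff_approx:
  fixes u w :: "'a::euclidean_space \<Rightarrow> real"
  assumes D: "open D" and u: "u \<in> H1_0 D" and w: "w \<in> H1_0 D"
  shows "\<exists>\<phi>. (\<forall>n. \<phi> n \<in> test_functions D) \<and>
    (\<lambda>n. abs_l2 (\<phi> n)) \<longlonglongrightarrow> abs_l2 (\<lambda>x. zero_ext D u x - zero_ext D w x) \<and>
    (\<lambda>n. abs_l2 (grad (\<phi> n))) \<longlonglongrightarrow>
      abs_l2 (\<lambda>x. zero_ext D (weak_gradient D u) x - zero_ext D (weak_gradient D w) x)"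
proof -
  note U = H1_0_D[OF D u] and W = H1_0_D[OF D w]
  obtain \<phi> where all: "\<forall>n. \<phi> n \<in> test_functions D" and lims: "(\<lambda>n. abs_l2 (\<phi> n)) \<longlonglongrightarrow> abs_l2 (zero_ext D u)"
    "(\<lambda>n. abs_l2 (grad (\<phi> n))) \<longlonglongrightarrow> abs_l2 (zero_ext D (weak_gradient D u))"
    using H1_0_approx[OF D u] by blast
  note \<phi> = spec[OF all] lims
  obtain \<psi> where all: "\<forall>n. \<psi> n \<in> test_functions D" and lims: "(\<lambda>n. abs_l2 (\<psi> n)) \<longlonglongrightarrow> abs_l2 (zero_ext D w)"
    "(\<lambda>n. abs_l2 (grad (\<psi> n))) \<longlonglongrightarrow> abs_l2 (zero_ext D (weak_gradient D w))"
    using H1_0_approx[OF D w] by blast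
  note \<psi> = spec[OF all] lims
  show ?thesis
  proof (intro exI[of _ "\<lambda>n x. \<phi> n x - \<psi> n x"] conjI allI)
    show "(\<lambda>x. \<phi> n x - \<psi> n x) \<in> test_functions D" for n by (rule test_functions_diff[OF \<phi>(1) \<psi>(1)])
    show "(\<lambda>n. abs_l2 (\<lambda>x. \<phi> n x - \<psi> n x)) \<longlonglongrightarrow> abs_l2 (\<lambda>x. zero_ext D u x - zero_ext D w x)"
      unfolding diff_abs_l2[OF test_function_L2[OF \<phi>(1)] test_function_L2[OF \<psi>(1)], symmetric]
        diff_abs_l2[OF U(2) W(2), symmetric]
      by (rule tendsto_diff[OF \<phi>(2) \<psi>(2)])
    have g: "grad (\<lambda>x. \<phi> n x - \<psi> n x) = (\<lambda>x. grad (\<phi> n) x - grad (\<psi> n) x)" for n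
      by (rule ext) (rule grad_diff[OF test_functions_smooth[OF \<phi>(1)] test_functions_smooth[OF \<psi>(1)]])
    show "(\<lambda>n. abs_l2 (grad (\<lambda>x. \<phi> n x - \<psi> n x))) \<longlonglongrightarrow>
      abs_l2 (\<lambda>x. zero_ext D (weak_gradient D u) x - zero_ext D (weak_gradient D w) x)"
      unfolding g diff_abs_l2[OF grad_test_function_L2[OF \<phi>(1)] grad_test_function_L2[OF \<psi>(1)], symmetric]
        diff_abs_l2[OF U(3) W(3), symmetric]
      by (rule tendsto_diff[OF \<phi>(3) \<psi>(3)])
  qed
qed

text \<open>Test functions of \<open>D\<close> approximating the difference of the states are
  dilated to test functions on the whole space. Their limit identifies the weak gradient, also
  across the boundary of the rescaled domain, and places it in the closure of
  \<open>test_gradients\<close>.\<close>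

lemma variation_gradient:
  fixes u :: "real \<Rightarrow> 'a::euclidean_space \<Rightarrow> real"
  assumes D: "open D" and u: "u \<epsilon> \<in> H1_0 D" "u 0 \<in> H1_0 D" and \<epsilon>: "\<epsilon> > 0"
  shows "variation_gradient D u \<epsilon> \<in> L2 UNIV"
    "has_weak_gradient UNIV (state_variation D u \<epsilon>) (variation_gradient D u \<epsilon>)"
    "abs_l2 (variation_gradient D u \<epsilon>) \<in> closure test_gradients"
proof -
  note U = H1_0_D[OF D u(1)] and W = H1_0_D[OF D u(2)]
  have \<epsilon>0: "\<epsilon> \<noteq> 0" using \<epsilon> by simp
  let ?s = "\<lambda>x. zero_ext D (u \<epsilon>) x - zero_ext D (u 0) x"
  let ?g = "\<lambda>x. zero_ext D (weak_gradient D (u \<epsilon>)) x - zero_ext D (weak_gradient D (u 0)) x"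
  have sL: "?s \<in> L2 UNIV" by (rule L2_diff[OF U(2) W(2)])
  have gL: "?g \<in> L2 UNIV" by (rule L2_diff[OF U(3) W(3)])
  show vL: "variation_gradient D u \<epsilon> \<in> L2 UNIV"
    unfolding variation_gradient_def[abs_def] by (rule L2_scale[OF \<epsilon>0 gL])
  have sv: "state_variation D u \<epsilon> = (\<lambda>x. (1 / \<epsilon>) *\<^sub>R ?s (\<epsilon> *\<^sub>R x))"
    by (rule ext) (simp add: state_variation_def)
  have svL: "state_variation D u \<epsilon> \<in> L2 UNIV"
    unfolding sv by (rule L2_scaleR[OF L2_scale[OF \<epsilon>0 sL]])
  obtain \<phi> where all: "\<forall>n. \<phi> n \<in> test_functions D" and lims: "(\<lambda>n. abs_l2 (\<phi> n)) \<longlonglongrightarrow> abs_l2 ?s"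
    "(\<lambda>n. abs_l2 (grad (\<phi> n))) \<longlonglongrightarrow> abs_l2 ?g"
    using H1_0_diff_approx[OF D u] by blast
  note \<phi> = spec[OF all] lims
  have \<phi>U: "\<phi> n \<in> test_functions UNIV" for n using \<phi>(1) test_functions_mono[of D UNIV] by blast
  note \<psi> = test_function_dilation[OF \<phi>U \<epsilon>0]
  have g: "(\<lambda>n. abs_l2 (grad (\<lambda>x. (1 / \<epsilon>) * \<phi> n (\<epsilon> *\<^sub>R x)))) \<longlonglongrightarrow> abs_l2 (variation_gradient D u \<epsilon>)"
    unfolding \<psi>(2) variation_gradient_def[abs_def]
    by (rule tendsto_l2_scale[OF \<epsilon>0 grad_test_function_L2[OF \<phi>(1)] gL \<phi>(3)])
  have "(\<lambda>n. (1 / \<epsilon>) *\<^sub>R abs_l2 (\<lambda>x. \<phi> n (\<epsilon> *\<^sub>R x))) \<longlonglongrightarrow> (1 / \<epsilon>) *\<^sub>R abs_l2 (\<lambda>x. ?s (\<epsilon> *\<^sub>R x))"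
    by (rule tendsto_scaleR[OF tendsto_const tendsto_l2_scale[OF \<epsilon>0 test_function_L2[OF \<phi>(1)] sL \<phi>(2)]])
  moreover have "(1 / \<epsilon>) *\<^sub>R abs_l2 (\<lambda>x. ?s (\<epsilon> *\<^sub>R x)) = abs_l2 (state_variation D u \<epsilon>)"
    unfolding sv by (rule scaleR_abs_l2[OF L2_scale[OF \<epsilon>0 sL]])
  moreover have "(1 / \<epsilon>) *\<^sub>R abs_l2 (\<lambda>x. \<phi> n (\<epsilon> *\<^sub>R x)) = abs_l2 (\<lambda>x. (1 / \<epsilon>) * \<phi> n (\<epsilon> *\<^sub>R x))" for n
    by (simp only: scaleR_abs_l2[OF L2_scale[OF \<epsilon>0 test_function_L2[OF \<phi>(1)]]] real_scaleR_def)
  ultimately have s: "(\<lambda>n. abs_l2 (\<lambda>x. (1 / \<epsilon>) * \<phi> n (\<epsilon> *\<^sub>R x))) \<longlonglongrightarrow> abs_l2 (state_variation D u \<epsilon>)"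
    by (simp only:)
  show "has_weak_gradient UNIV (state_variation D u \<epsilon>) (variation_gradient D u \<epsilon>)"
    by (rule has_weak_gradient_l2_limit[OF \<psi>(1) svL vL s g])
  show "abs_l2 (variation_gradient D u \<epsilon>) \<in> closure test_gradients"
    by (rule closure_sequentialI[OF _ g]) (unfold test_gradients_def, rule imageI[OF \<psi>(1)])
qed

section \<open>The state equations as orthogonality relations\<close>

context two_phase_field
begin

text \<open>The flux at gradient 0 is bounded on the bounded set \<open>D\<close>, and the Lipschitz
  bound controls the rest.\<close>

lemma phase_L2:
  assumes S: "S \<in> sets lebesgue" and D: "D \<in> sets lebesgue" "bounded D" and g: "zero_ext D g \<in> L2 UNIV"
  shows "zero_ext D (\<lambda>x. phase S x (g x)) \<in> L2 UNIV"
proof -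
  have mz: "(\<lambda>x. phase S x 0) \<in> borel_measurable lebesgue" by (rule phase_measurable[OF S]) simp
  have m0: "zero_ext D (\<lambda>x. phase S x 0) \<in> borel_measurable lebesgue"
    by (rule borel_measurable_scaleR[OF borel_measurable_indicator[OF D(1)] mz])
  define M where "M = norm (a1 0) + norm (a2 0)"
  have M: "zero_ext D (\<lambda>x. M) \<in> L2 UNIV"
    unfolding L2_indicator_iff[OF D(1)] by (rule const_L2[OF D])
  have z: "zero_ext D (\<lambda>x. phase S x 0) \<in> L2 UNIV"
    by (rule L2_bound[OF M m0], rule AE_I2) (simp add: M_def two_phase_def indicator_def)
  have mg: "(\<lambda>x. phase S x (zero_ext D g x)) \<in> borel_measurable lebesgue"
    by (rule phase_measurable[OF S L2_measurable[OF g]])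
  have d: "(\<lambda>x. phase S x (zero_ext D g x) - phase S x 0) \<in> L2 UNIV"
  proof (rule L2_bound[OF L2_scaleR[OF g, of c2] borel_measurable_diff[OF mg mz]], rule AE_I2)
    fix x
    show "norm (phase S x (zero_ext D g x) - phase S x 0) \<le> norm (c2 *\<^sub>R zero_ext D g x)"
      using phase_lipschitz[of S x "zero_ext D g x" 0] constants by simp
  qed
  have "(\<lambda>x. zero_ext D (\<lambda>x. phase S x 0) x + (phase S x (zero_ext D g x) - phase S x 0))
      = zero_ext D (\<lambda>x. phase S x (g x))"
    by (rule ext) (simp add: indicator_def)
  with L2_add[OF z d] show ?thesis by simp
qed

lemma state_solution_l2:
  assumes D: "open D" "bounded D" and S: "S \<in> sets lebesgue"
    and u: "state_solution a1 a2 D f S u" and \<phi>: "\<phi> \<in> test_functions D"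
  shows "abs_l2 (zero_ext D (\<lambda>x. phase S x (weak_gradient D u x))) \<bullet> abs_l2 (grad \<phi>) = (LINT x|lebesgue_on D. f x * \<phi> x)"
proof -
  have Dl: "D \<in> sets lebesgue" using D by simp
  have uH: "u \<in> H1_0 D" using u by (simp add: state_solution_def)
  note \<phi>H = test_functions_subset_H1_0[OF D(1) \<phi>]
  note W = H1_0_D(3)[OF D(1) \<phi>H] and A = phase_L2[OF S Dl D(2) H1_0_D(3)[OF D(1) uH]]
  have "AE x in lebesgue. x \<in> D \<longrightarrow> weak_gradient D \<phi> x = grad \<phi> x"
    using weak_gradient_test_function[OF D(1) \<phi>] unfolding AE_lebesgue_on[OF Dl] .
  then have "AE x in lebesgue. zero_ext D (weak_gradient D \<phi>) x = grad \<phi> x"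
  proof eventually_elim
    case (elim x)
    then show ?case using fun_cong[OF zero_ext_test_function(2)[OF \<phi>], of x] by (cases "x \<in> D") simp_all
  qed
  then have eq: "abs_l2 (zero_ext D (weak_gradient D \<phi>)) = abs_l2 (grad \<phi>)"
    unfolding abs_l2_eq_iff[OF W grad_test_function_L2[OF \<phi>]] .
  have "(LINT x|lebesgue_on D. f x * \<phi> x)
      = (LINT x|lebesgue_on D. phase S x (weak_gradient D u x) \<bullet> weak_gradient D \<phi> x)"
    using u \<phi>H unfolding state_solution_def by simp
  also have "\<dots> = (LINT x|lebesgue. zero_ext D (\<lambda>x. phase S x (weak_gradient D u x)) x \<bullet> zero_ext D (weak_gradient D \<phi>) x)"
    unfolding integral_lebesgue_on[OF Dl]
    by (rule Bochner_Integration.integral_cong[OF refl]) (simp add: indicator_def)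
  also have "\<dots> = abs_l2 (zero_ext D (\<lambda>x. phase S x (weak_gradient D u x))) \<bullet> abs_l2 (grad \<phi>)"
    unfolding eq[symmetric] inner_abs_l2[OF A W] ..
  finally show ?thesis ..
qed

definition flux_variation :: "'a set \<Rightarrow> 'a set \<Rightarrow> 'a set \<Rightarrow> ('a \<Rightarrow> real) \<Rightarrow> ('a \<Rightarrow> real) \<Rightarrow> 'a \<Rightarrow> 'a" where
  "flux_variation D S S' u w x =
    zero_ext D (\<lambda>x. phase S x (weak_gradient D u x)) x - zero_ext D (\<lambda>x. phase S' x (weak_gradient D w x)) x"

text \<open>Both states have the same right-hand side, so it cancels on every test function of
  \<open>D\<close>. The difference of the states is reached by approximation, since only gradients
  of tests enter.\<close>

lemma flux_variation:
  assumes D: "open D" "bounded D" and S: "S \<in> sets lebesgue" "S' \<in> sets lebesgue"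
    and u: "state_solution a1 a2 D f S u" and w: "state_solution a1 a2 D f S' w"
  shows "flux_variation D S S' u w \<in> L2 UNIV"
    "\<phi> \<in> test_functions D \<Longrightarrow> abs_l2 (flux_variation D S S' u w) \<bullet> abs_l2 (grad \<phi>) = 0"
    "abs_l2 (flux_variation D S S' u w)
      \<bullet> abs_l2 (\<lambda>x. zero_ext D (weak_gradient D u) x - zero_ext D (weak_gradient D w) x) = 0"
proof -
  have Dl: "D \<in> sets lebesgue" using D by simp
  have uH: "u \<in> H1_0 D" "w \<in> H1_0 D" using u w by (simp_all add: state_solution_def)
  note A = phase_L2[OF S(1) Dl D(2) H1_0_D(3)[OF D(1) uH(1)]]
    and B = phase_L2[OF S(2) Dl D(2) H1_0_D(3)[OF D(1) uH(2)]]
  show "flux_variation D S S' u w \<in> L2 UNIV"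
    unfolding flux_variation_def[abs_def] by (rule L2_diff[OF A B])
  have orth: "abs_l2 (flux_variation D S S' u w) \<bullet> abs_l2 (grad \<phi>) = 0" if "\<phi> \<in> test_functions D" for \<phi>
    unfolding flux_variation_def[abs_def] diff_abs_l2[OF A B, symmetric] inner_diff_left
      state_solution_l2[OF D S(1) u that] state_solution_l2[OF D S(2) w that] by simp
  then show "\<phi> \<in> test_functions D \<Longrightarrow> abs_l2 (flux_variation D S S' u w) \<bullet> abs_l2 (grad \<phi>) = 0" .
  obtain \<phi> where all: "\<forall>n. \<phi> n \<in> test_functions D" and lims: "(\<lambda>n. abs_l2 (\<phi> n)) \<longlonglongrightarrow> abs_l2 (\<lambda>x. zero_ext D u x - zero_ext D w x)"
    "(\<lambda>n. abs_l2 (grad (\<phi> n))) \<longlonglongrightarrow>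
      abs_l2 (\<lambda>x. zero_ext D (weak_gradient D u) x - zero_ext D (weak_gradient D w) x)"
    using H1_0_diff_approx[OF D(1) uH] by blast
  note \<phi> = spec[OF all] lims
  have "(\<lambda>n. abs_l2 (flux_variation D S S' u w) \<bullet> abs_l2 (grad (\<phi> n))) \<longlonglongrightarrow>
      abs_l2 (flux_variation D S S' u w)
        \<bullet> abs_l2 (\<lambda>x. zero_ext D (weak_gradient D u) x - zero_ext D (weak_gradient D w) x)"
    by (rule tendsto_inner[OF tendsto_const \<phi>(3)])
  then show "abs_l2 (flux_variation D S S' u w)
      \<bullet> abs_l2 (\<lambda>x. zero_ext D (weak_gradient D u) x - zero_ext D (weak_gradient D w) x) = 0"
    unfolding orth[OF \<phi>(1)] by (rule LIMSEQ_unique[OF _ tendsto_const])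
qed

end

section \<open>Strong convergence of the rescaled gradients\<close>

context two_phase_field
begin

text \<open>The first error on the right is made small by the choice of \<open>\<psi>\<close>, the
  second by \<open>\<epsilon>\<close> once \<open>R\<close> is fixed. Its last factor is the root of
  the volume of the ball. The condition \<open>\<epsilon> * R < \<delta>\<close> puts the rescaled
  ball where \<open>u 0\<close> is regular and away from \<open>\<Omega>\<close>.\<close>

lemma variation_estimate:
  fixes D \<Omega> \<omega> :: "'a set" and u :: "real \<Rightarrow> 'a \<Rightarrow> real"
  assumes D: "open D" "bounded D" and \<Omega>: "open \<Omega>" and \<omega>: "open \<omega>" "\<omega> \<subseteq> ball 0 R"
    and pos: "\<epsilon> > 0" and ball: "ball 0 \<delta> \<subseteq> D" "ball 0 \<delta> \<inter> \<Omega> = {}" "\<epsilon> * R < \<delta>"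
    and u: "state_solution a1 a2 D f (\<Omega> \<union> scaled_inclusion \<omega> \<epsilon>) (u \<epsilon>)" "state_solution a1 a2 D f \<Omega> (u 0)"
    and g0: "AE x in lebesgue. x \<in> ball 0 \<delta> \<longrightarrow> norm (weak_gradient D (u 0) x - U) \<le> C * norm x powr \<alpha>"
      "C \<ge> 0" "\<alpha> > 0"
    and \<psi>: "\<psi> \<in> test_functions UNIV" "\<And>x. x \<notin> ball 0 R \<Longrightarrow> \<psi> x = 0" "\<And>x. x \<notin> ball 0 R \<Longrightarrow> grad \<psi> x = 0"
    and k: "\<forall>s\<in>closure test_gradients. abs_l2 (limit_field \<omega> U (rep_l2 k)) \<bullet> s = 0"
  shows "c1 * norm (abs_l2 (variation_gradient D u \<epsilon>) - abs_l2 (grad \<psi>))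
    \<le> c2 * norm (k - abs_l2 (grad \<psi>))
      + 2 * c2 * (C * (\<epsilon> * R) powr \<alpha>) * norm (abs_l2 (zero_ext (ball (0::'a) R) (\<lambda>x. 1 :: real)))"
proof -
  define S where "S = \<Omega> \<union> scaled_inclusion \<omega> \<epsilon>"
  have \<epsilon>0: "\<epsilon> \<noteq> 0" using pos by simp
  have Sopen: "open S"
    unfolding S_def scaled_inclusion_def by (intro open_Un \<Omega> open_scaling \<epsilon>0 \<omega>)
  have in_S: "\<epsilon> *\<^sub>R x \<in> S \<longleftrightarrow> \<epsilon> *\<^sub>R x \<in> \<Omega> \<or> x \<in> \<omega>" for x
    using \<epsilon>0 by (auto simp: S_def scaled_inclusion_def)
  have in_ball: "\<epsilon> *\<^sub>R x \<in> ball 0 \<delta>" "\<epsilon> *\<^sub>R x \<in> D" "\<epsilon> *\<^sub>R x \<notin> \<Omega>" if "x \<in> ball 0 R" for x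
  proof -
    have "\<epsilon> * norm x < \<epsilon> * R" using that pos by simp
    then have "\<epsilon> * norm x < \<delta>" using ball(3) by linarith
    then show b: "\<epsilon> *\<^sub>R x \<in> ball 0 \<delta>" using pos by simp
    show "\<epsilon> *\<^sub>R x \<in> D" by (rule subsetD[OF ball(1) b])
    show "\<epsilon> *\<^sub>R x \<notin> \<Omega>" using b ball(2) by (metis IntI emptyE)
  qed
  have \<omega>l: "\<omega> \<in> sets lebesgue" "bounded \<omega>"
    by (simp add: \<omega>(1)) (rule bounded_subset[OF bounded_ball \<omega>(2)])
  have Sl: "S \<in> sets lebesgue" "\<Omega> \<in> sets lebesgue" "D \<in> sets lebesgue" using Sopen \<Omega> D by simp_all
  have uH: "u \<epsilon> \<in> H1_0 D" "u 0 \<in> H1_0 D" using u by (simp_all add: state_solution_def)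
  note u' = u[folded S_def]
  define h where "h = flux_variation D S \<Omega> (u \<epsilon>) (u 0)"
  note h = flux_variation[OF D Sl(1,2) u', folded h_def]
  define H where "H x = h (\<epsilon> *\<^sub>R x)" for x
  define p where "p x = zero_ext D (weak_gradient D (u 0)) (\<epsilon> *\<^sub>R x)" for x
  define K where "K = variation_gradient D u \<epsilon>"
  define q where "q = grad \<psi>"
  \<comment> \<open>\<open>M\<close> arises from \<open>H\<close> when \<open>K\<close> is replaced
    by \<open>q\<close>: inside the rescaled domain, the rescaled gradient of the perturbed state is
    \<open>K + p\<close>.\<close>
  define M where "M x = indicator D (\<epsilon> *\<^sub>R x) *\<^sub>R (phase S (\<epsilon> *\<^sub>R x) (q x + p x) - phase \<Omega> (\<epsilon> *\<^sub>R x) (p x))" for x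
  define N where "N = limit_field \<omega> U q"
  \<comment> \<open>Replacing the base point \<open>p\<close> by \<open>U\<close> costs one
    Lipschitz estimate for each of the two fluxes, and on the ball their distance is at most
    \<open>C * (\<epsilon> * R) powr \<alpha>\<close>.\<close>
  define t where "t = 2 * c2 * (C * (\<epsilon> * R) powr \<alpha>)"
  have t: "t \<ge> 0" unfolding t_def using constants g0(2) by simp
  let ?one = "zero_ext (ball (0::'a) R) (\<lambda>x. 1 :: real)"
  have KL: "K \<in> L2 UNIV" and Kcl: "abs_l2 K \<in> closure test_gradients"
    unfolding K_def by (rule variation_gradient[OF D(1) uH pos])+
  have qL: "q \<in> L2 UNIV" unfolding q_def by (rule grad_test_function_L2[OF \<psi>(1)])
  have qcl: "abs_l2 q \<in> closure test_gradients"
    unfolding q_def test_gradients_def by (rule subsetD[OF closure_subset imageI[OF \<psi>(1)]])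
  have HL: "H \<in> L2 UNIV" unfolding H_def[abs_def] by (rule L2_scale[OF \<epsilon>0 h(1)])
  have NL: "N \<in> L2 UNIV" unfolding N_def by (rule limit_field_L2[OF \<omega>l qL])
  have pL: "p \<in> L2 UNIV" unfolding p_def[abs_def] by (rule L2_scale[OF \<epsilon>0 H1_0_D(3)[OF D(1) uH(2)]])
  have oneL: "?one \<in> L2 UNIV"
  proof -
    have "ball (0::'a) R \<in> sets lebesgue" by simp
    then show ?thesis unfolding L2_indicator_iff[OF \<open>ball (0::'a) R \<in> sets lebesgue\<close>]
      by (rule const_L2[OF _ bounded_ball])
  qed
  have phase_m: "(\<lambda>x. phase T (\<epsilon> *\<^sub>R x) (r x)) \<in> borel_measurable lebesgue"
    if T: "open T" and r: "r \<in> borel_measurable lebesgue" for T and r :: "'a \<Rightarrow> 'a"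
  proof -
    have "open ((\<lambda>x. \<epsilon> *\<^sub>R x) -` T)"
      by (rule open_vimage[OF T]) (intro continuous_intros)
    then have Tl: "{x. \<epsilon> *\<^sub>R x \<in> T} \<in> sets lebesgue" by (simp add: vimage_def)
    show ?thesis using phase_measurable[OF Tl r] by (simp add: two_phase_def)
  qed
  have MM: "M \<in> borel_measurable lebesgue"
    unfolding M_def[abs_def]
    by (intro borel_measurable_scaleR borel_measurable_diff phase_m borel_measurable_add L2_measurable[OF pL]
        L2_measurable[OF qL] Sopen \<Omega> measurable_lebesgue_scale[OF borel_measurable_indicator[OF Sl(3)]])
  have le: "AE x in lebesgue. norm (N x - M x) \<le> norm (t *\<^sub>R ?one x)"
    using AE_lebesgue_scale[OF \<epsilon>0 g0(1)]
  proof eventually_elim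
    case (elim x)
    show ?case
    proof (cases "x \<in> ball 0 R")
      case True
      note x = in_ball[OF True]
      have p: "p x = weak_gradient D (u 0) (\<epsilon> *\<^sub>R x)" using x by (simp add: p_def)
      have "norm (p x - U) \<le> C * norm (\<epsilon> *\<^sub>R x) powr \<alpha>" using elim x(1) unfolding p by blast
      also have "\<dots> \<le> C * (\<epsilon> * R) powr \<alpha>"
        using True pos g0(2,3) by (intro mult_left_mono powr_mono2) simp_all
      finally have pU: "norm (p x - U) \<le> C * (\<epsilon> * R) powr \<alpha>" .
      have "N x - M x = (phase \<omega> x (q x + U) - phase \<omega> x (q x + p x)) - (a2 U - a2 (p x))"
        using x in_S[of x] by (simp add: N_def M_def limit_field_def two_phase_def)
      then have "norm (N x - M x) \<le> norm (phase \<omega> x (q x + U) - phase \<omega> x (q x + p x)) + norm (a2 U - a2 (p x))"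
        by (simp only: norm_triangle_ineq4)
      also have "\<dots> \<le> c2 * norm (p x - U) + c2 * norm (p x - U)"
        using phase_lipschitz[of \<omega> x "q x + U" "q x + p x"] lipschitz(2)[of U "p x"]
        by (simp add: norm_minus_commute)
      also have "\<dots> = 2 * c2 * norm (p x - U)" by simp
      also have "\<dots> \<le> t" unfolding t_def using pU constants by (intro mult_left_mono) simp_all
      finally show ?thesis using True t by simp
    next
      case False
      \<comment> \<open>Off the ball both fields vanish: \<open>q\<close> is 0, the limit field
        reduces to \<open>a2 U - a2 U\<close>, and \<open>\<epsilon> *\<^sub>R x\<close> lies in
        \<open>S\<close> exactly if it lies in \<open>\<Omega>\<close>.\<close>
      then have "x \<notin> \<omega>" using \<omega>(2) by blast
      then show ?thesis using False in_S[of x] \<psi>(3)[of x]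
        by (simp add: N_def M_def q_def limit_field_def two_phase_def)
    qed
  qed
  have NM_L2: "(\<lambda>x. N x - M x) \<in> L2 UNIV"
    by (rule L2_bound[OF L2_scaleR[OF oneL] borel_measurable_diff[OF L2_measurable[OF NL] MM] le])
  have M_L2: "M \<in> L2 UNIV" using L2_diff[OF NL NM_L2] by simp
  let ?d = "abs_l2 K - abs_l2 q"
  have mono: "c1 * (norm ?d)\<^sup>2 \<le> (abs_l2 H - abs_l2 M) \<bullet> ?d"
  proof (rule l2_monotone[OF KL qL HL M_L2], rule AE_I2)
    fix x
    show "c1 * (norm (K x - q x))\<^sup>2 \<le> (H x - M x) \<bullet> (K x - q x)"
    proof (cases "\<epsilon> *\<^sub>R x \<in> D")
      case True
      let ?y = "\<epsilon> *\<^sub>R x" and ?w = "weak_gradient D (u \<epsilon>) (\<epsilon> *\<^sub>R x)"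
      have Kq: "K x - q x = ?w - (q x + p x)" using True by (simp add: K_def variation_gradient_def p_def)
      have HM: "H x - M x = phase S ?y ?w - phase S ?y (q x + p x)"
        using True by (simp add: H_def h_def M_def flux_variation_def p_def)
      show ?thesis unfolding Kq HM by (rule phase_monotone)
    next
      case False
      \<comment> \<open>Such a point lies off the ball as well, so \<open>K\<close> and
        \<open>q\<close> both vanish and the inequality reads \<open>0 \<le> 0\<close>.\<close>
      then have "q x = 0" using in_ball(2) \<psi>(3) unfolding q_def by blast
      then show ?thesis using False by (simp add: K_def variation_gradient_def)
    qed
  qed
  have H_orth: "abs_l2 H \<bullet> ?d = 0"
  proof -
    have "abs_l2 h \<bullet> abs_l2 (\<lambda>x. zero_ext D (weak_gradient D (u \<epsilon>)) x - zero_ext D (weak_gradient D (u 0)) x)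
      = \<bar>\<epsilon>\<bar> ^ DIM('a) * (abs_l2 H \<bullet> abs_l2 K)"
      unfolding H_def[abs_def] K_def variation_gradient_def[abs_def]
      by (rule inner_l2_scale[OF \<epsilon>0 h(1) L2_diff[OF H1_0_D(3)[OF D(1) uH(1)] H1_0_D(3)[OF D(1) uH(2)]]])
    then have HK: "abs_l2 H \<bullet> abs_l2 K = 0" unfolding h(3) using \<epsilon>0 by simp
    \<comment> \<open>The function \<open>\<epsilon> * \<psi> (x / \<epsilon>)\<close>, written to
      match \<open>test_function_dilation\<close> with \<open>c = 1 / \<epsilon>\<close>. Its
      rescaled gradient is \<open>q\<close>, and its support lies in \<open>D\<close> because
      \<open>\<epsilon> * R < \<delta>\<close>.\<close>
    define \<phi> where "\<phi> x = (1 / (1 / \<epsilon>)) * \<psi> ((1 / \<epsilon>) *\<^sub>R x)" for x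
    have i: "1 / \<epsilon> \<noteq> 0" using \<epsilon>0 by simp
    note dil = test_function_dilation[OF \<psi>(1) i, folded \<phi>_def[abs_def]]
    have "\<phi> \<in> test_functions D"
    proof (rule test_functionsI[OF test_functions_smooth[OF dil(1)] compact_cball])
      show "cball 0 (\<epsilon> * R) \<subseteq> D" using ball by (auto intro!: subsetD[OF ball(1)])
      fix x :: 'a assume "x \<notin> cball 0 (\<epsilon> * R)"
      then have "(1 / \<epsilon>) *\<^sub>R x \<notin> ball 0 R" using pos by (simp add: field_simps)
      then show "\<phi> x = 0" unfolding \<phi>_def by (simp add: \<psi>(2))
    qed
    note \<phi> = this
    have "abs_l2 h \<bullet> abs_l2 (grad \<phi>) = \<bar>\<epsilon>\<bar> ^ DIM('a) * (abs_l2 H \<bullet> abs_l2 (\<lambda>x. grad \<phi> (\<epsilon> *\<^sub>R x)))"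
      unfolding H_def[abs_def] by (rule inner_l2_scale[OF \<epsilon>0 h(1) grad_test_function_L2[OF \<phi>]])
    moreover have "(\<lambda>x. grad \<phi> (\<epsilon> *\<^sub>R x)) = q" unfolding dil(2) q_def using \<epsilon>0 by simp
    ultimately have "abs_l2 H \<bullet> abs_l2 q = 0" unfolding h(2)[OF \<phi>] using \<epsilon>0 by simp
    then show ?thesis using HK by (simp only: inner_diff_right)
  qed
  have "c1 * (norm ?d)\<^sup>2 \<le> - (abs_l2 M \<bullet> ?d)"
    using mono unfolding inner_diff_left[of "abs_l2 H" "abs_l2 M"] H_orth by simp
  moreover have "abs_l2 (limit_field \<omega> U (rep_l2 k)) \<bullet> ?d = 0"
    using bspec[OF k Kcl] bspec[OF k qcl] by (simp only: inner_diff_right)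
  ultimately have "c1 * (norm ?d)\<^sup>2 \<le> (abs_l2 (limit_field \<omega> U (rep_l2 k)) - abs_l2 M) \<bullet> ?d"
    by (simp only: inner_diff_left)
  also have "\<dots> \<le> norm (abs_l2 (limit_field \<omega> U (rep_l2 k)) - abs_l2 M) * norm ?d"
    by (rule norm_cauchy_schwarz)
  finally have key: "c1 * norm ?d * norm ?d \<le> norm (abs_l2 (limit_field \<omega> U (rep_l2 k)) - abs_l2 M) * norm ?d"
    by (simp only: power2_eq_square mult.assoc)
  have "norm (abs_l2 (limit_field \<omega> U (rep_l2 k)) - abs_l2 M)
      \<le> norm (abs_l2 (limit_field \<omega> U (rep_l2 k)) - abs_l2 N) + norm (abs_l2 N - abs_l2 M)"
    using norm_triangle_ineq[of "abs_l2 (limit_field \<omega> U (rep_l2 k)) - abs_l2 N" "abs_l2 N - abs_l2 M"] by simp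
  also have "norm (abs_l2 (limit_field \<omega> U (rep_l2 k)) - abs_l2 N) \<le> c2 * norm (k - abs_l2 q)"
    using l2_lipschitz[OF rep_l2_L2[of k] qL limit_field_L2[OF \<omega>l rep_l2_L2] limit_field_L2[OF \<omega>l qL]
        less_imp_le[OF constants(2)] AE_I2[OF limit_field_lipschitz]]
    unfolding abs_rep_l2 N_def .
  also have "norm (abs_l2 N - abs_l2 M) \<le> t * norm (abs_l2 ?one)"
  proof -
    have "norm (abs_l2 N - abs_l2 M) \<le> norm (abs_l2 (\<lambda>x. t *\<^sub>R ?one x))"
      unfolding diff_abs_l2[OF NL M_L2] by (rule norm_abs_l2_le[OF NM_L2 L2_scaleR[OF oneL] le])
    also have "\<dots> = t * norm (abs_l2 ?one)"
      unfolding scaleR_abs_l2[OF oneL, symmetric] norm_scaleR using t by simp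
    finally show ?thesis .
  qed
  finally have bd: "norm (abs_l2 (limit_field \<omega> U (rep_l2 k)) - abs_l2 M) \<le> c2 * norm (k - abs_l2 q) + t * norm (abs_l2 ?one)"
    by simp
  have "c1 * norm ?d \<le> norm (abs_l2 (limit_field \<omega> U (rep_l2 k)) - abs_l2 M)"
  proof (cases "norm ?d = 0")
    case False
    then have "norm ?d > 0" by simp
    with key show ?thesis by (rule mult_right_le_imp_le)
  qed simp
  with bd have "c1 * norm ?d \<le> c2 * norm (k - abs_l2 q) + t * norm (abs_l2 ?one)" by linarith
  then show ?thesis unfolding K_def q_def t_def .
qed

lemma variation_tendsto:
  fixes D \<Omega> \<omega> :: "'a set" and u :: "real \<Rightarrow> 'a \<Rightarrow> real"
  assumes D: "open D" "bounded D" and \<Omega>: "open \<Omega>" and \<omega>: "open \<omega>" "bounded \<omega>" and \<tau>: "\<tau> > 0"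
    and ball: "\<delta> > 0" "ball 0 \<delta> \<subseteq> D" "ball 0 \<delta> \<inter> \<Omega> = {}"
    and u: "\<And>\<epsilon>. 0 < \<epsilon> \<Longrightarrow> \<epsilon> \<le> \<tau> \<Longrightarrow> state_solution a1 a2 D f (\<Omega> \<union> scaled_inclusion \<omega> \<epsilon>) (u \<epsilon>)"
      "state_solution a1 a2 D f \<Omega> (u 0)"
    and g0: "AE x in lebesgue. x \<in> ball 0 \<delta> \<longrightarrow> norm (weak_gradient D (u 0) x - U) \<le> C * norm x powr \<alpha>"
      "C \<ge> 0" "\<alpha> > 0"
    and k: "k \<in> closure test_gradients"
      "\<forall>s\<in>closure test_gradients. abs_l2 (limit_field \<omega> U (rep_l2 k)) \<bullet> s = 0"
  shows "((\<lambda>\<epsilon>. abs_l2 (variation_gradient D u \<epsilon>)) \<longlongrightarrow> k) (at_right 0)"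
proof (rule tendstoI)
  fix e :: real assume e: "e > 0"
  \<comment> \<open>The distance of \<open>k\<close> to the gradient of \<open>\<psi>\<close> enters
    with factor \<open>c2\<close> in the estimate and with factor \<open>c1\<close> in the triangle
    inequality; this value makes the two together cost half of \<open>c1 * e\<close>.\<close>
  define \<eta> where "\<eta> = c1 * e / (2 * (c1 + c2))"
  have \<eta>: "\<eta> > 0" "(c1 + c2) * \<eta> = c1 * e / 2" using constants e by (simp_all add: \<eta>_def field_simps)
  have "\<exists>y\<in>test_gradients. dist y k < \<eta>" using k(1) \<eta>(1) unfolding closure_approachable by blast
  then obtain \<psi> where \<psi>: "\<psi> \<in> test_functions UNIV" and close: "dist (abs_l2 (grad \<psi>)) k < \<eta>"
    unfolding test_gradients_def by blast
  obtain A where A: "compact A" "\<And>x. x \<notin> A \<Longrightarrow> \<psi> x = 0" "\<And>x. x \<notin> A \<Longrightarrow> grad \<psi> x = 0"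
    using \<psi> by (rule grad_test_function_support) (rule that)
  \<comment> \<open>The radius depends on \<open>\<psi>\<close> and hence on \<open>e\<close>;
    \<open>\<epsilon>\<close> is made small only afterwards.\<close>
  obtain R where R: "R > 0" "\<omega> \<union> A \<subseteq> ball 0 R"
    using bounded_subset_ballD[of "\<omega> \<union> A" 0] \<omega>(2) compact_imp_bounded[OF A(1)] by auto
  define V where "V = norm (abs_l2 (zero_ext (ball (0::'a) R) (\<lambda>x. 1 :: real)))"
  have "((\<lambda>\<epsilon>. \<epsilon> * R) \<longlongrightarrow> 0 * R) (at_right 0)" by (intro tendsto_intros)
  then have l0: "((\<lambda>\<epsilon>. \<epsilon> * R) \<longlongrightarrow> 0) (at_right 0)" by simp
  have ev0: "\<forall>\<^sub>F \<epsilon> in at_right (0::real). 0 < \<epsilon>" by (rule eventually_at_right_less)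
  have "\<forall>\<^sub>F \<epsilon> in at_right 0. 0 \<le> \<epsilon> * R" using ev0 by eventually_elim (use R in simp)
  then have "((\<lambda>\<epsilon>. (\<epsilon> * R) powr \<alpha>) \<longlongrightarrow> 0) (at_right 0)"
    using g0(3) by (intro tendsto_zero_powrI[OF l0 tendsto_const]) simp_all
  then have "((\<lambda>\<epsilon>. 2 * c2 * (C * (\<epsilon> * R) powr \<alpha>) * V) \<longlongrightarrow> 2 * c2 * (C * 0) * V) (at_right 0)"
    by (intro tendsto_intros)
  then have l1: "((\<lambda>\<epsilon>. 2 * c2 * (C * (\<epsilon> * R) powr \<alpha>) * V) \<longlongrightarrow> 0) (at_right 0)" by simp
  have "c1 * e / 2 > 0" using constants e by simp
  then have ev1: "\<forall>\<^sub>F \<epsilon> in at_right 0. 2 * c2 * (C * (\<epsilon> * R) powr \<alpha>) * V < c1 * e / 2"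
    by (rule order_tendstoD(2)[OF l1])
  have ev2: "\<forall>\<^sub>F \<epsilon> in at_right 0. \<epsilon> * R < \<delta>" by (rule order_tendstoD(2)[OF l0 ball(1)])
  have ev3: "\<forall>\<^sub>F \<epsilon> in at_right 0. \<epsilon> < \<tau>" by (rule order_tendstoD(2)[OF tendsto_ident_at \<tau>])
  from ev0 ev1 ev2 ev3 show "\<forall>\<^sub>F \<epsilon> in at_right 0. dist (abs_l2 (variation_gradient D u \<epsilon>)) k < e"
  proof eventually_elim
    case (elim \<epsilon>)
    let ?K = "abs_l2 (variation_gradient D u \<epsilon>)" and ?q = "abs_l2 (grad \<psi>)"
    have \<omega>R: "\<omega> \<subseteq> ball 0 R" using R(2) by blast
    have off: "\<psi> x = 0" "grad \<psi> x = 0" if "x \<notin> ball 0 R" for x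
      using that R(2) A(2,3) by blast+
    have "state_solution a1 a2 D f (\<Omega> \<union> scaled_inclusion \<omega> \<epsilon>) (u \<epsilon>)" using u(1) elim by simp
    note est = variation_estimate[OF D \<Omega> \<omega>(1) \<omega>R elim(1) ball(2,3) elim(3) this u(2) g0 \<psi> off k(2), folded V_def]
    have c: "norm (k - ?q) < \<eta>" using close unfolding dist_norm norm_minus_commute[of k] .
    have "c2 * norm (k - ?q) < c2 * \<eta>" "c1 * norm (k - ?q) < c1 * \<eta>"
      using c constants by (simp_all add: mult_strict_left_mono)
    moreover have "c1 * norm (?K - k) \<le> c1 * norm (?K - ?q) + c1 * norm (k - ?q)"
    proof -
      have "norm (?K - k) \<le> norm (?K - ?q) + norm (k - ?q)"
        using norm_triangle_ineq4[of "?K - ?q" "k - ?q"] by simp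
      then have "c1 * norm (?K - k) \<le> c1 * (norm (?K - ?q) + norm (k - ?q))"
        using constants by (intro mult_left_mono) simp_all
      then show ?thesis by (simp only: distrib_left)
    qed
    moreover have "c1 * \<eta> + c2 * \<eta> = c1 * e / 2" using \<eta>(2) by (simp only: distrib_right)
    ultimately have "c1 * norm (?K - k) < c1 * e" using est elim(2) by linarith
    then show ?case using constants unfolding dist_norm by simp
  qed
qed

end

text \<open>\<open>weak_gradient\<close> is a choice among almost everywhere equal fields, so square
  integrability and the class have to be carried over from the explicit field.\<close>

lemma variation_weak_gradient:
  fixes u :: "real \<Rightarrow> 'a::euclidean_space \<Rightarrow> real"
  assumes D: "open D" and u: "u \<epsilon> \<in> H1_0 D" "u 0 \<in> H1_0 D" and \<epsilon>: "\<epsilon> > 0"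
  shows "weak_gradient UNIV (state_variation D u \<epsilon>) \<in> L2 UNIV"
    "abs_l2 (weak_gradient UNIV (state_variation D u \<epsilon>)) = abs_l2 (variation_gradient D u \<epsilon>)"
proof -
  note V = variation_gradient[OF D u \<epsilon>]
  have W: "has_weak_gradient UNIV (state_variation D u \<epsilon>) (weak_gradient UNIV (state_variation D u \<epsilon>))"
    by (rule has_weak_gradient_weak_gradient[OF V(2)])
  have ae: "AE x in lebesgue. weak_gradient UNIV (state_variation D u \<epsilon>) x = variation_gradient D u \<epsilon> x"
    by (rule weak_gradient_AE_UNIV[OF V(2)])
  then have "AE x in lebesgue. variation_gradient D u \<epsilon> x = weak_gradient UNIV (state_variation D u \<epsilon>) x"
    by eventually_elim simp
  then show L: "weak_gradient UNIV (state_variation D u \<epsilon>) \<in> L2 UNIV"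
    by (rule L2_cong_AE[OF V(1) weak_gradient_measurable[OF W]])
  show "abs_l2 (weak_gradient UNIV (state_variation D u \<epsilon>)) = abs_l2 (variation_gradient D u \<epsilon>)"
    unfolding abs_l2_eq_iff[OF L V(1)] by (rule ae)
qed

theorem theorem4p3:
  fixes D \<Omega> \<omega> :: "(real ^ 'n) set"
    and f v :: "real ^ 'n \<Rightarrow> real"
    and a1 a2 :: "real ^ 'n \<Rightarrow> real ^ 'n"
    and u :: "real \<Rightarrow> real ^ 'n \<Rightarrow> real"
    and U0 :: "real ^ 'n"
    and \<tau> c1 c2 \<delta> \<alpha> :: real
  assumes D: "open D" "bounded D"
    and f: "f \<in> L2 D"
    and Omega: "open \<Omega>" "compactly_contained \<Omega> D" "0 \<in> D - closure \<Omega>"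
    and omega: "open \<omega>" "bounded \<omega>" "0 \<in> \<omega>"
    and tau: "\<tau> > 0"
      "\<And>\<epsilon>. \<epsilon> \<in> {0..\<tau>} \<Longrightarrow> compactly_contained (scaled_inclusion \<omega> \<epsilon>) (D - closure \<Omega>)"
    and differentiable: "\<And>x. a1 differentiable (at x)" "\<And>x. a2 differentiable (at x)"
    and constants: "c1 > 0" "c2 > 0"
    and monotone: "\<And>x y. (a1 x - a1 y) \<bullet> (x - y) \<ge> c1 * (norm (x - y))\<^sup>2"
      "\<And>x y. (a2 x - a2 y) \<bullet> (x - y) \<ge> c1 * (norm (x - y))\<^sup>2"
    and lipschitz: "\<And>x y. norm (a1 x - a1 y) \<le> c2 * norm (x - y)"
      "\<And>x y. norm (a2 x - a2 y) \<le> c2 * norm (x - y)"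
    and u: "\<And>\<epsilon>. \<epsilon> \<in> {0..\<tau>} \<Longrightarrow> state_solution a1 a2 D f (perturbed_set \<Omega> \<omega> \<epsilon>) (u \<epsilon>)"
    and regularity: "\<delta> > 0" "cball 0 \<delta> \<subseteq> D" "0 < \<alpha>" "\<alpha> < 1"
      "v \<in> C1_Holder \<alpha> (ball 0 \<delta>)" "AE x in lebesgue_on (ball 0 \<delta>). u 0 x = v x"
    and U0: "GDERIV v 0 :> U0"
  shows "(\<exists>!K. limit_solution a1 a2 \<omega> U0 K) \<and>
    (\<forall>K. limit_solution a1 a2 \<omega> U0 K \<longrightarrow>
       L2_tendsto UNIV (\<lambda>\<epsilon>. weak_gradient UNIV (state_variation D u \<epsilon>)) (BL_dot_gradient K) (at_right 0))"
proof -
  interpret two_phase_field a1 a2 c1 c2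
    by (rule two_phase_field.intro) (rule constants monotone lipschitz)+
  have \<omega>l: "\<omega> \<in> sets lebesgue" using omega(1) by simp
  obtain k K where k: "\<forall>s\<in>closure test_gradients. abs_l2 (limit_field \<omega> U0 (rep_l2 k)) \<bullet> s = 0"
    "k \<in> closure test_gradients" and K: "limit_solution a1 a2 \<omega> U0 K" "abs_l2 (BL_dot_gradient K) = k"
    using limit_solution_exists[OF \<omega>l omega(2), of U0] by blast
  have unique: "K' = K" if "limit_solution a1 a2 \<omega> U0 K'" for K'
    by (rule limit_solution_unique[OF \<omega>l omega(2) that K(1)])
  have gL: "BL_dot_gradient K \<in> L2 UNIV"
    by (rule BL_dot_gradient_L2[OF \<omega>l omega(2)]) (use K(1) in \<open>simp add: limit_solution_def\<close>)
  have u0: "state_solution a1 a2 D f \<Omega> (u 0)" using u[of 0] tau(1) by (simp add: perturbed_set_def)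
  have ue: "state_solution a1 a2 D f (\<Omega> \<union> scaled_inclusion \<omega> \<epsilon>) (u \<epsilon>)" if "0 < \<epsilon>" "\<epsilon> \<le> \<tau>" for \<epsilon>
    using u[of \<epsilon>] that by (simp add: perturbed_set_def)
  have uH: "u 0 \<in> H1_0 D" using u0 by (simp add: state_solution_def)
  have "open (- closure \<Omega>)" "0 \<in> - closure \<Omega>" using Omega(3) by auto
  then obtain r where r: "r > 0" "ball 0 r \<subseteq> - closure \<Omega>" by (auto elim!: openE)
  have B: "ball 0 \<delta> \<subseteq> D" using regularity(2) ball_subset_cball[of 0 \<delta>] by blast
  obtain C where C: "C \<ge> 0"
    "AE x in lebesgue. x \<in> ball 0 \<delta> \<longrightarrow> norm (weak_gradient D (u 0) x - U0) \<le> C * norm x powr \<alpha>"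
    using gradient_at_regular_point[OF D(1) B H1_0_D(1)[OF D(1) uH] regularity(5,6) U0 regularity(1,3)] by blast
  \<comment> \<open>One ball that serves both needs: the Hoelder bound for the gradient of
    \<open>u 0\<close>, and disjointness from \<open>\<Omega>\<close>.\<close>
  define \<rho> where "\<rho> = min \<delta> r"
  have "\<rho> > 0" "ball 0 \<rho> \<subseteq> ball (0::real^'n) \<delta>" "ball 0 \<rho> \<subseteq> ball (0::real^'n) r"
    using regularity(1) r(1) by (simp_all add: \<rho>_def subset_ball)
  note \<rho> = this
  have \<rho>D: "ball 0 \<rho> \<subseteq> D" using \<rho>(2) B by blast
  have \<rho>\<Omega>: "ball 0 \<rho> \<inter> \<Omega> = {}" using \<rho>(3) r(2) closure_subset[of \<Omega>] by blast
  have g: "AE x in lebesgue. x \<in> ball 0 \<rho> \<longrightarrow> norm (weak_gradient D (u 0) x - U0) \<le> C * norm x powr \<alpha>"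
    using C(2) by eventually_elim (use \<rho>(2) in blast)
  have lim: "((\<lambda>\<epsilon>. abs_l2 (variation_gradient D u \<epsilon>)) \<longlongrightarrow> k) (at_right 0)"
    by (rule variation_tendsto[OF D Omega(1) omega(1,2) tau(1) \<rho>(1) \<rho>D \<rho>\<Omega> ue u0 g C(1) regularity(3) k(2,1)])
  \<comment> \<open>States are given only for parameters up to \<open>\<tau>\<close>; all statements
    on the variation are therefore made eventually as \<open>\<epsilon>\<close> tends to 0 from the
    right.\<close>
  have ev0: "\<forall>\<^sub>F \<epsilon> in at_right 0. 0 < \<epsilon> \<and> \<epsilon> \<le> \<tau>"
    using eventually_at_right_less[of 0] order_tendstoD(2)[OF tendsto_ident_at tau(1)]
    by eventually_elim simp
  have uH': "u \<epsilon> \<in> H1_0 D" if "0 < \<epsilon> \<and> \<epsilon> \<le> \<tau>" for \<epsilon>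
    using ue[of \<epsilon>] that by (simp add: state_solution_def)
  let ?W = "\<lambda>\<epsilon>. weak_gradient UNIV (state_variation D u \<epsilon>)"
  have WL: "\<forall>\<^sub>F \<epsilon> in at_right 0. ?W \<epsilon> \<in> L2 UNIV"
    using ev0
  proof eventually_elim
    case (elim \<epsilon>)
    show ?case by (rule variation_weak_gradient(1)[OF D(1) uH'[OF elim] uH conjunct1[OF elim]])
  qed
  have "((\<lambda>\<epsilon>. norm (abs_l2 (variation_gradient D u \<epsilon>) - k)) \<longlongrightarrow> 0) (at_right 0)"
    using lim by (intro tendsto_norm_zero LIM_zero)
  moreover have "\<forall>\<^sub>F \<epsilon> in at_right 0. norm (abs_l2 (variation_gradient D u \<epsilon>) - k)
      = L2_norm UNIV (\<lambda>x. ?W \<epsilon> x - BL_dot_gradient K x)"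
    using ev0
  proof eventually_elim
    case (elim \<epsilon>)
    note V = variation_weak_gradient[OF D(1) uH'[OF elim] uH conjunct1[OF elim]]
    show ?case
      unfolding V(2)[symmetric] K(2)[symmetric] diff_abs_l2[OF V(1) gL] by (rule norm_abs_l2[OF L2_diff[OF V(1) gL]])
  qed
  ultimately have "((\<lambda>\<epsilon>. L2_norm UNIV (\<lambda>x. ?W \<epsilon> x - BL_dot_gradient K x)) \<longlongrightarrow> 0) (at_right 0)"
    by (rule Lim_transform_eventually)
  then have "L2_tendsto UNIV ?W (BL_dot_gradient K) (at_right 0)"
    unfolding L2_tendsto_def using gL WL by blast
  then show ?thesis using K(1) unique by blast
qed

end
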